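(* Let $T>0$ and let $\mathbf W$ be the Itô or the Stratonovich Brownian rough path over $\mathbb R^n$ on $[0,T]$. Almost surely, $\mathbf W(\omega)\in\mathbf B^{1/2}_{p\infty}([0,T])$ for every $p<\infty$, and $\mathbf W(\omega)\notin\mathbf B^{1/2}_{\infty\infty}([0,T])$. For the fractional Brownian rough path over $\mathbb R^n$ with Hurst parameter $H\in(1/4,1/2]$, the analogous statement holds with exponent $H$: almost surely it belongs to $\mathbf B^H_{p\infty}([0,T])$ for every $p<\infty$, and it does not belong to $\mathbf B^H_{\infty\infty}([0,T])$.
   Context: For measurable $A$ on $\Delta_2(0,T)=\{(s,t)\in[0,T]^2:s\le t\}$ put $\|A\|_{\mathbb B^\gamma_{p,\infty}([0,T])}=\sup_{0<\tau\le T}\tau^{-\gamma}\sup_{0\le h\le\tau}\|A_{\cdot,\cdot+h}\|_{L^p([0,T-h])}$. A level-$N$ rough path $\mathbf X=(1,\mathbf X^{(1)},\dots,\mathbf X^{(N)})$, $\mathbf X^{(k)}:\Delta_2(0,T)\to(\mathbb R^n)^{\otimes k}$, satisfying Chen's relation $\mathbf X_{st}\otimes\mathbf X_{tu}=\mathbf X_{su}$ for $s\le t\le u$ (truncated tensor product), is in $\mathbf B^\alpha_{p\infty}([0,T])$ (with $\alpha>\frac1{N+1}$, $\alpha>\frac1p$) if $\sum_{k=1}^N\|\mathbf X^{(k)}\|^{1/k}_{\mathbb B^{k\alpha}_{p/k,\infty}}<\infty$. ("Every $p<\infty$" is understood for the range $p>1/\alpha$ of the definition.) Brownian rough path (level $N=2$):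 $\mathbf W^{(1)}_{st}=W_t-W_s$ and $\mathbf W^{(2)}_{st}=\int_s^t(W_u-W_s)\otimes dW_u$ (Itô) or $\int_s^t(W_u-W_s)\otimes\circ dW_u$ (Stratonovich), for $W$ a standard $n$-dimensional Brownian motion. Fractional Brownian rough path: for $n$-dimensional fractional Brownian motion $B^H$ (independent components, each with covariance $\frac12(s^{2H}+t^{2H}-|t-s|^{2H})$), the canonical level-$N$ geometric lift, $N=2$ for $H\in(1/3,1/2]$ and $N=3$ for $H\in(1/4,1/3]$, i.e. the limit (uniformly on $\Delta_2(0,T)$, in probability) of the level-$N$ iterated integrals of the dyadic piecewise linear interpolations of $B^H$. *)

theory Defs
  imports "HOL-Probability.Probability"
begin

section \<open>Truncated tensors and Besov rough paths\<close>

text \<open>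
  With \<open>'n\<close> the index type of the coordinates of \<open>real ^ 'n\<close>, an element of the tensor algebra
  is given by its coordinates: the word \<open>[i\<^sub>1, \<dots>, i\<^sub>k]\<close> stands for the basis tensor
  \<open>e\<^bsub>i\<^sub>1\<^esub> \<otimes> \<dots> \<otimes> e\<^bsub>i\<^sub>k\<^esub>\<close>, so that the words of length \<open>k\<close> carry the level-\<open>k\<close> part.
  Levels above the truncation level \<open>N\<close> are junk and are never inspected.
\<close>

type_synonym 'n tensors = "'n list \<Rightarrow> real"
type_synonym 'n two_param = "real \<Rightarrow> real \<Rightarrow> 'n tensors"

definition tensor_prod :: "'n tensors \<Rightarrow> 'n tensors \<Rightarrow> 'n tensors" where
  "tensor_prod a b w = (\<Sum>j\<le>length w. a (take j w) * b (drop j w))"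

definition level_norm :: "nat \<Rightarrow> ('n::finite) tensors \<Rightarrow> real" where
  "level_norm k a = sqrt (\<Sum>w | length w = k. (a w)\<^sup>2)"

definition simplex2 :: "real \<Rightarrow> (real \<times> real) set" where
  "simplex2 T = {(s, t). 0 \<le> s \<and> s \<le> t \<and> t \<le> T}"

definition rough_path :: "nat \<Rightarrow> real \<Rightarrow> ('n::finite) two_param \<Rightarrow> bool" where
  "rough_path N T X \<longleftrightarrow>
     (\<forall>(s, t) \<in> simplex2 T. X s t [] = 1) \<and>
     (\<forall>w. length w \<le> N \<longrightarrow>
        (\<lambda>(s, t). X s t w) \<in> borel_measurable (restrict_space borel (simplex2 T))) \<and>
     (\<forall>s t u w. 0 \<le> s \<and> s \<le> t \<and> t \<le> u \<and> u \<le> T \<and> length w \<le> N \<longrightarrow>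
        tensor_prod (X s t) (X t u) w = X s u w)"

text \<open>Only used for exponents \<open>a > 0\<close>.\<close>

definition ennreal_powr :: "ennreal \<Rightarrow> real \<Rightarrow> ennreal" where
  "ennreal_powr x a = (if x = \<top> then \<top> else ennreal (enn2real x powr a))"

definition Lp_norm :: "ennreal \<Rightarrow> 'b measure \<Rightarrow> ('b \<Rightarrow> real) \<Rightarrow> ennreal" where
  "Lp_norm p M f =
     (if p = \<top> then esssup M (\<lambda>x. ennreal \<bar>f x\<bar>)
      else ennreal_powr (\<integral>\<^sup>+x. ennreal (\<bar>f x\<bar> powr enn2real p) \<partial>M) (1 / enn2real p))"

text \<open>Here \<open>A s t\<close> is the norm of the two-parameter function at \<open>(s, t)\<close>.\<close>

definition besov_norm :: "real \<Rightarrow> ennreal \<Rightarrow> real \<Rightarrow> (real \<Rightarrow> real \<Rightarrow> real) \<Rightarrow> ennreal" where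
  "besov_norm \<gamma> p T A =
     (SUP \<tau>\<in>{0<..T}. ennreal (\<tau> powr (-\<gamma>)) *
        (SUP h\<in>{0..\<tau>}. Lp_norm p (restrict_space lborel {0..T - h}) (\<lambda>t. A t (t + h))))"

text \<open>To be used with \<open>\<alpha> > 1 / (N + 1)\<close> and \<open>\<alpha> > 1 / p\<close>.\<close>

definition besov_rough_paths :: "nat \<Rightarrow> real \<Rightarrow> ennreal \<Rightarrow> real \<Rightarrow> ('n::finite) two_param set" where
  "besov_rough_paths N \<alpha> p T =
     {X. rough_path N T X \<and>
         (\<Sum>k = 1..N. ennreal_powr
            (besov_norm (real k * \<alpha>) (p / of_nat k) T (\<lambda>s t. level_norm k (X s t)))
            (1 / real k)) < \<top>}"


section \<open>Brownian motion and stochastic integrals\<close>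

definition brownian_motion :: "'a measure \<Rightarrow> real \<Rightarrow> (real \<Rightarrow> 'a \<Rightarrow> real ^ 'n) \<Rightarrow> bool" where
  "brownian_motion M T W \<longleftrightarrow>
     (\<forall>t\<in>{0..T}. W t \<in> borel_measurable M) \<and>
     (AE \<omega> in M. W 0 \<omega> = 0) \<and>
     (AE \<omega> in M. continuous_on {0..T} (\<lambda>t. W t \<omega>)) \<and>
     (\<forall>m (\<tau> :: nat \<Rightarrow> real). 0 \<le> \<tau> 0 \<and> \<tau> m \<le> T \<and> (\<forall>j<m. \<tau> j < \<tau> (Suc j)) \<longrightarrow>
        prob_space.indep_vars M (\<lambda>_. borel) (\<lambda>j \<omega>. W (\<tau> (Suc j)) \<omega> - W (\<tau> j) \<omega>) {..<m}) \<and>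
     (\<forall>s t. 0 \<le> s \<and> s < t \<and> t \<le> T \<longrightarrow>
        prob_space.indep_vars M (\<lambda>_. borel) (\<lambda>i \<omega>. W t \<omega> $ i - W s \<omega> $ i) UNIV \<and>
        (\<forall>i. distributed M lborel (\<lambda>\<omega>. W t \<omega> $ i - W s \<omega> $ i) (normal_density 0 (sqrt (t - s)))))"

definition natural_filtration :: "'a measure \<Rightarrow> (real \<Rightarrow> 'a \<Rightarrow> real ^ 'n) \<Rightarrow> real \<Rightarrow> 'a measure" where
  "natural_filtration M W t =
     sigma (space M) {W u -` A \<inter> space M | u A. 0 \<le> u \<and> u \<le> t \<and> A \<in> sets borel}"

definition partition_of :: "real \<Rightarrow> real \<Rightarrow> nat \<Rightarrow> (nat \<Rightarrow> real) \<Rightarrow> bool" where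
  "partition_of s t m \<tau> \<longleftrightarrow> \<tau> 0 = s \<and> \<tau> m = t \<and> (\<forall>j<m. \<tau> j \<le> \<tau> (Suc j))"

definition square_integrable :: "'a measure \<Rightarrow> ('a \<Rightarrow> real) \<Rightarrow> bool" where
  "square_integrable M f \<longleftrightarrow> f \<in> borel_measurable M \<and> integrable M (\<lambda>\<omega>. (f \<omega>)\<^sup>2)"

text \<open>
  The simple process with data \<open>(m, \<tau>, \<xi>)\<close> takes the value \<open>\<xi> j\<close> on \<open>(\<tau> j, \<tau> (j + 1)]\<close>.
\<close>

definition simple_adapted ::
  "'a measure \<Rightarrow> (real \<Rightarrow> 'a measure) \<Rightarrow> real \<Rightarrow> real \<Rightarrow> nat \<Rightarrow> (nat \<Rightarrow> real) \<Rightarrow> (nat \<Rightarrow> 'a \<Rightarrow> real) \<Rightarrow> bool"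
where
  "simple_adapted M F s t m \<tau> \<xi> \<longleftrightarrow>
     partition_of s t m \<tau> \<and>
     (\<forall>j<m. \<xi> j \<in> borel_measurable (F (\<tau> j)) \<and> square_integrable M (\<xi> j))"

definition simple_process ::
  "nat \<Rightarrow> (nat \<Rightarrow> real) \<Rightarrow> (nat \<Rightarrow> 'a \<Rightarrow> real) \<Rightarrow> real \<Rightarrow> 'a \<Rightarrow> real" where
  "simple_process m \<tau> \<xi> u \<omega> = (\<Sum>j<m. \<xi> j \<omega> * indicator {\<tau> j<..\<tau> (Suc j)} u)"

definition simple_ito_integral ::
  "(real \<Rightarrow> 'a \<Rightarrow> real) \<Rightarrow> nat \<Rightarrow> (nat \<Rightarrow> real) \<Rightarrow> (nat \<Rightarrow> 'a \<Rightarrow> real) \<Rightarrow> 'a \<Rightarrow> real" where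
  "simple_ito_integral B m \<tau> \<xi> \<omega> = (\<Sum>j<m. \<xi> j \<omega> * (B (\<tau> (Suc j)) \<omega> - B (\<tau> j) \<omega>))"

text \<open>
  \<open>I\<close> is (a version of) the Ito integral of \<open>Y\<close> against \<open>B\<close> over \<open>[s, t]\<close>: the \<open>L\<^sup>2\<close>-limit of the
  integrals of adapted simple processes that approximate \<open>Y\<close> in \<open>L\<^sup>2([s, t] \<times> \<Omega>)\<close>.  The existential
  quantifier over approximating sequences is harmless because of the Ito isometry.
\<close>

definition has_ito_integral ::
  "'a measure \<Rightarrow> (real \<Rightarrow> 'a measure) \<Rightarrow> (real \<Rightarrow> 'a \<Rightarrow> real) \<Rightarrow> real \<Rightarrow> real \<Rightarrow>
   (real \<Rightarrow> 'a \<Rightarrow> real) \<Rightarrow> ('a \<Rightarrow> real) \<Rightarrow> bool" where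
  "has_ito_integral M F B s t Y I \<longleftrightarrow>
     square_integrable M I \<and>
     (\<exists>(m :: nat \<Rightarrow> nat) \<tau> \<xi>.
        (\<forall>k. simple_adapted M F s t (m k) (\<tau> k) (\<xi> k)) \<and>
        (\<lambda>k. \<integral>\<^sup>+\<omega>. (\<integral>\<^sup>+u\<in>{s..t}. ennreal ((Y u \<omega> - simple_process (m k) (\<tau> k) (\<xi> k) u \<omega>)\<^sup>2)
             \<partial>lborel) \<partial>M) \<longlonglongrightarrow> 0 \<and>
        (\<lambda>k. \<integral>\<^sup>+\<omega>. ennreal ((I \<omega> - simple_ito_integral B (m k) (\<tau> k) (\<xi> k) \<omega>)\<^sup>2) \<partial>M) \<longlonglongrightarrow> 0)"

text \<open>Limit in probability of the sums of products of increments as the mesh tends to \<open>0\<close>.\<close>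

definition has_covariation ::
  "'a measure \<Rightarrow> real \<Rightarrow> real \<Rightarrow> (real \<Rightarrow> 'a \<Rightarrow> real) \<Rightarrow> (real \<Rightarrow> 'a \<Rightarrow> real) \<Rightarrow> ('a \<Rightarrow> real) \<Rightarrow> bool" where
  "has_covariation M s t Y B Q \<longleftrightarrow>
     Q \<in> borel_measurable M \<and>
     (\<forall>\<epsilon>>0. \<exists>\<delta>>0. \<forall>m \<tau>. partition_of s t m \<tau> \<and> (\<forall>j<m. \<tau> (Suc j) - \<tau> j < \<delta>) \<longrightarrow>
        measure M {\<omega> \<in> space M. \<epsilon> <
          \<bar>(\<Sum>j<m. (Y (\<tau> (Suc j)) \<omega> - Y (\<tau> j) \<omega>) * (B (\<tau> (Suc j)) \<omega> - B (\<tau> j) \<omega>)) - Q \<omega>\<bar>} < \<epsilon>)"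

definition has_stratonovich_integral ::
  "'a measure \<Rightarrow> (real \<Rightarrow> 'a measure) \<Rightarrow> (real \<Rightarrow> 'a \<Rightarrow> real) \<Rightarrow> real \<Rightarrow> real \<Rightarrow>
   (real \<Rightarrow> 'a \<Rightarrow> real) \<Rightarrow> ('a \<Rightarrow> real) \<Rightarrow> bool" where
  "has_stratonovich_integral M F B s t Y I \<longleftrightarrow>
     (\<exists>J Q. has_ito_integral M F B s t Y J \<and> has_covariation M s t Y B Q \<and>
        I \<in> borel_measurable M \<and> (AE \<omega> in M. I \<omega> = J \<omega> + Q \<omega> / 2))"

text \<open>
  The stochastic integrals determine the second level for each fixed \<open>(s, t)\<close> only up to null
  sets; continuity in \<open>(s, t)\<close> singles out the usual version, unique up to indistinguishability.
\<close>

definition lift_of_path :: "'a measure \<Rightarrow> real \<Rightarrow> (real \<Rightarrow> 'a \<Rightarrow> real ^ 'n) \<Rightarrow> ('a \<Rightarrow> 'n two_param) \<Rightarrow> bool"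
where
  "lift_of_path M T W X \<longleftrightarrow>
     (AE \<omega> in M. \<forall>(s, t) \<in> simplex2 T. X \<omega> s t [] = 1 \<and> (\<forall>i. X \<omega> s t [i] = W t \<omega> $ i - W s \<omega> $ i)) \<and>
     (AE \<omega> in M. \<forall>i j. continuous_on (simplex2 T) (\<lambda>(s, t). X \<omega> s t [i, j]))"

definition ito_brownian_rough_path ::
  "'a measure \<Rightarrow> real \<Rightarrow> (real \<Rightarrow> 'a \<Rightarrow> real ^ 'n) \<Rightarrow> ('a \<Rightarrow> 'n two_param) \<Rightarrow> bool" where
  "ito_brownian_rough_path M T W X \<longleftrightarrow>
     lift_of_path M T W X \<and>
     (\<forall>(s, t) \<in> simplex2 T. \<forall>i j.
        has_ito_integral M (natural_filtration M W) (\<lambda>u \<omega>. W u \<omega> $ j) s t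
          (\<lambda>u \<omega>. W u \<omega> $ i - W s \<omega> $ i) (\<lambda>\<omega>. X \<omega> s t [i, j]))"

definition stratonovich_brownian_rough_path ::
  "'a measure \<Rightarrow> real \<Rightarrow> (real \<Rightarrow> 'a \<Rightarrow> real ^ 'n) \<Rightarrow> ('a \<Rightarrow> 'n two_param) \<Rightarrow> bool" where
  "stratonovich_brownian_rough_path M T W X \<longleftrightarrow>
     lift_of_path M T W X \<and>
     (\<forall>(s, t) \<in> simplex2 T. \<forall>i j.
        has_stratonovich_integral M (natural_filtration M W) (\<lambda>u \<omega>. W u \<omega> $ j) s t
          (\<lambda>u \<omega>. W u \<omega> $ i - W s \<omega> $ i) (\<lambda>\<omega>. X \<omega> s t [i, j]))"


section \<open>Fractional Brownian motion and its canonical lift\<close>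

text \<open>The case \<open>\<sigma> = 0\<close> is the degenerate Gaussian law.\<close>

definition centered_gaussian :: "'a measure \<Rightarrow> ('a \<Rightarrow> real) \<Rightarrow> bool" where
  "centered_gaussian M Z \<longleftrightarrow> Z \<in> borel_measurable M \<and>
     ((AE \<omega> in M. Z \<omega> = 0) \<or> (\<exists>\<sigma>>0. distributed M lborel Z (normal_density 0 \<sigma>)))"

definition centered_gaussian_process :: "'a measure \<Rightarrow> real set \<Rightarrow> (real \<Rightarrow> 'a \<Rightarrow> real) \<Rightarrow> bool" where
  "centered_gaussian_process M S Z \<longleftrightarrow>
     (\<forall>J c. finite J \<and> J \<subseteq> S \<longrightarrow> centered_gaussian M (\<lambda>\<omega>. \<Sum>t\<in>J. c t * Z t \<omega>))"

definition fractional_brownian_motion ::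
  "'a measure \<Rightarrow> real \<Rightarrow> real \<Rightarrow> (real \<Rightarrow> 'a \<Rightarrow> real ^ 'n) \<Rightarrow> bool" where
  "fractional_brownian_motion M T H B \<longleftrightarrow>
     (AE \<omega> in M. continuous_on {0..T} (\<lambda>t. B t \<omega>)) \<and>
     (\<forall>i. centered_gaussian_process M {0..T} (\<lambda>t \<omega>. B t \<omega> $ i)) \<and>
     (\<forall>i. \<forall>s\<in>{0..T}. \<forall>t\<in>{0..T}. (LINT \<omega>|M. B s \<omega> $ i * B t \<omega> $ i) =
        (s powr (2 * H) + t powr (2 * H) - \<bar>t - s\<bar> powr (2 * H)) / 2) \<and>
     prob_space.indep_vars M (\<lambda>_. PiM {0..T} (\<lambda>_. borel)) (\<lambda>i \<omega>. \<lambda>t\<in>{0..T}. B t \<omega> $ i) UNIV"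

definition dyadic_interpolation :: "real \<Rightarrow> nat \<Rightarrow> (real \<Rightarrow> real ^ 'n) \<Rightarrow> real \<Rightarrow> real ^ 'n" where
  "dyadic_interpolation T m x u =
     (let h = T / 2 ^ m; k = of_int \<lfloor>u / h\<rfloor>
      in x (k * h) + ((u - k * h) / h) *\<^sub>R (x ((k + 1) * h) - x (k * h)))"

text \<open>
  Iterated integrals \<open>\<integral>\<^bsub>s < u\<^sub>1 < \<dots> < u\<^sub>k < t\<^esub> dx\<^bsup>i\<^sub>1\<^esup>(u\<^sub>1) \<dots> dx\<^bsup>i\<^sub>k\<^esup>(u\<^sub>k)\<close> of a piecewise
  smooth path.  The auxiliary function takes the word reversed, i.e. with the outermost
  integration first; the finitely many kinks, where \<open>deriv\<close> is unspecified, do not matter.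
\<close>

fun iterated_integral_rev :: "(real \<Rightarrow> real ^ 'n) \<Rightarrow> 'n list \<Rightarrow> real \<Rightarrow> real \<Rightarrow> real" where
  "iterated_integral_rev x [] s t = 1"
| "iterated_integral_rev x (i # w) s t =
     integral {s..t} (\<lambda>u. iterated_integral_rev x w s u * deriv (\<lambda>r. x r $ i) u)"

definition iterated_integral :: "(real \<Rightarrow> real ^ 'n) \<Rightarrow> 'n two_param" where
  "iterated_integral x s t w = iterated_integral_rev x (rev w) s t"

text \<open>
  Uniform convergence in probability.  The exceptional event \<open>E m\<close> covers the set where the
  supremum over the simplex exceeds \<open>\<epsilon>\<close>, which need not be measurable a priori
  (\<open>measure\<close> would assign \<open>0\<close> to a non-measurable set).
\<close>

definition uniform_limit_in_prob ::
  "'a measure \<Rightarrow> 'b set \<Rightarrow> (nat \<Rightarrow> 'b \<Rightarrow> 'a \<Rightarrow> real) \<Rightarrow> ('b \<Rightarrow> 'a \<Rightarrow> real) \<Rightarrow> bool" where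
  "uniform_limit_in_prob M D Z L \<longleftrightarrow>
     (\<forall>\<epsilon>>0. \<exists>E :: nat \<Rightarrow> 'a set.
        (\<forall>m. E m \<in> sets M \<and> (\<forall>\<omega> \<in> space M - E m. \<forall>z\<in>D. \<bar>Z m z \<omega> - L z \<omega>\<bar> \<le> \<epsilon>)) \<and>
        (\<lambda>m. measure M (E m)) \<longlonglongrightarrow> 0)"

definition canonical_lift ::
  "'a measure \<Rightarrow> nat \<Rightarrow> real \<Rightarrow> (real \<Rightarrow> 'a \<Rightarrow> real ^ 'n) \<Rightarrow> ('a \<Rightarrow> 'n two_param) \<Rightarrow> bool" where
  "canonical_lift M N T B X \<longleftrightarrow>
     (\<forall>w. length w \<le> N \<longrightarrow>
        (\<forall>(s, t) \<in> simplex2 T. (\<lambda>\<omega>. X \<omega> s t w) \<in> borel_measurable M) \<and>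
        uniform_limit_in_prob M (simplex2 T)
          (\<lambda>m (s, t) \<omega>. iterated_integral (dyadic_interpolation T m (\<lambda>u. B u \<omega>)) s t w)
          (\<lambda>(s, t) \<omega>. X \<omega> s t w))"

definition fbm_level :: "real \<Rightarrow> nat" where
  "fbm_level H = (if H > 1 / 3 then 2 else 3)"

end

theory Submission
 imports Defs
begin

text \<open>
 Both lifts are limits of signatures of grid sums of (fractional) Gaussian noise, so that after
 Brownian scaling the level-\<open>k\<close> increments over the dyadic intervals of length \<open>2\<^sup>-\<^sup>n\<close> are
 identically distributed polynomials in Gaussian variables, and the polynomials of disjoint
 intervals are asymptotically uncorrelated.  Hypercontractivity bounds all their moments, and a
 variance estimate with the Borel-Cantelli lemma shows that the averages of their powers over the
 \<open>2\<^sup>n\<close> intervals of generation \<open>n\<close> stay bounded almost surely.  By Chen's relation a general increment is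
 a product of dyadic ones over geometrically decreasing scales, whence the Besov norms for
 \<open>p < \<infinity>\<close> are finite.  At level one the averages converge to the moments of the normal law, which
 are unbounded in the exponent; a finite Hoelder norm would bound them all.
\<close>

subsection \<open>Polarization by finite differences\<close>

text \<open>No covariance of iterated integrals is ever computed. Convergence in probability to the
  given lift yields tightness, and hypercontractivity turns tightness of polynomials of bounded
  degree into bounds for all their moments. The constants may therefore depend on the degree but not
  on the number of variables, which grows without bound as the mesh is refined inside a fixed dyadic
  interval. For the same reason the dependence between two intervals is measured relative to the
  quadratic forms of their covariances, where the mesh cancels. Fractional noise has long memory, so
  this relative correlation is only bounded by a multiple of the inverse distance; a harmonic sum
  results, and the variance of an average of generation \<open>n\<close> is at most of order
  \<open>n / 2 ^ n\<close>, still summable. Gaussian families are encoded by the moments of their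
  linear combinations. Polarization makes the expectation of every polynomial a function of the
  covariance, and a factorization of the covariance matrix moves the question to independent
  standard normals. The bounds are proved for grid sums, uniformly in the mesh, and reach the lift
  through Fatou's lemma.\<close>

fun diffop :: "real list \<Rightarrow> (real \<Rightarrow> real) \<Rightarrow> real \<Rightarrow> real" where
 "diffop [] h s = h s"
| "diffop (y # ys) h s = diffop ys h (s + y) - diffop ys h s"

lemma diffop_shift: "diffop ys h (s + y) = diffop ys (\<lambda>t. h (t + y)) s"
proof (induction ys arbitrary: s)
 case (Cons a ys)
 have "s + y + a = (s + a) + y" by simp
 then show ?case by (simp only: diffop.simps Cons.IH[symmetric])
qed simp

lemma diffop_diff: "diffop ys (\<lambda>t. f t - g t) s = diffop ys f s - diffop ys g s"
 by (induction ys arbitrary: s) simp_all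

lemma diffop_sum: "diffop ys (\<lambda>t. \<Sum>j\<in>J. f j t) s = (\<Sum>j\<in>J. diffop ys (f j) s)"
 by (induction ys arbitrary: s) (simp_all add: sum_subtractf)

lemma diffop_cmult: "diffop ys (\<lambda>t. c * f t) s = c * diffop ys f s"
 by (induction ys arbitrary: s) (simp_all add: right_diff_distrib)

text \<open>One difference replaces \<open>t ^ k\<close> by a polynomial of degree
  \<open>k - 1\<close> with leading coefficient \<open>k * y\<close>. As many differences as the
  degree leave \<open>k!\<close> times the product of the steps, and more leave nothing.\<close>

lemma diffop_power:
 "k \<le> length ys \<Longrightarrow>
  diffop ys (\<lambda>t. t ^ k) s = (if k = length ys then fact k * prod_list ys else 0)"
proof (induction ys arbitrary: k s)
 case (Cons y ys)
 have "(t + y) ^ k - t ^ k = (\<Sum>j<k. (of_nat (k choose j) * y ^ (k - j)) * t ^ j)" for t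
  by (simp add: binomial_ring lessThan_Suc_atMost[symmetric] mult_ac)
 then have "diffop (y # ys) (\<lambda>t. t ^ k) s =
   (\<Sum>j<k. of_nat (k choose j) * y ^ (k - j) * diffop ys (\<lambda>t. t ^ j) s)"
  by (simp add: diffop_shift diffop_diff[symmetric] diffop_sum diffop_cmult)
 also have "\<dots> = (\<Sum>j<k. if j = length ys
   then of_nat (k choose j) * y ^ (k - j) * (fact j * prod_list ys) else 0)"
  using Cons.prems by (intro sum.cong refl) (simp add: Cons.IH)
 also have "\<dots> = (if k = length (y # ys) then fact k * prod_list (y # ys) else 0)"
  using Cons.prems by (auto simp: algebra_simps sum.delta')
 finally show ?case .
qed simp

text \<open>With equal steps the difference only samples \<open>h\<close> at \<open>s\<close>,
  \<open>s + y\<close>, and so on, and each step at most doubles a bound for the samples.\<close>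

lemma abs_diffop_le:
 assumes "\<And>j. j \<le> length ys \<Longrightarrow> \<bar>h (s + of_nat j * y)\<bar> \<le> B" "\<And>x. x \<in> set ys \<Longrightarrow> x = y"
 shows "\<bar>diffop ys h s\<bar> \<le> 2 ^ length ys * B"
 using assms
proof (induction ys arbitrary: s)
 case Nil
 then show ?case using Nil(1)[of 0] by simp
next
 case (Cons x ys)
 have x: "x = y" using Cons.prems(2) by simp
 have "\<bar>diffop ys h (s + y)\<bar> \<le> 2 ^ length ys * B"
 proof (rule Cons.IH)
  fix j assume "j \<le> length ys"
  then show "\<bar>h (s + y + of_nat j * y)\<bar> \<le> B"
   using Cons.prems(1)[of "Suc j"] by (simp add: algebra_simps)
 qed (use Cons.prems in auto)
 moreover have "\<bar>diffop ys h s\<bar> \<le> 2 ^ length ys * B"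
  by (rule Cons.IH) (use Cons.prems in auto)
 ultimately show ?case using x by simp
qed

lemma diffop_replicate_poly:
 "diffop (replicate D y) (\<lambda>t. \<Sum>k\<le>D. a k * t ^ k) s = a D * (fact D * y ^ D)"
proof -
 have "diffop (replicate D y) (\<lambda>t. \<Sum>k\<le>D. a k * t ^ k) s =
   (\<Sum>k\<le>D. a k * (if k = D then fact D * y ^ D else 0))"
  unfolding diffop_sum diffop_cmult
  by (intro sum.cong refl) (auto simp: diffop_power)
 also have "\<dots> = (\<Sum>k\<le>D. if k = D then a D * (fact D * y ^ D) else 0)"
  by (intro sum.cong) auto
 finally show ?thesis by simp
qed

text \<open>Equivalence of norms on polynomials of degree at most \<open>D\<close>, with one
  constant for all of them. Induction on the degree: an iterated difference isolates the leading
  coefficient, and subtracting the leading term costs only another multiple of the integral.\<close>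

lemma poly_coeff_bound:
 "\<exists>C>0. \<forall>(a :: nat \<Rightarrow> real). \<forall>k\<le>D. \<bar>a k\<bar> \<le> C * integral {0..1} (\<lambda>x. \<bar>\<Sum>k\<le>D. a k * x ^ k\<bar>)"
proof (induction D)
 case 0
 show ?case by (intro exI[of _ 1]) simp
next
 case (Suc D)
 then obtain C where C: "C > 0"
  "\<And>(a :: nat \<Rightarrow> real) k. k \<le> D \<Longrightarrow> \<bar>a k\<bar> \<le> C * integral {0..1} (\<lambda>x. \<bar>\<Sum>k\<le>D. a k * x ^ k\<bar>)"
  by blast
 define n where "n = Suc D"
 \<comment> \<open>This step keeps all \<open>n\<close> shifts of \<open>[0, 1/2]\<close> inside
   \<open>[0, 1]\<close>.\<close>
 define y :: real where "y = 1 / (2 * real n)"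
 have n0: "real n > 0" by (simp add: n_def)
 have y0: "y > 0" using n0 by (simp add: y_def)
 \<comment> \<open>A factor \<open>2\<close> for the length of \<open>[0, 1/2]\<close>,
   \<open>2 ^ n\<close> from \<open>abs_diffop_le\<close>, \<open>n + 1\<close> shifts, and the
   normalisation \<open>n! * y ^ n\<close> of the difference of \<open>t ^ n\<close>.\<close>
 define L where "L = 2 * 2 ^ n * real (Suc n) / (fact n * y ^ n)"
 have L0: "L > 0" using y0 by (simp add: L_def)
 have lead: "\<bar>a n\<bar> \<le> L * integral {0..1} (\<lambda>x. \<bar>\<Sum>k\<le>n. a k * x ^ k\<bar>)" for a :: "nat \<Rightarrow> real"
 proof -
  define h where "h x = (\<Sum>k\<le>n. a k * x ^ k)" for x
  have h_cont: "continuous_on A (\<lambda>x. \<bar>h (f x)\<bar>)" if "continuous_on A f" for A and f :: "real \<Rightarrow> real"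
   unfolding h_def by (intro continuous_intros that)
  have int: "(\<lambda>x. \<bar>h (f x)\<bar>) integrable_on {u..v}" if "continuous_on {u..v} f" for u v :: real and f
   by (intro integrable_continuous_real h_cont that)
  have shift: "integral {0..1/2} (\<lambda>x. \<bar>h (x + real j * y)\<bar>) \<le> integral {0..1} (\<lambda>x. \<bar>h x\<bar>)"
   if "j \<le> n" for j
  proof -
   have jy: "0 \<le> real j * y" "real j * y \<le> 1 / 2"
    using that n0 y0 by (auto simp: y_def field_simps)
   have "integral {0..1/2} (\<lambda>x. \<bar>h (x + real j * y)\<bar>)
     = integral {0..1/2} ((\<lambda>x. \<bar>h x\<bar>) \<circ> (+) (real j * y))"
    by (simp add: o_def add.commute)
   also have "\<dots> = integral {0 + real j * y..1/2 + real j * y} (\<lambda>x. \<bar>h x\<bar>)"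
    by (rule integral_shift_Icc_real)
   also have "\<dots> \<le> integral {0..1} (\<lambda>x. \<bar>h x\<bar>)"
    using jy by (intro integral_subset_le int continuous_intros) auto
   finally show ?thesis .
  qed
  have pt: "\<bar>a n\<bar> * (fact n * y ^ n) \<le> 2 ^ n * (\<Sum>j\<le>n. \<bar>h (x + real j * y)\<bar>)" for x
  proof -
   have "\<bar>a n * (fact n * y ^ n)\<bar> = \<bar>diffop (replicate n y) h x\<bar>"
    unfolding h_def by (subst diffop_replicate_poly) simp
   also have "\<dots> \<le> 2 ^ length (replicate n y) * (\<Sum>j\<le>n. \<bar>h (x + real j * y)\<bar>)"
    by (rule abs_diffop_le[of _ _ _ y]) (auto intro!: member_le_sum)
   finally show ?thesis using y0 by (simp add: abs_mult)
  qed
  have "\<bar>a n\<bar> * (fact n * y ^ n) * (1 / 2) = integral {0..1/2::real} (\<lambda>x. \<bar>a n\<bar> * (fact n * y ^ n))"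
   by simp
  also have "\<dots> \<le> integral {0..1/2} (\<lambda>x. 2 ^ n * (\<Sum>j\<le>n. \<bar>h (x + real j * y)\<bar>))"
   by (intro integral_le pt integrable_continuous_real continuous_intros h_cont)
  also have "\<dots> = 2 ^ n * (\<Sum>j\<le>n. integral {0..1/2} (\<lambda>x. \<bar>h (x + real j * y)\<bar>))"
   by (subst integral_mult_right, subst integral_sum) (auto intro!: int continuous_intros)
  also have "\<dots> \<le> 2 ^ n * (\<Sum>j\<le>n. integral {0..1} (\<lambda>x. \<bar>h x\<bar>))"
   by (intro mult_left_mono sum_mono shift) auto
  also have "\<dots> = 2 ^ n * (real (Suc n) * integral {0..1} (\<lambda>x. \<bar>h x\<bar>))"
   by simp
  finally show ?thesis
   using y0 unfolding L_def h_def by (simp add: field_simps)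
 qed
 show ?case
 proof (intro exI[of _ "C * (1 + L) + L"] conjI allI impI)
  show "C * (1 + L) + L > 0" using C(1) L0 by (simp add: add_pos_pos)
  fix a :: "nat \<Rightarrow> real" and k assume k: "k \<le> Suc D"
  define N where "N = integral {0..1} (\<lambda>x. \<bar>\<Sum>k\<le>n. a k * x ^ k\<bar>)"
  have N0: "N \<ge> 0" unfolding N_def by (rule integral_nonneg) (auto intro!: integrable_continuous_real continuous_intros)
  show "\<bar>a k\<bar> \<le> (C * (1 + L) + L) * integral {0..1} (\<lambda>x. \<bar>\<Sum>k\<le>Suc D. a k * x ^ k\<bar>)"
  proof (cases "k = n")
   case True
   have "\<bar>a n\<bar> \<le> L * N" using lead unfolding N_def .
   also have "\<dots> \<le> (C * (1 + L) + L) * N"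
    using C(1) L0 N0 by (intro mult_right_mono) auto
   finally show ?thesis using True by (simp add: N_def n_def)
  next
   case False
   then have kD: "k \<le> D" using k by (simp add: n_def)
   have "integral {0..1} (\<lambda>x. \<bar>\<Sum>k\<le>D. a k * x ^ k\<bar>)
     \<le> integral {0..1} (\<lambda>x. \<bar>\<Sum>k\<le>n. a k * x ^ k\<bar> + \<bar>a n\<bar>)"
   proof (intro integral_le integrable_continuous_real continuous_intros)
    fix x :: real assume x: "x \<in> {0..1}"
    have "\<bar>a n * x ^ n\<bar> \<le> \<bar>a n\<bar>"
     using x by (simp add: abs_mult mult_left_le power_le_one)
    moreover have "(\<Sum>k\<le>D. a k * x ^ k) = (\<Sum>k\<le>n. a k * x ^ k) - a n * x ^ n"
     by (simp add: n_def)
    ultimately show "\<bar>\<Sum>k\<le>D. a k * x ^ k\<bar> \<le> \<bar>\<Sum>k\<le>n. a k * x ^ k\<bar> + \<bar>a n\<bar>" by linarith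
   qed
   also have "\<dots> = N + \<bar>a n\<bar>"
    unfolding N_def by (subst integral_add) (auto intro!: integrable_continuous_real continuous_intros)
   also have "\<dots> \<le> N + L * N" using lead[of a] unfolding N_def by simp
   finally have le: "integral {0..1} (\<lambda>x. \<bar>\<Sum>k\<le>D. a k * x ^ k\<bar>) \<le> N + L * N" .
   have "\<bar>a k\<bar> \<le> C * (N + L * N)"
    using C(2)[OF kD, of a] mult_left_mono[OF le, of C] C(1) by linarith
   also have "\<dots> \<le> (C * (1 + L) + L) * N"
    using C(1) L0 N0 by (simp add: algebra_simps)
   finally show ?thesis by (simp add: N_def n_def)
  qed
 qed
qed

text \<open>Finite differences in the coefficient vector \<open>c\<close>, one unit step per letter
  of \<open>l\<close>. Applied to a power of the linear form with coefficients \<open>c\<close> they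
  extract a mixed product.\<close>

fun polar :: "'i list \<Rightarrow> (('i \<Rightarrow> real) \<Rightarrow> real) \<Rightarrow> ('i \<Rightarrow> real) \<Rightarrow> real" where
 "polar [] g c = g c"
| "polar (i # l) g c = polar l g (c(i := c i + 1)) - polar l g c"

text \<open>A unit step in coordinate \<open>i\<close> of \<open>c\<close> moves the value of the
  linear form by \<open>x i\<close>, so \<open>polar\<close> turns into \<open>diffop\<close> with
  these steps.\<close>

lemma polar_linear_form:
 assumes "finite I" "set l \<subseteq> I"
 shows "polar l (\<lambda>c. h (\<Sum>i\<in>I. c i * x i)) c = diffop (map x l) h (\<Sum>i\<in>I. c i * x i)"
 using assms(2)
proof (induction l arbitrary: c)
 case (Cons i l)
 have "(\<Sum>j\<in>I. (c(i := c i + 1)) j * x j) = (\<Sum>j\<in>I. c j * x j + (if j = i then x i else 0))"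
  by (intro sum.cong) (auto simp: algebra_simps)
 also have "\<dots> = (\<Sum>j\<in>I. c j * x j) + x i"
  using Cons.prems assms(1) by (simp add: sum.distrib)
 finally show ?case using Cons by simp
qed simp

text \<open>Every monomial is thus a fixed linear combination of powers of linear forms, which
  reduces mixed moments to moments of single variables.\<close>

lemma polarization:
 assumes "finite I" "set l \<subseteq> I"
 shows "polar l (\<lambda>c. (\<Sum>i\<in>I. c i * x i) ^ length l) c = fact (length l) * (\<Prod>i\<leftarrow>l. x i)"
 using polar_linear_form[OF assms, of "\<lambda>t. t ^ length l"] by (simp add: diffop_power)

subsection \<open>Gaussian moments\<close>

text \<open>For even \<open>k\<close> this is \<open>(k - 1)!! * v ^ (k div 2)\<close>, the moment
  of the centered normal law of variance \<open>v\<close>, with the double factorial written through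
  factorials. The value \<open>v = 0\<close> gives the point mass at \<open>0\<close>.\<close>

definition gauss_moment :: "nat \<Rightarrow> real \<Rightarrow> real" where
 "gauss_moment k v = (if even k then fact k / (2 ^ (k div 2) * fact (k div 2)) * v ^ (k div 2) else 0)"

lemma gauss_moment_0 [simp]: "gauss_moment 0 v = 1"
 by (simp add: gauss_moment_def)

lemma gauss_moment_zero_var: "k > 0 \<Longrightarrow> gauss_moment k 0 = 0"
 by (auto simp: gauss_moment_def elim!: evenE)

lemma gauss_moment_2 [simp]: "gauss_moment 2 v = v"
 by (simp add: gauss_moment_def fact_2)

lemma gauss_moment_scale: "gauss_moment k (s\<^sup>2 * v) = s ^ k * gauss_moment k v"
 by (auto simp: gauss_moment_def power_mult_distrib power_mult[symmetric] elim!: evenE)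

lemma gauss_moment_nonneg: "v \<ge> 0 \<Longrightarrow> gauss_moment k v \<ge> 0"
 by (simp add: gauss_moment_def)

text \<open>The moments of a sum of two independent centered normal variables. Odd indices
  contribute nothing; for even ones the factorials collapse to \<open>n choose j\<close>, and the
  binomial theorem for \<open>(u + v) ^ n\<close> remains.\<close>

lemma gauss_moment_add:
 "(\<Sum>i\<le>k. of_nat (k choose i) * (gauss_moment i u * gauss_moment (k - i) v)) = gauss_moment k (u + v)"
proof (cases "even k")
 case False
 then have "of_nat (k choose i) * (gauss_moment i u * gauss_moment (k - i) v) = (0 :: real)" if "i \<le> k" for i
  using that by (auto simp: gauss_moment_def)
 then have "(\<Sum>i\<le>k. of_nat (k choose i) * (gauss_moment i u * gauss_moment (k - i) v)) = (0 :: real)"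
  by (intro sum.neutral) auto
 then show ?thesis using False by (simp add: gauss_moment_def)
next
 case True
 then obtain n where k: "k = 2 * n" by (rule evenE)
 let ?t = "\<lambda>i. of_nat (k choose i) * (gauss_moment i u * gauss_moment (k - i) v)"
 have "(\<Sum>i\<le>k. ?t i) = (\<Sum>i<2 * n + 1. if even i then ?t i else 0)"
  unfolding k lessThan_Suc_atMost[symmetric] by (intro sum.cong) (auto simp: gauss_moment_def)
 also have "\<dots> = (\<Sum>j<Suc n. ?t (2 * j))"
  using sum_split_even_odd[of ?t "\<lambda>_. 0" n] by simp
 also have "\<dots> = (\<Sum>j<Suc n. fact k / (2 ^ n * fact n) * (of_nat (n choose j) * u ^ j * v ^ (n - j)))"
 proof (intro sum.cong refl)
  fix j assume "j \<in> {..<Suc n}"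
  then have j: "j \<le> n" by simp
  then have p: "(2 :: real) ^ n = 2 ^ j * 2 ^ (n - j)" by (simp add: power_add[symmetric])
  have d: "(2 * n - 2 * j) div 2 = n - j" using j by simp
  show "?t (2 * j) = fact k / (2 ^ n * fact n) * (of_nat (n choose j) * u ^ j * v ^ (n - j))"
   unfolding k gauss_moment_def using j
   by (simp add: binomial_fact d p)
 qed
 also have "\<dots> = fact k / (2 ^ n * fact n) * (u + v) ^ n"
  by (simp add: binomial_ring sum_distrib_left lessThan_Suc_atMost)
 also have "\<dots> = gauss_moment k (u + v)" by (simp add: gauss_moment_def k)
 finally show ?thesis .
qed

text \<open>Gaussianity through moments only. This suffices because only polynomials of the
  variables are integrated; it passes to sums of independent variables by
  \<open>gauss_moment_add\<close> and includes zero variance.\<close>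

definition gaussian_moments :: "'a measure \<Rightarrow> real \<Rightarrow> ('a \<Rightarrow> real) \<Rightarrow> bool" where
 "gaussian_moments M v Z \<longleftrightarrow> Z \<in> borel_measurable M \<and>
   (\<forall>k. integrable M (\<lambda>\<omega>. Z \<omega> ^ k) \<and> (LINT \<omega>|M. Z \<omega> ^ k) = gauss_moment k v)"

lemma gaussian_moments_cmult:
 assumes "gaussian_moments M v Z"
 shows "gaussian_moments M (c\<^sup>2 * v) (\<lambda>\<omega>. c * Z \<omega>)"
 using assms by (auto simp: gaussian_moments_def power_mult_distrib gauss_moment_scale)

lemma (in prob_space) gaussian_moments_const_0: "gaussian_moments M 0 (\<lambda>_. 0)"
proof -
 have "expectation (\<lambda>\<omega>. (0 :: real) ^ k) = gauss_moment k 0" for k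
  by (cases k) (simp_all add: gauss_moment_zero_var prob_space)
 then show ?thesis by (simp add: gaussian_moments_def)
qed

lemma gaussian_moments_AE_cong:
 assumes "gaussian_moments M v Z" "AE \<omega> in M. Z \<omega> = Y \<omega>" "Y \<in> borel_measurable M"
 shows "gaussian_moments M v Y"
 unfolding gaussian_moments_def
proof (intro conjI allI)
 fix k
 have Z[measurable]: "Z \<in> borel_measurable M" and Y[measurable]: "Y \<in> borel_measurable M"
  using assms by (auto simp: gaussian_moments_def)
 have ae: "AE \<omega> in M. Z \<omega> ^ k = Y \<omega> ^ k" using assms(2) by auto
 show "integrable M (\<lambda>\<omega>. Y \<omega> ^ k)"
  using assms(1) integrable_cong_AE[OF _ _ ae] by (auto simp: gaussian_moments_def)
 show "(LINT \<omega>|M. Y \<omega> ^ k) = gauss_moment k v"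
  using assms(1) integral_cong_AE[OF _ _ ae] by (auto simp: gaussian_moments_def)
qed (fact assms(3))

lemma (in prob_space) gaussian_moments_normal:
 assumes D: "distributed M lborel Z (normal_density 0 \<sigma>)" and s: "\<sigma> > 0"
 shows "gaussian_moments M (\<sigma>\<^sup>2) Z"
 unfolding gaussian_moments_def
proof (intro conjI allI)
 show "Z \<in> borel_measurable M" using distributed_measurable[OF D] by simp
 fix k
 show "integrable M (\<lambda>\<omega>. Z \<omega> ^ k)"
  using distributed_integrable[OF D, of "\<lambda>x. x ^ k"] integrable_normal_moment[OF s, of 0 k] by simp
 have E: "(LINT \<omega>|M. Z \<omega> ^ k) = integral\<^sup>L lborel (\<lambda>x. normal_density 0 \<sigma> x * x ^ k)"
  using distributed_integral[OF D, of "\<lambda>x. x ^ k"] by simp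
 show "(LINT \<omega>|M. Z \<omega> ^ k) = gauss_moment k (\<sigma>\<^sup>2)"
 proof (cases "even k")
  case True
  then obtain n where n: "k = 2 * n" by (rule evenE)
  show ?thesis unfolding E unfolding n using integral_normal_moment_even[OF s, of 0 n]
   by (simp add: gauss_moment_def power_divide field_simps)
 next
  case False
  then obtain n where n: "k = 2 * n + 1" by (rule oddE)
  show ?thesis unfolding E unfolding n using integral_normal_moment_odd[OF s, of 0 n]
   by (simp add: gauss_moment_def)
 qed
qed

lemma (in prob_space) gaussian_moments_add:
 assumes "indep_var borel X borel Y" "gaussian_moments M u X" "gaussian_moments M v Y"
 shows "gaussian_moments M (u + v) (\<lambda>\<omega>. X \<omega> + Y \<omega>)"
proof -
 have [measurable]: "X \<in> borel_measurable M" "Y \<in> borel_measurable M"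
  using assms by (auto simp: gaussian_moments_def)
 have ind: "indep_var borel (\<lambda>\<omega>. X \<omega> ^ i) borel (\<lambda>\<omega>. Y \<omega> ^ j)" for i j
  using indep_var_compose[OF assms(1), of "\<lambda>x. x ^ i" borel "\<lambda>x. x ^ j" borel] by (simp add: o_def)
 have iX: "integrable M (\<lambda>\<omega>. X \<omega> ^ i)" and eX: "expectation (\<lambda>\<omega>. X \<omega> ^ i) = gauss_moment i u"
  and iY: "integrable M (\<lambda>\<omega>. Y \<omega> ^ i)" and eY: "expectation (\<lambda>\<omega>. Y \<omega> ^ i) = gauss_moment i v" for i
  using assms by (auto simp: gaussian_moments_def)
 have int: "integrable M (\<lambda>\<omega>. X \<omega> ^ i * Y \<omega> ^ j)" for i j
  by (rule indep_var_integrable[OF ind iX iY])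
 have E: "expectation (\<lambda>\<omega>. X \<omega> ^ i * Y \<omega> ^ j) = gauss_moment i u * gauss_moment j v" for i j
  using indep_var_lebesgue_integral[OF ind iX iY] by (simp add: eX eY)
 have "integrable M (\<lambda>\<omega>. (X \<omega> + Y \<omega>) ^ k)" for k
  unfolding binomial_ring using int by (auto simp: mult.assoc)
 moreover have "expectation (\<lambda>\<omega>. (X \<omega> + Y \<omega>) ^ k) = gauss_moment k (u + v)" for k
  unfolding binomial_ring gauss_moment_add[symmetric] using int E by (simp add: mult.assoc)
 ultimately show ?thesis by (simp add: gaussian_moments_def)
qed

lemma (in prob_space) gaussian_moments_sum:
 assumes "finite I" "indep_vars (\<lambda>_. borel) Z I" "\<And>i. i \<in> I \<Longrightarrow> gaussian_moments M (v i) (Z i)"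
 shows "gaussian_moments M (\<Sum>i\<in>I. v i) (\<lambda>\<omega>. \<Sum>i\<in>I. Z i \<omega>)"
 using assms
proof (induction I)
 case empty
 then show ?case using gaussian_moments_const_0 by simp
next
 case (insert i I)
 have "gaussian_moments M (v i + (\<Sum>i\<in>I. v i)) (\<lambda>\<omega>. Z i \<omega> + (\<Sum>i\<in>I. Z i \<omega>))"
  using insert.hyps insert.prems
  by (intro gaussian_moments_add indep_vars_sum insert.IH) (auto intro: indep_vars_subset)
 then show ?case using insert.hyps by simp
qed

subsection \<open>Polynomials in families of variables\<close>

text \<open>Polynomials as functions, with \<open>D\<close> an upper bound for the degree. Monomials
  are lists of variables, the form in which \<open>polarization\<close> handles them.\<close>

inductive poly_fun :: "'i set \<Rightarrow> nat \<Rightarrow> (('i \<Rightarrow> real) \<Rightarrow> real) \<Rightarrow> bool" for I D where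
 zero: "poly_fun I D (\<lambda>x. 0)"
| add_monom: "poly_fun I D f \<Longrightarrow> set l \<subseteq> I \<Longrightarrow> length l \<le> D \<Longrightarrow> poly_fun I D (\<lambda>x. c * (\<Prod>i\<leftarrow>l. x i) + f x)"

lemma poly_fun_add: "poly_fun I D f \<Longrightarrow> poly_fun I D g \<Longrightarrow> poly_fun I D (\<lambda>x. f x + g x)"
 by (induction rule: poly_fun.induct) (auto simp: add.assoc intro: poly_fun.intros)

lemma poly_fun_monom: "set l \<subseteq> I \<Longrightarrow> length l \<le> D \<Longrightarrow> poly_fun I D (\<lambda>x. c * (\<Prod>i\<leftarrow>l. x i))"
 using poly_fun.add_monom[OF poly_fun.zero, of l I D c] by simp

lemma poly_fun_const: "poly_fun I D (\<lambda>x. c)"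
 using poly_fun_monom[of "[]" I D c] by simp

lemma poly_fun_var: "i \<in> I \<Longrightarrow> D \<ge> 1 \<Longrightarrow> poly_fun I D (\<lambda>x. x i)"
 using poly_fun_monom[of "[i]" I D 1] by simp

lemma poly_fun_mono: "poly_fun I D f \<Longrightarrow> I \<subseteq> I' \<Longrightarrow> D \<le> D' \<Longrightarrow> poly_fun I' D' f"
 by (induction rule: poly_fun.induct) (auto intro!: poly_fun.intros)

lemma poly_fun_sum: "(\<And>j. j \<in> J \<Longrightarrow> poly_fun I D (f j)) \<Longrightarrow> poly_fun I D (\<lambda>x. \<Sum>j\<in>J. f j x)"
 by (induction J rule: infinite_finite_induct) (auto intro: poly_fun.zero poly_fun_add)

lemma poly_fun_monom_mult:
 assumes "poly_fun I D g" "set l \<subseteq> I"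
 shows "poly_fun I (length l + D) (\<lambda>x. c * (\<Prod>i\<leftarrow>l. x i) * g x)"
 using assms
proof (induction rule: poly_fun.induct)
 case zero
 then show ?case using poly_fun.zero by simp
next
 case (add_monom f l' c')
 have "poly_fun I (length l + D) (\<lambda>x. (c * c') * (\<Prod>i\<leftarrow>l @ l'. x i) + c * (\<Prod>i\<leftarrow>l. x i) * f x)"
  using add_monom by (intro poly_fun.add_monom) auto
 then show ?case by (simp add: algebra_simps)
qed

lemma poly_fun_mult:
 assumes "poly_fun I D f" "poly_fun I D' g"
 shows "poly_fun I (D + D') (\<lambda>x. f x * g x)"
 using assms(1)
proof (induction rule: poly_fun.induct)
 case zero
 then show ?case using poly_fun.zero by simp
next
 case (add_monom f l c)
 have "poly_fun I (D + D') (\<lambda>x. c * (\<Prod>i\<leftarrow>l. x i) * g x + f x * g x)"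
  using poly_fun_monom_mult[OF assms(2) add_monom(2), of c] add_monom(3,4)
  by (intro poly_fun_add poly_fun_mono[OF poly_fun_monom_mult[OF assms(2) add_monom(2), of c]]) auto
 then show ?case by (simp add: algebra_simps)
qed

lemma poly_fun_cmult: "poly_fun I D f \<Longrightarrow> poly_fun I D (\<lambda>x. c * f x)"
 using poly_fun_mult[OF poly_fun_const[of I 0 c], of D f] by simp

lemma poly_fun_diff: "poly_fun I D f \<Longrightarrow> poly_fun I D g \<Longrightarrow> poly_fun I D (\<lambda>x. f x - g x)"
 using poly_fun_add[OF _ poly_fun_cmult[of I D g "-1"], of f] by simp

lemma poly_fun_power: "poly_fun I D f \<Longrightarrow> poly_fun I (k * D) (\<lambda>x. f x ^ k)"
 by (induction k) (auto intro: poly_fun_const poly_fun_mult)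

lemma poly_fun_prod_list:
 assumes "\<And>i. i \<in> set l \<Longrightarrow> poly_fun J 1 (\<phi> i)"
 shows "poly_fun J (length l) (\<lambda>x. \<Prod>i\<leftarrow>l. \<phi> i x)"
 using assms
proof (induction l)
 case (Cons i l)
 then show ?case using poly_fun_mult[of J 1 "\<phi> i" "length l"] by simp
qed (simp add: poly_fun_const)

lemma poly_fun_subst:
 assumes "poly_fun I D f" "\<And>i. i \<in> I \<Longrightarrow> poly_fun J 1 (\<phi> i)"
 shows "poly_fun J D (\<lambda>x. f (\<lambda>i. \<phi> i x))"
 using assms(1)
proof (induction rule: poly_fun.induct)
 case (add_monom f l c)
 have "poly_fun J D (\<lambda>x. \<Prod>i\<leftarrow>l. \<phi> i x)"
  using add_monom assms(2) by (intro poly_fun_mono[OF poly_fun_prod_list]) auto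
 then show ?case using add_monom by (intro poly_fun_add poly_fun_cmult)
qed (rule poly_fun.zero)

lemma poly_fun_cong: "poly_fun I D f \<Longrightarrow> (\<And>i. i \<in> I \<Longrightarrow> x i = y i) \<Longrightarrow> f x = f y"
proof (induction rule: poly_fun.induct)
 case (add_monom f l c)
 have "map x l = map y l" using add_monom by (intro map_cong) auto
 then show ?case using add_monom by (metis (no_types, lifting))
qed simp

subsection \<open>Gaussian families\<close>

abbreviation qform :: "'i set \<Rightarrow> ('i \<Rightarrow> 'i \<Rightarrow> real) \<Rightarrow> ('i \<Rightarrow> real) \<Rightarrow> real" where
 "qform I K c \<equiv> (\<Sum>i\<in>I. \<Sum>j\<in>I. c i * c j * K i j)"

text \<open>Joint Gaussianity in Cramer-Wold form. Since \<open>K\<close> enters only through its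
  quadratic form, symmetry of \<open>K\<close> is stated separately where the matrix is
  factored.\<close>

definition gaussian_family ::
 "'a measure \<Rightarrow> 'i set \<Rightarrow> ('i \<Rightarrow> 'a \<Rightarrow> real) \<Rightarrow> ('i \<Rightarrow> 'i \<Rightarrow> real) \<Rightarrow> bool" where
 "gaussian_family M I Z K \<longleftrightarrow> finite I \<and>
   (\<forall>c. gaussian_moments M (qform I K c) (\<lambda>\<omega>. \<Sum>i\<in>I. c i * Z i \<omega>))"

lemma qform_nonneg_of_family:
 assumes "gaussian_family M I Z K"
 shows "qform I K c \<ge> 0"
proof -
 have "gaussian_moments M (qform I K c) (\<lambda>\<omega>. \<Sum>i\<in>I. c i * Z i \<omega>)"
  using assms by (simp add: gaussian_family_def)
 then have "(LINT \<omega>|M. (\<Sum>i\<in>I. c i * Z i \<omega>) ^ 2) = gauss_moment 2 (qform I K c)"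
  unfolding gaussian_moments_def by blast
 then have "qform I K c = (LINT \<omega>|M. (\<Sum>i\<in>I. c i * Z i \<omega>) ^ 2)" by simp
 then show ?thesis by simp
qed

lemma qform_subset:
 assumes "finite I" "J \<subseteq> I"
 shows "qform I K (\<lambda>i. if i \<in> J then c i else 0) = qform J K c"
proof -
 have fJ: "finite J" using assms finite_subset by blast
 have "qform I K (\<lambda>i. if i \<in> J then c i else 0)
   = (\<Sum>i\<in>J. \<Sum>j\<in>I. (if i \<in> J then c i else 0) * (if j \<in> J then c j else 0) * K i j)"
  using assms by (intro sum.mono_neutral_right ballI sum.neutral) auto
 also have "\<dots> = (\<Sum>i\<in>J. \<Sum>j\<in>J. (if i \<in> J then c i else 0) * (if j \<in> J then c j else 0) * K i j)"
  using assms by (intro sum.cong refl sum.mono_neutral_right) auto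
 finally show ?thesis by simp
qed

lemma gaussian_family_subset:
 assumes "gaussian_family M I Z K" "J \<subseteq> I"
 shows "gaussian_family M J Z K"
proof -
 have fin: "finite I" using assms by (simp add: gaussian_family_def)
 show ?thesis unfolding gaussian_family_def
 proof (intro conjI allI)
  show "finite J" using fin assms(2) finite_subset by blast
  fix c
  have "gaussian_moments M (qform I K (\<lambda>i. if i \<in> J then c i else 0))
    (\<lambda>\<omega>. \<Sum>i\<in>I. (if i \<in> J then c i else 0) * Z i \<omega>)"
   using assms(1) by (simp add: gaussian_family_def)
  moreover have "(\<Sum>i\<in>I. (if i \<in> J then c i else 0) * Z i \<omega>) = (\<Sum>i\<in>J. c i * Z i \<omega>)" for \<omega>
   using fin assms(2) by (intro sum.mono_neutral_cong_right) auto
  ultimately show "gaussian_moments M (qform J K c) (\<lambda>\<omega>. \<Sum>i\<in>J. c i * Z i \<omega>)"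
   unfolding qform_subset[OF fin assms(2)] by simp
 qed
qed

lemma gaussian_family_cong:
 assumes "gaussian_family M I Z K" "\<And>i j. i \<in> I \<Longrightarrow> j \<in> I \<Longrightarrow> K i j = K' i j"
 shows "gaussian_family M I Z K'"
proof -
 have "qform I K c = qform I K' c" for c
  using assms(2) by (intro sum.cong) auto
 then show ?thesis using assms(1) by (simp add: gaussian_family_def)
qed

lemma gaussian_family_measurable:
 assumes "gaussian_family M I Z K" "i \<in> I"
 shows "Z i \<in> borel_measurable M"
proof -
 have fin: "finite I" using assms by (simp add: gaussian_family_def)
 have "(\<Sum>j\<in>I. (if j = i then 1 else 0) * Z j \<omega>) = Z i \<omega>" for \<omega>
  using assms(2) fin by (simp add: if_distrib[of "\<lambda>x. x * _"] sum.delta cong: if_cong)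
 moreover have "(\<lambda>\<omega>. \<Sum>j\<in>I. c j * Z j \<omega>) \<in> borel_measurable M" for c
  using assms(1) unfolding gaussian_family_def gaussian_moments_def by blast
 from this[of "\<lambda>j. if j = i then 1 else 0"]
 have "(\<lambda>\<omega>. \<Sum>j\<in>I. (if j = i then 1 else 0) * Z j \<omega>) \<in> borel_measurable M" .
 ultimately show ?thesis by simp
qed

text \<open>The mixed moment of Isserlis' theorem. Polarizing the one-dimensional moment formula
  takes the place of the sum over pairings and shows that the value depends only on the quadratic
  form of \<open>K\<close>.\<close>

definition wick :: "'i set \<Rightarrow> ('i \<Rightarrow> 'i \<Rightarrow> real) \<Rightarrow> 'i list \<Rightarrow> real" where
 "wick I K l = polar l (\<lambda>c. gauss_moment (length l) (qform I K c)) (\<lambda>_. 0) / fact (length l)"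

lemma polar_integral:
 assumes "\<And>c. integrable M (g c)"
 shows "integrable M (\<lambda>\<omega>. polar l (\<lambda>c. g c \<omega>) c)"
  and "(LINT \<omega>|M. polar l (\<lambda>c. g c \<omega>) c) = polar l (\<lambda>c. LINT \<omega>|M. g c \<omega>) c"
proof -
 have "integrable M (\<lambda>\<omega>. polar l (\<lambda>c. g c \<omega>) c) \<and>
   (LINT \<omega>|M. polar l (\<lambda>c. g c \<omega>) c) = polar l (\<lambda>c. LINT \<omega>|M. g c \<omega>) c"
  by (induction l arbitrary: c) (auto simp: assms)
 then show "integrable M (\<lambda>\<omega>. polar l (\<lambda>c. g c \<omega>) c)"
  "(LINT \<omega>|M. polar l (\<lambda>c. g c \<omega>) c) = polar l (\<lambda>c. LINT \<omega>|M. g c \<omega>) c" by auto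
qed

text \<open>Expectation commutes with the finitely many differences in \<open>polar\<close>, so
  \<open>polarization\<close> carries the moments of linear combinations over to products.\<close>

lemma gaussian_family_monom:
 assumes "gaussian_family M I Z K" "set l \<subseteq> I"
 shows "has_bochner_integral M (\<lambda>\<omega>. \<Prod>i\<leftarrow>l. Z i \<omega>) (wick I K l)"
proof -
 have fin: "finite I" using assms by (simp add: gaussian_family_def)
 let ?g = "\<lambda>c \<omega>. (\<Sum>i\<in>I. c i * Z i \<omega>) ^ length l"
 have int: "integrable M (?g c)" and E: "(LINT \<omega>|M. ?g c \<omega>) = gauss_moment (length l) (qform I K c)" for c
  using assms(1) by (auto simp: gaussian_family_def gaussian_moments_def)
 have eq: "(\<Prod>i\<leftarrow>l. Z i \<omega>) = polar l (\<lambda>c. ?g c \<omega>) (\<lambda>_. 0) / fact (length l)" for \<omega>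
  using polarization[OF fin assms(2), of "\<lambda>i. Z i \<omega>" "\<lambda>_. 0"] by simp
 show ?thesis
  unfolding eq has_bochner_integral_iff wick_def
  using polar_integral[of M ?g l "\<lambda>_. 0", OF int] by (simp add: E)
qed

lemma gaussian_family_integrable:
 assumes "gaussian_family M I Z K" "poly_fun I D f"
 shows "integrable M (\<lambda>\<omega>. f (\<lambda>i. Z i \<omega>))"
 using assms(2)
 by (induction rule: poly_fun.induct)
  (auto simp: gaussian_family_monom[OF assms(1), unfolded has_bochner_integral_iff])

text \<open>Expectations of polynomials are functions of the covariance alone. Any computation may
  therefore be moved to another space that carries a family with the same \<open>K\<close>.\<close>

lemma gaussian_family_determined:
 assumes "gaussian_family M I Z K" "gaussian_family M' I Z' K" "poly_fun I D f"
 shows "(LINT \<omega>|M. f (\<lambda>i. Z i \<omega>)) = (LINT \<omega>|M'. f (\<lambda>i. Z' i \<omega>))"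
 using assms(3)
proof (induction rule: poly_fun.induct)
 case (add_monom f l c)
 note 1 = gaussian_family_monom[OF assms(1) add_monom(2), unfolded has_bochner_integral_iff]
 note 2 = gaussian_family_monom[OF assms(2) add_monom(2), unfolded has_bochner_integral_iff]
 show ?case
  using 1 2 add_monom.IH gaussian_family_integrable[OF assms(1) add_monom(1)]
   gaussian_family_integrable[OF assms(2) add_monom(1)] by simp
qed simp

lemma qform_linear:
 "qform I (\<lambda>i j. \<Sum>l\<in>L. A i l * A j l) c = (\<Sum>l\<in>L. (\<Sum>i\<in>I. c i * A i l)^2)"
proof -
 have "qform I (\<lambda>i j. \<Sum>l\<in>L. A i l * A j l) c = (\<Sum>i\<in>I. \<Sum>j\<in>I. \<Sum>l\<in>L. (c i * A i l) * (c j * A j l))"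
  by (simp add: sum_distrib_left mult_ac)
 also have "\<dots> = (\<Sum>i\<in>I. \<Sum>l\<in>L. \<Sum>j\<in>I. (c i * A i l) * (c j * A j l))"
  by (intro sum.cong refl sum.swap)
 also have "\<dots> = (\<Sum>l\<in>L. \<Sum>i\<in>I. \<Sum>j\<in>I. (c i * A i l) * (c j * A j l))"
  by (rule sum.swap)
 also have "\<dots> = (\<Sum>l\<in>L. (\<Sum>i\<in>I. c i * A i l)^2)"
  by (simp add: power2_eq_square sum_product)
 finally show ?thesis .
qed

lemma gaussian_family_linear:
 assumes "\<And>c. gaussian_moments M (\<Sum>l\<in>L. (c l)^2) (\<lambda>\<omega>. \<Sum>l\<in>L. c l * N l \<omega>)" "finite I"
 shows "gaussian_family M I (\<lambda>i \<omega>. \<Sum>l\<in>L. A i l * N l \<omega>) (\<lambda>i j. \<Sum>l\<in>L. A i l * A j l)"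
 unfolding gaussian_family_def
proof (intro conjI allI)
 fix c :: "'c \<Rightarrow> real"
 have "(\<Sum>i\<in>I. c i * (\<Sum>l\<in>L. A i l * N l \<omega>)) = (\<Sum>l\<in>L. (\<Sum>i\<in>I. c i * A i l) * N l \<omega>)" for \<omega>
  unfolding sum_distrib_left sum_distrib_right by (subst sum.swap) (simp add: mult_ac)
 then show "gaussian_moments M (qform I (\<lambda>i j. \<Sum>l\<in>L. A i l * A j l) c)
   (\<lambda>\<omega>. \<Sum>i\<in>I. c i * (\<Sum>l\<in>L. A i l * N l \<omega>))"
  using assms(1)[of "\<lambda>l. \<Sum>i\<in>I. c i * A i l"] by (simp add: qform_linear)
qed (fact assms(2))

subsection \<open>Factorisation of positive semidefinite matrices\<close>

lemma qform_insert:
 assumes "finite I" "p \<notin> I"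
 shows "qform (insert p I) K c = (c p)^2 * K p p + c p * (\<Sum>i\<in>I. c i * (K p i + K i p)) + qform I K c"
 using assms
 by (simp add: sum.distrib power2_eq_square algebra_simps sum_distrib_left)

lemma qform_cong_upd: "p \<notin> I \<Longrightarrow> qform I K (c(p := t)) = qform I K c"
 by (intro sum.cong) auto

text \<open>Cholesky factorization by induction on the index set: the pivot \<open>p\<close> is
  eliminated and the Schur complement of the rest is factored.\<close>

lemma psd_factorization:
 assumes "finite I" "\<And>i j. i \<in> I \<Longrightarrow> j \<in> I \<Longrightarrow> K i j = K j i" "\<And>c. qform I K c \<ge> 0"
 shows "\<exists>A (d :: nat). \<forall>i\<in>I. \<forall>j\<in>I. K i j = (\<Sum>l<d. A i l * A j l)"
 using assms
proof (induction I arbitrary: K)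
 case empty
 then show ?case by simp
next
 case (insert p I)
 have ins: "qform (insert p I) K (c(p := t))
   = t\<^sup>2 * K p p + 2 * t * (\<Sum>i\<in>I. c i * K i p) + qform I K c" for c t
 proof -
  have s: "(\<Sum>i\<in>I. (c(p := t)) i * (K p i + K i p)) = 2 * (\<Sum>i\<in>I. c i * K i p)"
   unfolding sum_distrib_left using insert.hyps insert.prems(1)
   by (intro sum.cong) auto
  show ?thesis
   unfolding qform_insert[OF insert.hyps(1,2)] s qform_cong_upd[OF insert.hyps(2)] by simp
 qed
 have pp: "K p p \<ge> 0"
  using insert.prems(2)[of "(\<lambda>_. 0)(p := 1)"] unfolding ins by simp
 show ?case
 proof (cases "K p p = 0")
  case True
  \<comment> \<open>A zero pivot forces a zero row. Otherwise the quadratic form is affine in the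
    coefficient of \<open>p\<close> with nonzero slope, and the value chosen below makes it equal to
    \<open>-1\<close>.\<close>
  have z: "K j p = 0" if j: "j \<in> I" for j
  proof (rule ccontr)
   assume nz: "K j p \<noteq> 0"
   let ?c = "\<lambda>i. if i = j then 1 else 0 :: real"
   have s: "(\<Sum>i\<in>I. ?c i * K i p) = K j p"
    using j insert.hyps by (simp add: if_distrib[of "\<lambda>x. x * _"] cong: if_cong)
   have "0 \<le> 2 * t * K j p + qform I K ?c" for t
    using insert.prems(2)[of "?c(p := t)"] unfolding ins s True by simp
   from this[of "- (qform I K ?c + 1) / (2 * K j p)"] show False
    using nz by (simp add: field_simps)
  qed
  have "qform I K c \<ge> 0" for c
   using insert.prems(2)[of "c(p := 0)"] unfolding ins by simp
  then obtain A and d :: nat where A: "\<forall>i\<in>I. \<forall>j\<in>I. K i j = (\<Sum>l<d. A i l * A j l)"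
   using insert.IH[of K] insert.prems(1) by blast
  show ?thesis
   using A z True insert.prems(1) insert.hyps
   by (intro exI[of _ "A(p := \<lambda>_. 0)"] exI[of _ d]) auto
 next
  case False
  then have pp: "K p p > 0" using pp by simp
  \<comment> \<open>The Schur complement. Its quadratic form is that of \<open>K\<close> minimised
    over the coefficient of \<open>p\<close>, with the minimum at
    \<open>- S / K p p\<close>.\<close>
  define K' where "K' i j = K i j - K i p * K p j / K p p" for i j
  have psd: "qform I K' c \<ge> 0" for c
  proof -
   define S where "S = (\<Sum>i\<in>I. c i * K i p)"
   have S': "S = (\<Sum>j\<in>I. c j * K p j)"
    unfolding S_def using insert.prems(1) by (intro sum.cong) auto
   have "S * S = (\<Sum>i\<in>I. \<Sum>j\<in>I. (c i * K i p) * (c j * K p j))"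
    by (subst (1) S_def, subst S', simp add: sum_product)
   then have "qform I K' c = qform I K c - S * S / K p p"
    by (simp add: K'_def sum_subtractf sum_divide_distrib right_diff_distrib mult_ac)
   also have "\<dots> = (- S / K p p)^2 * K p p + 2 * (- S / K p p) * S + qform I K c"
    using pp by (simp add: field_simps power2_eq_square)
   also have "\<dots> = qform (insert p I) K (c(p := - S / K p p))" unfolding ins S_def ..
   finally show ?thesis using insert.prems(2) by simp
  qed
  have "K' i j = K' j i" if "i \<in> I" "j \<in> I" for i j
   using insert.prems(1)[of i j] insert.prems(1)[of i p] insert.prems(1)[of p j] that
   by (simp add: K'_def)
  then obtain A and d :: nat where A: "\<forall>i\<in>I. \<forall>j\<in>I. K' i j = (\<Sum>l<d. A i l * A j l)"
   using insert.IH[of K'] psd by blast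
  define A' where "A' i l = (if l = d then K i p / sqrt (K p p) else if i = p then 0 else A i l)" for i l
  have "K i j = (\<Sum>l<Suc d. A' i l * A' j l)" if ij: "i \<in> insert p I" "j \<in> insert p I" for i j
  proof -
   have last: "A' i d * A' j d = K i p * K j p / K p p"
    using pp by (simp add: A'_def)
   have first: "(\<Sum>l<d. A' i l * A' j l) = (if i = p \<or> j = p then 0 else K' i j)"
    using A ij by (auto simp: A'_def)
   have "K j p = K p j" using ij insert.prems(1)[of j p] by simp
   then show ?thesis
    unfolding sum.lessThan_Suc last first using pp by (auto simp: K'_def)
  qed
  then show ?thesis by (intro exI[of _ A'] exI[of _ "Suc d"]) auto
 qed
qed

subsection \<open>Independent standard normal variables\<close>

text \<open>The integral of \<open>(s * u + t * v)^2\<close> is nonnegative for all \<open>s\<close>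
  and \<open>t\<close>; the choice \<open>s = b\<close>, \<open>t = - c\<close> gives the inequality
  when \<open>b > 0\<close>.\<close>

lemma integral_Cauchy_Schwarz:
 fixes u v :: "'a \<Rightarrow> real"
 assumes "integrable M (\<lambda>x. (u x)^2)" "integrable M (\<lambda>x. (v x)^2)" "integrable M (\<lambda>x. u x * v x)"
 shows "(LINT x|M. u x * v x)^2 \<le> (LINT x|M. (u x)^2) * (LINT x|M. (v x)^2)"
proof -
 define a where "a = (LINT x|M. (u x)^2)"
 define b where "b = (LINT x|M. (v x)^2)"
 define c where "c = (LINT x|M. u x * v x)"
 have *: "0 \<le> s\<^sup>2 * a + 2 * s * t * c + t\<^sup>2 * b" for s t
 proof -
  have "0 \<le> (LINT x|M. (s * u x + t * v x)^2)" by simp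
  also have "\<dots> = (LINT x|M. s\<^sup>2 * (u x)^2 + 2 * s * t * (u x * v x) + t\<^sup>2 * (v x)^2)"
   by (simp add: power2_eq_square algebra_simps)
  also have "\<dots> = s\<^sup>2 * a + 2 * s * t * c + t\<^sup>2 * b"
   using assms by (simp add: a_def b_def c_def)
  finally show ?thesis .
 qed
 have b0: "b \<ge> 0" by (simp add: b_def)
 show ?thesis
 proof (cases "b = 0")
  case True
  have "c = 0"
  proof (rule ccontr)
   assume "c \<noteq> 0"
   then show False using *[of 1 "- (a + 1) / (2 * c)"] True by (simp add: field_simps)
  qed
  then show ?thesis using True by (simp add: b_def c_def)
 next
  case False
  then have "b > 0" using b0 by simp
  moreover have "0 \<le> b * (b * a - c\<^sup>2)"
   using *[of b "- c"] by (simp add: power2_eq_square algebra_simps)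
  ultimately show ?thesis
   by (simp add: a_def[symmetric] b_def[symmetric] c_def[symmetric] zero_le_mult_iff mult.commute)
 qed
qed

abbreviation std_normal :: "real measure" where
 "std_normal \<equiv> density lborel std_normal_density"

text \<open>The model space of independent standard normal coordinates. Finite Gaussian families
  with symmetric covariance are compared with linear images of these coordinates.\<close>

definition normal_seq :: "(nat \<Rightarrow> real) measure" where
 "normal_seq = PiM UNIV (\<lambda>_. std_normal)"

interpretation std_normal: prob_space std_normal
 using prob_space_normal_density[of 1 0] by simp

lemma prob_space_normal_seq: "prob_space normal_seq"
 unfolding normal_seq_def by (rule prob_space_PiM) (rule std_normal.prob_space_axioms)

interpretation normal_seq: prob_space normal_seq
 by (rule prob_space_normal_seq)

lemma sets_normal_seq [measurable_cong]: "sets normal_seq = sets (PiM UNIV (\<lambda>_. borel))"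
 unfolding normal_seq_def by (intro sets_PiM_cong) auto

lemma distr_normal_seq_coord: "distr normal_seq borel (\<lambda>\<omega>. \<omega> i) = std_normal"
proof -
 have "distr normal_seq std_normal (\<lambda>\<omega>. \<omega> i) = std_normal"
  unfolding normal_seq_def by (rule distr_PiM_component) (auto intro: std_normal.prob_space_axioms)
 moreover have "distr normal_seq borel (\<lambda>\<omega>. \<omega> i) = distr normal_seq std_normal (\<lambda>\<omega>. \<omega> i)"
  by (intro distr_cong) auto
 ultimately show ?thesis by simp
qed

lemma normal_seq_coord_expectation:
 "f \<in> borel_measurable borel \<Longrightarrow> (LINT \<omega>|normal_seq. f (\<omega> i)) = (LINT x|std_normal. (f x :: real))"
 unfolding distr_normal_seq_coord[of i, symmetric] by (subst integral_distr) auto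

lemma normal_seq_indep: "normal_seq.indep_vars (\<lambda>_. borel) (\<lambda>i \<omega>. \<omega> i) UNIV"
proof (subst normal_seq.indep_vars_iff_distr_eq_PiM)
 have "distr normal_seq (PiM UNIV (\<lambda>_. borel)) (\<lambda>x. \<lambda>i\<in>UNIV. x i) = normal_seq"
  by (simp add: restrict_UNIV distr_id2 sets_normal_seq)
 then show "distr normal_seq (PiM UNIV (\<lambda>_. borel)) (\<lambda>x. \<lambda>i\<in>UNIV. x i) =
   PiM UNIV (\<lambda>i. distr normal_seq borel (\<lambda>\<omega>. \<omega> i))"
  unfolding distr_normal_seq_coord by (simp add: normal_seq_def)
qed auto

lemma gaussian_moments_coord: "gaussian_moments normal_seq 1 (\<lambda>\<omega>. \<omega> i)"
proof -
 have "distributed normal_seq lborel (\<lambda>\<omega>. \<omega> i) std_normal_density"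
  unfolding distributed_def
 proof (intro conjI)
  have "distr normal_seq lborel (\<lambda>\<omega>. \<omega> i) = distr normal_seq borel (\<lambda>\<omega>. \<omega> i)"
   by (intro distr_cong) auto
  then show "distr normal_seq lborel (\<lambda>\<omega>. \<omega> i) = std_normal"
   using distr_normal_seq_coord[of i] by simp
 qed auto
 then show ?thesis using normal_seq.gaussian_moments_normal[of "\<lambda>\<omega>. \<omega> i" 1] by simp
qed

lemma gaussian_moments_normal_seq_linear:
 "finite L \<Longrightarrow> gaussian_moments normal_seq (\<Sum>l\<in>L. (c l)^2) (\<lambda>\<omega>. \<Sum>l\<in>L. c l * \<omega> l)"
proof (rule normal_seq.gaussian_moments_sum)
 show "normal_seq.indep_vars (\<lambda>_. borel) (\<lambda>l \<omega>. c l * \<omega> l) L"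
  using normal_seq.indep_vars_compose2[OF normal_seq.indep_vars_subset[OF normal_seq_indep, of L],
    of "\<lambda>l x. c l * x" "\<lambda>_. borel"] by auto
 show "gaussian_moments normal_seq ((c l)^2) (\<lambda>\<omega>. c l * \<omega> l)" for l
  using gaussian_moments_cmult[OF gaussian_moments_coord, of "c l" l] by simp
qed

lemma normal_seq_family_linear:
 "finite I \<Longrightarrow> finite L \<Longrightarrow>
  gaussian_family normal_seq I (\<lambda>i \<omega>. \<Sum>l\<in>L. A i l * \<omega> l) (\<lambda>i j. \<Sum>l\<in>L. A i l * A j l)"
 using gaussian_family_linear[of normal_seq L "\<lambda>l \<omega>. \<omega> l" I A] gaussian_moments_normal_seq_linear by blast

lemma normal_seq_family: "finite L \<Longrightarrow> gaussian_family normal_seq L (\<lambda>l \<omega>. \<omega> l) (\<lambda>i j. of_bool (i = j))"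
proof -
 assume L: "finite L"
 have "qform L (\<lambda>i j. of_bool (i = j)) c = (\<Sum>l\<in>L. (c l)^2)" for c
 proof (rule sum.cong)
  fix i assume "i \<in> L"
  then show "(\<Sum>j\<in>L. c i * c j * of_bool (i = j)) = (c i)^2"
   using L by (simp add: of_bool_def if_distrib power2_eq_square cong: if_cong)
 qed simp
 then show ?thesis
  using L gaussian_moments_normal_seq_linear[OF L] by (simp add: gaussian_family_def)
qed

lemma normal_seq_poly_integrable: "finite L \<Longrightarrow> poly_fun L D f \<Longrightarrow> integrable normal_seq f"
 using gaussian_family_integrable[OF normal_seq_family] by blast

text \<open>The factor \<open>A\<close> of \<open>K\<close> is applied to independent standard
  normals.\<close>

lemma psd_realization:
 assumes "finite I" "\<And>i j. i \<in> I \<Longrightarrow> j \<in> I \<Longrightarrow> K i j = K j i" "\<And>c. qform I K c \<ge> 0"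
 obtains A and d :: nat where "gaussian_family normal_seq I (\<lambda>i \<omega>. \<Sum>l<d. A i l * \<omega> l) K"
  "\<And>i j. i \<in> I \<Longrightarrow> j \<in> I \<Longrightarrow> K i j = (\<Sum>l<d. A i l * A j l)"
proof -
 from psd_factorization[of I K] assms obtain A and d :: nat
  where A: "\<forall>i\<in>I. \<forall>j\<in>I. K i j = (\<Sum>l<d. A i l * A j l)"
  by blast
 show ?thesis
  by (rule that[of A d], rule gaussian_family_cong[OF normal_seq_family_linear])
   (use A assms(1) in auto)
qed

lemma poly_fun_measurable: "poly_fun L D f \<Longrightarrow> f \<in> borel_measurable (PiM L (\<lambda>_. borel))"
proof (induction rule: poly_fun.induct)
 case (add_monom f l c)
 have "(\<lambda>x. \<Prod>i\<leftarrow>l. x i :: real) \<in> borel_measurable (PiM L (\<lambda>_. borel))"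
  using add_monom(2)
 proof (induction l)
  case (Cons i l)
  have "(\<lambda>x. x i :: real) \<in> borel_measurable (PiM L (\<lambda>_. borel))"
   using Cons.prems by (intro measurable_component_singleton) auto
  moreover have "(\<lambda>x. \<Prod>i\<leftarrow>l. x i :: real) \<in> borel_measurable (PiM L (\<lambda>_. borel))"
   using Cons by simp
  ultimately show ?case by simp
 qed simp
 then show ?case using add_monom.IH by simp
qed simp

lemma normal_seq_indep_poly:
 assumes "finite L" "finite L'" "L \<inter> L' = {}" "poly_fun L D f" "poly_fun L' D' g"
 shows "(LINT \<omega>|normal_seq. f \<omega> * g \<omega>) = (LINT \<omega>|normal_seq. f \<omega>) * (LINT \<omega>|normal_seq. g \<omega>)"
proof (rule normal_seq.indep_var_lebesgue_integral)
 have "normal_seq.indep_var borel (f \<circ> (\<lambda>\<omega>. restrict (\<lambda>i. \<omega> i) L))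
   borel (g \<circ> (\<lambda>\<omega>. restrict (\<lambda>i. \<omega> i) L'))"
  by (intro normal_seq.indep_var_compose[OF normal_seq.indep_var_restrict[OF normal_seq_indep assms(3)]]
    poly_fun_measurable[OF assms(4)] poly_fun_measurable[OF assms(5)]) auto
 moreover have "f \<circ> (\<lambda>\<omega>. restrict (\<lambda>i. \<omega> i) L) = f" "g \<circ> (\<lambda>\<omega>. restrict (\<lambda>i. \<omega> i) L') = g"
  by (auto simp: fun_eq_iff intro: poly_fun_cong[OF assms(4)] poly_fun_cong[OF assms(5)])
 ultimately show "normal_seq.indep_var borel f borel g" by simp
qed (use assms normal_seq_poly_integrable in auto)

subsection \<open>Hypercontractivity\<close>

text \<open>Monomials are sorted by the power of the last variable. That the coefficient of its
  \<open>k\<close>-th power has degree only \<open>D - k\<close> is what lets the induction in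
  \<open>hypercontractivity\<close> gain a factor.\<close>

lemma poly_fun_last_variable:
 assumes "poly_fun {..<Suc d} D f"
 shows "\<exists>g. (\<forall>k\<le>D. poly_fun {..<d} (D - k) (g k)) \<and> f = (\<lambda>x. \<Sum>k\<le>D. x d ^ k * g k x)"
 using assms
proof (induction rule: poly_fun.induct)
 case zero
 show ?case by (rule exI[of _ "\<lambda>k x. 0"]) (auto intro: poly_fun.zero)
next
 case (add_monom f l c)
 then obtain g where g: "\<And>k. k \<le> D \<Longrightarrow> poly_fun {..<d} (D - k) (g k)"
  "f = (\<lambda>x. \<Sum>k\<le>D. x d ^ k * g k x)" by blast
 define n where "n = count_list l d"
 define l' where "l' = filter (\<lambda>i. i \<noteq> d) l"
 have split: "(\<Prod>i\<leftarrow>l. x i) = x d ^ n * (\<Prod>i\<leftarrow>l'. x i)" for x :: "nat \<Rightarrow> real"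
  unfolding n_def l'_def by (induction l) auto
 have len: "length l = n + length l'"
  unfolding n_def l'_def by (induction l) auto
 have set: "set l' \<subseteq> {..<d}" using add_monom(2) by (auto simp: l'_def less_Suc_eq)
 define g' where "g' = g(n := \<lambda>x. c * (\<Prod>i\<leftarrow>l'. x i) + g n x)"
 have nD: "n \<le> D" using len add_monom(3) by simp
 have "poly_fun {..<d} (D - k) (g' k)" if "k \<le> D" for k
  using that g(1) set len add_monom(3) by (auto simp: g'_def intro!: poly_fun.add_monom)
 moreover have "c * (\<Prod>i\<leftarrow>l. x i) + f x = (\<Sum>k\<le>D. x d ^ k * g' k x)" for x
 proof -
  have "(\<Sum>k\<le>D. x d ^ k * g' k x)
    = (\<Sum>k\<le>D. (if k = n then x d ^ n * (c * (\<Prod>i\<leftarrow>l'. x i)) else 0) + x d ^ k * g k x)"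
   by (intro sum.cong) (auto simp: g'_def algebra_simps)
  also have "\<dots> = x d ^ n * (c * (\<Prod>i\<leftarrow>l'. x i)) + f x"
   using nD by (simp add: sum.distrib g(2))
  finally show ?thesis by (simp add: split)
 qed
 ultimately show ?case by (intro exI[of _ g']) auto
qed

text \<open>By \<open>poly_coeff_bound\<close> the coefficients are controlled by the integral over
  \<open>[0, 1]\<close>, where the normal density is at least its value at \<open>1\<close>. The
  integral of the modulus is passed to that of the square by expanding the variance on
  \<open>[0, 1]\<close>.\<close>

lemma normal_coeff_bound:
 "\<exists>C>0. \<forall>a :: nat \<Rightarrow> real. (\<Sum>k\<le>D. (a k)^2) \<le> C * (LINT x|std_normal. (\<Sum>k\<le>D. a k * x ^ k)^2)"
proof -
 obtain C where C: "C > 0"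
  "\<And>(a :: nat \<Rightarrow> real) k. k \<le> D \<Longrightarrow> \<bar>a k\<bar> \<le> C * integral {0..1} (\<lambda>x. \<bar>\<Sum>k\<le>D. a k * x ^ k\<bar>)"
  using poly_coeff_bound[of D] by blast
 define \<delta> :: real where "\<delta> = std_normal_density 1"
 have d0: "\<delta> > 0" by (simp add: \<delta>_def normal_density_pos)
 have main: "(a k)^2 \<le> C\<^sup>2 / \<delta> * (LINT x|std_normal. (\<Sum>k\<le>D. a k * x ^ k)^2)"
  if "k \<le> D" for a :: "nat \<Rightarrow> real" and k
 proof -
  define p where "p x = (\<Sum>k\<le>D. a k * x ^ k)" for x
  have pc: "continuous_on A p" for A unfolding p_def by (intro continuous_intros)
  have [measurable]: "p \<in> borel_measurable borel" unfolding p_def by measurable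
  define m where "m = integral {0..1} (\<lambda>x. \<bar>p x\<bar>)"
  have "0 \<le> integral {0..1} (\<lambda>x. (\<bar>p x\<bar> - m)^2)"
   by (intro integral_nonneg integrable_continuous_real continuous_intros pc) auto
  also have "\<dots> = integral {0..1} (\<lambda>x. (p x)^2 - 2 * m * \<bar>p x\<bar> + m\<^sup>2)"
   by (simp add: power2_diff algebra_simps)
  also have "\<dots> = integral {0..1} (\<lambda>x. (p x)^2) - 2 * m * m + m\<^sup>2"
   unfolding m_def
   by (subst integral_add, (auto intro!: integrable_continuous_real continuous_intros pc)[2],
    subst integral_diff, (auto intro!: integrable_continuous_real continuous_intros pc)[2]) simp
  finally have m2: "m\<^sup>2 \<le> integral {0..1} (\<lambda>x. (p x)^2)" by (simp add: power2_eq_square)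
  have int_sq: "set_integrable lborel {0..1} (\<lambda>x. (p x)^2)"
   by (intro borel_integrable_atLeastAtMost' continuous_intros pc)
  have int_full: "integrable lborel (\<lambda>x. std_normal_density x * (p x)^2)"
  proof -
   have "(p x)^2 = (\<Sum>j\<le>D. \<Sum>k\<le>D. a j * a k * x ^ (j + k))" for x
    unfolding p_def power2_eq_square sum_product by (simp add: power_add mult_ac)
   then have "std_normal_density x * (p x)^2
     = (\<Sum>j\<le>D. \<Sum>k\<le>D. a j * a k * (std_normal_density x * (x - 0) ^ (j + k)))" for x
    by (simp add: sum_distrib_left mult_ac)
   moreover have "integrable lborel (\<lambda>x. \<Sum>j\<le>D. \<Sum>k\<le>D. a j * a k * (std_normal_density x * (x - 0) ^ (j + k)))"
    by (intro Bochner_Integration.integrable_sum Bochner_Integration.integrable_mult_right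
      integrable_normal_moment) simp
   ultimately show ?thesis by simp
  qed
  have "\<delta> * integral {0..1} (\<lambda>x. (p x)^2) = (LINT x|lborel. \<delta> * (indicator {0..1} x * (p x)^2))"
   using set_borel_integral_eq_integral(2)[OF int_sq] by (simp add: set_lebesgue_integral_def)
  also have "\<dots> \<le> (LINT x|lborel. std_normal_density x * (p x)^2)"
  proof (rule integral_mono)
   show "integrable lborel (\<lambda>x. \<delta> * (indicator {0..1} x * (p x)^2))"
    using int_sq by (simp add: set_integrable_def)
   show "\<delta> * (indicator {0..1} x * (p x)^2) \<le> std_normal_density x * (p x)^2" for x
   proof (cases "x \<in> {0..1}")
    case True
    then have "\<delta> \<le> std_normal_density x"
     by (auto simp: \<delta>_def std_normal_density_def divide_simps power_le_one)
    then show ?thesis using True by (simp add: mult_right_mono)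
   qed simp
  qed (fact int_full)
  also have "\<dots> = (LINT x|std_normal. (p x)^2)"
   by (subst integral_density) auto
  finally have le: "integral {0..1} (\<lambda>x. (p x)^2) \<le> (LINT x|std_normal. (p x)^2) / \<delta>"
   using d0 by (simp add: field_simps)
  have "\<bar>a k\<bar> \<le> C * m" using C(2)[OF that, of a] by (simp add: m_def p_def)
  then have "(a k)^2 \<le> (C * m)^2" using abs_le_square_iff[of "a k" "C * m"] by simp
  also have "\<dots> \<le> C\<^sup>2 * ((LINT x|std_normal. (p x)^2) / \<delta>)"
   unfolding power_mult_distrib by (rule mult_left_mono[OF order.trans[OF m2 le]]) simp
  finally show ?thesis by (simp add: p_def)
 qed
 show ?thesis
 proof (intro exI[of _ "real (Suc D) * (C\<^sup>2 / \<delta>)"] conjI allI)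
  show "0 < real (Suc D) * (C\<^sup>2 / \<delta>)" using C(1) d0 by simp
  fix a :: "nat \<Rightarrow> real"
  have "(\<Sum>k\<le>D. (a k)^2) \<le> of_nat (card {..D}) * (C\<^sup>2 / \<delta> * (LINT x|std_normal. (\<Sum>k\<le>D. a k * x ^ k)^2))"
   by (rule sum_bounded_above) (use main[of _ a] in auto)
  then show "(\<Sum>k\<le>D. (a k)^2) \<le> real (Suc D) * (C\<^sup>2 / \<delta>) * (LINT x|std_normal. (\<Sum>k\<le>D. a k * x ^ k)^2)"
   by (simp add: mult.assoc)
 qed
qed

text \<open>Cauchy-Schwarz for finite sums, applied twice.\<close>

lemma sum_power4_le:
 fixes u :: "'b \<Rightarrow> real"
 shows "(\<Sum>k\<in>A. u k) ^ 4 \<le> real (card A) ^ 3 * (\<Sum>k\<in>A. u k ^ 4)"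
proof -
 have 1: "(\<Sum>k\<in>A. u k)^2 \<le> real (card A) * (\<Sum>k\<in>A. (u k)^2)"
  and 2: "(\<Sum>k\<in>A. (u k)^2)^2 \<le> real (card A) * (\<Sum>k\<in>A. ((u k)^2)^2)"
  by (metis sum_squared_le_sum_of_squares mult.commute)+
 have "(\<Sum>k\<in>A. u k) ^ 4 = ((\<Sum>k\<in>A. u k)^2)^2" by simp
 also have "\<dots> \<le> (real (card A) * (\<Sum>k\<in>A. (u k)^2))^2" by (rule power_mono[OF 1]) simp
 also have "\<dots> = (real (card A))^2 * (\<Sum>k\<in>A. (u k)^2)^2" by (simp add: power_mult_distrib)
 also have "\<dots> \<le> (real (card A))^2 * (real (card A) * (\<Sum>k\<in>A. ((u k)^2)^2))"
  by (rule mult_left_mono[OF 2]) simp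
 finally show ?thesis by (simp add: power2_eq_square power3_eq_cube power4_eq_xxxx mult.assoc)
qed

abbreviation EN :: "((nat \<Rightarrow> real) \<Rightarrow> real) \<Rightarrow> real" where
 "EN f \<equiv> (LINT \<omega>|normal_seq. f \<omega>)"

text \<open>
 Induction on the number of variables: split \<open>f = h + r\<close>, where \<open>h\<close> is the average of \<open>f\<close> over
 the last variable.  The mixed term \<open>h\<^sup>3 r\<close> has mean zero, and each factor of the last variable
 lowers the degree of its coefficient, which gains a power of \<open>K\<close>.
\<close>

lemma hypercontractivity:
 "\<exists>K\<ge>1. \<forall>d D f. D \<le> D0 \<longrightarrow> poly_fun {..<d} D f \<longrightarrow> EN (\<lambda>\<omega>. f \<omega> ^ 4) \<le> K ^ D * (EN (\<lambda>\<omega>. (f \<omega>)^2))^2"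
proof -
 define m where "m k = gauss_moment k 1" for k
 define B where "B = (\<Sum>k\<le>D0. LINT x|std_normal. (x ^ k - m k) ^ 4)"
 obtain c where c: "c > 0"
  "\<And>a :: nat \<Rightarrow> real. (\<Sum>k\<le>D0. (a k)^2) \<le> c * (LINT x|std_normal. (\<Sum>k\<le>D0. a k * x ^ k)^2)"
  using normal_coeff_bound[of D0] by blast
 \<comment> \<open>\<open>D0 ^ 3\<close> comes from \<open>sum_power4_le\<close>, \<open>B\<close>
   from the fourth moments of the centered powers, and the square of \<open>c\<close> from the
   coefficient bound. The factor \<open>16\<close> in \<open>K\<close> leaves \<open>1 / 16\<close>
   in the bound for the fourth moment of \<open>r\<close>.\<close>
 define C where "C = real D0 ^ 3 * B * c\<^sup>2 + 1"
 define K where "K = 16 * C"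
 have B0: "B \<ge> 0" unfolding B_def by (intro sum_nonneg Bochner_Integration.integral_nonneg) auto
 have C1: "C \<ge> 1" unfolding C_def using B0 by simp
 have K1: "K \<ge> 1" using C1 by (simp add: K_def)
 have Em: "EN (\<lambda>\<omega>. \<omega> d ^ k) = m k" for d k
  using gaussian_moments_coord[of d] by (simp add: gaussian_moments_def m_def)
 have main: "EN (\<lambda>\<omega>. f \<omega> ^ 4) \<le> K ^ D * (EN (\<lambda>\<omega>. (f \<omega>)^2))^2"
  if "D \<le> D0" "poly_fun {..<d} D f" for d D f
  using that
 proof (induction d arbitrary: D f)
  case 0
  have f: "f \<omega> = f (\<lambda>_. 0)" for \<omega> using poly_fun_cong[OF 0(2), of \<omega> "\<lambda>_. 0"] by simp
  have "1 * f (\<lambda>_. 0) ^ 4 \<le> K ^ D * f (\<lambda>_. 0) ^ 4"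
   using K1 by (intro mult_right_mono one_le_power) auto
  then show ?case using normal_seq.prob_space by (subst (1 2) f) simp
 next
  case (Suc d)
  obtain g where g: "\<And>k. k \<le> D \<Longrightarrow> poly_fun {..<d} (D - k) (g k)"
   "f = (\<lambda>x. \<Sum>k\<le>D. x d ^ k * g k x)"
   using poly_fun_last_variable[OF Suc.prems(2)] by blast
  define h where "h x = (\<Sum>k\<le>D. m k * g k x)" for x
  define r where "r x = (\<Sum>k\<in>{1..D}. (x d ^ k - m k) * g k x)" for x
  have f_eq: "f x = h x + r x" for x
  proof -
   have "(\<Sum>k\<le>D. (x d ^ k - m k) * g k x) = r x"
    unfolding r_def by (intro sum.mono_neutral_right) (auto simp: m_def not_le)
   then show ?thesis unfolding g(2) h_def by (simp add: algebra_simps sum_subtractf)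
  qed
  have gD: "poly_fun {..<d} D (g k)" if "k \<le> D" for k
   by (rule poly_fun_mono[OF g(1)[OF that]]) auto
  have ph: "poly_fun {..<d} D h"
   unfolding h_def by (intro poly_fun_sum poly_fun_cmult gD) auto
  have px: "poly_fun {d} (k + k') (\<lambda>x. (x d ^ k - m k) * (x d ^ k' - m k'))"
   and px1: "poly_fun {d} k (\<lambda>x. x d ^ k - m k)" for k k'
  proof -
   have *: "poly_fun {d} k (\<lambda>x. x d ^ k - m k)" for k
    using poly_fun_diff[OF poly_fun_power[OF poly_fun_var[of d "{d}" 1]] poly_fun_const, of k "m k"] by simp
   show "poly_fun {d} (k + k') (\<lambda>x. (x d ^ k - m k) * (x d ^ k' - m k'))"
    by (rule poly_fun_mult[OF * *])
   show "poly_fun {d} k (\<lambda>x. x d ^ k - m k)" by (rule *)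
  qed
  have pr: "poly_fun {..<Suc d} (D + D) r"
   unfolding r_def
   by (intro poly_fun_sum poly_fun_mult poly_fun_mono[OF px1] poly_fun_mono[OF gD]) auto
  have ph': "poly_fun {..<Suc d} D h" by (rule poly_fun_mono[OF ph]) auto
  have int: "integrable normal_seq (\<lambda>\<omega>. h \<omega> ^ i * r \<omega> ^ j)" for i j
   by (rule normal_seq_poly_integrable[of "{..<Suc d}", OF _ poly_fun_mult[OF poly_fun_power[OF ph'] poly_fun_power[OF pr]]]) simp
  have z0: "EN (\<lambda>\<omega>. \<omega> d ^ k - m k) = 0" for k
   using gaussian_moments_coord[of d] normal_seq.prob_space
   by (subst Bochner_Integration.integral_diff) (auto simp: Em gaussian_moments_def)
  have zero: "EN (\<lambda>\<omega>. h \<omega> ^ i * r \<omega>) = 0" for i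
  proof -
   have "EN (\<lambda>\<omega>. h \<omega> ^ i * r \<omega>) = EN (\<lambda>\<omega>. \<Sum>k\<in>{1..D}. (\<omega> d ^ k - m k) * (h \<omega> ^ i * g k \<omega>))"
    unfolding r_def sum_distrib_left by (simp add: mult_ac)
   also have "\<dots> = (\<Sum>k\<in>{1..D}. EN (\<lambda>\<omega>. (\<omega> d ^ k - m k) * (h \<omega> ^ i * g k \<omega>)))"
   proof (rule Bochner_Integration.integral_sum)
    fix k assume "k \<in> {1..D}"
    then show "integrable normal_seq (\<lambda>\<omega>. (\<omega> d ^ k - m k) * (h \<omega> ^ i * g k \<omega>))"
     by (intro normal_seq_poly_integrable[of "{..<Suc d}" "k + (i * D + D)"] poly_fun_mult
       poly_fun_mono[OF px1] poly_fun_power ph' poly_fun_mono[OF gD]) auto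
   qed
   also have "\<dots> = (\<Sum>k\<in>{1..D}. EN (\<lambda>\<omega>. \<omega> d ^ k - m k) * EN (\<lambda>\<omega>. h \<omega> ^ i * g k \<omega>))"
   proof (rule sum.cong[OF refl])
    fix k assume "k \<in> {1..D}"
    then show "EN (\<lambda>\<omega>. (\<omega> d ^ k - m k) * (h \<omega> ^ i * g k \<omega>))
      = EN (\<lambda>\<omega>. \<omega> d ^ k - m k) * EN (\<lambda>\<omega>. h \<omega> ^ i * g k \<omega>)"
     by (intro normal_seq_indep_poly[of "{d}" "{..<d}" k _ "i * D + D"] poly_fun_mult px1 poly_fun_power ph gD) auto
   qed
   also have "\<dots> = 0" by (simp add: z0)
   finally show ?thesis .
  qed
  define a where "a = EN (\<lambda>\<omega>. (h \<omega>)^2)"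
  define b where "b = EN (\<lambda>\<omega>. (r \<omega>)^2)"
  have ab: "a \<ge> 0" "b \<ge> 0" by (simp_all add: a_def b_def)
  have Ef2: "EN (\<lambda>\<omega>. (f \<omega>)^2) = a + b"
  proof -
   have "EN (\<lambda>\<omega>. (f \<omega>)^2) = EN (\<lambda>\<omega>. (h \<omega>)^2 + (r \<omega>)^2 + 2 * (h \<omega> ^ 1 * r \<omega>))"
    by (simp add: f_eq power2_sum mult.assoc)
   also have "\<dots> = a + b"
    using int[of 2 0] int[of 0 2] int[of 1 1] zero[of 1] by (simp add: a_def b_def)
   finally show ?thesis .
  qed
  \<comment> \<open>By \<open>normal_coeff_bound\<close> the Gram matrix \<open>G\<close> of the
    centered powers dominates the identity divided by \<open>c\<close>. The difference
    \<open>Q\<close> is therefore a sum of squares of linear forms, and inserting the functions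
    \<open>g k\<close> into these forms bounds their second moments.\<close>
  have Eg: "(\<Sum>k\<in>{1..D}. EN (\<lambda>\<omega>. (g k \<omega>)^2)) \<le> c * b"
  proof -
   define G where "G k l = EN (\<lambda>\<omega>. (\<omega> d ^ k - m k) * (\<omega> d ^ l - m l))" for k l
   define Q where "Q k l = G k l - of_bool (k = l) / c" for k l
   have intG: "integrable normal_seq (\<lambda>\<omega>. (\<omega> d ^ k - m k) * (\<omega> d ^ l - m l))" for k l
    by (rule normal_seq_poly_integrable[OF _ px]) simp
   have diag: "(\<Sum>k\<in>{1..D}. \<Sum>l\<in>{1..D}. F k l * (of_bool (k = l) / c)) = (\<Sum>k\<in>{1..D}. F k k) / c" for F
   proof -
    have "(\<Sum>l\<in>{1..D}. F k l * (of_bool (k = l) / c)) = F k k / c" if "k \<in> {1..D}" for k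
    proof -
     have "(\<Sum>l\<in>{1..D}. F k l * (of_bool (k = l) / c)) = (\<Sum>l\<in>{1..D}. if l = k then F k k / c else 0)"
      by (intro sum.cong) auto
     then show ?thesis using that by simp
    qed
    then show ?thesis unfolding sum_divide_distrib by (rule sum.cong[OF refl])
   qed
   have psd: "qform {1..D} Q s \<ge> 0" for s :: "nat \<Rightarrow> real"
   proof -
    \<comment> \<open>The constant coefficient is chosen so that the polynomial with coefficients
      \<open>t\<close> is the combination of centered powers with weights \<open>s\<close>.\<close>
    define t where "t k = (if k = 0 then - (\<Sum>k\<in>{1..D}. s k * m k) else if k \<le> D then s k else 0)" for k
    have t_eq: "(\<Sum>k\<le>D0. t k * x ^ k) = (\<Sum>k\<in>{1..D}. s k * (x ^ k - m k))" for x :: real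
    proof -
     have "(\<Sum>k\<le>D0. t k * x ^ k) = (\<Sum>k\<in>insert 0 {1..D}. t k * x ^ k)"
      using Suc.prems(1) by (intro sum.mono_neutral_right) (auto simp: t_def)
     also have "\<dots> = t 0 + (\<Sum>k\<in>{1..D}. s k * x ^ k)" by (subst sum.insert) (auto simp: t_def)
     finally show ?thesis by (simp add: t_def algebra_simps sum_subtractf)
    qed
    have "(\<Sum>k\<in>{1..D}. (s k)^2) = (\<Sum>k\<in>{1..D}. (t k)^2)" by (simp add: t_def)
    also have "\<dots> \<le> (\<Sum>k\<le>D0. (t k)^2)" using Suc.prems(1) by (intro sum_mono2) auto
    also have "\<dots> \<le> c * (LINT x|std_normal. (\<Sum>k\<le>D0. t k * x ^ k)^2)" by (rule c(2))
    also have "(LINT x|std_normal. (\<Sum>k\<le>D0. t k * x ^ k)^2) = EN (\<lambda>\<omega>. (\<Sum>k\<le>D0. t k * \<omega> d ^ k)^2)"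
     by (rule normal_seq_coord_expectation[symmetric]) measurable
    also have "EN (\<lambda>\<omega>. (\<Sum>k\<le>D0. t k * \<omega> d ^ k)^2)
      = EN (\<lambda>\<omega>. \<Sum>k\<in>{1..D}. \<Sum>l\<in>{1..D}. s k * s l * ((\<omega> d ^ k - m k) * (\<omega> d ^ l - m l)))"
     unfolding t_eq by (simp add: power2_eq_square sum_product mult_ac)
    also have "\<dots> = (\<Sum>k\<in>{1..D}. \<Sum>l\<in>{1..D}. s k * s l * G k l)"
     unfolding G_def using intG by simp
    finally have "(\<Sum>k\<in>{1..D}. (s k)^2) / c \<le> (\<Sum>k\<in>{1..D}. \<Sum>l\<in>{1..D}. s k * s l * G k l)"
     using c(1) by (simp add: field_simps)
    moreover have "qform {1..D} Q s = (\<Sum>k\<in>{1..D}. \<Sum>l\<in>{1..D}. s k * s l * G k l) - (\<Sum>k\<in>{1..D}. (s k)^2) / c"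
     using diag[of "\<lambda>k l. s k * s l"]
     by (simp add: Q_def right_diff_distrib sum_subtractf power2_eq_square)
    ultimately show ?thesis by simp
   qed
   have sym: "Q k l = Q l k" for k l by (auto simp: Q_def G_def mult.commute)
   obtain A and n :: nat where A: "\<forall>k\<in>{1..D}. \<forall>l\<in>{1..D}. Q k l = (\<Sum>i<n. A k i * A l i)"
    using psd_factorization[of "{1..D}" Q] sym psd by blast
   have intg: "integrable normal_seq (\<lambda>\<omega>. g k \<omega> * g l \<omega>)" if "k \<in> {1..D}" "l \<in> {1..D}" for k l
    using that by (intro normal_seq_poly_integrable[of "{..<d}" "D + D"] poly_fun_mult gD) auto
   define W where "W k l = EN (\<lambda>\<omega>. g k \<omega> * g l \<omega>)" for k l
   have "0 \<le> EN (\<lambda>\<omega>. \<Sum>i<n. (\<Sum>k\<in>{1..D}. g k \<omega> * A k i)^2)"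
    by (intro Bochner_Integration.integral_nonneg sum_nonneg) auto
   also have "\<dots> = EN (\<lambda>\<omega>. qform {1..D} (\<lambda>k l. \<Sum>i<n. A k i * A l i) (\<lambda>k. g k \<omega>))"
    by (subst qform_linear) simp
   also have "\<dots> = EN (\<lambda>\<omega>. \<Sum>k\<in>{1..D}. \<Sum>l\<in>{1..D}. Q k l * (g k \<omega> * g l \<omega>))"
    using A by (intro Bochner_Integration.integral_cong refl sum.cong) (auto simp: mult_ac)
   also have "\<dots> = (\<Sum>k\<in>{1..D}. \<Sum>l\<in>{1..D}. Q k l * W k l)"
    unfolding W_def using intg by (subst Bochner_Integration.integral_sum, force)
     (intro sum.cong refl, subst Bochner_Integration.integral_sum, auto)
   also have "\<dots> = (\<Sum>k\<in>{1..D}. \<Sum>l\<in>{1..D}. G k l * W k l) - (\<Sum>k\<in>{1..D}. W k k) / c"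
   proof -
    have "Q k l * W k l = G k l * W k l - W k l * (of_bool (k = l) / c)" for k l
     by (simp add: Q_def algebra_simps)
    then show ?thesis by (simp only: sum_subtractf diag)
   qed
   finally have "(\<Sum>k\<in>{1..D}. W k k) \<le> c * (\<Sum>k\<in>{1..D}. \<Sum>l\<in>{1..D}. G k l * W k l)"
    using c(1) by (simp add: field_simps)
   also have "(\<Sum>k\<in>{1..D}. \<Sum>l\<in>{1..D}. G k l * W k l) = b"
   proof -
    have e: "(r \<omega>)^2 = (\<Sum>k\<in>{1..D}. \<Sum>l\<in>{1..D}. ((\<omega> d ^ k - m k) * (\<omega> d ^ l - m l)) * (g k \<omega> * g l \<omega>))" for \<omega>
     by (simp add: r_def power2_eq_square sum_product mult_ac)
    have ee: "EN (\<lambda>\<omega>. ((\<omega> d ^ k - m k) * (\<omega> d ^ l - m l)) * (g k \<omega> * g l \<omega>)) = G k l * W k l"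
     if "k \<in> {1..D}" "l \<in> {1..D}" for k l
     unfolding G_def W_def using that
     by (intro normal_seq_indep_poly[of "{d}" "{..<d}" "k + l" _ "D + D"] px poly_fun_mult[OF gD gD]) auto
    have ie: "integrable normal_seq (\<lambda>\<omega>. ((\<omega> d ^ k - m k) * (\<omega> d ^ l - m l)) * (g k \<omega> * g l \<omega>))"
     if "k \<in> {1..D}" "l \<in> {1..D}" for k l
     using that by (intro normal_seq_poly_integrable[of "{..<Suc d}" "(k + l) + (D + D)"]
       poly_fun_mult[OF poly_fun_mono[OF px] poly_fun_mult] poly_fun_mono[OF gD]) auto
    show ?thesis
     unfolding b_def e
     by (subst Bochner_Integration.integral_sum)
      (auto simp: ee ie intro!: Bochner_Integration.integrable_sum sum.cong)
   qed
   finally show ?thesis by (simp add: W_def power2_eq_square)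
  qed
  have r4: "EN (\<lambda>\<omega>. r \<omega> ^ 4) \<le> K ^ D * b\<^sup>2 / 16"
  proof (cases "D = 0")
   case True
   then have "r = (\<lambda>_. 0)" by (simp add: r_def fun_eq_iff)
   then show ?thesis using K1 by simp
  next
   case False
   have i4: "integrable normal_seq (\<lambda>\<omega>. ((\<omega> d ^ k - m k) * g k \<omega>) ^ 4)" if "k \<in> {1..D}" for k
    using that by (intro normal_seq_poly_integrable[of "{..<Suc d}" "4 * (k + D)"]
      poly_fun_power poly_fun_mult poly_fun_mono[OF px1] poly_fun_mono[OF gD]) auto
   \<comment> \<open>The last variable is independent of \<open>g k\<close>, and the induction
     hypothesis applies to \<open>g k\<close> with degree \<open>D - k\<close>, which is at most
     \<open>D - 1\<close> because the centered power of order \<open>0\<close> has been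
     dropped.\<close>
   have each: "EN (\<lambda>\<omega>. ((\<omega> d ^ k - m k) * g k \<omega>) ^ 4) \<le> B * (K ^ (D - 1) * (EN (\<lambda>\<omega>. (g k \<omega>)^2))^2)"
    if k: "k \<in> {1..D}" for k
   proof -
    have "EN (\<lambda>\<omega>. ((\<omega> d ^ k - m k) * g k \<omega>) ^ 4) = EN (\<lambda>\<omega>. (\<omega> d ^ k - m k) ^ 4 * g k \<omega> ^ 4)"
     by (simp add: power_mult_distrib)
    also have "\<dots> = EN (\<lambda>\<omega>. (\<omega> d ^ k - m k) ^ 4) * EN (\<lambda>\<omega>. g k \<omega> ^ 4)"
     using k by (intro normal_seq_indep_poly[of "{d}" "{..<d}" "4 * k" _ "4 * D"] poly_fun_power px1 gD) auto
    also have "EN (\<lambda>\<omega>. (\<omega> d ^ k - m k) ^ 4) = (LINT x|std_normal. (x ^ k - m k) ^ 4)"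
     by (rule normal_seq_coord_expectation) measurable
    also have "\<dots> \<le> B"
     unfolding B_def using k Suc.prems(1)
     by (intro member_le_sum[of k "{..D0}" "\<lambda>k. LINT x|std_normal. (x ^ k - m k) ^ 4"] Bochner_Integration.integral_nonneg) auto
    also have "EN (\<lambda>\<omega>. g k \<omega> ^ 4) \<le> K ^ (D - k) * (EN (\<lambda>\<omega>. (g k \<omega>)^2))^2"
     using k Suc.prems(1) by (intro Suc.IH g(1)) auto
    also have "\<dots> \<le> K ^ (D - 1) * (EN (\<lambda>\<omega>. (g k \<omega>)^2))^2"
     using k K1 by (intro mult_right_mono power_increasing) auto
    finally show ?thesis by (simp add: mult_right_mono mult_left_mono B0)
   qed
   have "EN (\<lambda>\<omega>. r \<omega> ^ 4) \<le> EN (\<lambda>\<omega>. real D ^ 3 * (\<Sum>k\<in>{1..D}. ((\<omega> d ^ k - m k) * g k \<omega>) ^ 4))"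
   proof (rule integral_mono)
    show "integrable normal_seq (\<lambda>\<omega>. r \<omega> ^ 4)" using int[of 0 4] by simp
    show "r \<omega> ^ 4 \<le> real D ^ 3 * (\<Sum>k\<in>{1..D}. ((\<omega> d ^ k - m k) * g k \<omega>) ^ 4)" for \<omega>
     unfolding r_def using sum_power4_le[of "\<lambda>k. (\<omega> d ^ k - m k) * g k \<omega>" "{1..D}"] by simp
   qed (use i4 in auto)
   also have "\<dots> = real D ^ 3 * (\<Sum>k\<in>{1..D}. EN (\<lambda>\<omega>. ((\<omega> d ^ k - m k) * g k \<omega>) ^ 4))"
    using i4 by simp
   also have "\<dots> \<le> real D0 ^ 3 * (\<Sum>k\<in>{1..D}. B * (K ^ (D - 1) * (EN (\<lambda>\<omega>. (g k \<omega>)^2))^2))"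
    using Suc.prems(1) by (intro mult_mono sum_mono each power_mono sum_nonneg) auto
   also have "\<dots> = real D0 ^ 3 * B * K ^ (D - 1) * (\<Sum>k\<in>{1..D}. (EN (\<lambda>\<omega>. (g k \<omega>)^2))^2)"
    by (simp add: sum_distrib_left mult_ac)
   also have "\<dots> \<le> real D0 ^ 3 * B * K ^ (D - 1) * (c * b)^2"
   proof (rule mult_left_mono)
    have "(\<Sum>k\<in>{1..D}. (EN (\<lambda>\<omega>. (g k \<omega>)^2))^2) \<le> (\<Sum>k\<in>{1..D}. EN (\<lambda>\<omega>. (g k \<omega>)^2))^2"
    proof -
     have "(\<Sum>k\<in>S. (v k)^2) \<le> (\<Sum>k\<in>S. v k)^2" if "finite S" "\<And>k. v k \<ge> 0" for S :: "nat set" and v :: "nat \<Rightarrow> real"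
      using that(1)
     proof (induction S)
      case (insert x S)
      have "0 \<le> v x * sum v S" using that by (intro mult_nonneg_nonneg sum_nonneg) auto
      then show ?case using insert by (simp add: power2_sum)
     qed simp
     then show ?thesis by simp
    qed
    also have "\<dots> \<le> (c * b)^2"
     by (rule power_mono[OF Eg]) (intro sum_nonneg Bochner_Integration.integral_nonneg, auto)
    finally show "(\<Sum>k\<in>{1..D}. (EN (\<lambda>\<omega>. (g k \<omega>)^2))^2) \<le> (c * b)^2" .
   qed (use B0 K1 in auto)
   also have "\<dots> = (real D0 ^ 3 * B * c\<^sup>2) * (K ^ (D - 1) * b\<^sup>2)"
    by (simp add: power_mult_distrib mult_ac)
   also have "\<dots> \<le> C * (K ^ (D - 1) * b\<^sup>2)"
    using K1 by (intro mult_right_mono) (auto simp: C_def)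
   also have "\<dots> = K ^ D * b\<^sup>2 / 16"
    using False by (cases D) (simp_all add: K_def)
   finally show ?thesis .
  qed
  have h4: "EN (\<lambda>\<omega>. h \<omega> ^ 4) \<le> K ^ D * a\<^sup>2"
   unfolding a_def by (rule Suc.IH[OF Suc.prems(1) ph])
  \<comment> \<open>Cauchy-Schwarz for the squares of \<open>h\<close> and \<open>r\<close>; the
    factor \<open>1 / 16\<close> becomes \<open>1 / 4\<close>.\<close>
  have hr: "EN (\<lambda>\<omega>. (h \<omega>)^2 * (r \<omega>)^2) \<le> K ^ D * a * b / 4"
  proof (rule power2_le_imp_le)
   have p4: "((h \<omega>)^2)^2 = h \<omega> ^ 4" "((r \<omega>)^2)^2 = r \<omega> ^ 4" for \<omega> by simp_all
   have "(EN (\<lambda>\<omega>. (h \<omega>)^2 * (r \<omega>)^2))^2 \<le> EN (\<lambda>\<omega>. ((h \<omega>)^2)^2) * EN (\<lambda>\<omega>. ((r \<omega>)^2)^2)"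
    unfolding p4 using int[of 4 0] int[of 0 4] int[of 2 2]
    by (intro integral_Cauchy_Schwarz[of normal_seq "\<lambda>\<omega>. (h \<omega>)^2" "\<lambda>\<omega>. (r \<omega>)^2", unfolded p4]) auto
   also have "\<dots> \<le> (K ^ D * a\<^sup>2) * (K ^ D * b\<^sup>2 / 16)"
    unfolding p4 using h4 r4 K1 by (intro mult_mono) auto
   also have "\<dots> = (K ^ D * a * b / 4)^2" by (simp add: power2_eq_square mult_ac)
   finally show "(EN (\<lambda>\<omega>. (h \<omega>)^2 * (r \<omega>)^2))^2 \<le> (K ^ D * a * b / 4)^2" .
  qed (use K1 ab in auto)
  have "EN (\<lambda>\<omega>. f \<omega> ^ 4) \<le> EN (\<lambda>\<omega>. h \<omega> ^ 4 + 4 * (h \<omega> ^ 3 * r \<omega>) + 8 * ((h \<omega>)^2 * (r \<omega>)^2) + 3 * r \<omega> ^ 4)"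
  proof (rule integral_mono)
   show "integrable normal_seq (\<lambda>\<omega>. f \<omega> ^ 4)"
    by (rule normal_seq_poly_integrable[OF _ poly_fun_power[OF Suc.prems(2)]]) simp
   show "integrable normal_seq (\<lambda>\<omega>. h \<omega> ^ 4 + 4 * (h \<omega> ^ 3 * r \<omega>) + 8 * ((h \<omega>)^2 * (r \<omega>)^2) + 3 * r \<omega> ^ 4)"
    using int[of 4 0] int[of 3 1] int[of 2 2] int[of 0 4] by simp
   fix \<omega>
   \<comment> \<open>This replaces the term \<open>4 * h * r ^ 3\<close> of the expansion by
     multiples of \<open>h ^ 2 * r ^ 2\<close> and \<open>r ^ 4\<close>. The term
     \<open>4 * h ^ 3 * r\<close> is kept, since its mean is zero.\<close>
   have "0 \<le> 2 * (r \<omega>)^2 * (h \<omega> - r \<omega>)^2" by simp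
   then show "f \<omega> ^ 4 \<le> h \<omega> ^ 4 + 4 * (h \<omega> ^ 3 * r \<omega>) + 8 * ((h \<omega>)^2 * (r \<omega>)^2) + 3 * r \<omega> ^ 4"
    unfolding f_eq by (simp add: power4_eq_xxxx power3_eq_cube power2_eq_square algebra_simps)
  qed
  also have "\<dots> = EN (\<lambda>\<omega>. h \<omega> ^ 4) + 8 * EN (\<lambda>\<omega>. (h \<omega>)^2 * (r \<omega>)^2) + 3 * EN (\<lambda>\<omega>. r \<omega> ^ 4)"
   using int[of 4 0] int[of 3 1] int[of 2 2] int[of 0 4] zero[of 3] by simp
  also have "\<dots> \<le> K ^ D * a\<^sup>2 + 8 * (K ^ D * a * b / 4) + 3 * (K ^ D * b\<^sup>2 / 16)"
   using h4 hr r4 by linarith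
  \<comment> \<open>The cross term \<open>8 * (a * b / 4)\<close> is exactly the
    \<open>2 * a * b\<close> of the square, so the constants close.\<close>
  also have "\<dots> \<le> K ^ D * (a + b)^2"
   using K1 ab by (simp add: power2_eq_square algebra_simps)
  finally show ?case unfolding Ef2 .
 qed
 then show ?thesis using K1 by blast
qed

subsection \<open>Moments and decorrelation of Gaussian polynomials\<close>

lemma poly_fun_linear: "L \<subseteq> I \<Longrightarrow> poly_fun I 1 (\<lambda>x. \<Sum>l\<in>L. a l * x l)"
 by (intro poly_fun_sum poly_fun_cmult poly_fun_var) auto

lemma gaussian_family_psd:
 assumes "gaussian_family M I Z K" "\<And>i j. i \<in> I \<Longrightarrow> j \<in> I \<Longrightarrow> K i j = K j i"
 obtains A and d :: nat where "gaussian_family normal_seq I (\<lambda>i \<omega>. \<Sum>l<d. A i l * \<omega> l) K"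
  "\<And>i j. i \<in> I \<Longrightarrow> j \<in> I \<Longrightarrow> K i j = (\<Sum>l<d. A i l * A j l)"
proof -
 have "finite I" using assms(1) by (simp add: gaussian_family_def)
 from psd_realization[OF this assms(2) qform_nonneg_of_family[OF assms(1)]] that show ?thesis by blast
qed

text \<open>The bound on \<open>normal_seq\<close> does not depend on the number of variables, so it
  survives the substitution of the linear forms that realise the family.\<close>

lemma gaussian_hypercontractivity:
 fixes M :: "'a measure"
 shows "\<exists>C\<ge>1. \<forall>(I :: 'i set) Z K f. gaussian_family M I Z K \<longrightarrow> (\<forall>i\<in>I. \<forall>j\<in>I. K i j = K j i) \<longrightarrow> poly_fun I D f \<longrightarrow>
   (LINT \<omega>|M. f (\<lambda>i. Z i \<omega>) ^ 4) \<le> C * (LINT \<omega>|M. (f (\<lambda>i. Z i \<omega>))^2)^2"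
proof -
 obtain C where C: "C \<ge> 1" "\<And>d f. poly_fun {..<d} D f \<Longrightarrow>
   EN (\<lambda>\<omega>. f \<omega> ^ 4) \<le> C ^ D * (EN (\<lambda>\<omega>. (f \<omega>)^2))^2"
  using hypercontractivity[of D] by blast
 show ?thesis
 proof (intro exI[of _ "C ^ D"] conjI allI impI)
  show "1 \<le> C ^ D" using C(1) by simp
  fix I Z K and f :: "('i \<Rightarrow> real) \<Rightarrow> real"
  assume fam: "gaussian_family M I Z K" and sym: "\<forall>i\<in>I. \<forall>j\<in>I. K i j = K j i" and f: "poly_fun I D f"
  obtain A and d :: nat where A: "gaussian_family normal_seq I (\<lambda>i \<omega>. \<Sum>l<d. A i l * \<omega> l) K"
   by (rule gaussian_family_psd[OF fam]) (use sym in auto)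
  have eq: "(LINT \<omega>|M. f (\<lambda>i. Z i \<omega>) ^ k) = EN (\<lambda>\<omega>. f (\<lambda>i. \<Sum>l<d. A i l * \<omega> l) ^ k)" for k
   by (rule gaussian_family_determined[OF fam A poly_fun_power[OF f]])
  have "poly_fun {..<d} D (\<lambda>\<omega>. f (\<lambda>i. \<Sum>l<d. A i l * \<omega> l))"
   by (rule poly_fun_subst[OF f]) (rule poly_fun_linear, simp)
  from C(2)[OF this] show "(LINT \<omega>|M. f (\<lambda>i. Z i \<omega>) ^ 4) \<le> C ^ D * (LINT \<omega>|M. (f (\<lambda>i. Z i \<omega>))^2)^2"
   by (simp add: eq)
 qed
qed

text \<open>The fourth moment bound, applied to the polynomial \<open>f ^ (2 ^ s)\<close>, doubles
  the exponent at each step. The degree grows with \<open>s\<close>, but the constant still depends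
  only on \<open>s\<close>, \<open>D\<close> and \<open>V\<close>.\<close>

lemma gaussian_moment_growth_pow2:
 fixes M :: "'a measure"
 shows "\<exists>C\<ge>1. \<forall>(I :: 'i set) Z K f. gaussian_family M I Z K \<longrightarrow> (\<forall>i\<in>I. \<forall>j\<in>I. K i j = K j i) \<longrightarrow> poly_fun I D f \<longrightarrow>
   (LINT \<omega>|M. (f (\<lambda>i. Z i \<omega>))^2) \<le> V \<longrightarrow> (LINT \<omega>|M. f (\<lambda>i. Z i \<omega>) ^ (2 ^ Suc s)) \<le> C"
proof (induction s)
 case 0
 show ?case by (intro exI[of _ "max 1 V"]) auto
next
 case (Suc s)
 then obtain C where C: "C \<ge> 1" "\<And>I Z K f. gaussian_family M I Z K \<Longrightarrow> (\<forall>i\<in>I. \<forall>j\<in>I. K i j = K j i) \<Longrightarrow>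
   poly_fun I D f \<Longrightarrow> (LINT \<omega>|M. (f (\<lambda>i :: 'i. Z i \<omega>))^2) \<le> V \<Longrightarrow> (LINT \<omega>|M. f (\<lambda>i. Z i \<omega>) ^ (2 ^ Suc s)) \<le> C"
  by blast
 obtain C' where C': "C' \<ge> 1" "\<And>I Z K f. gaussian_family M I Z K \<Longrightarrow> (\<forall>i\<in>I. \<forall>j\<in>I. K i j = K j i) \<Longrightarrow>
   poly_fun I (2 ^ s * D) f \<Longrightarrow> (LINT \<omega>|M. f (\<lambda>i :: 'i. Z i \<omega>) ^ 4) \<le> C' * (LINT \<omega>|M. (f (\<lambda>i. Z i \<omega>))^2)^2"
  using gaussian_hypercontractivity[of M "2 ^ s * D"] by blast
 show ?case
 proof (intro exI[of _ "C' * C\<^sup>2"] conjI allI impI)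
  have "1 * 1 \<le> C' * C\<^sup>2" using C(1) C'(1) by (intro mult_mono) auto
  then show "1 \<le> C' * C\<^sup>2" by simp
  fix I Z K and f :: "('i \<Rightarrow> real) \<Rightarrow> real"
  assume *: "gaussian_family M I Z K" "\<forall>i\<in>I. \<forall>j\<in>I. K i j = K j i" "poly_fun I D f"
   "(LINT \<omega>|M. (f (\<lambda>i. Z i \<omega>))^2) \<le> V"
  have e: "x ^ (2 ^ Suc (Suc s)) = (x ^ (2 ^ s)) ^ 4" "(x ^ (2 ^ s))^2 = x ^ (2 ^ Suc s)" for x :: real
   by (simp_all add: power_mult[symmetric] mult_ac)
  have "(LINT \<omega>|M. (f (\<lambda>i. Z i \<omega>) ^ (2 ^ s)) ^ 4) \<le> C' * (LINT \<omega>|M. (f (\<lambda>i. Z i \<omega>) ^ (2 ^ s))^2)^2"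
   by (rule C'(2)[OF *(1,2) poly_fun_power[OF *(3)]])
  also have "\<dots> \<le> C' * C\<^sup>2"
  proof (intro mult_left_mono power_mono)
   show "(LINT \<omega>|M. (f (\<lambda>i. Z i \<omega>) ^ (2 ^ s))^2) \<le> C" unfolding e using C(2)[OF *] .
  qed (use C'(1) in auto)
  finally show "(LINT \<omega>|M. f (\<lambda>i. Z i \<omega>) ^ (2 ^ Suc (Suc s))) \<le> C' * C\<^sup>2" unfolding e .
 qed
qed

text \<open>Other even exponents lie below a power of two: \<open>2 * e \<le> 2 ^ Suc e\<close>, and
  the lower power is at most \<open>1\<close> plus the higher one.\<close>

lemma (in prob_space) gaussian_moment_growth:
 "\<exists>C\<ge>1. \<forall>(I :: 'i set) Z K f. gaussian_family M I Z K \<longrightarrow> (\<forall>i\<in>I. \<forall>j\<in>I. K i j = K j i) \<longrightarrow> poly_fun I D f \<longrightarrow>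
   (LINT \<omega>|M. (f (\<lambda>i. Z i \<omega>))^2) \<le> V \<longrightarrow> (LINT \<omega>|M. f (\<lambda>i. Z i \<omega>) ^ (2 * e)) \<le> C"
proof -
 obtain C where C: "C \<ge> 1" "\<And>I Z K f. gaussian_family M I Z K \<Longrightarrow> (\<forall>i\<in>I. \<forall>j\<in>I. K i j = K j i) \<Longrightarrow>
   poly_fun I D f \<Longrightarrow> (LINT \<omega>|M. (f (\<lambda>i :: 'i. Z i \<omega>))^2) \<le> V \<Longrightarrow> (LINT \<omega>|M. f (\<lambda>i. Z i \<omega>) ^ (2 ^ Suc e)) \<le> C"
  using gaussian_moment_growth_pow2[of M D V e] by blast
 show ?thesis
 proof (intro exI[of _ "1 + C"] conjI allI impI)
  show "1 \<le> 1 + C" using C(1) by simp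
  fix I Z K and f :: "('i \<Rightarrow> real) \<Rightarrow> real"
  assume *: "gaussian_family M I Z K" "\<forall>i\<in>I. \<forall>j\<in>I. K i j = K j i" "poly_fun I D f"
   "(LINT \<omega>|M. (f (\<lambda>i. Z i \<omega>))^2) \<le> V"
  have i: "integrable M (\<lambda>\<omega>. f (\<lambda>i. Z i \<omega>) ^ k)" for k
   by (rule gaussian_family_integrable[OF *(1) poly_fun_power[OF *(3)]])
  have pt: "x ^ (2 * e) \<le> 1 + x ^ (2 ^ Suc e)" for x :: real
  proof (cases "\<bar>x\<bar> \<le> 1")
   case True
   then have "\<bar>x\<bar> ^ (2 * e) \<le> 1" by (intro power_le_one) auto
   moreover have "0 \<le> x ^ (2 ^ Suc e)" by (intro zero_le_even_power) simp
   ultimately show ?thesis using power_even_abs[of "2 * e" x] by (simp del: power_Suc)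
  next
   case False
   have "\<bar>x\<bar> ^ (2 * e) \<le> \<bar>x\<bar> ^ (2 ^ Suc e)"
    using False less_exp[of e] by (intro power_increasing) auto
   then show ?thesis using power_even_abs[of "2 * e" x] power_even_abs[of "2 ^ Suc e" x] by simp
  qed
  have "(LINT \<omega>|M. f (\<lambda>i. Z i \<omega>) ^ (2 * e)) \<le> (LINT \<omega>|M. 1 + f (\<lambda>i. Z i \<omega>) ^ (2 ^ Suc e))"
   by (rule integral_mono) (use i pt in auto)
  also have "\<dots> = 1 + (LINT \<omega>|M. f (\<lambda>i. Z i \<omega>) ^ (2 ^ Suc e))"
   using i by (simp add: prob_space)
  also have "\<dots> \<le> 1 + C" using C(2)[OF *] by simp
  finally show "(LINT \<omega>|M. f (\<lambda>i. Z i \<omega>) ^ (2 * e)) \<le> 1 + C" .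
 qed
qed

text \<open>A converse to Chebyshev's inequality. On the improbable event
  \<open>L < \<bar>f \<omega>\<bar>\<close>, Cauchy-Schwarz and the fourth moment bound leave at
  most half of the second moment; elsewhere the square is at most \<open>L^2\<close>. It turns
  convergence in probability into bounds in mean square.\<close>

lemma (in prob_space) second_moment_of_tightness:
 assumes [measurable]: "f \<in> borel_measurable M" and "integrable M (\<lambda>\<omega>. f \<omega> ^ 4)" "integrable M (\<lambda>\<omega>. (f \<omega>)^2)"
  and "expectation (\<lambda>\<omega>. f \<omega> ^ 4) \<le> C * (expectation (\<lambda>\<omega>. (f \<omega>)^2))^2" "C > 0"
  and "prob {\<omega> \<in> space M. L < \<bar>f \<omega>\<bar>} \<le> 1 / (4 * C)" "L \<ge> 0"
 shows "expectation (\<lambda>\<omega>. (f \<omega>)^2) \<le> 2 * L\<^sup>2"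
proof -
 define A where "A = {\<omega> \<in> space M. L < \<bar>f \<omega>\<bar>}"
 have [measurable]: "A \<in> sets M" unfolding A_def by measurable
 define V where "V = expectation (\<lambda>\<omega>. (f \<omega>)^2)"
 have V0: "V \<ge> 0" by (simp add: V_def)
 have f22: "((f \<omega>)^2)^2 = f \<omega> ^ 4" "(indicator A \<omega>)^2 = (indicator A \<omega> :: real)" for \<omega>
  by (simp_all add: indicator_def)
 have intA: "integrable M (\<lambda>\<omega>. (f \<omega>)^2 * indicator A \<omega>)"
  using integrable_real_mult_indicator[OF _ assms(3), of A] by simp
 have indA: "integrable M (indicat_real A)"
  by (rule integrable_real_indicator) (auto simp: emeasure_eq_measure)
 have "(expectation (\<lambda>\<omega>. (f \<omega>)^2 * indicator A \<omega>))^2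
   \<le> expectation (\<lambda>\<omega>. ((f \<omega>)^2)^2) * expectation (\<lambda>\<omega>. (indicator A \<omega>)^2)"
  by (rule integral_Cauchy_Schwarz) (simp_all add: f22 assms intA indA)
 also have "\<dots> \<le> (C * V\<^sup>2) * (1 / (4 * C))"
  unfolding f22 V_def using assms(4,5,6)
  by (intro mult_mono) (auto simp: A_def[symmetric])
 also have "\<dots> = (V / 2)^2" using assms(5) by (simp add: power2_eq_square)
 finally have "(expectation (\<lambda>\<omega>. (f \<omega>)^2 * indicator A \<omega>))^2 \<le> (V / 2)^2" .
 then have 1: "expectation (\<lambda>\<omega>. (f \<omega>)^2 * indicator A \<omega>) \<le> V / 2"
  by (rule power2_le_imp_le) (use V0 in simp)
 have "V \<le> expectation (\<lambda>\<omega>. (f \<omega>)^2 * indicator A \<omega> + L\<^sup>2)"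
  unfolding V_def
 proof (rule integral_mono)
  show "integrable M (\<lambda>\<omega>. (f \<omega>)^2 * indicator A \<omega> + L\<^sup>2)" using intA by simp
  fix \<omega> assume "\<omega> \<in> space M"
  then show "(f \<omega>)^2 \<le> (f \<omega>)^2 * indicator A \<omega> + L\<^sup>2"
   using assms(7) by (cases "\<omega> \<in> A") (auto simp: A_def not_less abs_le_square_iff[symmetric])
 qed (fact assms(3))
 also have "\<dots> = expectation (\<lambda>\<omega>. (f \<omega>)^2 * indicator A \<omega>) + L\<^sup>2"
  using intA by (simp add: prob_space)
 finally show ?thesis using 1 unfolding V_def[symmetric] by simp
qed

section \<open>Gaussian expectations along a line of covariances, and decorrelation\<close>

lemma qform_affine: "qform I (\<lambda>i j. A i j + \<theta> * B i j) c = qform I A c + \<theta> * qform I B c"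
 by (simp add: sum.distrib sum_distrib_left algebra_simps)

text \<open>The variance is affine in \<open>\<theta>\<close>, \<open>gauss_moment\<close> is a
  polynomial in the variance, and \<open>polar\<close> only takes differences.\<close>

lemma wick_affine_poly:
 "\<exists>p :: real poly. degree p \<le> length l \<and> (\<forall>\<theta>. wick I (\<lambda>i j. A i j + \<theta> * B i j) l = poly p \<theta>)"
proof -
 define n where "n = length l"
 have base: "\<exists>p :: real poly. degree p \<le> n \<and> (\<forall>\<theta>. gauss_moment n (u + \<theta> * v) = poly p \<theta>)" for u v
 proof (cases "even n")
  case True
  let ?p = "smult (fact n / (2 ^ (n div 2) * fact (n div 2))) ([:u, v:] ^ (n div 2))"
  have "degree ?p \<le> degree ([:u, v:] ^ (n div 2))" by (rule degree_smult_le)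
  also have "\<dots> \<le> degree [:u, v:] * (n div 2)" by (rule degree_power_le)
  also have "\<dots> \<le> 1 * (n div 2)" by (intro mult_right_mono) auto
  also have "\<dots> \<le> n" by simp
  finally show ?thesis using True
   by (intro exI[of _ ?p]) (simp add: gauss_moment_def)
 next
  case False
  then show ?thesis by (intro exI[of _ 0]) (simp add: gauss_moment_def)
 qed
 have "\<exists>p :: real poly. degree p \<le> n \<and>
   (\<forall>\<theta>. polar l' (\<lambda>c. gauss_moment n (qform I (\<lambda>i j. A i j + \<theta> * B i j) c)) c = poly p \<theta>)" for l' c
 proof (induction l' arbitrary: c)
  case Nil
  then show ?case using base by (simp only: polar.simps qform_affine)
 next
  case (Cons i l')
  from Cons[of "c(i := c i + 1)"] Cons[of c] obtain p q :: "real poly" where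
   "degree p \<le> n" "degree q \<le> n"
   "\<forall>\<theta>. polar l' (\<lambda>c. gauss_moment n (qform I (\<lambda>i j. A i j + \<theta> * B i j) c)) (c(i := c i + 1)) = poly p \<theta>"
   "\<forall>\<theta>. polar l' (\<lambda>c. gauss_moment n (qform I (\<lambda>i j. A i j + \<theta> * B i j) c)) c = poly q \<theta>"
   by blast
  then show ?case by (intro exI[of _ "p - q"]) (auto intro: degree_diff_le)
 qed
 from this[of l "\<lambda>_. 0"] obtain p :: "real poly" where "degree p \<le> n"
  "\<forall>\<theta>. polar l (\<lambda>c. gauss_moment n (qform I (\<lambda>i j. A i j + \<theta> * B i j) c)) (\<lambda>_. 0) = poly p \<theta>"
  by blast
 then show ?thesis
  by (intro exI[of _ "smult (1 / fact n) p"])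
   (auto simp: wick_def n_def[symmetric] intro: order.trans[OF degree_smult_le])
qed

text \<open>
 The two measures are needed because the covariance is realised on the given space for one
 value of \<open>\<theta>\<close> and on \<open>normal_seq\<close> for all others.
\<close>

lemma gaussian_expectation_affine_poly:
 fixes M :: "'a measure" and M' :: "'b measure"
 assumes "poly_fun I D f"
 shows "\<exists>p :: real poly. degree p \<le> D \<and>
   (\<forall>\<theta> Z. gaussian_family M I Z (\<lambda>i j. A i j + \<theta> * B i j) \<longrightarrow> (LINT \<omega>|M. f (\<lambda>i. Z i \<omega>)) = poly p \<theta>) \<and>
   (\<forall>\<theta> Z. gaussian_family M' I Z (\<lambda>i j. A i j + \<theta> * B i j) \<longrightarrow> (LINT \<omega>|M'. f (\<lambda>i. Z i \<omega>)) = poly p \<theta>)"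
 using assms
proof (induction rule: poly_fun.induct)
 case zero
 then show ?case by (intro exI[of _ 0]) auto
next
 case (add_monom f l c)
 from add_monom.IH obtain p :: "real poly" where p: "degree p \<le> D"
   "\<And>\<theta> Z. gaussian_family M I Z (\<lambda>i j. A i j + \<theta> * B i j) \<Longrightarrow> (LINT \<omega>|M. f (\<lambda>i. Z i \<omega>)) = poly p \<theta>"
   "\<And>\<theta> Z. gaussian_family M' I Z (\<lambda>i j. A i j + \<theta> * B i j) \<Longrightarrow> (LINT \<omega>|M'. f (\<lambda>i. Z i \<omega>)) = poly p \<theta>"
  by blast
 obtain q :: "real poly" where q: "degree q \<le> length l" "\<And>\<theta>. wick I (\<lambda>i j. A i j + \<theta> * B i j) l = poly q \<theta>"
  using wick_affine_poly[of l I A B] by blast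
 have **: "(LINT \<omega>|N. c * (\<Prod>i\<leftarrow>l. Z i \<omega>) + f (\<lambda>i. Z i \<omega>)) = c * poly q \<theta> + (LINT \<omega>|N. f (\<lambda>i. Z i \<omega>))"
  if "gaussian_family N I Z (\<lambda>i j. A i j + \<theta> * B i j)" for N :: "'b measure" and Z \<theta>
  using gaussian_family_monom[OF that add_monom(2), unfolded has_bochner_integral_iff]
   gaussian_family_integrable[OF that add_monom(1)] q(2) by simp
 have ***: "(LINT \<omega>|N. c * (\<Prod>i\<leftarrow>l. Z i \<omega>) + f (\<lambda>i. Z i \<omega>)) = c * poly q \<theta> + (LINT \<omega>|N. f (\<lambda>i. Z i \<omega>))"
  if "gaussian_family N I Z (\<lambda>i j. A i j + \<theta> * B i j)" for N :: "'a measure" and Z \<theta>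
  using gaussian_family_monom[OF that add_monom(2), unfolded has_bochner_integral_iff]
   gaussian_family_integrable[OF that add_monom(1)] q(2) by simp
 show ?case
  using p q(1) add_monom(3) ** ***
  by (intro exI[of _ "smult c q + p"])
   (auto intro!: degree_add_le order.trans[OF degree_smult_le])
qed

lemma qform_union:
 assumes "finite I1" "finite I2" "I1 \<inter> I2 = {}" "\<And>i j. i \<in> I1 \<Longrightarrow> j \<in> I2 \<Longrightarrow> K i j = K j i"
 shows "qform (I1 \<union> I2) K c = qform I1 K c + qform I2 K c + 2 * (\<Sum>i\<in>I1. \<Sum>j\<in>I2. c i * c j * K i j)"
proof -
 have "qform (I1 \<union> I2) K c = ((\<Sum>i\<in>I1. \<Sum>j\<in>I1. c i * c j * K i j) + (\<Sum>i\<in>I1. \<Sum>j\<in>I2. c i * c j * K i j))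
   + ((\<Sum>i\<in>I2. \<Sum>j\<in>I1. c i * c j * K i j) + (\<Sum>i\<in>I2. \<Sum>j\<in>I2. c i * c j * K i j))"
  using assms by (simp add: sum.union_disjoint sum.distrib)
 moreover have "(\<Sum>i\<in>I2. \<Sum>j\<in>I1. c i * c j * K i j) = (\<Sum>i\<in>I1. \<Sum>j\<in>I2. c i * c j * K i j)"
  by (subst sum.swap, intro sum.cong refl) (auto simp: assms(4))
 ultimately show ?thesis by simp
qed

lemma abs_mult_le_half_squares: "\<bar>u * v\<bar> \<le> (u\<^sup>2 + v\<^sup>2) / 2" for u v :: real
 using sum_squares_bound[of u v] sum_squares_bound[of "- u" v] by (simp add: abs_le_iff power2_eq_square)

lemma abs_integral_mult_le:
 fixes u v :: "'a \<Rightarrow> real"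
 assumes "integrable M (\<lambda>x. (u x)^2)" "integrable M (\<lambda>x. (v x)^2)" "integrable M (\<lambda>x. u x * v x)"
 shows "\<bar>LINT x|M. u x * v x\<bar> \<le> ((LINT x|M. (u x)^2) + (LINT x|M. (v x)^2)) / 2"
proof -
 have "\<bar>LINT x|M. u x * v x\<bar> \<le> (LINT x|M. \<bar>u x * v x\<bar>)"
  using integral_norm_bound[of M "\<lambda>x. u x * v x"] by simp
 also have "\<dots> \<le> (LINT x|M. ((u x)^2 + (v x)^2) / 2)"
  using assms by (intro integral_mono abs_mult_le_half_squares) auto
 also have "\<dots> = ((LINT x|M. (u x)^2) + (LINT x|M. (v x)^2)) / 2"
  using assms by simp
 finally show ?thesis .
qed

lemma (in prob_space) expectation_square_le:
 fixes u :: "'a \<Rightarrow> real"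
 assumes "integrable M (\<lambda>x. (u x)^2)" "integrable M u"
 shows "(expectation u)^2 \<le> expectation (\<lambda>x. (u x)^2)"
 using integral_Cauchy_Schwarz[of M u "\<lambda>_. 1"] assms by (simp add: prob_space)

text \<open>
 Scaling the cross covariances by \<open>\<theta> \<in> [0, 1/\<rho>]\<close> keeps the covariance positive semidefinite.
 The mixed expectation is a polynomial in \<open>\<theta>\<close>, bounded on this interval because the marginals do
 not change, so its increment between \<open>\<theta> = 0\<close> (independent blocks) and \<open>\<theta> = 1\<close> is of order \<open>\<rho>\<close>.
 In the proof the parameter is rescaled to \<open>[0, 1]\<close>.
\<close>

lemma gaussian_decorrelation:
 fixes M :: "'a measure"
 assumes "prob_space M"
 shows "\<exists>C>0. \<forall>(I1 :: 'i set) I2 Z K \<rho> f g. gaussian_family M (I1 \<union> I2) Z K \<longrightarrow> I1 \<inter> I2 = {} \<longrightarrow>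
   (\<forall>i\<in>I1 \<union> I2. \<forall>j\<in>I1 \<union> I2. K i j = K j i) \<longrightarrow> \<rho> > 0 \<longrightarrow>
   (\<forall>c. 2 * \<bar>\<Sum>i\<in>I1. \<Sum>j\<in>I2. c i * c j * K i j\<bar> \<le> \<rho> * (qform I1 K c + qform I2 K c)) \<longrightarrow>
   poly_fun I1 D f \<longrightarrow> poly_fun I2 D g \<longrightarrow>
   \<bar>(LINT \<omega>|M. f (\<lambda>i. Z i \<omega>) * g (\<lambda>i. Z i \<omega>)) - (LINT \<omega>|M. f (\<lambda>i. Z i \<omega>)) * (LINT \<omega>|M. g (\<lambda>i. Z i \<omega>))\<bar>
    \<le> C * \<rho> * ((LINT \<omega>|M. (f (\<lambda>i. Z i \<omega>))^2) + (LINT \<omega>|M. (g (\<lambda>i. Z i \<omega>))^2))"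
proof -
 interpret prob_space M by fact
 obtain C where C: "C > 0"
  "\<And>(a :: nat \<Rightarrow> real) k. k \<le> 2 * D \<Longrightarrow> \<bar>a k\<bar> \<le> C * integral {0..1} (\<lambda>x. \<bar>\<Sum>k\<le>2 * D. a k * x ^ k\<bar>)"
  using poly_coeff_bound[of "2 * D"] by blast
 show ?thesis
 \<comment> \<open>The summand \<open>1\<close> serves \<open>\<rho> \<ge> 1\<close>; the other one
   covers the \<open>2 * D\<close> nonconstant coefficients of the polynomial.\<close>
 proof (intro exI[of _ "1 + 2 * real D * C"] conjI allI impI)
  show "0 < 1 + 2 * real D * C" using C(1) by (simp add: add_pos_nonneg)
  fix I1 I2 :: "'i set" and Z K \<rho> and f g :: "('i \<Rightarrow> real) \<Rightarrow> real"
  assume fam: "gaussian_family M (I1 \<union> I2) Z K" and disj: "I1 \<inter> I2 = {}"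
   and sym: "\<forall>i\<in>I1 \<union> I2. \<forall>j\<in>I1 \<union> I2. K i j = K j i" and \<rho>: "\<rho> > 0"
   and cross: "\<forall>c. 2 * \<bar>\<Sum>i\<in>I1. \<Sum>j\<in>I2. c i * c j * K i j\<bar> \<le> \<rho> * (qform I1 K c + qform I2 K c)"
   and f: "poly_fun I1 D f" and g: "poly_fun I2 D g"
  define F where "F = (\<lambda>\<omega>. f (\<lambda>i. Z i \<omega>))"
  define G where "G = (\<lambda>\<omega>. g (\<lambda>i. Z i \<omega>))"
  define S where "S = expectation (\<lambda>\<omega>. (F \<omega>)^2) + expectation (\<lambda>\<omega>. (G \<omega>)^2)"
  have S0: "S \<ge> 0" by (simp add: S_def)
  have fin: "finite I1" "finite I2" using fam by (auto simp: gaussian_family_def)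
  have f': "poly_fun (I1 \<union> I2) D f" by (rule poly_fun_mono[OF f]) auto
  have g': "poly_fun (I1 \<union> I2) D g" by (rule poly_fun_mono[OF g]) auto
  have fg: "poly_fun (I1 \<union> I2) (D + D) (\<lambda>x. f x * g x)" by (rule poly_fun_mult[OF f' g'])
  note i = gaussian_family_integrable[OF fam]
  have iF: "integrable M (\<lambda>\<omega>. F \<omega> ^ k)" and iG: "integrable M (\<lambda>\<omega>. G \<omega> ^ k)" for k
   using i[OF poly_fun_power[OF f']] i[OF poly_fun_power[OF g']] by (auto simp: F_def G_def)
  have iFG: "integrable M (\<lambda>\<omega>. F \<omega> * G \<omega>)"
   using i[OF fg] by (simp add: F_def G_def)
  show "\<bar>expectation (\<lambda>\<omega>. f (\<lambda>i. Z i \<omega>) * g (\<lambda>i. Z i \<omega>))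
     - expectation (\<lambda>\<omega>. f (\<lambda>i. Z i \<omega>)) * expectation (\<lambda>\<omega>. g (\<lambda>i. Z i \<omega>))\<bar>
    \<le> (1 + 2 * real D * C) * \<rho> * (expectation (\<lambda>\<omega>. (f (\<lambda>i. Z i \<omega>))^2) + expectation (\<lambda>\<omega>. (g (\<lambda>i. Z i \<omega>))^2))"
  \<comment> \<open>For \<open>\<rho> \<ge> 1\<close> the elementary bound for products is enough;
    otherwise \<open>\<rho>\<close> lies in the interval on which the polynomial is
    controlled.\<close>
  proof (cases "\<rho> \<ge> 1")
   case True
   have "\<bar>expectation (\<lambda>\<omega>. F \<omega> * G \<omega>)\<bar> \<le> S / 2"
    unfolding S_def by (rule abs_integral_mult_le) (use iF iG iFG in auto)
   moreover have "\<bar>expectation F * expectation G\<bar> \<le> S / 2"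
    using abs_mult_le_half_squares[of "expectation F" "expectation G"]
     expectation_square_le[of F] expectation_square_le[of G] iF[of 1] iG[of 1] iF[of 2] iG[of 2]
    by (simp add: S_def)
   ultimately have "\<bar>expectation (\<lambda>\<omega>. F \<omega> * G \<omega>) - expectation F * expectation G\<bar> \<le> 1 * S"
    by linarith
   also have "\<dots> \<le> ((1 + 2 * real D * C) * \<rho>) * S"
   proof (rule mult_right_mono)
    have "1 * 1 \<le> (1 + 2 * real D * C) * \<rho>" using True C(1) by (intro mult_mono) auto
    then show "1 \<le> (1 + 2 * real D * C) * \<rho>" by simp
   qed (fact S0)
   finally show ?thesis by (simp add: F_def G_def S_def)
  next
   case False
   \<comment> \<open>\<open>A\<close> keeps the two diagonal blocks and \<open>B\<close> is the
     cross part divided by \<open>\<rho>\<close>. Thus \<open>\<theta> = \<rho>\<close> is the given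
     covariance and \<open>\<theta> = 0\<close> decouples the blocks.\<close>
   define A where "A i j = (if (i \<in> I1) = (j \<in> I1) then K i j else 0)" for i j
   define B where "B i j = (if (i \<in> I1) = (j \<in> I1) then 0 else K i j / \<rho>)" for i j
   define Kt where "Kt \<theta> i j = A i j + \<theta> * B i j" for \<theta> i j
   have Kt_\<rho>: "Kt \<rho> = K" using \<rho> by (auto simp: Kt_def A_def B_def fun_eq_iff)
   have Kt1: "Kt \<theta> i j = K i j" if "i \<in> I1" "j \<in> I1" for \<theta> i j
    using that by (simp add: Kt_def A_def B_def)
   have Kt2: "Kt \<theta> i j = K i j" if "i \<in> I2" "j \<in> I2" for \<theta> i j
    using that disj by (auto simp: Kt_def A_def B_def)
   have Kt_sym: "Kt \<theta> i j = Kt \<theta> j i" if "i \<in> I1 \<union> I2" "j \<in> I1 \<union> I2" for \<theta> i j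
    using sym that by (auto simp: Kt_def A_def B_def)
   have Q1: "qform I1 (Kt \<theta>) c = qform I1 K c" and Q2: "qform I2 (Kt \<theta>) c = qform I2 K c" for \<theta> c
    by (intro sum.cong refl, simp add: Kt1 Kt2)+
   have psd: "qform (I1 \<union> I2) (Kt \<theta>) c \<ge> 0" if \<theta>: "0 \<le> \<theta>" "\<theta> \<le> 1" for \<theta> c
   proof -
    define X where "X = (\<Sum>i\<in>I1. \<Sum>j\<in>I2. c i * c j * K i j)"
    define Q where "Q = qform I1 K c + qform I2 K c"
    have X: "2 * \<bar>X\<bar> \<le> \<rho> * Q" using cross unfolding X_def Q_def by blast
    then have Q0: "Q \<ge> 0" using \<rho> by (metis abs_ge_zero mult_le_0_iff mult_nonneg_nonneg not_less order.trans zero_le_mult_iff zero_le_numeral)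
    have "(\<Sum>i\<in>I1. \<Sum>j\<in>I2. c i * c j * Kt \<theta> i j) = \<theta> / \<rho> * X"
     unfolding X_def sum_distrib_left using disj
     by (intro sum.cong refl) (auto simp: Kt_def A_def B_def)
    then have eq: "qform (I1 \<union> I2) (Kt \<theta>) c = Q + 2 * (\<theta> / \<rho> * X)"
     by (subst qform_union[OF fin disj]) (auto simp: Q1 Q2 Q_def Kt_sym)
    have "\<bar>2 * (\<theta> / \<rho> * X)\<bar> \<le> Q"
    proof -
     have "\<bar>2 * (\<theta> / \<rho> * X)\<bar> = \<theta> / \<rho> * (2 * \<bar>X\<bar>)" using \<theta> \<rho> by (simp add: abs_mult)
     also have "\<dots> \<le> \<theta> / \<rho> * (\<rho> * Q)" using X \<theta> \<rho> by (intro mult_left_mono) auto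
     also have "\<dots> = \<theta> * Q" using \<rho> by simp
     also have "\<dots> \<le> Q" using \<theta> Q0 by (simp add: mult_left_le_one_le)
     finally show ?thesis .
    qed
    moreover have "\<bar>t\<bar> \<le> q \<Longrightarrow> 0 \<le> q + t" for t q :: real by linarith
    ultimately have "0 \<le> Q + 2 * (\<theta> / \<rho> * X)" by blast
    then show ?thesis unfolding eq .
   qed
   obtain p :: "real poly" where p: "degree p \<le> D + D"
    "\<And>\<theta> Z. gaussian_family M (I1 \<union> I2) Z (Kt \<theta>) \<Longrightarrow> (LINT \<omega>|M. f (\<lambda>i. Z i \<omega>) * g (\<lambda>i. Z i \<omega>)) = poly p \<theta>"
    "\<And>\<theta> Z. gaussian_family normal_seq (I1 \<union> I2) Z (Kt \<theta>) \<Longrightarrow> EN (\<lambda>\<omega>. f (\<lambda>i. Z i \<omega>) * g (\<lambda>i. Z i \<omega>)) = poly p \<theta>"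
    using gaussian_expectation_affine_poly[OF fg, of M A B normal_seq] unfolding Kt_def by blast
   have p\<rho>: "poly p \<rho> = expectation (\<lambda>\<omega>. F \<omega> * G \<omega>)"
    using p(2)[of Z \<rho>] fam by (simp add: Kt_\<rho> F_def G_def)
   have marg1: "(LINT \<omega>|M. h (\<lambda>i. Z i \<omega>)) = EN (\<lambda>\<omega>. h (\<lambda>i. Y i \<omega>))"
    if "gaussian_family normal_seq (I1 \<union> I2) Y (Kt \<theta>)" "poly_fun I1 D' h" for Y \<theta> D' h
    by (rule gaussian_family_determined[OF gaussian_family_subset[OF fam]
      gaussian_family_cong[OF gaussian_family_subset[OF that(1)]] that(2)]) (auto simp: Kt1)
   have marg2: "(LINT \<omega>|M. h (\<lambda>i. Z i \<omega>)) = EN (\<lambda>\<omega>. h (\<lambda>i. Y i \<omega>))"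
    if "gaussian_family normal_seq (I1 \<union> I2) Y (Kt \<theta>)" "poly_fun I2 D' h" for Y \<theta> D' h
    by (rule gaussian_family_determined[OF gaussian_family_subset[OF fam]
      gaussian_family_cong[OF gaussian_family_subset[OF that(1)]] that(2)]) (auto simp: Kt2)
   have pb: "\<bar>poly p \<theta>\<bar> \<le> S / 2" if \<theta>: "\<theta> \<in> {0..1}" for \<theta>
   proof -
    obtain A' and d :: nat where Y: "gaussian_family normal_seq (I1 \<union> I2) (\<lambda>i \<omega>. \<Sum>l<d. A' i l * \<omega> l) (Kt \<theta>)"
     by (rule psd_realization[of "I1 \<union> I2" "Kt \<theta>"]) (use fin Kt_sym psd \<theta> in auto)
    note i = gaussian_family_integrable[OF Y]
    have "\<bar>poly p \<theta>\<bar> \<le> (EN (\<lambda>\<omega>. (f (\<lambda>i. \<Sum>l<d. A' i l * \<omega> l))^2) + EN (\<lambda>\<omega>. (g (\<lambda>i. \<Sum>l<d. A' i l * \<omega> l))^2)) / 2"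
     unfolding p(3)[OF Y, symmetric]
     by (rule abs_integral_mult_le) (use i[OF poly_fun_power[OF f']] i[OF poly_fun_power[OF g']] i[OF fg] in auto)
    also have "\<dots> = S / 2"
     using marg1[OF Y poly_fun_power[OF f, of 2]] marg2[OF Y poly_fun_power[OF g, of 2]]
     by (simp add: S_def F_def G_def)
    finally show ?thesis .
   qed
   have p0: "poly p 0 = expectation F * expectation G"
   proof -
    obtain A1 and d1 :: nat where A1: "\<And>i j. i \<in> I1 \<Longrightarrow> j \<in> I1 \<Longrightarrow> K i j = (\<Sum>l<d1. A1 i l * A1 j l)"
     by (rule gaussian_family_psd[OF gaussian_family_subset[OF fam, of I1]]) (use sym in auto)
    obtain A2 and d2 :: nat where A2: "\<And>i j. i \<in> I2 \<Longrightarrow> j \<in> I2 \<Longrightarrow> K i j = (\<Sum>l<d2. A2 i l * A2 j l)"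
     by (rule gaussian_family_psd[OF gaussian_family_subset[OF fam, of I2]]) (use sym in auto)
    \<comment> \<open>At \<open>\<theta> = 0\<close> the blocks are built from disjoint sets of
      coordinates, the first \<open>d1\<close> and the next \<open>d2\<close>, so that the
      expectation of the product factors.\<close>
    define A' where "A' i l = (if i \<in> I1 then (if l < d1 then A1 i l else 0) else (if l < d1 then 0 else A2 i (l - d1)))" for i l
    have split: "(\<Sum>l<d1 + d2. h l) = (\<Sum>l<d1. h l) + (\<Sum>l<d2. h (d1 + l))" for h :: "nat \<Rightarrow> real"
     using sum.atLeastLessThan_concat[of 0 d1 "d1 + d2" h] sum.shift_bounds_nat_ivl[of h 0 d1 d2]
     by (simp add: atLeast0LessThan add.commute)
    have cov: "(\<Sum>l<d1 + d2. A' i l * A' j l) = Kt 0 i j" if "i \<in> I1 \<union> I2" "j \<in> I1 \<union> I2" for i j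
     using that disj unfolding split by (auto simp: A'_def Kt_def A_def A1 A2)
    have Y: "gaussian_family normal_seq (I1 \<union> I2) (\<lambda>i \<omega>. \<Sum>l<d1 + d2. A' i l * \<omega> l) (Kt 0)"
     by (rule gaussian_family_cong[OF normal_seq_family_linear]) (use fin cov in auto)
    have fe: "f (\<lambda>i. \<Sum>l<d1 + d2. A' i l * \<omega> l) = f (\<lambda>i. \<Sum>l<d1. A1 i l * \<omega> l)" for \<omega>
     by (rule poly_fun_cong[OF f]) (simp only: split, simp add: A'_def)
    have ge: "g (\<lambda>i. \<Sum>l<d1 + d2. A' i l * \<omega> l) = g (\<lambda>i. \<Sum>l<d2. A2 i l * \<omega> (d1 + l))" for \<omega>
    proof (rule poly_fun_cong[OF g])
     fix i assume "i \<in> I2"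
     then have "i \<notin> I1" using disj by auto
     then show "(\<Sum>l<d1 + d2. A' i l * \<omega> l) = (\<Sum>l<d2. A2 i l * \<omega> (d1 + l))"
      by (simp only: split) (simp add: A'_def)
    qed
    have "poly p 0 = EN (\<lambda>\<omega>. f (\<lambda>i. \<Sum>l<d1. A1 i l * \<omega> l) * g (\<lambda>i. \<Sum>l<d2. A2 i l * \<omega> (d1 + l)))"
     using p(3)[OF Y] by (simp add: fe ge)
    also have "\<dots> = EN (\<lambda>\<omega>. f (\<lambda>i. \<Sum>l<d1. A1 i l * \<omega> l)) * EN (\<lambda>\<omega>. g (\<lambda>i. \<Sum>l<d2. A2 i l * \<omega> (d1 + l)))"
     by (rule normal_seq_indep_poly[of "{..<d1}" "{d1..<d1 + d2}" D _ D])
      (auto intro!: poly_fun_subst[OF f] poly_fun_subst[OF g] poly_fun_sum poly_fun_cmult poly_fun_var)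
    also have "\<dots> = expectation F * expectation G"
     using marg1[OF Y f] marg2[OF Y g] by (simp add: fe ge F_def G_def)
    finally show ?thesis .
   qed
   have px: "poly p x = (\<Sum>k\<le>2 * D. coeff p k * x ^ k)" for x
    unfolding poly_altdef using p(1)
    by (intro sum.mono_neutral_left) (auto simp: coeff_eq_0 not_le)
   have coef: "\<bar>coeff p k\<bar> \<le> C * (S / 2)" if "k \<le> 2 * D" for k
   proof -
    have "\<bar>coeff p k\<bar> \<le> C * integral {0..1} (\<lambda>x. \<bar>poly p x\<bar>)"
     unfolding px by (rule C(2)[OF that])
    also have "\<dots> \<le> C * integral {0..1} (\<lambda>x :: real. S / 2)"
     using C(1) pb by (intro mult_left_mono integral_le integrable_continuous_real continuous_intros) auto
    finally show ?thesis by simp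
   qed
   have "poly p \<rho> - poly p 0 = (\<Sum>k\<in>{1..2 * D}. coeff p k * \<rho> ^ k)"
   proof -
    have "(\<Sum>k\<le>2 * D. coeff p k * \<rho> ^ k) = coeff p 0 + (\<Sum>k\<in>{1..2 * D}. coeff p k * \<rho> ^ k)"
    proof -
     have "{..2 * D} = insert 0 {1..2 * D}" by auto
     then show ?thesis by simp
    qed
    then show ?thesis unfolding px[of \<rho>] by (simp add: poly_0_coeff_0)
   qed
   then have "\<bar>poly p \<rho> - poly p 0\<bar> \<le> (\<Sum>k\<in>{1..2 * D}. \<bar>coeff p k * \<rho> ^ k\<bar>)"
    by simp
   also have "\<dots> \<le> (\<Sum>k\<in>{1..2 * D}. C * (S / 2) * \<rho>)"
   proof (rule sum_mono)
    fix k assume k: "k \<in> {1..2 * D}"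
    have "\<rho> ^ k \<le> \<rho> ^ 1" using \<rho> False k by (intro power_decreasing) auto
    then show "\<bar>coeff p k * \<rho> ^ k\<bar> \<le> C * (S / 2) * \<rho>"
     unfolding abs_mult using coef[of k] k \<rho> C(1) S0 by (intro mult_mono) auto
   qed
   also have "\<dots> = real D * C * \<rho> * S" by simp
   also have "\<dots> \<le> (1 + 2 * real D * C) * \<rho> * S"
    using C(1) \<rho> S0 by (intro mult_right_mono) auto
   finally show ?thesis unfolding p\<rho> p0 by (simp add: F_def G_def S_def)
  qed
 qed
qed

subsection \<open>Covariance of fractional Gaussian noise\<close>

text \<open>The covariance of two unit-step increments of fractional Brownian motion at lag
  \<open>x\<close>: half the second difference of \<open>\<bar>x\<bar> powr (2 * H)\<close>.\<close>

definition fgn :: "real \<Rightarrow> real \<Rightarrow> real" where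
 "fgn H x = (\<bar>x + 1\<bar> powr (2 * H) + \<bar>x - 1\<bar> powr (2 * H) - 2 * \<bar>x\<bar> powr (2 * H)) / 2"

lemma fgn_minus: "fgn H (- x) = fgn H x"
proof -
 have "\<bar>- x + 1\<bar> = \<bar>x - 1\<bar>" "\<bar>- x - 1\<bar> = \<bar>x + 1\<bar>" by linarith+
 then show ?thesis by (simp add: fgn_def)
qed

lemma fgn_0 [simp]: "H > 0 \<Longrightarrow> fgn H 0 = 1"
 by (simp add: fgn_def)

lemma powr_diff_MVT:
 fixes x s :: real
 assumes "x > 0"
 obtains z where "x < z" "z < x + 1" "(x + 1) powr s - x powr s = s * z powr (s - 1)"
proof -
 have "\<exists>z. x < z \<and> z < x + 1 \<and> (x + 1) powr s - x powr s = (x + 1 - x) * (s * z powr (s - 1))"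
  by (rule MVT2) (use assms in \<open>auto intro!: has_real_derivative_powr\<close>)
 then show ?thesis using that by auto
qed

text \<open>The mean value theorem, twice: the second difference of \<open>x powr s\<close> with
  \<open>0 < s \<le> 1\<close> is nonpositive by concavity, and its size is governed by the second
  derivative at a point beyond \<open>x - 1\<close>.\<close>

lemma fgn_far:
 assumes H: "0 < H" "H \<le> 1 / 2" and x: "x \<ge> 2"
 shows "fgn H x \<le> 0" "\<bar>fgn H x\<bar> \<le> (x - 1) powr (2 * H - 2)"
proof -
 define s where "s = 2 * H"
 have s: "0 < s" "s \<le> 1" using H by (auto simp: s_def)
 obtain z1 where z1: "x < z1" "z1 < x + 1" "(x + 1) powr s - x powr s = s * z1 powr (s - 1)"
  using powr_diff_MVT[of x s] x by auto
 obtain z2 where z2: "x - 1 < z2" "z2 < x" "x powr s - (x - 1) powr s = s * z2 powr (s - 1)"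
  using powr_diff_MVT[of "x - 1" s] x by auto
 have "\<exists>z. z2 < z \<and> z < z1 \<and> z1 powr (s - 1) - z2 powr (s - 1) = (z1 - z2) * ((s - 1) * z powr (s - 1 - 1))"
 proof (rule MVT2)
  fix t assume "z2 \<le> t" "t \<le> z1"
  then show "((\<lambda>a. a powr (s - 1)) has_real_derivative (s - 1) * t powr (s - 1 - 1)) (at t)"
   using z2 x by (intro has_real_derivative_powr) auto
 qed (use z1 z2 in auto)
 then obtain z where z: "z2 < z" "z < z1"
  "z1 powr (s - 1) - z2 powr (s - 1) = (z1 - z2) * ((s - 1) * z powr (s - 2))"
  by auto
 have "\<bar>x + 1\<bar> = x + 1" "\<bar>x - 1\<bar> = x - 1" "\<bar>x\<bar> = x" using x by auto
 then have "2 * fgn H x = ((x + 1) powr s - x powr s) - (x powr s - (x - 1) powr s)"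
  by (simp add: fgn_def s_def)
 also have "\<dots> = s * (z1 powr (s - 1) - z2 powr (s - 1))"
  unfolding z1(3) z2(3) by (simp add: algebra_simps)
 also have "\<dots> = - (s * (1 - s) * (z1 - z2) * z powr (s - 2))"
  unfolding z(3) by (simp add: algebra_simps)
 finally have eq: "2 * fgn H x = - (s * (1 - s) * (z1 - z2) * z powr (s - 2))" .
 have nn: "0 \<le> s * (1 - s) * (z1 - z2) * z powr (s - 2)"
  using s z by (intro mult_nonneg_nonneg) auto
 then show "fgn H x \<le> 0" using eq by linarith
 have "s * (1 - s) * (z1 - z2) * z powr (s - 2) \<le> (1 * 1 * 2) * (x - 1) powr (s - 2)"
 proof (intro mult_mono)
  show "z powr (s - 2) \<le> (x - 1) powr (s - 2)"
   using s z z2 x by (intro powr_mono2') auto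
 qed (use s z z1 z2 in auto)
 then show "\<bar>fgn H x\<bar> \<le> (x - 1) powr (2 * H - 2)" using eq nn unfolding s_def by linarith
qed

text \<open>Lag \<open>1\<close> is below the range of \<open>fgn_far\<close> and follows directly
  from \<open>2 powr (2 * H) \<le> 2\<close>.\<close>

lemma fgn_nonpos:
 assumes H: "0 < H" "H \<le> 1 / 2" and ab: "a \<noteq> (b :: nat)"
 shows "fgn H (real a - real b) \<le> 0"
proof -
 have *: "fgn H (real d) \<le> 0" if "d \<ge> 1" for d :: nat
 proof (cases "d = 1")
  case True
  have "(2 :: real) powr (2 * H) \<le> 2 powr 1" using H by (intro powr_mono) auto
  then show ?thesis using True by (simp add: fgn_def)
 next
  case False
  then show ?thesis using that by (intro fgn_far H) auto
 qed
 show ?thesis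
 proof (cases "a > b")
  case True
  then show ?thesis using *[of "a - b"] by (simp add: of_nat_diff)
 next
  case False
  then show ?thesis using *[of "b - a"] ab fgn_minus[of H "real a - real b"] by (simp add: of_nat_diff)
 qed
qed

text \<open>The row sum telescopes. It is the covariance of one increment with the total increment
  over the range, half a sum of two increments of \<open>x powr (2 * H)\<close>; by concavity each
  of these is at least the derivative at \<open>R\<close>.\<close>

lemma fgn_row_sum:
 assumes H: "0 < H" "H \<le> 1 / 2" and a: "a \<in> {p..<p + R}"
 shows "(\<Sum>b\<in>{p..<p + R}. fgn H (real a - real b)) \<ge> 2 * H * real R powr (2 * H - 1)"
proof -
 define s where "s = 2 * H"
 have s: "0 < s" "s \<le> 1" using H by (auto simp: s_def)
 define u where "u y = \<bar>y\<bar> powr s" for y :: real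
 define d where "d = a - p"
 have d: "d < R" "a = p + d" using a by (auto simp: d_def)
 define f where "f b = (u (real d - real b + 1) - u (real d - real b)) / 2" for b :: nat
 have fg: "fgn H (real d - real b) = f b - f (Suc b)" for b
 proof -
  have e: "real d - real (Suc b) + 1 = real d - real b" "real d - real (Suc b) = real d - real b - 1" by simp_all
  show ?thesis unfolding f_def e by (simp add: fgn_def u_def s_def add_divide_distrib diff_divide_distrib)
 qed
 have "(\<Sum>b\<in>{p..<p + R}. fgn H (real a - real b)) = (\<Sum>b<R. fgn H (real a - real (b + p)))"
  using sum.shift_bounds_nat_ivl[of "\<lambda>b. fgn H (real a - real b)" 0 p R]
  by (simp add: atLeast0LessThan add.commute)
 also have "\<dots> = (\<Sum>b<R. f b - f (Suc b))" by (simp add: d(2) fg[symmetric])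
 also have "\<dots> = f 0 - f R" by (rule sum_lessThan_telescope')
 also have "f 0 - f R = ((real d + 1) powr s - real d powr s) / 2 + (real (R - d) powr s - real (R - d - 1) powr s) / 2"
 proof -
  have "\<bar>real d - real R + 1\<bar> = real (R - d - 1)" "\<bar>real d - real R\<bar> = real (R - d)"
   using d by (auto simp: of_nat_diff)
  then show ?thesis by (simp add: f_def u_def diff_divide_distrib)
 qed
 also have "\<dots> \<ge> s * real R powr (s - 1)"
 proof -
  have *: "(real k + 1) powr s - real k powr s \<ge> s * real R powr (s - 1)" if k: "k < R" for k
  proof (cases "k = 0")
   case True
   have "real R powr (s - 1) \<le> 1 powr (s - 1)" using k s by (intro powr_mono2') auto
   then have "s * real R powr (s - 1) \<le> 1 * 1" using s by (intro mult_mono) auto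
   then show ?thesis using True s by simp
  next
   case False
   then obtain z where z: "real k < z" "z < real k + 1" "(real k + 1) powr s - real k powr s = s * z powr (s - 1)"
    using powr_diff_MVT[of "real k" s] by auto
   have "real R powr (s - 1) \<le> z powr (s - 1)" using z k s by (intro powr_mono2') auto
   then show ?thesis unfolding z(3) using s by (intro mult_left_mono) auto
  qed
  have e: "real (R - d - 1) + 1 = real (R - d)" using d by auto
  have half: "A \<ge> L \<Longrightarrow> B \<ge> L \<Longrightarrow> A / 2 + B / 2 \<ge> L" for A B L :: real by linarith
  have "R - d - 1 < R" using d by simp
  from half[OF *[OF d(1)] *[OF this, unfolded e]] show ?thesis .
 qed
 finally show ?thesis by (simp add: s_def)
qed

text \<open>Off-diagonal entries are nonpositive and row sums are bounded below, so the matrix is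
  diagonally dominant: writing \<open>2 * c a * c b\<close> as
  \<open>(c a)^2 + (c b)^2 - (c a - c b)^2\<close> bounds the form from below by the row
  sums.\<close>

lemma fgn_quadratic_lower:
 fixes p R :: nat
 assumes H: "0 < H" "H \<le> 1 / 2"
 defines "J \<equiv> {p..<p + R}"
 shows "(\<Sum>a\<in>J. \<Sum>b\<in>J. c a * c b * fgn H (real a - real b)) \<ge> 2 * H * real R powr (2 * H - 1) * (\<Sum>a\<in>J. (c a)^2)"
proof -
 let ?g = "\<lambda>a b. fgn H (real a - real b)"
 have sym: "?g a b = ?g b a" for a b using fgn_minus[of H "real a - real b"] by simp
 have 1: "(\<Sum>a\<in>J. \<Sum>b\<in>J. (c b)^2 * ?g a b) = (\<Sum>a\<in>J. \<Sum>b\<in>J. (c a)^2 * ?g a b)"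
  by (subst sum.swap) (simp add: sym)
 have "(\<Sum>a\<in>J. \<Sum>b\<in>J. (c a - c b)^2 * ?g a b) = (\<Sum>a\<in>J. \<Sum>b\<in>J. (c a)^2 * ?g a b)
   + (\<Sum>a\<in>J. \<Sum>b\<in>J. (c b)^2 * ?g a b) - 2 * (\<Sum>a\<in>J. \<Sum>b\<in>J. c a * c b * ?g a b)"
  by (simp add: power2_diff sum.distrib sum_subtractf sum_distrib_left algebra_simps)
 then have eq: "2 * (\<Sum>a\<in>J. \<Sum>b\<in>J. c a * c b * ?g a b) =
   2 * (\<Sum>a\<in>J. \<Sum>b\<in>J. (c a)^2 * ?g a b) - (\<Sum>a\<in>J. \<Sum>b\<in>J. (c a - c b)^2 * ?g a b)"
  unfolding 1 by simp
 have "(\<Sum>a\<in>J. \<Sum>b\<in>J. (c a - c b)^2 * ?g a b) \<le> 0"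
 proof (intro sum_nonpos)
  fix a b show "(c a - c b)^2 * ?g a b \<le> 0"
   using fgn_nonpos[OF H, of a b] by (cases "a = b") (auto intro: mult_nonneg_nonpos)
 qed
 moreover have "(\<Sum>a\<in>J. \<Sum>b\<in>J. (c a)^2 * ?g a b) \<ge> (\<Sum>a\<in>J. (c a)^2 * (2 * H * real R powr (2 * H - 1)))"
  unfolding sum_distrib_left[symmetric] J_def
  by (intro sum_mono mult_left_mono fgn_row_sum H) auto
 moreover have "(\<Sum>a\<in>J. (c a)^2 * (2 * H * real R powr (2 * H - 1))) = 2 * H * real R powr (2 * H - 1) * (\<Sum>a\<in>J. (c a)^2)"
  by (subst sum_distrib_left, intro sum.cong refl, simp add: mult_ac)
 ultimately show ?thesis using eq by linarith
qed

definition noise_cov :: "real \<Rightarrow> nat \<times> 'n \<Rightarrow> nat \<times> 'n \<Rightarrow> real" where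
 "noise_cov H p q = (if snd p = snd q then fgn H (real (fst p) - real (fst q)) else 0)"

lemma noise_cov_sym: "noise_cov H p q = noise_cov H q p"
 using fgn_minus[of H "real (fst p) - real (fst q)"] by (auto simp: noise_cov_def)

lemma noise_cov_sum:
 fixes c :: "nat \<times> 'n::finite \<Rightarrow> real"
 assumes "finite J" "finite J'"
 shows "(\<Sum>p\<in>J \<times> UNIV. \<Sum>q\<in>J' \<times> UNIV. c p * c q * noise_cov H p q)
  = (\<Sum>i\<in>UNIV. \<Sum>a\<in>J. \<Sum>b\<in>J'. c (a, i) * c (b, i) * fgn H (real a - real b))"
proof -
 have "(\<Sum>p\<in>J \<times> UNIV. \<Sum>q\<in>J' \<times> UNIV. c p * c q * noise_cov H p q)
  = (\<Sum>a\<in>J. \<Sum>i\<in>UNIV. \<Sum>b\<in>J'. \<Sum>j\<in>UNIV. c (a, i) * c (b, j) * noise_cov H (a, i) (b, j))"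
 proof -
  have "(\<Sum>p\<in>J \<times> UNIV. h p) = (\<Sum>a\<in>J. \<Sum>i\<in>UNIV. h (a, i))" for h :: "nat \<times> 'n \<Rightarrow> real" and J
   by (simp add: sum.cartesian_product)
  then show ?thesis by simp
 qed
 also have "\<dots> = (\<Sum>a\<in>J. \<Sum>i\<in>UNIV. \<Sum>b\<in>J'. c (a, i) * c (b, i) * fgn H (real a - real b))"
 proof (intro sum.cong refl)
  fix a i b
  have "(\<Sum>j\<in>UNIV. c (a, i) * c (b, j) * noise_cov H (a, i) (b, j))
    = (\<Sum>j\<in>UNIV. if j = i then c (a, i) * c (b, i) * fgn H (real a - real b) else 0)"
   by (intro sum.cong) (auto simp: noise_cov_def)
  then show "(\<Sum>j\<in>UNIV. c (a, i) * c (b, j) * noise_cov H (a, i) (b, j)) = c (a, i) * c (b, i) * fgn H (real a - real b)"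
   by simp
 qed
 also have "\<dots> = (\<Sum>i\<in>UNIV. \<Sum>a\<in>J. \<Sum>b\<in>J'. c (a, i) * c (b, i) * fgn H (real a - real b))"
  by (rule sum.swap)
 finally show ?thesis .
qed

text \<open>All components of the \<open>k\<close>-th run of \<open>R\<close> consecutive
  increments, that is, the noise inside one interval of a coarser generation.\<close>

definition block :: "nat \<Rightarrow> nat \<Rightarrow> (nat \<times> 'n) set" where
 "block R k = {k * R..<k * R + R} \<times> UNIV"

lemma block_disjoint:
 assumes "k \<noteq> l"
 shows "block R k \<inter> block R l = {}"
proof -
 have *: "{k * R..<k * R + R} \<inter> {l * R..<l * R + R} = {}" if "k < l" for k l
 proof -
  have "Suc k * R \<le> l * R" using that by (intro mult_right_mono) auto
  then show ?thesis by auto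
 qed
 have "{k * R..<k * R + R} \<inter> {l * R..<l * R + R} = {}"
  using *[of k l] *[of l k] assms by (cases k l rule: linorder_cases) (auto simp: Int_commute)
 then show ?thesis unfolding block_def by blast
qed

text \<open>A cross covariance is at most \<open>P\<close>, a row of the cross block has
  \<open>R\<close> relevant entries, and the two forms on the right are bounded below by
  \<open>fgn_quadratic_lower\<close>. The powers of \<open>R\<close> cancel, so the bound depends
  only on the distance of the blocks; this makes the later estimates uniform in the mesh.\<close>

lemma noise_cov_block_cross:
 fixes c :: "nat \<times> 'n::finite \<Rightarrow> real"
 assumes H: "0 < H" "H \<le> 1 / 2" and R: "R > 0" and kl: "k + 2 \<le> l"
 shows "2 * \<bar>\<Sum>p\<in>block R k. \<Sum>q\<in>block R l. c p * c q * noise_cov H p q\<bar>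
  \<le> 1 / (2 * H * real (l - k - 1)) * (qform (block R k) (noise_cov H) c + qform (block R l) (noise_cov H) c)"
proof -
 define J where "J k = {k * R..<k * R + R}" for k
 define m where "m = l - k - 1"
 have m1: "m \<ge> 1" and l: "l = k + 1 + m" using kl by (auto simp: m_def)
 define S where "S k = (\<Sum>i\<in>UNIV. \<Sum>a\<in>J k. (c (a, i))^2)" for k
 define P where "P = (real m * real R) powr (2 * H - 2)"
 have P0: "P \<ge> 0" by (simp add: P_def)
 have S0: "S k \<ge> 0" for k unfolding S_def by (intro sum_nonneg) auto
 have Q: "2 * H * real R powr (2 * H - 1) * S k \<le> qform (block R k) (noise_cov H) c" for k
  unfolding block_def S_def J_def noise_cov_sum[OF finite_atLeastLessThan finite_atLeastLessThan]
  unfolding sum_distrib_left[of _ _ UNIV]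
  by (rule sum_mono) (rule fgn_quadratic_lower[OF H])
 have g: "\<bar>fgn H (real a - real b)\<bar> \<le> P" if "a \<in> J k" "b \<in> J l" for a b
 proof -
  have 1: "a + 1 \<le> k * R + R" "l * R \<le> b" using that by (auto simp: J_def)
  have 2: "a + 1 + m * R \<le> b"
   using 1 unfolding l by (simp add: algebra_simps)
  have mR: "1 \<le> m * R" using m1 R by (simp add: Suc_le_eq)
  have 3: "real m * real R \<le> real b - real a - 1"
   using 2 of_nat_mono[OF 2, where 'a=real] by simp
  have 4: "1 \<le> real m * real R" using mR of_nat_mono[OF mR, where 'a=real] by simp
  have "\<bar>fgn H (real b - real a)\<bar> \<le> (real b - real a - 1) powr (2 * H - 2)"
   using 3 4 by (intro fgn_far H) auto
  also have "\<dots> \<le> P" unfolding P_def using 3 4 H by (intro powr_mono2') auto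
  finally show ?thesis using fgn_minus[of H "real a - real b"] by simp
 qed
 have "2 * \<bar>\<Sum>p\<in>block R k. \<Sum>q\<in>block R l. c p * c q * noise_cov H p q\<bar>
   = 2 * \<bar>\<Sum>i\<in>UNIV. \<Sum>a\<in>J k. \<Sum>b\<in>J l. c (a, i) * c (b, i) * fgn H (real a - real b)\<bar>"
  unfolding block_def J_def by (subst noise_cov_sum) auto
 also have "\<dots> \<le> 2 * (\<Sum>i\<in>UNIV. \<Sum>a\<in>J k. \<Sum>b\<in>J l. \<bar>c (a, i) * c (b, i) * fgn H (real a - real b)\<bar>)"
  by (intro mult_left_mono order.trans[OF sum_abs] sum_mono) auto
 also have "\<dots> \<le> 2 * (\<Sum>i\<in>UNIV. \<Sum>a\<in>J k. \<Sum>b\<in>J l. ((c (a, i))^2 + (c (b, i))^2) / 2 * P)"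
  unfolding abs_mult[of "_ * _"]
  by (intro mult_left_mono sum_mono mult_mono abs_mult_le_half_squares g) auto
 also have "\<dots> = P * real R * (S k + S l)"
 proof -
  have card: "card (J k) = R" for k by (simp add: J_def)
  have "(\<Sum>a\<in>J k. \<Sum>b\<in>J l. ((c (a, i))^2 + (c (b, i))^2) / 2 * P)
    = P / 2 * (real R * (\<Sum>a\<in>J k. (c (a, i))^2) + real R * (\<Sum>b\<in>J l. (c (b, i))^2))" for i
   by (simp add: card sum.distrib sum_distrib_left sum_distrib_right sum_divide_distrib algebra_simps add_divide_distrib)
  then show ?thesis unfolding S_def
   by (simp add: sum.distrib sum_distrib_left algebra_simps)
 qed
 also have "\<dots> = (P * real R / (2 * H * real R powr (2 * H - 1))) * (2 * H * real R powr (2 * H - 1) * (S k + S l))"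
  using H R by simp
 also have "\<dots> \<le> 1 / (2 * H * real m) * (qform (block R k) (noise_cov H) c + qform (block R l) (noise_cov H) c)"
 proof (intro mult_mono)
  have "P * real R = real m powr (2 * H - 2) * real R powr (2 * H - 1)"
  proof -
   have "real R powr (2 * H - 2) * real R = real R powr (2 * H - 2) * real R powr 1" using R by simp
   also have "\<dots> = real R powr (2 * H - 1)" unfolding powr_add[symmetric] by simp
   finally show ?thesis unfolding P_def by (simp add: powr_mult)
  qed
  then have "P * real R / (2 * H * real R powr (2 * H - 1)) = real m powr (2 * H - 2) / (2 * H)"
   using R H by simp
  \<comment> \<open>Here \<open>H \<le> 1 / 2\<close> enters through
    \<open>2 * H - 2 \<le> - 1\<close>.\<close>
  also have "\<dots> \<le> real m powr (- 1) / (2 * H)"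
   using m1 H by (intro divide_right_mono powr_mono) auto
  also have "\<dots> = 1 / (2 * H * real m)" using m1 by (simp add: powr_minus_divide)
  finally show "P * real R / (2 * H * real R powr (2 * H - 1)) \<le> 1 / (2 * H * real m)" .
  show "2 * H * real R powr (2 * H - 1) * (S k + S l)
    \<le> qform (block R k) (noise_cov H) c + qform (block R l) (noise_cov H) c"
   using Q[of k] Q[of l] by (simp add: distrib_left)
 qed (use H S0 in \<open>auto intro!: mult_nonneg_nonneg add_nonneg_nonneg\<close>)
 finally show ?thesis by (simp add: m_def)
qed

subsection \<open>Signatures of sequences of increments\<close>

definition tens_one :: "'n tensors" where
 "tens_one w = (if w = [] then 1 else 0)"

definition tens_exp :: "(nat \<Rightarrow> real) \<Rightarrow> ('n \<Rightarrow> real) \<Rightarrow> 'n tensors" where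
 "tens_exp c x w = c (length w) * (\<Prod>i\<leftarrow>w. x i)"

text \<open>
 With \<open>c k = 1 / k!\<close> this is the signature of the polygon with increments \<open>\<xi> a, \<dots>, \<xi> (a + r - 1)\<close>;
 the choices \<open>c = (1, 1, 0, \<dots>)\<close> and \<open>c = (1, 1, 1/2, \<dots>)\<close> give at level \<open>2\<close> the Ito and
 Stratonovich sums.
\<close>

fun sig :: "(nat \<Rightarrow> real) \<Rightarrow> (nat \<Rightarrow> 'n \<Rightarrow> real) \<Rightarrow> nat \<Rightarrow> nat \<Rightarrow> 'n tensors" where
 "sig c \<xi> a 0 = tens_one"
| "sig c \<xi> a (Suc r) = tensor_prod (sig c \<xi> a r) (tens_exp c (\<xi> (a + r)))"

lemma tensor_prod_Nil [simp]: "tensor_prod a b [] = a [] * b []"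
 by (simp add: tensor_prod_def)

lemma tensor_prod_Cons: "tensor_prod a b (x # w) = a [] * b (x # w) + tensor_prod (\<lambda>v. a (x # v)) b w"
 unfolding tensor_prod_def by (simp add: sum.atMost_Suc_shift del: sum.atMost_Suc)

lemma tensor_prod_add_left: "tensor_prod (\<lambda>v. a v + b v) c w = tensor_prod a c w + tensor_prod b c w"
 by (simp add: tensor_prod_def sum.distrib algebra_simps)

lemma tensor_prod_cmult_left: "tensor_prod (\<lambda>v. s * a v) c w = s * tensor_prod a c w"
 by (simp add: tensor_prod_def sum_distrib_left algebra_simps)

lemma tensor_prod_assoc: "tensor_prod (tensor_prod a b) c w = tensor_prod a (tensor_prod b c) w"
proof (induction w arbitrary: a)
 case (Cons x w)
 have "tensor_prod (tensor_prod a b) c (x # w)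
   = a [] * b [] * c (x # w) + tensor_prod (\<lambda>v. a [] * b (x # v) + tensor_prod (\<lambda>v. a (x # v)) b v) c w"
  by (simp add: tensor_prod_Cons)
 also have "\<dots> = a [] * (b [] * c (x # w) + tensor_prod (\<lambda>v. b (x # v)) c w)
   + tensor_prod (tensor_prod (\<lambda>v. a (x # v)) b) c w"
  by (simp add: tensor_prod_add_left tensor_prod_cmult_left algebra_simps)
 also have "\<dots> = tensor_prod a (tensor_prod b c) (x # w)"
  by (simp add: tensor_prod_Cons Cons.IH)
 finally show ?case .
qed simp

lemma tensor_prod_one_right [simp]: "tensor_prod a tens_one w = a w"
proof -
 have "tensor_prod a tens_one w = (\<Sum>j\<le>length w. if j = length w then a w else 0)"
  unfolding tensor_prod_def by (intro sum.cong) (auto simp: tens_one_def)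
 then show ?thesis by simp
qed

lemma tensor_prod_cong:
 "(\<And>j. j \<le> length w \<Longrightarrow> a (take j w) = a' (take j w)) \<Longrightarrow> (\<And>j. j \<le> length w \<Longrightarrow> b (drop j w) = b' (drop j w)) \<Longrightarrow>
  tensor_prod a b w = tensor_prod a' b' w"
 by (simp add: tensor_prod_def)

text \<open>Chen's relation on the grid; it is associativity of the tensor product.\<close>

lemma sig_append: "sig c \<xi> a (r + r') w = tensor_prod (sig c \<xi> a r) (sig c \<xi> (a + r) r') w"
proof (induction r' arbitrary: w)
 case (Suc r')
 have "sig c \<xi> a (r + r') = tensor_prod (sig c \<xi> a r) (sig c \<xi> (a + r) r')"
  using Suc by (simp add: fun_eq_iff)
 then show ?case by (simp add: tensor_prod_assoc add.assoc)
qed simp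

text \<open>The link to the Gaussian estimates: a coefficient of level \<open>k\<close> is a
  polynomial of degree at most \<open>k\<close> in the increments of its own range, however fine the
  grid is.\<close>

lemma sig_poly:
 "poly_fun ({a..<a + r} \<times> UNIV) (length w) (\<lambda>x. sig c (\<lambda>b i. x (b, i)) a r w)"
proof (induction r arbitrary: w)
 case 0
 then show ?case by (simp add: poly_fun_const)
next
 case (Suc r)
 have 1: "poly_fun ({a..<a + Suc r} \<times> UNIV) (length w - j) (\<lambda>x. tens_exp c (\<lambda>i. x (a + r, i)) (drop j w))" for j
 proof -
  have "poly_fun ({a..<a + Suc r} \<times> UNIV) (length (drop j w)) (\<lambda>x. \<Prod>i\<leftarrow>drop j w. x (a + r, i))"
   by (rule poly_fun_prod_list) (auto intro!: poly_fun_var)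
  then show ?thesis unfolding tens_exp_def by (intro poly_fun_cmult) simp
 qed
 have 2: "poly_fun ({a..<a + Suc r} \<times> UNIV) j (\<lambda>x. sig c (\<lambda>b i. x (b, i)) a r (take j w))" if "j \<le> length w" for j
  by (rule poly_fun_mono[OF Suc]) (use that in auto)
 show ?case
  unfolding sig.simps tensor_prod_def
 proof (intro poly_fun_sum)
  fix j assume "j \<in> {..length w}"
  then have j: "j \<le> length w" by simp
  show "poly_fun ({a..<a + Suc r} \<times> UNIV) (length w)
    (\<lambda>x. sig c (\<lambda>b i. x (b, i)) a r (take j w) * tens_exp c (\<lambda>i. x (a + r, i)) (drop j w))"
   using poly_fun_mult[OF 2[OF j] 1[of j]] j by simp
 qed
qed

lemma sig_scale: "sig c (\<lambda>b i. s * \<xi> b i) a r w = s ^ length w * sig c \<xi> a r w"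
proof (induction r arbitrary: w)
 case (Suc r)
 have e: "tens_exp c (\<lambda>i. s * x i) v = s ^ length v * tens_exp c x v" for x and v :: "'a list"
 proof -
  have "(\<Prod>i\<leftarrow>v. s * x i) = s ^ length v * (\<Prod>i\<leftarrow>v. x i)" by (induction v) auto
  then show ?thesis by (simp add: tens_exp_def)
 qed
 have "s ^ j * s ^ (length w - j) = s ^ length w" if "j \<le> length w" for j
  using that by (simp add: power_add[symmetric])
 then have *: "s ^ j * u * (s ^ (length w - j) * v) = s ^ length w * (u * v)" if "j \<le> length w" for j u v
  using that by (metis (no_types, lifting) mult.assoc mult.left_commute)
 show ?case
  unfolding sig.simps tensor_prod_def sum_distrib_left
  by (intro sum.cong refl) (simp add: Suc e *)
qed (simp add: tens_one_def)

lemma sig_shift: "sig c (\<lambda>b. \<xi> (b + p)) a r = sig c \<xi> (a + p) r"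
 by (induction r) (simp_all add: add_ac)

lemma sig_Nil: "c 0 = 1 \<Longrightarrow> sig c \<xi> a r [] = 1"
 by (induction r) (simp_all add: tens_one_def tens_exp_def)

lemma sig_single: "c 0 = 1 \<Longrightarrow> c 1 = 1 \<Longrightarrow> sig c \<xi> a r [i] = (\<Sum>b<r. \<xi> (a + b) i)"
 by (induction r) (simp_all add: tens_one_def tens_exp_def sig_Nil tensor_prod_def)

subsection \<open>Averages over blocks of fractional Gaussian noise\<close>

text \<open>Each dyadic block of the harmonic series contributes at most \<open>1\<close>.\<close>

lemma harm_pow2_le: "harm (2 ^ n) \<le> (real n + 1)"
proof (induction n)
 case (Suc n)
 have "harm (2 ^ Suc n) = harm (2 ^ n) + (\<Sum>k\<in>{2 ^ n<..2 ^ Suc n}. inverse (real k))"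
 proof -
  have "{1..2 ^ Suc n} = {1..2 ^ n} \<union> {2 ^ n<..2 ^ Suc n :: nat}" by auto
  then show ?thesis unfolding harm_def by (simp only:) (rule sum.union_disjoint, auto)
 qed
 also have "(\<Sum>k\<in>{2 ^ n<..2 ^ Suc n}. inverse (real k)) \<le> (\<Sum>k\<in>{2 ^ n<..2 ^ Suc n :: nat}. inverse (2 ^ n))"
 proof (intro sum_mono le_imp_inverse_le)
  fix k :: nat assume "k \<in> {2 ^ n<..2 ^ Suc n}"
  then have "2 ^ n \<le> k" by simp
  then show "2 ^ n \<le> real k" using of_nat_mono[of "2 ^ n" k, where 'a=real] by simp
 qed simp
 also have "\<dots> = 1" by simp
 finally show ?case using Suc by simp
qed (simp add: harm_def)

text \<open>Decorrelation is available for blocks at distance at least \<open>2\<close>, where it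
  has size \<open>1 / (d - 1)\<close>; equal and adjacent blocks get the trivial weight
  \<open>1\<close>.\<close>

definition dist_weight :: "nat \<Rightarrow> real" where
 "dist_weight d = (if d \<le> 1 then 1 else 1 / real (d - 1))"

lemma dist_weight_nonneg: "dist_weight d \<ge> 0"
 by (simp add: dist_weight_def)

lemma sum_dist_weight: "(\<Sum>d<N. dist_weight d) \<le> 2 + harm N"
proof -
 have "(\<Sum>d<N. dist_weight d) \<le> (\<Sum>d\<in>{..<2} \<union> {2..N + 1}. dist_weight d)"
  by (intro sum_mono2) (auto simp: dist_weight_nonneg)
 also have "\<dots> = (\<Sum>d\<in>{..<2}. dist_weight d) + (\<Sum>d\<in>{2..N + 1}. dist_weight d)"
  by (intro sum.union_disjoint) auto
 also have "(\<Sum>d\<in>{..<2}. dist_weight d) = 2"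
  by (simp add: dist_weight_def numeral_2_eq_2)
 also have "(\<Sum>d\<in>{2..N + 1}. dist_weight d) = harm N"
  unfolding harm_def
  by (rule sum.reindex_bij_witness[of _ "\<lambda>d. d + 1" "\<lambda>d. d - 1"])
   (auto simp: dist_weight_def inverse_eq_divide)
 finally show ?thesis .
qed

lemma sum_dist_weight_abs:
 assumes "k < N"
 shows "(\<Sum>l<N. dist_weight (if k \<le> l then l - k else k - l)) \<le> 2 * (2 + harm N)"
proof -
 let ?w = "\<lambda>l. dist_weight (if k \<le> l then l - k else k - l)"
 have "(\<Sum>l<N. ?w l) = (\<Sum>l\<in>{..<k} \<union> {k..<N}. ?w l)"
  using assms by (intro sum.cong) auto
 also have "\<dots> = (\<Sum>l\<in>{..<k}. ?w l) + (\<Sum>l\<in>{k..<N}. ?w l)"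
  by (intro sum.union_disjoint) auto
 also have "(\<Sum>l\<in>{..<k}. ?w l) = (\<Sum>d\<in>{1..k}. dist_weight d)"
  by (rule sum.reindex_bij_witness[of _ "\<lambda>d. k - d" "\<lambda>l. k - l"]) auto
 also have "\<dots> \<le> (\<Sum>d<N. dist_weight d)"
  using assms by (intro sum_mono2) (auto simp: dist_weight_nonneg)
 also have "(\<Sum>l\<in>{k..<N}. ?w l) = (\<Sum>d\<in>{..<N - k}. dist_weight d)"
  by (rule sum.reindex_bij_witness[of _ "\<lambda>d. k + d" "\<lambda>l. l - k"]) auto
 also have "\<dots> \<le> (\<Sum>d<N. dist_weight d)"
  by (intro sum_mono2) (auto simp: dist_weight_nonneg)
 finally show ?thesis using sum_dist_weight[of N] by simp
qed

text \<open>The variance of an average is a double sum of covariances. These decay like the inverse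
  distance of the blocks, so each row contributes a harmonic sum of order \<open>n\<close>, and the
  outcome is summable in \<open>n\<close>. The constant does not depend on the block length
  \<open>R\<close>, hence not on the mesh.\<close>

lemma (in prob_space) noise_average_variance:
 assumes H: "0 < H" "H \<le> 1 / 2"
 shows "\<exists>C>0. \<forall>R n (Z :: nat \<times> 'n::finite \<Rightarrow> 'a \<Rightarrow> real) f V a. R > 0 \<longrightarrow>
   gaussian_family M ({..<2 ^ n * R} \<times> UNIV) Z (noise_cov H) \<longrightarrow>
   (\<forall>k<2 ^ n. poly_fun (block R k) D (f k) \<and> expectation (\<lambda>\<omega>. (f k (\<lambda>i. Z i \<omega>))^2) \<le> V \<and>
    expectation (\<lambda>\<omega>. f k (\<lambda>i. Z i \<omega>)) = a) \<longrightarrow>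
   expectation (\<lambda>\<omega>. ((\<Sum>k<2 ^ n. f k (\<lambda>i. Z i \<omega>)) / 2 ^ n - a)^2) \<le> C * V * (real n + 3) / 2 ^ n"
proof -
 obtain C where C: "C > 0" "\<forall>(I1 :: (nat \<times> 'n) set) I2 Z K \<rho> f g. gaussian_family M (I1 \<union> I2) Z K \<longrightarrow> I1 \<inter> I2 = {} \<longrightarrow>
   (\<forall>i\<in>I1 \<union> I2. \<forall>j\<in>I1 \<union> I2. K i j = K j i) \<longrightarrow> \<rho> > 0 \<longrightarrow>
   (\<forall>c. 2 * \<bar>\<Sum>i\<in>I1. \<Sum>j\<in>I2. c i * c j * K i j\<bar> \<le> \<rho> * (qform I1 K c + qform I2 K c)) \<longrightarrow>
   poly_fun I1 D f \<longrightarrow> poly_fun I2 D g \<longrightarrow>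
   \<bar>(LINT \<omega>|M. f (\<lambda>i. Z i \<omega>) * g (\<lambda>i. Z i \<omega>)) - (LINT \<omega>|M. f (\<lambda>i. Z i \<omega>)) * (LINT \<omega>|M. g (\<lambda>i. Z i \<omega>))\<bar>
    \<le> C * \<rho> * ((LINT \<omega>|M. (f (\<lambda>i. Z i \<omega>))^2) + (LINT \<omega>|M. (g (\<lambda>i. Z i \<omega>))^2))"
  using gaussian_decorrelation[OF prob_space_axioms, of D, where 'i = "nat \<times> 'n"]
  by (elim exE conjE) (rule that, assumption+)
 \<comment> \<open>\<open>2\<close> is the trivial bound for near blocks; \<open>C / H\<close>
   combines the constant \<open>C\<close>, the factor \<open>1 / (2 * H)\<close> in
   \<open>\<rho>\<close> and the two second moments.\<close>
 define B where "B = 2 + C / H"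
 have B: "B > 0" using C(1) H by (simp add: B_def add_pos_pos)
 show ?thesis
 proof (intro exI[of _ "2 * B"] conjI allI impI)
  show "0 < 2 * B" using B by simp
  fix R n :: nat and Z :: "nat \<times> 'n \<Rightarrow> 'a \<Rightarrow> real" and f V a
  assume R: "R > 0" and fam: "gaussian_family M ({..<2 ^ n * R} \<times> UNIV) Z (noise_cov H)"
   and f: "\<forall>k<2 ^ n. poly_fun (block R k) D (f k) \<and> expectation (\<lambda>\<omega>. (f k (\<lambda>i. Z i \<omega>))^2) \<le> V \<and>
    expectation (\<lambda>\<omega>. f k (\<lambda>i. Z i \<omega>)) = a"
  let ?I = "{..<2 ^ n * R} \<times> (UNIV :: 'n set)"
  define F where "F k \<omega> = f k (\<lambda>i. Z i \<omega>)" for k \<omega>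
  have sub: "block R k \<subseteq> ?I" if "k < 2 ^ n" for k
  proof -
   have "Suc k * R \<le> 2 ^ n * R" using that by (intro mult_right_mono) auto
   then show ?thesis by (auto simp: block_def)
  qed
  have pf: "poly_fun ?I D (f k)" if "k < 2 ^ n" for k
   by (rule poly_fun_mono[OF _ sub[OF that]]) (use f that in auto)
  note i = gaussian_family_integrable[OF fam]
  have i1: "integrable M (F k)" if "k < 2 ^ n" for k
   using i[OF pf[OF that]] by (simp add: F_def[abs_def])
  have i2: "integrable M (\<lambda>\<omega>. F k \<omega> * F l \<omega>)" if "k < 2 ^ n" "l < 2 ^ n" for k l
   using i[OF poly_fun_mult[OF pf[OF that(1)] pf[OF that(2)]]] by (simp add: F_def)
  have isq: "integrable M (\<lambda>\<omega>. (F k \<omega>)^2)" if "k < 2 ^ n" for k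
   using i2[OF that that] by (simp add: power2_eq_square)
  have Ea: "expectation (F k) = a" and EV: "expectation (\<lambda>\<omega>. (F k \<omega>)^2) \<le> V" if "k < 2 ^ n" for k
   using f that by (auto simp: F_def[abs_def])
  have V0: "V \<ge> 0"
  proof -
   have "0 \<le> expectation (\<lambda>\<omega>. (F 0 \<omega>)^2)" by simp
   also have "\<dots> \<le> V" by (rule EV) simp
   finally show ?thesis .
  qed
  define Cv where "Cv k l = expectation (\<lambda>\<omega>. F k \<omega> * F l \<omega>) - a * a" for k l
  have Cv_sym: "Cv k l = Cv l k" for k l by (simp add: Cv_def mult.commute)
  have near: "\<bar>Cv k l\<bar> \<le> 2 * V" if "k < 2 ^ n" "l < 2 ^ n" for k l
  proof -
   have "\<bar>expectation (\<lambda>\<omega>. F k \<omega> * F l \<omega>)\<bar> \<le> V"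
    by (rule order.trans[OF abs_integral_mult_le[OF isq[OF that(1)] isq[OF that(2)] i2[OF that]]])
     (use add_mono[OF EV[OF that(1)] EV[OF that(2)]] in simp)
   moreover have "\<bar>a * a\<bar> \<le> V"
    using expectation_square_le[OF isq[OF that(1)] i1[OF that(1)]] EV[OF that(1)] Ea[OF that(1)]
    by (simp add: power2_eq_square)
   moreover have "\<bar>x\<bar> \<le> V \<Longrightarrow> \<bar>y\<bar> \<le> V \<Longrightarrow> \<bar>x - y\<bar> \<le> 2 * V" for x y :: real by linarith
   ultimately show ?thesis unfolding Cv_def by blast
  qed
  have far: "\<bar>Cv k l\<bar> \<le> B * V * dist_weight (l - k)" if kl: "k \<le> l" "l < 2 ^ n" for k l
  proof (cases "l - k \<le> 1")
   case True
   have "\<bar>Cv k l\<bar> \<le> 2 * V" using kl by (intro near) auto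
   also have "\<dots> \<le> B * V" using V0 C(1) H by (intro mult_right_mono) (auto simp: B_def)
   finally show ?thesis using True by (simp add: dist_weight_def)
  next
   case False
   then have kl2: "k + 2 \<le> l" by simp
   define \<rho> where "\<rho> = 1 / (2 * H * real (l - k - 1))"
   have \<rho>: "\<rho> > 0" unfolding \<rho>_def using H False by (intro divide_pos_pos mult_pos_pos) auto
   have "\<bar>expectation (\<lambda>\<omega>. f k (\<lambda>i. Z i \<omega>) * f l (\<lambda>i. Z i \<omega>)) - expectation (\<lambda>\<omega>. f k (\<lambda>i. Z i \<omega>)) * expectation (\<lambda>\<omega>. f l (\<lambda>i. Z i \<omega>))\<bar>
    \<le> C * \<rho> * (expectation (\<lambda>\<omega>. (f k (\<lambda>i. Z i \<omega>))^2) + expectation (\<lambda>\<omega>. (f l (\<lambda>i. Z i \<omega>))^2))"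
   proof (rule C(2)[rule_format, of "block R k" "block R l" Z "noise_cov H"])
    show "gaussian_family M (block R k \<union> block R l) Z (noise_cov H)"
     using sub[of k] sub[of l] kl by (intro gaussian_family_subset[OF fam]) auto
    show "block R k \<inter> block R l = {}" by (rule block_disjoint) (use kl2 in simp)
    show "2 * \<bar>\<Sum>i\<in>block R k. \<Sum>j\<in>block R l. c i * c j * noise_cov H i j\<bar>
      \<le> \<rho> * (qform (block R k) (noise_cov H) c + qform (block R l) (noise_cov H) c)" for c :: "nat \<times> 'n \<Rightarrow> real"
     unfolding \<rho>_def by (rule noise_cov_block_cross[OF H R kl2])
   qed (use \<rho> f kl in \<open>auto intro: noise_cov_sym\<close>)
   then have "\<bar>Cv k l\<bar> \<le> C * \<rho> * (expectation (\<lambda>\<omega>. (F k \<omega>)^2) + expectation (\<lambda>\<omega>. (F l \<omega>)^2))"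
    using f kl by (auto simp: Cv_def F_def)
   also have "\<dots> \<le> C * \<rho> * (V + V)"
    using C(1) \<rho> EV[of k] EV[of l] kl by (intro mult_left_mono add_mono) auto
   also have "\<dots> = C / H * V * dist_weight (l - k)"
    using False H by (simp add: \<rho>_def dist_weight_def)
   also have "\<dots> \<le> B * V * dist_weight (l - k)"
    using V0 by (intro mult_right_mono dist_weight_nonneg) (auto simp: B_def)
   finally show ?thesis .
  qed
  have cov: "\<bar>Cv k l\<bar> \<le> B * V * dist_weight (if k \<le> l then l - k else k - l)" if "k < 2 ^ n" "l < 2 ^ n" for k l
   using far[of k l] far[of l k] that by (auto simp: Cv_sym[of k l])
  define N :: real where "N = 2 ^ n"
  have N: "N > 0" by (simp add: N_def)
  have "expectation (\<lambda>\<omega>. ((\<Sum>k<2 ^ n. F k \<omega>) / N - a)^2) = (\<Sum>k<2 ^ n. \<Sum>l<2 ^ n. Cv k l) / N\<^sup>2"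
  proof -
   have "((\<Sum>k<2 ^ n. F k \<omega>) / N - a)^2
     = (\<Sum>k<2 ^ n. \<Sum>l<2 ^ n. F k \<omega> * F l \<omega> - a * F k \<omega> - a * F l \<omega> + a * a) / N\<^sup>2" for \<omega>
   proof -
    have "(\<Sum>k<2 ^ n. F k \<omega>) / N - a = (\<Sum>k<2 ^ n. F k \<omega> - a) / N"
     using N by (simp add: sum_subtractf diff_divide_distrib) (simp add: N_def)
    then have "((\<Sum>k<2 ^ n. F k \<omega>) / N - a)^2 = (\<Sum>k<2 ^ n. \<Sum>l<2 ^ n. (F k \<omega> - a) * (F l \<omega> - a)) / N\<^sup>2"
     by (simp add: power_divide power2_eq_square[of "sum _ _"] sum_product)
    then show ?thesis by (simp add: algebra_simps)
   qed
   then have "expectation (\<lambda>\<omega>. ((\<Sum>k<2 ^ n. F k \<omega>) / N - a)^2)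
     = expectation (\<lambda>\<omega>. \<Sum>k<2 ^ n. \<Sum>l<2 ^ n. F k \<omega> * F l \<omega> - a * F k \<omega> - a * F l \<omega> + a * a) / N\<^sup>2"
    by simp
   also have "expectation (\<lambda>\<omega>. \<Sum>k<2 ^ n. \<Sum>l<2 ^ n. F k \<omega> * F l \<omega> - a * F k \<omega> - a * F l \<omega> + a * a)
     = (\<Sum>k<2 ^ n. \<Sum>l<2 ^ n. expectation (\<lambda>\<omega>. F k \<omega> * F l \<omega> - a * F k \<omega> - a * F l \<omega> + a * a))"
    using i1 i2 by (subst Bochner_Integration.integral_sum, force)
     (intro sum.cong refl Bochner_Integration.integral_sum, auto)
   also have "\<dots> = (\<Sum>k<2 ^ n. \<Sum>l<2 ^ n. Cv k l)"
    using i1 i2 Ea by (intro sum.cong refl) (simp add: Cv_def prob_space)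
   finally show ?thesis .
  qed
  also have "\<dots> \<le> (N * (B * V * (2 * (2 + harm (2 ^ n))))) / N\<^sup>2"
  proof (rule divide_right_mono)
   have "(\<Sum>k<2 ^ n. \<Sum>l<2 ^ n. Cv k l) \<le> (\<Sum>k<2 ^ n :: nat. B * V * (2 * (2 + harm (2 ^ n))))"
   proof (rule sum_mono)
    fix k :: nat assume k: "k \<in> {..<2 ^ n}"
    have "(\<Sum>l<2 ^ n. Cv k l) \<le> (\<Sum>l<2 ^ n. B * V * dist_weight (if k \<le> l then l - k else k - l))"
    proof (rule sum_mono)
     fix l :: nat assume "l \<in> {..<2 ^ n}"
     then show "Cv k l \<le> B * V * dist_weight (if k \<le> l then l - k else k - l)"
      using cov[of k l] k by (auto simp: abs_le_iff)
    qed
    also have "\<dots> \<le> B * V * (2 * (2 + harm (2 ^ n)))"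
     unfolding sum_distrib_left[symmetric] using k B V0
     by (intro mult_left_mono sum_dist_weight_abs) auto
    finally show "(\<Sum>l<2 ^ n. Cv k l) \<le> B * V * (2 * (2 + harm (2 ^ n)))" .
   qed
   then show "(\<Sum>k<2 ^ n. \<Sum>l<2 ^ n. Cv k l) \<le> N * (B * V * (2 * (2 + harm (2 ^ n))))"
    by (simp add: N_def)
  qed simp
  also have "\<dots> = 2 * B * V * (2 + harm (2 ^ n)) / N"
   using N by (simp add: power2_eq_square)
  also have "\<dots> \<le> 2 * B * V * (real n + 3) / N"
   using B V0 N harm_pow2_le[of n] by (intro divide_right_mono mult_left_mono) auto
  finally show "expectation (\<lambda>\<omega>. ((\<Sum>k<2 ^ n. f k (\<lambda>i. Z i \<omega>)) / 2 ^ n - a)^2) \<le> 2 * B * V * (real n + 3) / 2 ^ n"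
   by (simp add: F_def N_def)
 qed
qed

text \<open>Used with a shift of the time index, this expresses the stationarity of the
  noise.\<close>

lemma gaussian_family_reindex:
 fixes I :: "'b set" and J :: "'c set"
 assumes "gaussian_family M I Z K" "inj_on \<phi> J" "\<phi> ` J \<subseteq> I"
 shows "gaussian_family M J (\<lambda>j. Z (\<phi> j)) (\<lambda>i j. K (\<phi> i) (\<phi> j))"
proof -
 have fam: "gaussian_family M (\<phi> ` J) Z K" by (rule gaussian_family_subset[OF assms(1,3)])
 show ?thesis unfolding gaussian_family_def
 proof (intro conjI allI)
  show "finite J" using fam assms(2) by (simp add: gaussian_family_def finite_image_iff)
  fix c :: "'c \<Rightarrow> real"
  define c' where "c' i = c (the_inv_into J \<phi> i)" for i
  have c': "c' (\<phi> j) = c j" if "j \<in> J" for j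
   using that assms(2) by (simp add: c'_def the_inv_into_f_f)
  have "gaussian_moments M (qform (\<phi> ` J) K c') (\<lambda>\<omega>. \<Sum>i\<in>\<phi> ` J. c' i * Z i \<omega>)"
   using fam by (simp add: gaussian_family_def)
  moreover have "qform (\<phi> ` J) K c' = qform J (\<lambda>i j. K (\<phi> i) (\<phi> j)) c"
   using assms(2) by (simp add: sum.reindex c')
  moreover have "(\<Sum>i\<in>\<phi> ` J. c' i * Z i \<omega>) = (\<Sum>j\<in>J. c j * Z (\<phi> j) \<omega>)" for \<omega>
   using assms(2) by (simp add: sum.reindex c')
  ultimately show "gaussian_moments M (qform J (\<lambda>i j. K (\<phi> i) (\<phi> j)) c) (\<lambda>\<omega>. \<Sum>j\<in>J. c j * Z (\<phi> j) \<omega>)"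
   by simp
 qed
qed

text \<open>Diagonal choice: the \<open>j\<close>-th index makes the first \<open>j + 1\<close>
  events have probability at most \<open>(1 / 2) ^ j\<close>, which is summable in \<open>j\<close>
  for each fixed event. One subsequence thus serves countably many limits in probability.\<close>

lemma (in prob_space) common_subsequence_AE:
 fixes E :: "nat \<Rightarrow> nat \<Rightarrow> 'a set"
 assumes "\<And>i m. E i m \<in> sets M" "\<And>i. (\<lambda>m. prob (E i m)) \<longlonglongrightarrow> 0"
 obtains r :: "nat \<Rightarrow> nat" where "strict_mono r" "AE \<omega> in M. \<forall>i. \<forall>\<^sub>F j in sequentially. \<omega> \<notin> E i (r j)"
proof -
 have "\<exists>m0. \<forall>m\<ge>m0. \<forall>i\<le>j. prob (E i m) \<le> (1 / 2) ^ j" for j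
 proof -
  have "\<forall>\<^sub>F m in sequentially. \<forall>i\<in>{..j}. prob (E i m) < (1 / 2) ^ j"
   by (intro eventually_ball_finite ballI order_tendstoD(2)[OF assms(2)]) auto
  then show ?thesis unfolding eventually_sequentially by (auto intro: less_imp_le)
 qed
 then obtain g where g: "\<And>j m i. g j \<le> m \<Longrightarrow> i \<le> j \<Longrightarrow> prob (E i m) \<le> (1 / 2) ^ j"
  by metis
 \<comment> \<open>The sum makes \<open>r j\<close> at least \<open>g j\<close>, and the summand
   \<open>j\<close> makes \<open>r\<close> strictly increasing.\<close>
 define r where "r j = j + (\<Sum>i\<le>j. g i)" for j
 have "strict_mono r" unfolding strict_mono_Suc_iff r_def by simp
 moreover have gr: "g j \<le> r j" for j
  unfolding r_def using member_le_sum[of j "{..j}" g] by simp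
 have "AE \<omega> in M. \<forall>\<^sub>F j in sequentially. \<omega> \<notin> E i (r j)" for i
 proof -
  have "AE \<omega> in M. \<forall>\<^sub>F j in sequentially. \<omega> \<in> space M - (if i \<le> j then E i (r j) else {})"
  proof (rule borel_cantelli_AE1)
   have "summable (\<lambda>j. (1 / 2 :: real) ^ j)" by (rule summable_geometric) simp
   then show "summable (\<lambda>j. prob (if i \<le> j then E i (r j) else {}))"
    by (rule summable_comparison_test[rotated]) (use g[OF gr] in \<open>auto intro!: exI[of _ 0]\<close>)
  qed (use assms(1) in \<open>auto simp: emeasure_eq_measure\<close>)
  then show ?thesis
  proof (rule AE_mp, intro AE_I2 impI)
   fix \<omega> assume "\<forall>\<^sub>F j in sequentially. \<omega> \<in> space M - (if i \<le> j then E i (r j) else {})"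
   then show "\<forall>\<^sub>F j in sequentially. \<omega> \<notin> E i (r j)"
    using eventually_ge_at_top[of i] by eventually_elim auto
  qed
 qed
 then have "AE \<omega> in M. \<forall>i. \<forall>\<^sub>F j in sequentially. \<omega> \<notin> E i (r j)"
  unfolding AE_all_countable by blast
 ultimately show ?thesis using that by blast
qed

subsection \<open>Dyadic averages of a lift of fractional Gaussian noise\<close>

text \<open>For \<open>H > 0\<close> the range \<open>p > 0\<close> contains the required range
  \<open>p > 1 / H\<close>.\<close>

abbreviation besov_critical :: "nat \<Rightarrow> real \<Rightarrow> real \<Rightarrow> 'n::finite two_param \<Rightarrow> bool" where
 "besov_critical N H T X \<equiv> (\<forall>p>0. X \<in> besov_rough_paths N H (ennreal p) T) \<and> X \<notin> besov_rough_paths N H \<top> T"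

abbreviation dyad :: "real \<Rightarrow> nat \<Rightarrow> nat \<Rightarrow> real" where
 "dyad T n k \<equiv> T * real k / 2 ^ n"

text \<open>Monotone convergence makes the expected series finite. With \<open>u\<close> a squared
  deviation or excess this is the Borel-Cantelli step.\<close>

lemma AE_summable_of_nn_integral:
 fixes u :: "nat \<Rightarrow> 'a \<Rightarrow> real"
 assumes "\<And>n. u n \<in> borel_measurable M" "\<And>n \<omega>. u n \<omega> \<ge> 0"
  and "\<And>n. (\<integral>\<^sup>+\<omega>. ennreal (u n \<omega>) \<partial>M) \<le> ennreal (\<delta> n)" "summable \<delta>" "\<And>n. \<delta> n \<ge> 0"
 shows "AE \<omega> in M. summable (\<lambda>n. u n \<omega>)"
proof -
 have "(\<integral>\<^sup>+\<omega>. (\<Sum>n. ennreal (u n \<omega>)) \<partial>M) = (\<Sum>n. \<integral>\<^sup>+\<omega>. ennreal (u n \<omega>) \<partial>M)"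
  using assms(1) by (intro nn_integral_suminf) auto
 also have "\<dots> \<le> (\<Sum>n. ennreal (\<delta> n))" by (intro suminf_le assms(3)) auto
 also have "\<dots> < \<infinity>" using suminf_ennreal2[OF assms(5,4)] by simp
 finally have "AE \<omega> in M. (\<Sum>n. ennreal (u n \<omega>)) \<noteq> \<infinity>"
  using assms(1) by (intro nn_integral_PInf_AE) auto
 then show ?thesis
  by eventually_elim (auto intro: summable_suminf_not_top assms(2))
qed

lemma summable_linear_over_pow2: "summable (\<lambda>n. C * (real n + 3) / 2 ^ n)"
proof -
 have "summable (\<lambda>n. (real n + 3) / 2 ^ n)"
 proof (rule summable_ratio_test[of "3 / 4" 0])
  fix n :: nat
  show "norm ((real (Suc n) + 3) / 2 ^ Suc n) \<le> 3 / 4 * norm ((real n + 3) / 2 ^ n)"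
   by (simp add: field_simps)
 qed simp
 then have "summable (\<lambda>n. C * ((real n + 3) / 2 ^ n))" by (rule summable_mult)
 then show ?thesis by simp
qed

text \<open>What the Ito, Stratonovich and fractional lifts have in common: the normalised
  increments of each generation form fractional Gaussian noise, and the lift at dyadic times is the
  limit in probability of grid signatures. For \<open>m < n\<close> the truncated difference
  \<open>m - n\<close> gives indices off the intended grid, which does not affect the limit.\<close>

locale noise_lift = prob_space M for M :: "'a measure" +
 fixes T H :: real and c :: "nat \<Rightarrow> real" and N :: nat
  and \<xi> :: "nat \<Rightarrow> nat \<Rightarrow> 'n::finite \<Rightarrow> 'a \<Rightarrow> real" and X :: "'a \<Rightarrow> 'n two_param"
 assumes T: "0 < T" and H: "0 < H" "H \<le> 1 / 2" and c0: "c 0 = 1" and N1: "1 \<le> N"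
  and noise: "\<And>m. gaussian_family M ({..<2 ^ m} \<times> UNIV) (\<lambda>p \<omega>. \<xi> m (fst p) (snd p) \<omega>) (noise_cov H)"
  and X_measurable: "\<And>n a b w. a \<le> b \<Longrightarrow> b \<le> 2 ^ n \<Longrightarrow> length w \<le> N \<Longrightarrow>
   (\<lambda>\<omega>. X \<omega> (dyad T n a) (dyad T n b) w) \<in> borel_measurable M"
  and X_limit: "\<And>n a b w \<epsilon>. a \<le> b \<Longrightarrow> b \<le> 2 ^ n \<Longrightarrow> length w \<le> N \<Longrightarrow> \<epsilon> > 0 \<Longrightarrow>
   (\<lambda>m. prob {\<omega> \<in> space M. \<epsilon> < \<bar>sig c (\<lambda>b i. (T / 2 ^ m) powr H * \<xi> m b i \<omega>) (a * 2 ^ (m - n)) ((b - a) * 2 ^ (m - n)) w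
     - X \<omega> (dyad T n a) (dyad T n b) w\<bar>}) \<longlonglongrightarrow> 0"
  and X_level1: "AE \<omega> in M. \<forall>n i. \<forall>k<2 ^ n.
   X \<omega> (dyad T n k) (dyad T n (Suc k)) [i] = (T / 2 ^ n) powr H * \<xi> n k i \<omega>"
begin

definition gridsig :: "nat \<Rightarrow> 'a \<Rightarrow> nat \<Rightarrow> nat \<Rightarrow> 'n tensors" where
 "gridsig m \<omega> = sig c (\<lambda>b i. (T / 2 ^ m) powr H * \<xi> m b i \<omega>)"

definition noisesig :: "nat \<Rightarrow> 'a \<Rightarrow> nat \<Rightarrow> nat \<Rightarrow> 'n tensors" where
 "noisesig m \<omega> = sig c (\<lambda>b i. \<xi> m b i \<omega>)"

lemma gridsig_eq: "gridsig m \<omega> a r w = ((T / 2 ^ m) powr H) ^ length w * noisesig m \<omega> a r w"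
 unfolding gridsig_def noisesig_def by (rule sig_scale)

lemma noisesig_measurable:
 assumes "a + r \<le> 2 ^ m"
 shows "(\<lambda>\<omega>. noisesig m \<omega> a r w) \<in> borel_measurable M"
proof -
 have "poly_fun ({..<2 ^ m} \<times> UNIV) (length w) (\<lambda>x. sig c (\<lambda>b i. x (b, i)) a r w)"
  by (rule poly_fun_mono[OF sig_poly]) (use assms in auto)
 from gaussian_family_integrable[OF noise this] show ?thesis
  by (simp add: noisesig_def)
qed

lemma gridsig_measurable: "a + r \<le> 2 ^ m \<Longrightarrow> (\<lambda>\<omega>. gridsig m \<omega> a r w) \<in> borel_measurable M"
 unfolding gridsig_eq using noisesig_measurable by simp

lemma grid_index:
 assumes "a \<le> b" "b \<le> 2 ^ n" "n \<le> m"
 shows "a * 2 ^ (m - n) + (b - a) * 2 ^ (m - n) \<le> (2 :: nat) ^ m"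
proof -
 have "a * 2 ^ (m - n) + (b - a) * 2 ^ (m - n) = b * 2 ^ (m - n)"
  using assms by (simp add: add_mult_distrib[symmetric])
 also have "\<dots> \<le> 2 ^ n * 2 ^ (m - n)" using assms by (intro mult_right_mono) auto
 also have "\<dots> = 2 ^ m" using assms by (simp add: power_add[symmetric])
 finally show ?thesis .
qed

text \<open>Dyadic end points, words and tolerances are countably many, so
  \<open>common_subsequence_AE\<close> gives one subsequence along which all these limits hold
  almost surely.\<close>

lemma dyadic_limit_AE:
 obtains r where "strict_mono r"
  "AE \<omega> in M. \<forall>n a b w. a \<le> b \<longrightarrow> b \<le> 2 ^ n \<longrightarrow> length w \<le> N \<longrightarrow>
   (\<lambda>j. gridsig (r j) \<omega> (a * 2 ^ (r j - n)) ((b - a) * 2 ^ (r j - n)) w)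
    \<longlonglongrightarrow> X \<omega> (dyad T n a) (dyad T n b) w"
proof -
 define D where "D n a b w l m = (if a \<le> b \<and> b \<le> 2 ^ n \<and> length w \<le> N \<and> n \<le> m then
   {\<omega> \<in> space M. 1 / real (Suc l) < \<bar>gridsig m \<omega> (a * 2 ^ (m - n)) ((b - a) * 2 ^ (m - n)) w
     - X \<omega> (dyad T n a) (dyad T n b) w\<bar>} else {})"
  for n a b :: nat and w :: "'n list" and l m
 define E where "E i m = (case from_nat i of (n, a, b, w, l) \<Rightarrow> D n a b w l m)" for i m
 have D_sets: "D n a b w l m \<in> sets M" for n a b w l m
  unfolding D_def using gridsig_measurable[OF grid_index, of a b n m w] X_measurable[of a b n w]
  by (auto intro!: borel_measurable_less borel_measurable_abs borel_measurable_diff)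
 have D_lim: "(\<lambda>m. prob (D n a b w l m)) \<longlonglongrightarrow> 0" for n a b w l
 proof (cases "a \<le> b \<and> b \<le> 2 ^ n \<and> length w \<le> N")
  case True
  have "(\<lambda>m. prob {\<omega> \<in> space M. 1 / real (Suc l) < \<bar>gridsig m \<omega> (a * 2 ^ (m - n)) ((b - a) * 2 ^ (m - n)) w
     - X \<omega> (dyad T n a) (dyad T n b) w\<bar>}) \<longlonglongrightarrow> 0"
   unfolding gridsig_def using True by (intro X_limit) auto
  then show ?thesis
  proof (rule Lim_transform_eventually)
   show "\<forall>\<^sub>F m in sequentially. prob {\<omega> \<in> space M. 1 / real (Suc l) < \<bar>gridsig m \<omega> (a * 2 ^ (m - n)) ((b - a) * 2 ^ (m - n)) w
     - X \<omega> (dyad T n a) (dyad T n b) w\<bar>} = prob (D n a b w l m)"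
    using eventually_ge_at_top[of n] by eventually_elim (use True in \<open>simp add: D_def\<close>)
  qed
 next
  case False
  then have "D n a b w l m = {}" for m by (auto simp: D_def)
  then show ?thesis by simp
 qed
 have "E i m \<in> sets M" for i m unfolding E_def using D_sets by (simp split: prod.split)
 moreover have "(\<lambda>m. prob (E i m)) \<longlonglongrightarrow> 0" for i unfolding E_def using D_lim by (simp add: split_beta)
 ultimately obtain r where r: "strict_mono r" "AE \<omega> in M. \<forall>i. \<forall>\<^sub>F j in sequentially. \<omega> \<notin> E i (r j)"
  using common_subsequence_AE[of E] by blast
 show ?thesis
 proof (rule that[OF r(1)])
  show "AE \<omega> in M. \<forall>n a b w. a \<le> b \<longrightarrow> b \<le> 2 ^ n \<longrightarrow> length w \<le> N \<longrightarrow>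
   (\<lambda>j. gridsig (r j) \<omega> (a * 2 ^ (r j - n)) ((b - a) * 2 ^ (r j - n)) w)
    \<longlonglongrightarrow> X \<omega> (dyad T n a) (dyad T n b) w"
   using r(2) AE_space
  proof eventually_elim
   case (elim \<omega>)
   show ?case
   proof (intro allI impI)
    fix n a b :: nat and w :: "'n list"
    assume *: "a \<le> b" "b \<le> 2 ^ n" "length w \<le> N"
    show "(\<lambda>j. gridsig (r j) \<omega> (a * 2 ^ (r j - n)) ((b - a) * 2 ^ (r j - n)) w)
    \<longlonglongrightarrow> X \<omega> (dyad T n a) (dyad T n b) w"
    proof (rule tendstoI)
     fix e :: real assume "e > 0"
     then obtain l where l: "1 / real (Suc l) < e" using nat_approx_posE by blast
     have "\<forall>\<^sub>F j in sequentially. \<omega> \<notin> D n a b w l (r j)"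
      using elim(1)[rule_format, of "to_nat (n, a, b, w, l)"] by (simp add: E_def)
     then show "\<forall>\<^sub>F j in sequentially. dist (gridsig (r j) \<omega> (a * 2 ^ (r j - n)) ((b - a) * 2 ^ (r j - n)) w)
       (X \<omega> (dyad T n a) (dyad T n b) w) < e"
      using eventually_ge_at_top[of n]
     proof eventually_elim
      case (elim j)
      have "n \<le> r j" using seq_suble[OF r(1), of j] elim(2) by simp
      then show ?case using elim(1) * l \<open>\<omega> \<in> space M\<close> by (auto simp: D_def dist_real_def not_less)
     qed
    qed
   qed
  qed
 qed
qed

text \<open>\<open>sig_append\<close> holds exactly on every grid and passes to the almost sure
  limit coordinate by coordinate.\<close>

lemma chen_dyadic_AE:
 "AE \<omega> in M. \<forall>n a b d w. a \<le> b \<longrightarrow> b \<le> d \<longrightarrow> d \<le> 2 ^ n \<longrightarrow> length w \<le> N \<longrightarrow>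
   tensor_prod (X \<omega> (dyad T n a) (dyad T n b)) (X \<omega> (dyad T n b) (dyad T n d)) w
    = X \<omega> (dyad T n a) (dyad T n d) w"
 and nil_dyadic_AE:
 "AE \<omega> in M. \<forall>n a b. a \<le> b \<longrightarrow> b \<le> 2 ^ n \<longrightarrow> X \<omega> (dyad T n a) (dyad T n b) [] = 1"
proof -
 obtain r where r: "strict_mono r"
  "AE \<omega> in M. \<forall>n a b w. a \<le> b \<longrightarrow> b \<le> 2 ^ n \<longrightarrow> length w \<le> N \<longrightarrow>
   (\<lambda>j. gridsig (r j) \<omega> (a * 2 ^ (r j - n)) ((b - a) * 2 ^ (r j - n)) w)
    \<longlonglongrightarrow> X \<omega> (dyad T n a) (dyad T n b) w"
  by (rule dyadic_limit_AE)
 show "AE \<omega> in M. \<forall>n a b d w. a \<le> b \<longrightarrow> b \<le> d \<longrightarrow> d \<le> 2 ^ n \<longrightarrow> length w \<le> N \<longrightarrow>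
   tensor_prod (X \<omega> (dyad T n a) (dyad T n b)) (X \<omega> (dyad T n b) (dyad T n d)) w
    = X \<omega> (dyad T n a) (dyad T n d) w"
  using r(2)
 proof eventually_elim
  case (elim \<omega>)
  show ?case
  proof (intro allI impI)
   fix n a b d :: nat and w :: "'n list"
   assume *: "a \<le> b" "b \<le> d" "d \<le> 2 ^ n" "length w \<le> N"
   let ?s = "\<lambda>a b j. gridsig (r j) \<omega> (a * 2 ^ (r j - n)) ((b - a) * 2 ^ (r j - n))"
   let ?X = "\<lambda>a b. X \<omega> (dyad T n a) (dyad T n b)"
   have lim: "(\<lambda>j. ?s a b j v) \<longlonglongrightarrow> ?X a b v" if "a \<le> b" "b \<le> 2 ^ n" "length v \<le> N" for a b v
    using elim that by blast
   have "(\<lambda>j. tensor_prod (?s a b j) (?s b d j) w) \<longlonglongrightarrow> tensor_prod (?X a b) (?X b d) w"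
    unfolding tensor_prod_def using * by (intro tendsto_intros lim) auto
   moreover have "tensor_prod (?s a b j) (?s b d j) w = ?s a d j w" for j
   proof -
    have "?s a d j w = gridsig (r j) \<omega> (a * 2 ^ (r j - n)) ((b - a) * 2 ^ (r j - n) + (d - b) * 2 ^ (r j - n)) w"
     using * by (simp add: add_mult_distrib[symmetric])
    also have "\<dots> = tensor_prod (?s a b j) (gridsig (r j) \<omega> (a * 2 ^ (r j - n) + (b - a) * 2 ^ (r j - n)) ((d - b) * 2 ^ (r j - n))) w"
     unfolding gridsig_def by (rule sig_append)
    also have "a * 2 ^ (r j - n) + (b - a) * 2 ^ (r j - n) = b * 2 ^ (r j - n)"
     using * by (simp add: add_mult_distrib[symmetric])
    finally show ?thesis by simp
   qed
   moreover have "(\<lambda>j. ?s a d j w) \<longlonglongrightarrow> ?X a d w" using * by (intro lim) auto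
   ultimately show "tensor_prod (?X a b) (?X b d) w = ?X a d w"
    using LIMSEQ_unique by fastforce
  qed
 qed
 show "AE \<omega> in M. \<forall>n a b. a \<le> b \<longrightarrow> b \<le> 2 ^ n \<longrightarrow> X \<omega> (dyad T n a) (dyad T n b) [] = 1"
  using r(2)
 proof eventually_elim
  case (elim \<omega>)
  show ?case
  proof (intro allI impI)
   fix n a b :: nat assume *: "a \<le> b" "b \<le> 2 ^ n"
   have "(\<lambda>j. gridsig (r j) \<omega> (a * 2 ^ (r j - n)) ((b - a) * 2 ^ (r j - n)) [])
    \<longlonglongrightarrow> X \<omega> (dyad T n a) (dyad T n b) []"
    using elim * by simp
   then show "X \<omega> (dyad T n a) (dyad T n b) [] = 1"
    by (simp add: gridsig_def sig_Nil c0 LIMSEQ_const_iff)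
  qed
 qed
qed

text \<open>The signature of \<open>2 ^ m\<close> noise steps rescaled to unit length. By
  self-similarity it models the normalised grid signature over any dyadic interval that contains
  \<open>2 ^ m\<close> grid steps.\<close>

definition unitsig :: "nat \<Rightarrow> 'n list \<Rightarrow> 'a \<Rightarrow> real" where
 "unitsig m w \<omega> = ((1 / 2 ^ m) powr H) ^ length w * noisesig m \<omega> 0 (2 ^ m) w"

definition unitpoly :: "nat \<Rightarrow> 'n list \<Rightarrow> nat \<Rightarrow> (nat \<times> 'n \<Rightarrow> real) \<Rightarrow> real" where
 "unitpoly m w k x = ((1 / 2 ^ m) powr H) ^ length w * sig c (\<lambda>b i. x (b, i)) (k * 2 ^ m) (2 ^ m) w"

lemma unitpoly_poly: "poly_fun (block (2 ^ m) k) (length w) (unitpoly m w k)"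
 unfolding unitpoly_def block_def by (intro poly_fun_cmult sig_poly)

lemma block_0: "block R 0 = {..<R} \<times> UNIV"
 by (auto simp: block_def)

lemma unitsig_eq: "unitsig m w \<omega> = unitpoly m w 0 (\<lambda>p. \<xi> m (fst p) (snd p) \<omega>)"
 by (simp add: unitsig_def unitpoly_def noisesig_def)

text \<open>The grid signatures over \<open>[0, T]\<close> converge in probability to the lift,
  hence are tight, and \<open>second_moment_of_tightness\<close> makes their second moments bounded
  in \<open>m\<close>. The fourth moment bound it requires is hypercontractivity.\<close>

lemma unitsig_second_moment:
 assumes w: "length w \<le> N"
 shows "\<exists>V. \<forall>m. expectation (\<lambda>\<omega>. (unitsig m w \<omega>)^2) \<le> V"
proof -
 define \<tau> where "\<tau> = (T powr H) ^ length w"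
 have \<tau>: "\<tau> > 0" using T by (simp add: \<tau>_def)
 let ?X = "\<lambda>\<omega>. X \<omega> 0 T w"
 let ?A = "\<lambda>L :: nat. {\<omega> \<in> space M. real L < \<bar>?X \<omega>\<bar>}" and ?D = "\<lambda>m. {\<omega> \<in> space M. 1 < \<bar>\<tau> * unitsig m w \<omega> - ?X \<omega>\<bar>}"
 let ?v = "\<lambda>m. expectation (\<lambda>\<omega>. (unitsig m w \<omega>)^2)"
 have Xm [measurable]: "?X \<in> borel_measurable M" using X_measurable[of 0 1 0 w] w by simp
 have pm: "poly_fun ({..<2 ^ m} \<times> UNIV) (length w) (unitpoly m w 0)" for m
  using unitpoly_poly[of m 0 w] by (simp add: block_0)
 have int: "integrable M (\<lambda>\<omega>. unitsig m w \<omega> ^ k)" for m k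
  using gaussian_family_integrable[OF noise poly_fun_power[OF pm]] by (simp add: unitsig_eq)
 have um [measurable]: "unitsig m w \<in> borel_measurable M" for m
  using int[of m 1] by simp
 have lim: "(\<lambda>m. prob (?D m)) \<longlonglongrightarrow> 0"
 proof -
  have "gridsig m \<omega> 0 (2 ^ m) w = \<tau> * unitsig m w \<omega>" for m \<omega>
   unfolding gridsig_eq unitsig_def \<tau>_def using T
   by (simp add: power_mult_distrib[symmetric] powr_mult[symmetric] mult.assoc[symmetric])
  then show ?thesis
   using X_limit[of 0 1 0 w 1] w by (simp add: gridsig_def)
 qed
 obtain C where C: "C \<ge> 1" "\<forall>(I :: (nat \<times> 'n) set) Z K f. gaussian_family M I Z K \<longrightarrow> (\<forall>i\<in>I. \<forall>j\<in>I. K i j = K j i) \<longrightarrow> poly_fun I (length w) f \<longrightarrow>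
   (LINT \<omega>|M. f (\<lambda>i. Z i \<omega>) ^ 4) \<le> C * (LINT \<omega>|M. (f (\<lambda>i. Z i \<omega>))^2)^2"
  using gaussian_hypercontractivity[of M "length w", where 'i = "nat \<times> 'n"]
  by (elim exE conjE) (rule that, assumption+)
 have E4: "expectation (\<lambda>\<omega>. unitsig m w \<omega> ^ 4) \<le> C * (?v m)^2" for m
  using C(2)[rule_format, OF noise noise_cov_sym pm] by (simp add: unitsig_eq)
 have "(\<lambda>L. prob (?A L)) \<longlonglongrightarrow> prob (\<Inter>L. ?A L)"
  by (rule finite_Lim_measure_decseq) (auto simp: decseq_def)
 moreover have "(\<Inter>L. ?A L) = {}"
 proof -
  have "\<exists>L. \<not> real L < \<bar>?X \<omega>\<bar>" for \<omega> using reals_Archimedean2[of "\<bar>?X \<omega>\<bar>"] by (auto intro: less_imp_le simp: not_less)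
  then show ?thesis by blast
 qed
 ultimately have "(\<lambda>L. prob (?A L)) \<longlonglongrightarrow> 0" by simp
 then have "\<forall>\<^sub>F L in sequentially. prob (?A L) < 1 / (8 * C)"
  using C(1) by (intro order_tendstoD(2)) auto
 then obtain L :: nat where L: "prob (?A L) < 1 / (8 * C)"
  using eventually_happens trivial_limit_sequentially by blast
 have "\<forall>\<^sub>F m in sequentially. prob (?D m) < 1 / (8 * C)"
  using C(1) by (intro order_tendstoD(2)[OF lim]) auto
 then obtain m0 where m0: "\<And>m. m \<ge> m0 \<Longrightarrow> prob (?D m) < 1 / (8 * C)"
  unfolding eventually_sequentially by blast
 \<comment> \<open>Outside \<open>?A L\<close> the limit is at most \<open>L\<close>, outside
   \<open>?D m\<close> the error is at most \<open>1\<close>, and dividing by \<open>\<tau>\<close>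
   undoes the scaling to \<open>[0, T]\<close>.\<close>
 define B where "B = (real L + 1) / \<tau>"
 have B: "B \<ge> 0" using \<tau> by (simp add: B_def)
 have big: "?v m \<le> 2 * B\<^sup>2" if m: "m \<ge> m0" for m
 proof (rule second_moment_of_tightness[OF um int int E4])
  have "prob {\<omega> \<in> space M. B < \<bar>unitsig m w \<omega>\<bar>}
    \<le> prob (?A L \<union> ?D m)"
  proof (rule finite_measure_mono)
   show "{\<omega> \<in> space M. B < \<bar>unitsig m w \<omega>\<bar>}
     \<subseteq> ?A L \<union> ?D m"
   proof
    fix \<omega> assume a: "\<omega> \<in> {\<omega> \<in> space M. B < \<bar>unitsig m w \<omega>\<bar>}"
    then have "real L + 1 < \<tau> * \<bar>unitsig m w \<omega>\<bar>" using \<tau> by (simp add: B_def field_simps)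
    then have "real L + 1 < \<bar>\<tau> * unitsig m w \<omega>\<bar>" using \<tau> by (simp add: abs_mult)
    then show "\<omega> \<in> ?A L \<union> ?D m"
     using a by (auto simp: not_less)
   qed
  qed measurable
  also have "\<dots> \<le> prob (?A L) + prob (?D m)"
   by (rule measure_Un_le) measurable
  also have "\<dots> \<le> 1 / (8 * C) + 1 / (8 * C)" using L m0[OF m] by simp
  finally show "prob {\<omega> \<in> space M. B < \<bar>unitsig m w \<omega>\<bar>} \<le> 1 / (4 * C)" by simp
 qed (use C(1) B in auto)
 show ?thesis
 proof (intro exI allI)
  fix m
  show "?v m \<le> 2 * B\<^sup>2 + (\<Sum>m<m0. ?v m)"
  proof (cases "m < m0")
   case True
   then have "?v m \<le> (\<Sum>m<m0. ?v m)"
    by (intro member_le_sum) auto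
   then show ?thesis by (simp add: add_increasing)
  next
   case False
   then show ?thesis using big[of m] by (simp add: add_increasing2 sum_nonneg)
  qed
 qed
qed

text \<open>Stationarity: \<open>noise_cov\<close> depends on index differences only, so moving
  block \<open>k\<close> to block \<open>0\<close> and passing from generation \<open>m\<close> to
  generation \<open>r\<close> leave the covariance unchanged.\<close>

lemma unitpoly_law:
 assumes "(k + 1) * 2 ^ r \<le> 2 ^ m"
 shows "expectation (\<lambda>\<omega>. unitpoly r w k (\<lambda>p. \<xi> m (fst p) (snd p) \<omega>) ^ j) = expectation (\<lambda>\<omega>. unitsig r w \<omega> ^ j)"
proof -
 let ?J = "{..<2 ^ r} \<times> (UNIV :: 'n set)"
 define \<phi> where "\<phi> p = (fst p + k * 2 ^ r, snd p)" for p :: "nat \<times> 'n"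
 have "gaussian_family M ?J (\<lambda>p \<omega>. \<xi> m (fst (\<phi> p)) (snd (\<phi> p)) \<omega>) (\<lambda>p q. noise_cov H (\<phi> p) (\<phi> q))"
 proof (rule gaussian_family_reindex[OF noise])
  show "inj_on \<phi> ?J" by (auto simp: inj_on_def \<phi>_def)
  show "\<phi> ` ?J \<subseteq> {..<2 ^ m} \<times> UNIV" using assms by (auto simp: \<phi>_def)
 qed
 then have fam: "gaussian_family M ?J (\<lambda>p \<omega>. \<xi> m (fst (\<phi> p)) (snd (\<phi> p)) \<omega>) (noise_cov H)"
  by (rule gaussian_family_cong) (auto simp: noise_cov_def \<phi>_def)
 have "unitpoly r w k (\<lambda>p. \<xi> m (fst p) (snd p) \<omega>) = unitpoly r w 0 (\<lambda>p. \<xi> m (fst (\<phi> p)) (snd (\<phi> p)) \<omega>)" for \<omega>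
  unfolding unitpoly_def \<phi>_def using sig_shift[of c "\<lambda>b i. \<xi> m b i \<omega>" "k * 2 ^ r" 0 "2 ^ r"] by simp
 moreover have pp: "poly_fun ?J (j * length w) (\<lambda>x. unitpoly r w 0 x ^ j)"
  using poly_fun_power[OF unitpoly_poly[of r 0 w], of j] by (simp add: block_0)
 ultimately show ?thesis
  using gaussian_family_determined[OF fam noise pp] by (simp add: unitsig_eq)
qed

text \<open>An empirical moment of the increments of generation \<open>n\<close>, rescaled to unit
  length. The even exponent keeps every term a nonnegative polynomial of the noise before the
  limit.\<close>

definition average :: "nat \<Rightarrow> 'n list \<Rightarrow> nat \<Rightarrow> 'a \<Rightarrow> real" where
 "average e w n \<omega> = (\<Sum>k<2 ^ n.
   (((2 ^ n / T) powr H) ^ length w * X \<omega> (dyad T n k) (dyad T n (Suc k)) w) ^ (2 * e)) / 2 ^ n"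

text \<open>The means of the approximants depend on the mesh, so only an upper bound is sought: the
  excess over the uniform bound \<open>C1\<close> is estimated in mean square, uniformly in the
  mesh, and Fatou's lemma passes to the lift. Summability in \<open>n\<close> then bounds all
  generations at once.\<close>

theorem averages_bounded_AE:
 assumes w: "length w \<le> N"
 shows "AE \<omega> in M. \<exists>C. \<forall>n. average e w n \<omega> \<le> C"
proof -
 obtain V where V: "\<And>m. expectation (\<lambda>\<omega>. (unitsig m w \<omega>)^2) \<le> V"
  using unitsig_second_moment[OF w] by blast
 have pm: "poly_fun ({..<2 ^ m} \<times> UNIV) (length w) (unitpoly m w 0)" for m
  using unitpoly_poly[of m 0 w] by (simp add: block_0)
 have growth: "\<exists>C\<ge>1. \<forall>m. expectation (\<lambda>\<omega>. unitsig m w \<omega> ^ (2 * e)) \<le> C" for e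
 proof -
  obtain C where C: "C \<ge> 1" "\<forall>(I :: (nat \<times> 'n) set) Z K f. gaussian_family M I Z K \<longrightarrow> (\<forall>i\<in>I. \<forall>j\<in>I. K i j = K j i) \<longrightarrow> poly_fun I (length w) f \<longrightarrow>
    (LINT \<omega>|M. (f (\<lambda>i. Z i \<omega>))^2) \<le> V \<longrightarrow> (LINT \<omega>|M. f (\<lambda>i. Z i \<omega>) ^ (2 * e)) \<le> C"
   using gaussian_moment_growth[of "length w" V e, where 'i = "nat \<times> 'n"]
   by (elim exE conjE) (rule that, assumption+)
  have "expectation (\<lambda>\<omega>. unitsig m w \<omega> ^ (2 * e)) \<le> C" for m
   using C(2)[rule_format, OF noise noise_cov_sym pm] V by (simp add: unitsig_eq)
  then show ?thesis using C(1) by blast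
 qed
 obtain C1 where C1: "C1 \<ge> 1" "\<And>m. expectation (\<lambda>\<omega>. unitsig m w \<omega> ^ (2 * e)) \<le> C1"
  using growth by blast
 obtain C2 where C2: "C2 \<ge> 1" "\<And>m. expectation (\<lambda>\<omega>. unitsig m w \<omega> ^ (2 * (2 * e))) \<le> C2"
  using growth by blast
 obtain C3 where C3: "C3 > 0" "\<forall>R n (Z :: nat \<times> 'n \<Rightarrow> 'a \<Rightarrow> real) f V a. R > 0 \<longrightarrow>
   gaussian_family M ({..<2 ^ n * R} \<times> UNIV) Z (noise_cov H) \<longrightarrow>
   (\<forall>k<2 ^ n. poly_fun (block R k) (2 * e * length w) (f k) \<and> expectation (\<lambda>\<omega>. (f k (\<lambda>i. Z i \<omega>))^2) \<le> V \<and>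
    expectation (\<lambda>\<omega>. f k (\<lambda>i. Z i \<omega>)) = a) \<longrightarrow>
   expectation (\<lambda>\<omega>. ((\<Sum>k<2 ^ n. f k (\<lambda>i. Z i \<omega>)) / 2 ^ n - a)^2) \<le> C3 * V * (real n + 3) / 2 ^ n"
  using noise_average_variance[OF H, of "2 * e * length w", where 'n = 'n]
  by (elim exE conjE) (rule that, assumption+)
 define A where "A n m \<omega> = (\<Sum>k<2 ^ n. unitpoly (m - n) w k (\<lambda>p. \<xi> m (fst p) (snd p) \<omega>) ^ (2 * e)) / 2 ^ n" for n m \<omega>
 \<comment> \<open>The squared excess over \<open>C1\<close>. It is continuous, as the passage to
   the limit requires, and at most the squared deviation from any mean
   \<open>a \<le> C1\<close>.\<close>
 define p where "p x = (max 0 (x - C1))^2" for x :: real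
 define \<delta> where "\<delta> n = C3 * C2 * (real n + 3) / 2 ^ n" for n
 have pc: "continuous_on UNIV p" unfolding p_def by (intro continuous_intros)
 have [measurable]: "p \<in> borel_measurable borel" by (rule borel_measurable_continuous_onI[OF pc])
 have p0: "p x \<ge> 0" for x by (simp add: p_def)
 have idx: "(k + 1) * 2 ^ (m - n) \<le> (2 :: nat) ^ m" if "n \<le> m" "k < 2 ^ n" for k n m
 proof -
  have "(k + 1) * 2 ^ (m - n) \<le> 2 ^ n * 2 ^ (m - n)" using that by (intro mult_right_mono) auto
  also have "\<dots> = (2 :: nat) ^ m" using that by (simp add: power_add[symmetric])
  finally show ?thesis .
 qed
 have Aint: "integrable M (\<lambda>\<omega>. A n m \<omega> ^ j)" if "n \<le> m" for n m j
 proof -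
  have "poly_fun ({..<2 ^ m} \<times> UNIV) (2 * e * length w) (\<lambda>x. unitpoly (m - n) w k x ^ (2 * e))" if "k < 2 ^ n" for k
   by (rule poly_fun_mono[OF poly_fun_power[OF unitpoly_poly]])
    (use idx[OF \<open>n \<le> m\<close> that] in \<open>auto simp: block_def\<close>)
  then have "poly_fun ({..<2 ^ m} \<times> UNIV) (2 * e * length w)
    (\<lambda>x. (1 / 2 ^ n) * (\<Sum>k<2 ^ n. unitpoly (m - n) w k x ^ (2 * e)))"
   by (intro poly_fun_cmult poly_fun_sum) auto
  from gaussian_family_integrable[OF noise poly_fun_power[OF this]] show ?thesis
   by (simp add: A_def)
 qed
 have Am: "A n m \<in> borel_measurable M" if "n \<le> m" for n m
  using Aint[OF that, of 1] by simp
 have Avar: "(\<integral>\<^sup>+\<omega>. ennreal (p (A n m \<omega>)) \<partial>M) \<le> ennreal (\<delta> n)" if nm: "n \<le> m" for n m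
 proof -
  define a where "a = expectation (\<lambda>\<omega>. unitsig (m - n) w \<omega> ^ (2 * e))"
  have 2: "(2 :: nat) ^ n * 2 ^ (m - n) = 2 ^ m" using nm by (simp add: power_add[symmetric])
  have "expectation (\<lambda>\<omega>. (A n m \<omega> - a)^2) \<le> \<delta> n"
   unfolding A_def \<delta>_def
  proof (rule C3(2)[rule_format, of "2 ^ (m - n)" n "\<lambda>p \<omega>. \<xi> m (fst p) (snd p) \<omega>" "\<lambda>k x. unitpoly (m - n) w k x ^ (2 * e)" C2 a])
   show "gaussian_family M ({..<2 ^ n * 2 ^ (m - n)} \<times> UNIV) (\<lambda>p \<omega>. \<xi> m (fst p) (snd p) \<omega>) (noise_cov H)"
    unfolding 2 by (rule noise)
   fix k :: nat assume k: "k < 2 ^ n"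
   have sq: "(x ^ (2 * e))^2 = x ^ (2 * (2 * e))" for x :: real by (simp add: power_mult[symmetric] mult_ac)
   show "poly_fun (block (2 ^ (m - n)) k) (2 * e * length w) (\<lambda>x. unitpoly (m - n) w k x ^ (2 * e)) \<and>
     expectation (\<lambda>\<omega>. (unitpoly (m - n) w k (\<lambda>i. \<xi> m (fst i) (snd i) \<omega>) ^ (2 * e))^2) \<le> C2 \<and>
     expectation (\<lambda>\<omega>. unitpoly (m - n) w k (\<lambda>i. \<xi> m (fst i) (snd i) \<omega>) ^ (2 * e)) = a"
    unfolding sq unitpoly_law[OF idx[OF nm k]] a_def
    using C2(2) by (intro conjI poly_fun_power unitpoly_poly) auto
  qed simp
  moreover have "a \<le> C1" unfolding a_def by (rule C1(2))
  then have pa: "p x \<le> (x - a)^2" for x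
   unfolding p_def by (cases "x \<le> C1") (auto intro: power_mono)
  have i: "integrable M (\<lambda>\<omega>. (A n m \<omega> - a)^2)"
   using Aint[OF nm, of 1] Aint[OF nm, of 2] by (simp add: power2_diff)
  ultimately have "(\<integral>\<^sup>+\<omega>. ennreal ((A n m \<omega> - a)^2) \<partial>M) \<le> ennreal (\<delta> n)"
   by (subst nn_integral_eq_integral) (auto intro: ennreal_leI)
  moreover have "(\<integral>\<^sup>+\<omega>. ennreal (p (A n m \<omega>)) \<partial>M) \<le> (\<integral>\<^sup>+\<omega>. ennreal ((A n m \<omega> - a)^2) \<partial>M)"
   by (intro nn_integral_mono ennreal_leI pa)
  ultimately show ?thesis by (rule order.trans[rotated])
 qed
 obtain r where r: "strict_mono r"
  "AE \<omega> in M. \<forall>n a b w. a \<le> b \<longrightarrow> b \<le> 2 ^ n \<longrightarrow> length w \<le> N \<longrightarrow>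
   (\<lambda>j. gridsig (r j) \<omega> (a * 2 ^ (r j - n)) ((b - a) * 2 ^ (r j - n)) w)
    \<longlonglongrightarrow> X \<omega> (dyad T n a) (dyad T n b) w"
  by (rule dyadic_limit_AE)
 \<comment> \<open>Starting the subsequence at \<open>n\<close> ensures
   \<open>n \<le> r (j + n)\<close>, so that the subtractions of naturals below are exact.\<close>
 have rn: "n \<le> r (j + n)" for j n using seq_suble[OF r(1), of "j + n"] by simp
 have lim: "AE \<omega> in M. \<forall>n. (\<lambda>j. A n (r (j + n)) \<omega>) \<longlonglongrightarrow> average e w n \<omega>"
  using r(2)
 proof eventually_elim
  case (elim \<omega>)
  show ?case
  proof
   fix n
   have "(\<lambda>j. unitpoly (r (j + n) - n) w k (\<lambda>p. \<xi> (r (j + n)) (fst p) (snd p) \<omega>))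
     \<longlonglongrightarrow> ((2 ^ n / T) powr H) ^ length w * X \<omega> (dyad T n k) (dyad T n (Suc k)) w"
    if k: "k < 2 ^ n" for k
   proof -
    have lim: "(\<lambda>j. gridsig (r j) \<omega> (k * 2 ^ (r j - n)) ((Suc k - k) * 2 ^ (r j - n)) w)
      \<longlonglongrightarrow> X \<omega> (dyad T n k) (dyad T n (Suc k)) w"
     using elim[rule_format, of k "Suc k" n w] k w by simp
    have "(\<lambda>j. gridsig (r (j + n)) \<omega> (k * 2 ^ (r (j + n) - n)) (2 ^ (r (j + n) - n)) w)
      \<longlonglongrightarrow> X \<omega> (dyad T n k) (dyad T n (Suc k)) w"
     using LIMSEQ_ignore_initial_segment[OF lim, of n] by simp
    then have "(\<lambda>j. ((2 ^ n / T) powr H) ^ length w * gridsig (r (j + n)) \<omega> (k * 2 ^ (r (j + n) - n)) (2 ^ (r (j + n) - n)) w)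
      \<longlonglongrightarrow> ((2 ^ n / T) powr H) ^ length w * X \<omega> (dyad T n k) (dyad T n (Suc k)) w"
     by (intro tendsto_mult tendsto_const)
    moreover have "((2 ^ n / T) powr H) ^ length w * gridsig (r (j + n)) \<omega> (k * 2 ^ (r (j + n) - n)) (2 ^ (r (j + n) - n)) w
      = unitpoly (r (j + n) - n) w k (\<lambda>p. \<xi> (r (j + n)) (fst p) (snd p) \<omega>)" for j
    proof -
     have "(2 ^ n / T) powr H * (T / 2 ^ r (j + n)) powr H = (1 / 2 ^ (r (j + n) - n)) powr H"
      using T rn[of n j] by (simp add: powr_mult[symmetric] power_diff)
     then show ?thesis
      unfolding gridsig_eq unitpoly_def noisesig_def
      by (simp add: mult.assoc[symmetric] power_mult_distrib[symmetric])
    qed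
    ultimately show ?thesis by simp
   qed
   then show "(\<lambda>j. A n (r (j + n)) \<omega>) \<longlonglongrightarrow> average e w n \<omega>"
    unfolding A_def average_def by (intro tendsto_intros) auto
  qed
 qed
 have avm: "average e w n \<in> borel_measurable M" for n
 proof -
  have "(\<lambda>\<omega>. X \<omega> (dyad T n k) (dyad T n (Suc k)) w) \<in> borel_measurable M" if "k \<in> {..<2 ^ n}" for k
   using X_measurable[of k "Suc k" n w] that w by simp
  then show ?thesis unfolding average_def
   by (intro borel_measurable_divide borel_measurable_sum borel_measurable_power borel_measurable_times
     borel_measurable_const)
 qed
 have "(\<integral>\<^sup>+\<omega>. ennreal (p (average e w n \<omega>)) \<partial>M) \<le> ennreal (\<delta> n)" for n
 proof -
  have "(\<integral>\<^sup>+\<omega>. ennreal (p (average e w n \<omega>)) \<partial>M) = (\<integral>\<^sup>+\<omega>. liminf (\<lambda>j. ennreal (p (A n (r (j + n)) \<omega>))) \<partial>M)"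
  proof (rule nn_integral_cong_AE)
   show "AE \<omega> in M. ennreal (p (average e w n \<omega>)) = liminf (\<lambda>j. ennreal (p (A n (r (j + n)) \<omega>)))"
    using lim
   proof eventually_elim
    case (elim \<omega>)
    have "(\<lambda>j. p (A n (r (j + n)) \<omega>)) \<longlonglongrightarrow> p (average e w n \<omega>)"
     using elim by (intro continuous_on_tendsto_compose[OF pc]) auto
    then have "(\<lambda>j. ennreal (p (A n (r (j + n)) \<omega>))) \<longlonglongrightarrow> ennreal (p (average e w n \<omega>))"
     by (rule tendsto_ennrealI)
    then show ?case by (rule lim_imp_Liminf[OF trivial_limit_sequentially, symmetric])
   qed
  qed
  also have "\<dots> \<le> liminf (\<lambda>j. \<integral>\<^sup>+\<omega>. ennreal (p (A n (r (j + n)) \<omega>)) \<partial>M)"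
   using Am[OF rn] by (intro nn_integral_liminf) measurable
  also have "\<dots> \<le> liminf (\<lambda>j. ennreal (\<delta> n))"
   by (intro Liminf_mono always_eventually allI Avar rn)
  also have "\<dots> = ennreal (\<delta> n)" by (simp add: Liminf_const)
  finally show ?thesis .
 qed
 moreover have "\<delta> n \<ge> 0" for n using C2(1) C3(1) by (simp add: \<delta>_def)
 moreover have "summable \<delta>" unfolding \<delta>_def by (rule summable_linear_over_pow2)
 moreover have "(\<lambda>\<omega>. p (average e w n \<omega>)) \<in> borel_measurable M" for n using avm[of n] by measurable
 ultimately have "AE \<omega> in M. summable (\<lambda>n. p (average e w n \<omega>))"
  using p0 by (intro AE_summable_of_nn_integral[of "\<lambda>n \<omega>. p (average e w n \<omega>)" M \<delta>]) auto
 then show ?thesis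
 proof eventually_elim
  case (elim \<omega>)
  show ?case
  proof (intro exI allI)
   fix n
   have "p (average e w n \<omega>) \<le> (\<Sum>n. p (average e w n \<omega>))"
    using sum_le_suminf[OF elim, of "{n}"] p0 by simp
   moreover have "max 0 x \<le> 1 + (max 0 x)^2" for x :: real
    using zero_le_power2[of "max 0 x - 1"] zero_le_power2[of "max 0 x"]
    unfolding power2_eq_square by (simp add: algebra_simps)
   then have "average e w n \<omega> - C1 \<le> 1 + p (average e w n \<omega>)"
    unfolding p_def by (metis max.cobounded2 order.trans)
   ultimately show "average e w n \<omega> \<le> C1 + 1 + (\<Sum>n. p (average e w n \<omega>))" by linarith
  qed
 qed
qed

text \<open>At level one the increments are the noise itself, with no limit in the mesh. Their means
  are exactly the normal moments, so the variance bound gives convergence and not only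
  boundedness.\<close>

theorem averages_limit_AE:
 "AE \<omega> in M. (\<lambda>n. average e [i] n \<omega>) \<longlonglongrightarrow> gauss_moment (2 * e) 1"
proof -
 define a where "a = gauss_moment (2 * e) 1"
 define V where "V = gauss_moment (2 * (2 * e)) 1"
 obtain C3 where C3: "C3 > 0" "\<forall>R n (Z :: nat \<times> 'n \<Rightarrow> 'a \<Rightarrow> real) f V a. R > 0 \<longrightarrow>
   gaussian_family M ({..<2 ^ n * R} \<times> UNIV) Z (noise_cov H) \<longrightarrow>
   (\<forall>k<2 ^ n. poly_fun (block R k) (2 * e) (f k) \<and> expectation (\<lambda>\<omega>. (f k (\<lambda>i. Z i \<omega>))^2) \<le> V \<and>
    expectation (\<lambda>\<omega>. f k (\<lambda>i. Z i \<omega>)) = a) \<longrightarrow>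
   expectation (\<lambda>\<omega>. ((\<Sum>k<2 ^ n. f k (\<lambda>i. Z i \<omega>)) / 2 ^ n - a)^2) \<le> C3 * V * (real n + 3) / 2 ^ n"
  using noise_average_variance[OF H, of "2 * e", where 'n = 'n]
  by (elim exE conjE) (rule that, assumption+)
 define A where "A n \<omega> = (\<Sum>k<2 ^ n. \<xi> n k i \<omega> ^ (2 * e)) / 2 ^ n" for n \<omega>
 define \<delta> where "\<delta> n = C3 * V * (real n + 3) / 2 ^ n" for n
 have mom: "gaussian_moments M 1 (\<xi> n k i)" if "k < 2 ^ n" for n k
 proof -
  have "gaussian_family M {(k, i)} (\<lambda>p \<omega>. \<xi> n (fst p) (snd p) \<omega>) (noise_cov H)"
   by (rule gaussian_family_subset[OF noise[of n]]) (use that in auto)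
  from this[unfolded gaussian_family_def, THEN conjunct2, THEN spec, of "\<lambda>_. 1"]
  show ?thesis using H by (simp add: noise_cov_def)
 qed
 have Aint: "integrable M (\<lambda>\<omega>. A n \<omega> ^ j)" for n j
 proof -
  have "poly_fun ({..<2 ^ n} \<times> UNIV) (2 * e * 1)
    (\<lambda>x. (1 / 2 ^ n) * (\<Sum>k<2 ^ n. x (k, i) ^ (2 * e)))"
   by (intro poly_fun_cmult poly_fun_sum poly_fun_power poly_fun_var) auto
  from gaussian_family_integrable[OF noise poly_fun_power[OF this]] show ?thesis
   by (simp add: A_def)
 qed
 have var: "(\<integral>\<^sup>+\<omega>. ennreal ((A n \<omega> - a)^2) \<partial>M) \<le> ennreal (\<delta> n)" for n
 proof -
  have "expectation (\<lambda>\<omega>. (A n \<omega> - a)^2) \<le> \<delta> n"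
   unfolding A_def \<delta>_def
  proof (rule C3(2)[rule_format, of 1 n "\<lambda>p \<omega>. \<xi> n (fst p) (snd p) \<omega>" "\<lambda>k x. x (k, i) ^ (2 * e)" V a, simplified fst_conv snd_conv])
   show "gaussian_family M ({..<2 ^ n * 1} \<times> UNIV) (\<lambda>p \<omega>. \<xi> n (fst p) (snd p) \<omega>) (noise_cov H)"
    using noise[of n] by simp
   fix k :: nat assume k: "k < 2 ^ n"
   have sq: "(x ^ (2 * e))^2 = x ^ (2 * (2 * e))" for x :: real by (simp add: power_mult[symmetric] mult_ac)
   have "poly_fun (block 1 k) (2 * e * 1) (\<lambda>x. x (k, i) ^ (2 * e))"
    by (intro poly_fun_power poly_fun_var) (auto simp: block_def)
   then show "poly_fun (block 1 k) (2 * e) (\<lambda>x. x (k, i) ^ (2 * e)) \<and>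
     expectation (\<lambda>\<omega>. (\<xi> n k i \<omega> ^ (2 * e))^2) \<le> V \<and>
     expectation (\<lambda>\<omega>. \<xi> n k i \<omega> ^ (2 * e)) = a"
    unfolding sq a_def V_def using mom[OF k] by (simp add: gaussian_moments_def)
  qed simp
  moreover have "integrable M (\<lambda>\<omega>. (A n \<omega> - a)^2)"
   using Aint[of n 1] Aint[of n 2] by (simp add: power2_diff)
  ultimately show ?thesis
   by (subst nn_integral_eq_integral) (auto intro: ennreal_leI)
 qed
 have Am: "A n \<in> borel_measurable M" for n using Aint[of n 1] by simp
 have "\<delta> n \<ge> 0" for n using C3(1) by (simp add: \<delta>_def V_def gauss_moment_nonneg)
 moreover have "summable \<delta>" unfolding \<delta>_def by (rule summable_linear_over_pow2)
 moreover have "(\<lambda>\<omega>. (A n \<omega> - a)^2) \<in> borel_measurable M" for n using Am[of n] by measurable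
 ultimately have "AE \<omega> in M. summable (\<lambda>n. (A n \<omega> - a)^2)"
  using var by (intro AE_summable_of_nn_integral[of "\<lambda>n \<omega>. (A n \<omega> - a)^2" M \<delta>]) auto
 then show ?thesis using X_level1
 proof eventually_elim
  case (elim \<omega>)
  have "average e [i] n \<omega> = A n \<omega>" for n
  proof -
   have "(2 ^ n / T) powr H * (T / 2 ^ n) powr H = 1"
    using T by (simp add: powr_mult[symmetric])
   then show ?thesis
    unfolding average_def A_def using elim(2) by (simp add: mult.assoc[symmetric])
  qed
  moreover have "(\<lambda>n. (A n \<omega> - a)^2) \<longlonglongrightarrow> 0" by (rule summable_LIMSEQ_zero[OF elim(1)])
  then have "(\<lambda>n. sqrt ((A n \<omega> - a)^2)) \<longlonglongrightarrow> sqrt 0" by (rule tendsto_real_sqrt)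
  then have "(\<lambda>n. A n \<omega> - a) \<longlonglongrightarrow> 0" by (simp add: tendsto_rabs_zero_iff)
  then have "(\<lambda>n. A n \<omega>) \<longlonglongrightarrow> a" by (simp add: LIM_zero_iff)
  ultimately show ?case by (simp add: a_def)
 qed
qed

end

subsection \<open>Besov regularity from dyadic averages\<close>

lemma finite_words [simp]: "finite {w :: 'n::finite list. length w = k}"
 using finite_lists_length_eq[of "UNIV :: 'n set" k] by simp

text \<open>The \<open>l^1\<close> counterpart of \<open>level_norm\<close>. It splits exactly over
  prefixes and suffixes of words, which suits Chen's relation.\<close>

definition word_sum :: "nat \<Rightarrow> ('n::finite) tensors \<Rightarrow> real" where
 "word_sum k a = (\<Sum>w | length w = k. \<bar>a w\<bar>)"

lemma word_sum_nonneg: "word_sum k a \<ge> 0"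
 by (simp add: word_sum_def sum_nonneg)

lemma level_norm_le_word_sum: "level_norm k a \<le> word_sum k a"
 using L2_set_le_sum_abs[of a "{w. length w = k}"] by (simp add: level_norm_def word_sum_def L2_set_def)

lemma abs_le_level_norm: "\<bar>a w\<bar> \<le> level_norm (length w) (a :: 'n::finite tensors)"
proof -
 have "(a w)^2 \<le> (\<Sum>v | length v = length w. (a v)^2)"
  by (rule member_le_sum[of w]) auto
 then have "sqrt ((a w)^2) \<le> level_norm (length w) a"
  unfolding level_norm_def by (rule real_sqrt_le_mono)
 then show ?thesis by simp
qed

text \<open>A word of length \<open>k\<close> is the same as a prefix of length \<open>j\<close>
  followed by a suffix of length \<open>k - j\<close>, so the double sums factor.\<close>

lemma word_sum_tensor_prod:
 fixes a b :: "'n::finite tensors"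
 shows "word_sum k (tensor_prod a b) \<le> (\<Sum>j\<le>k. word_sum j a * word_sum (k - j) b)"
proof -
 have "word_sum k (tensor_prod a b) \<le> (\<Sum>w | length w = k. \<Sum>j\<le>k. \<bar>a (take j w)\<bar> * \<bar>b (drop j w)\<bar>)"
  unfolding word_sum_def tensor_prod_def
  by (intro sum_mono) (auto simp: abs_mult[symmetric] intro: sum_abs)
 also have "\<dots> = (\<Sum>j\<le>k. \<Sum>w | length w = k. \<bar>a (take j w)\<bar> * \<bar>b (drop j w)\<bar>)"
  by (rule sum.swap)
 also have "\<dots> = (\<Sum>j\<le>k. word_sum j a * word_sum (k - j) b)"
 proof (rule sum.cong[OF refl])
  fix j assume "j \<in> {..k}"
  then have j: "j \<le> k" by simp
  have "(\<Sum>w | length w = k. \<bar>a (take j w)\<bar> * \<bar>b (drop j w)\<bar>)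
    = (\<Sum>(u, v)\<in>{u. length u = j} \<times> {v. length v = k - j}. \<bar>a u\<bar> * \<bar>b v\<bar>)"
   by (rule sum.reindex_bij_witness[of _ "\<lambda>(u, v). u @ v" "\<lambda>w. (take j w, drop j w)"]) (use j in auto)
  also have "\<dots> = word_sum j a * word_sum (k - j) b"
   unfolding word_sum_def sum_product sum.cartesian_product by simp
  finally show "(\<Sum>w | length w = k. \<bar>a (take j w)\<bar> * \<bar>b (drop j w)\<bar>) = word_sum j a * word_sum (k - j) b" .
 qed
 finally show ?thesis .
qed

lemma sum_power_le:
 fixes x :: "'b \<Rightarrow> real"
 assumes "finite A" "\<And>i. i \<in> A \<Longrightarrow> x i \<ge> 0" "m > 0"
 shows "(\<Sum>i\<in>A. x i) ^ m \<le> real (card A) ^ m * (\<Sum>i\<in>A. x i ^ m)"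
proof (cases "A = {}")
 case True
 then show ?thesis using assms by (simp add: power_0_left)
next
 case False
 define y where "y = Max (x ` A)"
 have "y \<in> x ` A" unfolding y_def using False assms(1) by (intro Max_in) auto
 then obtain i where i: "i \<in> A" "x i = y" by auto
 have "(\<Sum>i\<in>A. x i) \<le> real (card A) * y"
  by (rule sum_bounded_above) (use assms(1) in \<open>auto simp: y_def\<close>)
 then have "(\<Sum>i\<in>A. x i) ^ m \<le> (real (card A) * y) ^ m"
  using assms by (intro power_mono sum_nonneg) auto
 also have "\<dots> = real (card A) ^ m * x i ^ m" by (simp add: power_mult_distrib i)
 also have "\<dots> \<le> real (card A) ^ m * (\<Sum>i\<in>A. x i ^ m)"
  using assms i by (intro mult_left_mono member_le_sum) auto
 finally show ?thesis .
qed

definition dyadic_average :: "real \<Rightarrow> real \<Rightarrow> 'n two_param \<Rightarrow> nat \<Rightarrow> 'n list \<Rightarrow> nat \<Rightarrow> real" where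
 "dyadic_average T H Y e w n = (\<Sum>k<2 ^ n.
   (((2 ^ n / T) powr H) ^ length w * Y (dyad T n k) (dyad T n (Suc k)) w) ^ (2 * e)) / 2 ^ n"

text \<open>The purely pathwise part. The algebra is assumed at dyadic times only, which is what
  countably many almost sure events provide; continuity extends it to all times.\<close>

locale besov_lift =
 fixes T H :: real and N :: nat and X :: "'n::finite two_param"
 assumes T: "0 < T" and H: "0 < H"
  and cont: "\<And>w. length w \<le> N \<Longrightarrow> continuous_on (simplex2 T) (\<lambda>(s, t). X s t w)"
  and nil: "\<And>n a b. a \<le> b \<Longrightarrow> b \<le> 2 ^ n \<Longrightarrow> X (dyad T n a) (dyad T n b) [] = 1"
  and chen: "\<And>n a b d w. a \<le> b \<Longrightarrow> b \<le> d \<Longrightarrow> d \<le> 2 ^ n \<Longrightarrow> length w \<le> N \<Longrightarrow>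
   tensor_prod (X (dyad T n a) (dyad T n b)) (X (dyad T n b) (dyad T n d)) w
    = X (dyad T n a) (dyad T n d) w"
begin

definition dfloor :: "nat \<Rightarrow> real \<Rightarrow> nat" where
 "dfloor n t = nat \<lfloor>t * 2 ^ n / T\<rfloor>"

definition dceil :: "nat \<Rightarrow> real \<Rightarrow> nat" where
 "dceil n t = nat \<lceil>t * 2 ^ n / T\<rceil>"

lemma dfloor_bounds:
 assumes "0 \<le> t"
 shows "dyad T n (dfloor n t) \<le> t" "t < dyad T n (Suc (dfloor n t))"
proof -
 have "real (dfloor n t) = of_int \<lfloor>t * 2 ^ n / T\<rfloor>" using assms T by (simp add: dfloor_def)
 then have "real (dfloor n t) \<le> t * 2 ^ n / T" "t * 2 ^ n / T < real (dfloor n t) + 1"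
  by linarith+
 then show "dyad T n (dfloor n t) \<le> t" "t < dyad T n (Suc (dfloor n t))"
  using T by (simp_all add: field_simps)
qed

lemma dceil_bounds:
 assumes "0 \<le> t"
 shows "t \<le> dyad T n (dceil n t)" "T * (real (dceil n t) - 1) / 2 ^ n < t"
proof -
 have "0 \<le> \<lceil>t * 2 ^ n / T\<rceil>" using assms T by (simp add: order.strict_trans2[of _ 0])
 then have "real (dceil n t) = of_int \<lceil>t * 2 ^ n / T\<rceil>" by (simp add: dceil_def)
 then have "t * 2 ^ n / T \<le> real (dceil n t)" "real (dceil n t) - 1 < t * 2 ^ n / T"
  by linarith+
 then show "t \<le> dyad T n (dceil n t)" "T * (real (dceil n t) - 1) / 2 ^ n < t"
  using T by (simp_all add: field_simps)
qed

lemma dfloor_mono: "s \<le> t \<Longrightarrow> dfloor n s \<le> dfloor n t"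
 unfolding dfloor_def using T by (intro nat_mono floor_mono divide_right_mono mult_right_mono) auto

lemma dfloor_le: "t \<le> T \<Longrightarrow> dfloor n t \<le> 2 ^ n"
proof -
 assume "t \<le> T"
 then have "dfloor n t \<le> dfloor n T" by (rule dfloor_mono)
 also have "dfloor n T = 2 ^ n" using T by (simp add: dfloor_def nat_power_eq)
 finally show ?thesis .
qed

lemma dceil_le: "t \<le> T \<Longrightarrow> dceil n t \<le> 2 ^ n"
proof -
 assume "t \<le> T"
 then have "t * 2 ^ n / T \<le> real (2 ^ n)" using T by (simp add: field_simps)
 then have "\<lceil>t * 2 ^ n / T\<rceil> \<le> 2 ^ n" by (simp add: ceiling_le_iff)
 then show ?thesis unfolding dceil_def by (simp add: nat_le_iff)
qed

lemma mesh_tendsto: "(\<lambda>n. T / 2 ^ n) \<longlonglongrightarrow> 0"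
proof -
 have "(\<lambda>n. T * (1 / 2) ^ n) \<longlonglongrightarrow> T * 0" by (intro tendsto_intros LIMSEQ_power_zero) simp
 then show ?thesis by (simp add: power_one_over divide_simps)
qed

lemma dfloor_tendsto: "0 \<le> t \<Longrightarrow> (\<lambda>n. dyad T n (dfloor n t)) \<longlonglongrightarrow> t"
proof (rule real_tendsto_sandwich[of "\<lambda>n. t - T / 2 ^ n" _ _ "\<lambda>_. t"])
 assume t: "0 \<le> t"
 show "\<forall>\<^sub>F n in sequentially. t - T / 2 ^ n \<le> dyad T n (dfloor n t)"
  using dfloor_bounds(2)[OF t] by (intro always_eventually allI) (simp add: distrib_left add_divide_distrib less_imp_le algebra_simps)
 show "\<forall>\<^sub>F n in sequentially. dyad T n (dfloor n t) \<le> t"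
  using dfloor_bounds(1)[OF t] by (intro always_eventually allI)
 show "(\<lambda>n. t - T / 2 ^ n) \<longlonglongrightarrow> t" using tendsto_diff[OF tendsto_const[of t] mesh_tendsto] by simp
qed simp

lemma dceil_tendsto: "0 \<le> t \<Longrightarrow> (\<lambda>n. dyad T n (dceil n t)) \<longlonglongrightarrow> t"
proof (rule real_tendsto_sandwich[of "\<lambda>n. t" _ _ "\<lambda>n. t + T / 2 ^ n"])
 assume t: "0 \<le> t"
 show "\<forall>\<^sub>F n in sequentially. dyad T n (dceil n t) \<le> t + T / 2 ^ n"
  using dceil_bounds(2)[OF t] by (intro always_eventually allI) (simp add: right_diff_distrib diff_divide_distrib less_imp_le algebra_simps)
 show "\<forall>\<^sub>F n in sequentially. t \<le> dyad T n (dceil n t)"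
  using dceil_bounds(1)[OF t] by (intro always_eventually allI)
 show "(\<lambda>n. t + T / 2 ^ n) \<longlonglongrightarrow> t" using tendsto_add[OF tendsto_const[of t] mesh_tendsto] by simp
qed simp

lemma grid_in: "a \<le> b \<Longrightarrow> b \<le> 2 ^ n \<Longrightarrow> (dyad T n a, dyad T n b) \<in> simplex2 T"
 using T of_nat_mono[of b "2 ^ n", where 'a=real] by (auto simp: simplex2_def divide_right_mono field_simps)

lemma X_tendsto:
 assumes "length w \<le> N" "\<And>n. (f n, g n) \<in> simplex2 T" "f \<longlonglongrightarrow> s" "g \<longlonglongrightarrow> t" "(s, t) \<in> simplex2 T"
 shows "(\<lambda>n. X (f n) (g n) w) \<longlonglongrightarrow> X s t w"
proof -
 have "(\<lambda>n. (\<lambda>(s, t). X s t w) (f n, g n)) \<longlonglongrightarrow> (\<lambda>(s, t). X s t w) (s, t)"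
  by (rule continuous_on_tendsto_compose[OF cont[OF assms(1)]])
   (use assms in \<open>auto intro: tendsto_Pair\<close>)
 then show ?thesis by simp
qed

lemma X_nil: "(s, t) \<in> simplex2 T \<Longrightarrow> X s t [] = 1"
proof -
 assume st: "(s, t) \<in> simplex2 T"
 have "(\<lambda>n. X (dyad T n (dfloor n s)) (dyad T n (dfloor n t)) []) \<longlonglongrightarrow> X s t []"
  using st by (intro X_tendsto grid_in dfloor_tendsto dfloor_mono dfloor_le) (auto simp: simplex2_def)
 moreover have "X (dyad T n (dfloor n s)) (dyad T n (dfloor n t)) [] = 1" for n
  using st by (intro nil dfloor_mono dfloor_le) (auto simp: simplex2_def)
 ultimately show ?thesis by (simp add: LIMSEQ_const_iff)
qed

text \<open>Lower dyadic approximations preserve the order of \<open>s\<close>, \<open>t\<close> and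
  \<open>u\<close>, so the dyadic relation applies to them and continuity gives the limit.\<close>

lemma X_chen:
 assumes "0 \<le> s" "s \<le> t" "t \<le> u" "u \<le> T" "length w \<le> N"
 shows "tensor_prod (X s t) (X t u) w = X s u w"
proof -
 let ?d = "\<lambda>x n. dyad T n (dfloor n x)"
 have lim: "(\<lambda>n. X (?d x n) (?d y n) v) \<longlonglongrightarrow> X x y v" if "0 \<le> x" "x \<le> y" "y \<le> T" "length v \<le> N" for x y v
  using that by (intro X_tendsto grid_in dfloor_tendsto dfloor_mono dfloor_le) (auto simp: simplex2_def)
 have "(\<lambda>n. tensor_prod (X (?d s n) (?d t n)) (X (?d t n) (?d u n)) w) \<longlonglongrightarrow> tensor_prod (X s t) (X t u) w"
  unfolding tensor_prod_def using assms by (intro tendsto_intros lim) auto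
 moreover have "tensor_prod (X (?d s n) (?d t n)) (X (?d t n) (?d u n)) w = X (?d s n) (?d u n) w" for n
  using assms by (intro chen dfloor_mono dfloor_le)
 moreover have "(\<lambda>n. X (?d s n) (?d u n) w) \<longlonglongrightarrow> X s u w" using assms by (intro lim) auto
 ultimately show ?thesis using LIMSEQ_unique by fastforce
qed

text \<open>Chen's relation at \<open>t, t, t\<close>: by induction the inner terms vanish, and
  \<open>x = 2 * x\<close> remains.\<close>

lemma X_diag:
 assumes "0 \<le> t" "t \<le> T" "length w \<le> N" "w \<noteq> []"
 shows "X t t w = 0"
 using assms(3,4)
proof (induction w rule: length_induct)
 case (1 w)
 have n: "X t t [] = 1" using assms by (intro X_nil) (auto simp: simplex2_def)
 have "X t t w = (\<Sum>j\<le>length w. X t t (take j w) * X t t (drop j w))"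
  using X_chen[of t t t w] assms 1 by (simp add: tensor_prod_def)
 also have "\<dots> = (\<Sum>j\<in>{0, length w}. X t t (take j w) * X t t (drop j w))"
 proof (intro sum.mono_neutral_right ballI)
  fix j assume "j \<in> {..length w} - {0, length w}"
  then have "0 < j" "j < length w" by auto
  then have "X t t (take j w) = 0" using 1 by (intro 1(1)[rule_format]) auto
  then show "X t t (take j w) * X t t (drop j w) = 0" by simp
 qed auto
 also have "\<dots> = 2 * X t t w" using 1(3) n by simp
 finally show ?case by simp
qed

lemma X_rough_path: "rough_path N T X"
 unfolding rough_path_def
proof (intro conjI allI impI)
 show "\<forall>(s, t)\<in>simplex2 T. X s t [] = 1" using X_nil by auto
 fix w :: "'n list" assume "length w \<le> N"
 then show "(\<lambda>(s, t). X s t w) \<in> borel_measurable (restrict_space borel (simplex2 T))"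
  by (intro borel_measurable_continuous_on_restrict cont)
next
 fix s t u :: real and w :: "'n list"
 assume "0 \<le> s \<and> s \<le> t \<and> t \<le> u \<and> u \<le> T \<and> length w \<le> N"
 then show "tensor_prod (X s t) (X t u) w = X s u w" by (intro X_chen) auto
qed

definition domin :: "real \<Rightarrow> real \<Rightarrow> real \<Rightarrow> bool" where
 "domin r s t \<longleftrightarrow> r \<ge> 0 \<and> (\<forall>k\<in>{1..N}. fact k * word_sum k (X s t) \<le> r ^ k)"

text \<open>
 The smallest \<open>r\<close> with \<open>domin r s t\<close> is the homogeneous norm \<open>max\<^sub>k (k! |X\<^sup>k|)\<^bsup>1/k\<^esup>\<close>;
 the factorials make it subadditive by the binomial theorem.
\<close>

lemma domin_add:
 assumes "domin r s t" "domin r' t u" "0 \<le> s" "s \<le> t" "t \<le> u" "u \<le> T"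
 shows "domin (r + r') s u"
proof -
 have st: "(s, t) \<in> simplex2 T" "(t, u) \<in> simplex2 T" using assms by (auto simp: simplex2_def)
 have r0: "r \<ge> 0" "r' \<ge> 0" using assms by (auto simp: domin_def)
 have w0: "word_sum 0 a = \<bar>a []\<bar>" for a :: "'n tensors" by (simp add: word_sum_def)
 have b1: "word_sum j (X s t) \<le> r ^ j / fact j" and b2: "word_sum j (X t u) \<le> r' ^ j / fact j" if "j \<le> N" for j
  using assms(1,2) that X_nil[OF st(1)] X_nil[OF st(2)]
  by (cases "j = 0"; force simp: domin_def w0 field_simps)+
 have "fact k * word_sum k (X s u) \<le> (r + r') ^ k" if k: "k \<in> {1..N}" for k
 proof -
  have "word_sum k (X s u) = word_sum k (tensor_prod (X s t) (X t u))"
   unfolding word_sum_def using X_chen[OF assms(3-6)] k by (intro sum.cong) auto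
  also have "\<dots> \<le> (\<Sum>j\<le>k. word_sum j (X s t) * word_sum (k - j) (X t u))" by (rule word_sum_tensor_prod)
  also have "\<dots> \<le> (\<Sum>j\<le>k. (r ^ j / fact j) * (r' ^ (k - j) / fact (k - j)))"
   using k r0 by (intro sum_mono mult_mono b1 b2 word_sum_nonneg) auto
  finally have "fact k * word_sum k (X s u) \<le> fact k * (\<Sum>j\<le>k. (r ^ j / fact j) * (r' ^ (k - j) / fact (k - j)))"
   by (intro mult_left_mono) auto
  also have "\<dots> = (\<Sum>j\<le>k. of_nat (k choose j) * r ^ j * r' ^ (k - j))"
   unfolding sum_distrib_left by (intro sum.cong refl) (simp add: binomial_fact)
  also have "\<dots> = (r + r') ^ k" by (simp add: binomial_ring)
  finally show ?thesis .
 qed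
 then show ?thesis using r0 by (simp add: domin_def)
qed

lemma domin_diag: "0 \<le> t \<Longrightarrow> t \<le> T \<Longrightarrow> domin 0 t t"
proof -
 assume t: "0 \<le> t" "t \<le> T"
 have "word_sum k (X t t) = 0" if "k \<in> {1..N}" for k
  unfolding word_sum_def
 proof (intro sum.neutral ballI)
  fix w :: "'n list" assume "w \<in> {w. length w = k}"
  then have "length w \<le> N" "w \<noteq> []" using that by auto
  then show "\<bar>X t t w\<bar> = 0" using X_diag[OF t] by simp
 qed
 then show ?thesis by (simp add: domin_def)
qed

text \<open>A size that dominates one dyadic increment. Summing the roots over the levels, instead
  of taking their maximum, keeps its powers easy to average.\<close>

definition cell :: "nat \<Rightarrow> nat \<Rightarrow> real" where
 "cell n k = (\<Sum>j\<in>{1..N}. root j (fact j * word_sum j (X (dyad T n k) (dyad T n (Suc k)))))"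

lemma cell_nonneg: "cell n k \<ge> 0"
 unfolding cell_def by (intro sum_nonneg real_root_ge_zero mult_nonneg_nonneg word_sum_nonneg) auto

lemma domin_cell: "domin (cell n k) (dyad T n k) (dyad T n (Suc k))"
 unfolding domin_def
proof (intro conjI ballI cell_nonneg)
 fix j assume j: "j \<in> {1..N}"
 let ?x = "\<lambda>j. fact j * word_sum j (X (dyad T n k) (dyad T n (Suc k)))"
 have x0: "?x j \<ge> 0" for j by (intro mult_nonneg_nonneg word_sum_nonneg) auto
 have "root j (?x j) \<le> cell n k"
  unfolding cell_def using j x0 by (intro member_le_sum[of j "{1..N}" "\<lambda>j. root j (?x j)"] real_root_ge_zero) auto
 then have "root j (?x j) ^ j \<le> cell n k ^ j" using x0 by (intro power_mono real_root_ge_zero) auto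
 then show "?x j \<le> cell n k ^ j" using j x0 by (simp add: real_root_pow_pos2)
qed

text \<open>\<open>P\<close> is a multiple of \<open>2 * j\<close> for every level \<open>j\<close>,
  so the \<open>P\<close>-th power of a \<open>j\<close>-th root is an even integral power of that
  level, and these are the powers in the dyadic averages.\<close>

lemma cell_average:
 assumes avg: "\<And>w e. 1 \<le> length w \<Longrightarrow> length w \<le> N \<Longrightarrow> \<exists>C. \<forall>n. dyadic_average T H X e w n \<le> C"
  and P: "\<And>j. j \<in> {1..N} \<Longrightarrow> \<exists>e>0. P = j * (2 * e)" and P0: "P > 0"
 shows "\<exists>B\<ge>0. \<forall>n. (\<Sum>k<2 ^ n. cell n k ^ P) \<le> B * 2 ^ n * ((T / 2 ^ n) powr H) ^ P"
proof -
 define W where "W j = {w :: 'n list. length w = j}" for j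
 define e where "e j = P div j div 2" for j
 have e: "P = j * (2 * e j)" "e j > 0" if "j \<in> {1..N}" for j using P[OF that] that by (auto simp: e_def)
 have "\<exists>C. \<forall>w\<in>(\<Union>j\<in>{1..N}. W j). \<forall>n. dyadic_average T H X (e (length w)) w n \<le> C w"
  using avg by (intro bchoice) (auto simp: W_def)
 then obtain C where "\<forall>w\<in>(\<Union>j\<in>{1..N}. W j). \<forall>n. dyadic_average T H X (e (length w)) w n \<le> C w"
  by blast
 then have C: "dyadic_average T H X (e (length w)) w n \<le> C w" if "1 \<le> length w" "length w \<le> N" for w n
  using that by (auto simp: W_def)
 define Q where "Q j = real (card (W j)) ^ (2 * e j) * fact j ^ (2 * e j)" for j
 have Q0: "Q j \<ge> 0" for j by (simp add: Q_def)
 define B where "B = real N ^ P * (\<Sum>j\<in>{1..N}. Q j * (\<Sum>w\<in>W j. max 0 (C w)))"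
 have fW: "finite (W j)" for j by (simp add: W_def)
 show ?thesis
 proof (intro exI[of _ B] conjI allI)
  show "B \<ge> 0" unfolding B_def by (intro mult_nonneg_nonneg sum_nonneg Q0) auto
  fix n :: nat
  define Y where "Y k = X (dyad T n k) (dyad T n (Suc k))" for k
  define \<sigma> where "\<sigma> = (T / 2 ^ n) powr H"
  have \<sigma>: "\<sigma> > 0" "(2 ^ n / T) powr H = 1 / \<sigma>"
   using T by (auto simp: \<sigma>_def powr_divide)
  have pt: "cell n k ^ P \<le> real N ^ P * (\<Sum>j\<in>{1..N}. Q j * (\<Sum>w\<in>W j. Y k w ^ (2 * e j)))" for k
  proof -
   have x0: "fact j * word_sum j (Y k) \<ge> 0" for j by (intro mult_nonneg_nonneg word_sum_nonneg) auto
   have "cell n k ^ P = (\<Sum>j\<in>{1..N}. root j (fact j * word_sum j (Y k))) ^ P"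
    by (simp add: cell_def Y_def)
   also have "\<dots> \<le> real (card {1..N}) ^ P * (\<Sum>j\<in>{1..N}. root j (fact j * word_sum j (Y k)) ^ P)"
    using P0 x0 by (intro sum_power_le real_root_ge_zero) auto
   also have "\<dots> \<le> real N ^ P * (\<Sum>j\<in>{1..N}. Q j * (\<Sum>w\<in>W j. Y k w ^ (2 * e j)))"
   proof (simp only: card_atLeastAtMost diff_Suc_1, intro mult_left_mono sum_mono)
    fix j assume j: "j \<in> {1..N}"
    have "root j (fact j * word_sum j (Y k)) ^ P = (root j (fact j * word_sum j (Y k)) ^ j) ^ (2 * e j)"
     unfolding power_mult[symmetric] using e[OF j] by simp
    also have "\<dots> = (fact j * word_sum j (Y k)) ^ (2 * e j)"
     using j x0 by (simp add: real_root_pow_pos2)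
    also have "\<dots> = fact j ^ (2 * e j) * (\<Sum>w\<in>W j. \<bar>Y k w\<bar>) ^ (2 * e j)"
     by (simp add: power_mult_distrib word_sum_def W_def)
    also have "\<dots> \<le> fact j ^ (2 * e j) * (real (card (W j)) ^ (2 * e j) * (\<Sum>w\<in>W j. \<bar>Y k w\<bar> ^ (2 * e j)))"
     using e(2)[OF j] by (intro mult_left_mono sum_power_le fW) auto
    also have "\<dots> = Q j * (\<Sum>w\<in>W j. Y k w ^ (2 * e j))"
     by (simp add: Q_def power_even_abs)
    finally show "root j (fact j * word_sum j (Y k)) ^ P \<le> Q j * (\<Sum>w\<in>W j. Y k w ^ (2 * e j))" .
   qed simp
   finally show ?thesis .
  qed
  have av: "(\<Sum>k<2 ^ n. Y k w ^ (2 * e j)) \<le> max 0 (C w) * 2 ^ n * \<sigma> ^ P" if j: "j \<in> {1..N}" and w: "w \<in> W j" for j w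
  proof -
   have lw: "length w = j" using w by (simp add: W_def)
   have *: "dyadic_average T H X (e j) w n = (\<Sum>k<2 ^ n. (1 / \<sigma>) ^ P * Y k w ^ (2 * e j)) / 2 ^ n"
    unfolding dyadic_average_def \<sigma>(2) lw Y_def using e(1)[OF j]
    by (simp add: power_mult_distrib power_mult[symmetric])
   have "(\<Sum>k<2 ^ n. Y k w ^ (2 * e j)) = dyadic_average T H X (e j) w n * 2 ^ n * \<sigma> ^ P"
   proof -
    have "dyadic_average T H X (e j) w n = (\<Sum>k<2 ^ n. Y k w ^ (2 * e j)) / \<sigma> ^ P / 2 ^ n"
     unfolding * by (simp add: power_one_over sum_divide_distrib)
    then show ?thesis using \<sigma>(1) by (simp add: field_simps)
   qed
   also have "\<dots> \<le> max 0 (C w) * 2 ^ n * \<sigma> ^ P"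
    using C[of w n] lw j \<sigma>(1) by (intro mult_right_mono) auto
   finally show ?thesis .
  qed
  have "(\<Sum>k<2 ^ n. cell n k ^ P) \<le> (\<Sum>k<2 ^ n. real N ^ P * (\<Sum>j\<in>{1..N}. Q j * (\<Sum>w\<in>W j. Y k w ^ (2 * e j))))"
   by (intro sum_mono pt)
  also have "\<dots> = real N ^ P * (\<Sum>j\<in>{1..N}. Q j * (\<Sum>w\<in>W j. \<Sum>k<2 ^ n. Y k w ^ (2 * e j)))"
   unfolding sum_distrib_left[symmetric]
   by (subst sum.swap, simp only: sum_distrib_left[symmetric], subst (2) sum.swap, simp)
  also have "\<dots> \<le> real N ^ P * (\<Sum>j\<in>{1..N}. Q j * (\<Sum>w\<in>W j. max 0 (C w) * 2 ^ n * \<sigma> ^ P))"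
   by (intro mult_left_mono sum_mono av Q0) auto
  also have "\<dots> = B * 2 ^ n * \<sigma> ^ P"
   by (simp add: B_def sum_distrib_left sum_distrib_right mult_ac)
  finally show "(\<Sum>k<2 ^ n. cell n k ^ P) \<le> B * 2 ^ n * ((T / 2 ^ n) powr H) ^ P"
   by (simp add: \<sigma>_def)
 qed
qed

end

text \<open>A function of a step index is integrated by summing over the index;
  \<open>\<delta>\<close> bounds the length of each step.\<close>

lemma nn_integral_index_le:
 fixes \<phi> :: "real \<Rightarrow> nat" and f :: "nat \<Rightarrow> ennreal"
 assumes "\<phi> \<in> measurable borel (count_space UNIV)" "A \<in> sets borel"
  and "\<And>k. k \<ge> K \<Longrightarrow> f k = 0" "\<And>k. k < K \<Longrightarrow> emeasure lborel {t \<in> A. \<phi> t = k} \<le> \<delta>"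
 shows "(\<integral>\<^sup>+t\<in>A. f (\<phi> t) \<partial>lborel) \<le> \<delta> * (\<Sum>k<K. f k)"
proof -
 have S: "{t \<in> A. \<phi> t = k} \<in> sets lborel" for k
 proof -
  have "\<phi> -` {k} \<inter> space borel \<in> sets borel" by (rule measurable_sets[OF assms(1)]) simp
  then have "A \<inter> (\<phi> -` {k}) \<in> sets borel" using assms(2) by auto
  also have "A \<inter> (\<phi> -` {k}) = {t \<in> A. \<phi> t = k}" by auto
  finally show ?thesis by simp
 qed
 have "f (\<phi> t) * indicator A t = (\<Sum>k<K. f k * indicator {t \<in> A. \<phi> t = k} t)" for t
 proof (cases "t \<in> A \<and> \<phi> t < K")
  case True
  have "(\<Sum>k<K. f k * indicator {t \<in> A. \<phi> t = k} t) = (\<Sum>k<K. if k = \<phi> t then f (\<phi> t) else 0)"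
   using True by (intro sum.cong) (auto simp: indicator_def)
  then show ?thesis using True by simp
 next
  case False
  then have "(\<Sum>k<K. f k * indicator {t \<in> A. \<phi> t = k} t) = 0"
   by (intro sum.neutral) (auto simp: indicator_def)
  then show ?thesis using False assms(3)[of "\<phi> t"] by (auto simp: indicator_def not_less)
 qed
 then have "(\<integral>\<^sup>+t\<in>A. f (\<phi> t) \<partial>lborel) = (\<integral>\<^sup>+t. (\<Sum>k<K. f k * indicator {t \<in> A. \<phi> t = k} t) \<partial>lborel)"
  by (simp only:)
 also have "\<dots> = (\<Sum>k<K. \<integral>\<^sup>+t. f k * indicator {t \<in> A. \<phi> t = k} t \<partial>lborel)"
  by (intro nn_integral_sum borel_measurable_times_ennreal borel_measurable_const borel_measurable_indicator S)
 also have "\<dots> = (\<Sum>k<K. f k * emeasure lborel {t \<in> A. \<phi> t = k})"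
  by (intro sum.cong refl nn_integral_cmult_indicator S)
 also have "\<dots> \<le> (\<Sum>k<K. f k * \<delta>)" by (intro sum_mono mult_left_mono assms(4)) auto
 also have "\<dots> = \<delta> * (\<Sum>k<K. f k)" by (simp add: sum_distrib_left mult.commute)
 finally show ?thesis .
qed

section \<open>Chaining over dyadic scales\<close>

context besov_lift
begin

lemma domin_mono: "domin r s t \<Longrightarrow> r \<le> r' \<Longrightarrow> domin r' s t"
 unfolding domin_def by (auto intro: order.trans power_mono)

text \<open>Cells are addressed by grid points: \<open>vcell\<close> is the cell that starts at
  point \<open>k\<close>, \<open>vcell'\<close> the one that ends there. Both vanish when there is
  no such cell, so out-of-range indices contribute nothing.\<close>

definition vcell :: "nat \<Rightarrow> nat \<Rightarrow> real" where
 "vcell n k = (if k < 2 ^ n then cell n k else 0)"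

definition vcell' :: "nat \<Rightarrow> nat \<Rightarrow> real" where
 "vcell' n k = (if 1 \<le> k \<and> k \<le> 2 ^ n then cell n (k - 1) else 0)"

lemma vcell_nonneg: "vcell n k \<ge> 0" "vcell' n k \<ge> 0"
 by (simp_all add: vcell_def vcell'_def cell_nonneg)

lemma point_bounds: "k \<le> 2 ^ n \<Longrightarrow> 0 \<le> dyad T n k \<and> dyad T n k \<le> T"
 using T of_nat_mono[of k "2 ^ n", where 'a=real] by (simp add: field_simps)

lemma grid_less: "T * x / 2 ^ n < T * y / 2 ^ n \<longleftrightarrow> x < y"
 using T by (simp add: divide_less_cancel mult_less_cancel_left_pos)

lemma grid_refine: "T * x / 2 ^ n = T * (2 * x) / 2 ^ Suc n"
 by simp

lemma add_scaled_less: "A / c + h < B / c \<Longrightarrow> c > 0 \<Longrightarrow> A + h * c < B" for A B c h :: real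
 by (simp add: pos_less_divide_eq distrib_right)

lemma le_add_scaled: "A / c \<le> B / c + h \<Longrightarrow> c > 0 \<Longrightarrow> A \<le> B + h * c" for A B c h :: real
 by (simp add: pos_divide_le_eq distrib_right)

text \<open>From one generation to the next, the upper dyadic approximation of \<open>t\<close>
  stays or moves left by one cell, and subadditivity of \<open>domin\<close> collects these cells.
  The index inequality is carried along because \<open>domin_add\<close> asks for ordered
  times.\<close>

lemma chain_left:
 assumes "0 \<le> t" "t \<le> T" "n \<le> m"
 shows "domin (\<Sum>i\<in>{n<..m}. vcell i (dceil i t)) (dyad T m (dceil m t)) (dyad T n (dceil n t))
  \<and> dceil m t \<le> dceil n t * 2 ^ (m - n)"
 using assms(3)
proof (induction m rule: dec_induct)
 case base
 then show ?case using point_bounds[OF dceil_le[OF assms(2)]] by (simp add: domin_diag)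
next
 case (step m)
 let ?a = "dceil m t" and ?b = "dceil (Suc m) t"
 have le: "?b \<le> 2 * ?a"
 proof -
  have "T * (real ?b - 1) / 2 ^ Suc m < dyad T m ?a"
   using dceil_bounds(2)[OF assms(1), of "Suc m"] dceil_bounds(1)[OF assms(1), of m] by linarith
  then have "real ?b < real (2 * ?a + 1)" unfolding grid_refine[of _ m] grid_less by simp
  then show ?thesis by linarith
 qed
 have ge: "2 * ?a \<le> ?b + 1"
 proof -
  have "T * (real ?a - 1) / 2 ^ m < dyad T (Suc m) ?b"
   using dceil_bounds(2)[OF assms(1), of m] dceil_bounds(1)[OF assms(1), of "Suc m"] by linarith
  then have "real (2 * ?a) < real (?b + 2)" unfolding grid_refine[of _ m] grid_less by simp
  then show ?thesis by linarith
 qed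
 have pa: "dyad T m ?a = dyad T (Suc m) (2 * ?a)" by simp
 have b1: "?b \<le> 2 ^ Suc m" by (rule dceil_le[OF assms(2)])
 have step1: "domin (vcell (Suc m) ?b) (dyad T (Suc m) ?b) (dyad T m ?a)"
 proof (cases "2 * ?a = ?b")
  case True
  show ?thesis unfolding pa True using point_bounds[OF b1]
   by (intro domin_mono[OF domin_diag vcell_nonneg(1)]) auto
 next
  case False
  then have e: "2 * ?a = Suc ?b" using le ge by simp
  have "?b < 2 ^ Suc m" using dceil_le[OF assms(2), of m] e by simp
  then show ?thesis unfolding pa e using domin_cell[of "Suc m" ?b] by (simp add: vcell_def)
 qed
 have "domin (vcell (Suc m) ?b + (\<Sum>i\<in>{n<..m}. vcell i (dceil i t))) (dyad T (Suc m) ?b) (dyad T n (dceil n t))"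
 proof (rule domin_add[OF step1])
  show "domin (\<Sum>i\<in>{n<..m}. vcell i (dceil i t)) (dyad T m ?a) (dyad T n (dceil n t))"
   using step.IH by simp
  show "dyad T (Suc m) ?b \<le> dyad T m ?a"
   unfolding pa using le T of_nat_mono[OF le, where 'a=real] by (intro divide_right_mono mult_left_mono) auto
  have "real ?a \<le> real (dceil n t * 2 ^ (m - n))" using step.IH by (intro of_nat_mono) simp
  moreover have "(2 :: real) ^ m = 2 ^ (m - n) * 2 ^ n" using step.hyps by (simp add: power_add[symmetric])
  ultimately show "dyad T m ?a \<le> dyad T n (dceil n t)"
   using T by (simp add: field_simps)
 qed (use point_bounds[OF b1] point_bounds[OF dceil_le[OF assms(2)]] in auto)
 moreover have "{n<..Suc m} = insert (Suc m) {n<..m}" using step.hyps by auto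
 moreover have "?b \<le> dceil n t * 2 ^ (Suc m - n)"
  using le step by (simp add: Suc_diff_le)
 ultimately show ?case by simp
qed

text \<open>The mirror image: the lower approximation stays or moves right by one cell, the cell
  that ends at the new point.\<close>

lemma chain_right:
 assumes "0 \<le> t" "t \<le> T" "n \<le> m"
 shows "domin (\<Sum>i\<in>{n<..m}. vcell' i (dfloor i t)) (dyad T n (dfloor n t)) (dyad T m (dfloor m t))
  \<and> dfloor n t * 2 ^ (m - n) \<le> dfloor m t"
 using assms(3)
proof (induction m rule: dec_induct)
 case base
 then show ?case using point_bounds[OF dfloor_le[OF assms(2)]] by (simp add: domin_diag)
next
 case (step m)
 let ?a = "dfloor m t" and ?b = "dfloor (Suc m) t"
 have le: "2 * ?a \<le> ?b"
 proof -
  have "dyad T m ?a < dyad T (Suc m) (Suc ?b)"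
   using dfloor_bounds(2)[OF assms(1), of "Suc m"] dfloor_bounds(1)[OF assms(1), of m] by linarith
  then have "real (2 * ?a) < real (?b + 1)" unfolding grid_refine[of _ m] grid_less by simp
  then show ?thesis by linarith
 qed
 have ge: "?b \<le> 2 * ?a + 1"
 proof -
  have "dyad T (Suc m) ?b < dyad T m (Suc ?a)"
   using dfloor_bounds(2)[OF assms(1), of m] dfloor_bounds(1)[OF assms(1), of "Suc m"] by linarith
  then have "real ?b < real (2 * ?a + 2)" unfolding grid_refine[of _ m] grid_less by simp
  then show ?thesis by linarith
 qed
 have pa: "dyad T m ?a = dyad T (Suc m) (2 * ?a)" by simp
 have b1: "?b \<le> 2 ^ Suc m" by (rule dfloor_le[OF assms(2)])
 have step1: "domin (vcell' (Suc m) ?b) (dyad T m ?a) (dyad T (Suc m) ?b)"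
 proof (cases "2 * ?a = ?b")
  case True
  show ?thesis unfolding pa True using point_bounds[OF b1]
   by (intro domin_mono[OF domin_diag vcell_nonneg(2)]) auto
 next
  case False
  then have e: "?b = Suc (2 * ?a)" using le ge by simp
  have "Suc (2 * ?a) \<le> 2 ^ Suc m" using b1 e by simp
  then show ?thesis unfolding pa e using domin_cell[of "Suc m" "2 * ?a"] by (simp add: vcell'_def)
 qed
 have "domin ((\<Sum>i\<in>{n<..m}. vcell' i (dfloor i t)) + vcell' (Suc m) ?b) (dyad T n (dfloor n t)) (dyad T (Suc m) ?b)"
 proof (rule domin_add[OF _ step1])
  show "domin (\<Sum>i\<in>{n<..m}. vcell' i (dfloor i t)) (dyad T n (dfloor n t)) (dyad T m ?a)"
   using step.IH by simp
  show "dyad T m ?a \<le> dyad T (Suc m) ?b"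
   unfolding pa using le T of_nat_mono[OF le, where 'a=real] by (intro divide_right_mono mult_left_mono) auto
  have "real (dfloor n t * 2 ^ (m - n)) \<le> real ?a" using step.IH by (intro of_nat_mono) simp
  moreover have "(2 :: real) ^ m = 2 ^ (m - n) * 2 ^ n" using step.hyps by (simp add: power_add[symmetric])
  ultimately show "dyad T n (dfloor n t) \<le> dyad T m ?a"
   using T by (simp add: field_simps)
 qed (use point_bounds[OF b1] point_bounds[OF dfloor_le[OF assms(2)]] in auto)
 moreover have "{n<..Suc m} = insert (Suc m) {n<..m}" using step.hyps by auto
 moreover have "dfloor n t * 2 ^ (Suc m - n) \<le> ?b"
  using le step by (simp add: Suc_diff_le)
 ultimately show ?case by (simp add: add.commute)
qed

text \<open>Generation \<open>n\<close> has mesh at most \<open>h\<close> and more than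
  \<open>h / 2\<close>. The inner approximations of \<open>t\<close> and \<open>t + h\<close> are
  then at most one cell apart, and this cell is the \<open>vcell\<close> term with
  \<open>i = n\<close> of the sum.\<close>

lemma chain_total:
 assumes t: "0 \<le> t" "0 \<le> h" "t + h \<le> T" and n: "T \<le> h * 2 ^ n" "h * 2 ^ n < 2 * T" and nm: "n \<le> m"
 shows "domin (\<Sum>i\<in>{n..m}. vcell i (dceil i t) + vcell' i (dfloor i (t + h)))
  (dyad T m (dceil m t)) (dyad T m (dfloor m (t + h))) \<and> dceil m t \<le> dfloor m (t + h)"
proof -
 let ?a = "dceil n t" and ?b = "dfloor n (t + h)"
 have th: "0 \<le> t + h" "t \<le> T" using t by auto
 have le: "?a \<le> ?b"
 proof -
  have "T * (real ?a - 1) / 2 ^ n + h < dyad T n (Suc ?b)"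
   using dceil_bounds(2)[OF t(1), of n] dfloor_bounds(2)[OF th(1), of n] by linarith
  then have "T * (real ?a - 1) + h * 2 ^ n < T * real (Suc ?b)" by (rule add_scaled_less) simp
  then have "T * (real ?a - 1) + T < T * real (Suc ?b)" using n by linarith
  then have "T * real ?a < T * real (Suc ?b)" by (simp add: algebra_simps)
  then show ?thesis using T by simp
 qed
 have ge: "?b \<le> ?a + 1"
 proof -
  have "dyad T n ?b \<le> dyad T n ?a + h"
   using dceil_bounds(1)[OF t(1), of n] dfloor_bounds(1)[OF th(1), of n] by linarith
  then have "T * real ?b \<le> T * real ?a + h * 2 ^ n" by (rule le_add_scaled) simp
  then have "T * real ?b < T * real ?a + 2 * T" using n by linarith
  then have "T * real ?b < T * real (?a + 2)" by (simp add: algebra_simps)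
  then show ?thesis using T by simp
 qed
 have bT: "?b \<le> 2 ^ n" by (rule dfloor_le[OF t(3)])
 have mid: "domin (vcell n ?a) (dyad T n ?a) (dyad T n ?b)"
 proof (cases "?a = ?b")
  case True
  then show ?thesis using point_bounds[OF bT] by (simp add: domin_mono[OF domin_diag vcell_nonneg(1)])
 next
  case False
  then have e: "?b = Suc ?a" using le ge by simp
  have "?a < 2 ^ n" using bT e by simp
  then show ?thesis unfolding e using domin_cell[of n ?a] by (simp add: vcell_def)
 qed
 note L = chain_left[OF t(1) th(2) nm] and R = chain_right[OF th(1) t(3) nm]
 have two: "(2 :: real) ^ m = 2 ^ (m - n) * 2 ^ n" using nm by (simp add: power_add[symmetric])
 have p1: "dyad T m (dceil m t) \<le> dyad T n ?a"
 proof -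
  have "real (dceil m t) \<le> real (?a * 2 ^ (m - n))" using L by (intro of_nat_mono) simp
  then show ?thesis using T two by (simp add: field_simps)
 qed
 have p2: "dyad T n ?b \<le> dyad T m (dfloor m (t + h))"
 proof -
  have "real (?b * 2 ^ (m - n)) \<le> real (dfloor m (t + h))" using R by (intro of_nat_mono) simp
  then show ?thesis using T two by (simp add: field_simps)
 qed
 have p3: "dyad T n ?a \<le> dyad T n ?b"
  using le T by (intro divide_right_mono mult_left_mono) auto
 have "domin ((\<Sum>i\<in>{n<..m}. vcell i (dceil i t)) + vcell n ?a + (\<Sum>i\<in>{n<..m}. vcell' i (dfloor i (t + h))))
  (dyad T m (dceil m t)) (dyad T m (dfloor m (t + h)))"
  using p1 p2 p3 point_bounds[OF dceil_le[OF th(2)]] point_bounds[OF dfloor_le[OF t(3)]] L R mid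
  by (intro domin_add[OF domin_add[of _ _ "dyad T n ?a" _ "dyad T n ?b"]]) (auto intro: order.trans)
 moreover have "(\<Sum>i\<in>{n<..m}. vcell i (dceil i t)) + vcell n ?a + (\<Sum>i\<in>{n<..m}. vcell' i (dfloor i (t + h)))
   \<le> (\<Sum>i\<in>{n..m}. vcell i (dceil i t) + vcell' i (dfloor i (t + h)))"
 proof -
  have "{n..m} = insert n {n<..m}" using nm by auto
  then show ?thesis by (simp add: sum.distrib vcell_nonneg)
 qed
 moreover have "dceil m t \<le> dfloor m (t + h)"
 proof -
  have "dceil m t \<le> ?a * 2 ^ (m - n)" using L by simp
  also have "\<dots> \<le> ?b * 2 ^ (m - n)" using le by simp
  also have "\<dots> \<le> dfloor m (t + h)" using R by simp
  finally show ?thesis .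
 qed
 ultimately show ?thesis using domin_mono by blast
qed

lemma dceil_measurable: "dceil n \<in> measurable borel (count_space UNIV)"
 unfolding dceil_def by measurable

lemma dfloor_measurable: "(\<lambda>t. dfloor n (t + h)) \<in> measurable borel (count_space UNIV)"
 unfolding dfloor_def by measurable

text \<open>
 The weights \<open>q\<^bsup>iP\<^esup>\<close> with \<open>q = 2\<^bsup>H/2\<^esup>\<close> split the decay \<open>2\<^bsup>-iHP\<^esup>\<close> of the \<open>P\<close>-th moments in two
 halves: one sums the series of integrals, the other the chain itself.
\<close>

lemma word_sum_integral_bound:
 assumes avg: "\<And>w e. 1 \<le> length w \<Longrightarrow> length w \<le> N \<Longrightarrow> \<exists>C. \<forall>n. dyadic_average T H X e w n \<le> C"
  and P: "\<And>j. j \<in> {1..N} \<Longrightarrow> \<exists>e>0. P = j * (2 * e)" and P0: "P > 0"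
 shows "\<exists>C\<ge>0. \<forall>k\<in>{1..N}. \<forall>h. 0 < h \<longrightarrow> h \<le> T \<longrightarrow>
  (\<integral>\<^sup>+t\<in>{0..T - h}. ennreal (word_sum k (X t (t + h)) ^ (P div k)) \<partial>lborel) \<le> ennreal (C * (h powr H) ^ P)"
proof -
 obtain B where B: "B \<ge> 0" "\<And>n. (\<Sum>k<2 ^ n. cell n k ^ P) \<le> B * 2 ^ n * ((T / 2 ^ n) powr H) ^ P"
  using cell_average[OF avg P P0] by blast
 define q :: real where "q = 2 powr (H / 2)"
 have q1: "q > 1" unfolding q_def using H by simp
 have q2: "(1 / 2 ^ i) powr H = (1 / q\<^sup>2) ^ i" for i :: nat
 proof -
  have "q\<^sup>2 = 2 powr H" by (simp add: q_def power2_eq_square powr_add[symmetric])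
  moreover have "(1 / 2 ^ i) powr H = 1 / (2 powr H) ^ i"
   by (simp add: powr_divide powr_realpow[symmetric] powr_powr mult.commute powr_power)
  ultimately show ?thesis by (simp add: power_one_over)
 qed
 define \<kappa> where "\<kappa> = 1 / (1 - 1 / q)"
 have \<kappa>: "\<kappa> > 0" using q1 by (simp add: \<kappa>_def)
 \<comment> \<open>\<open>2 ^ P\<close> comes from the power of a sum of two terms, and each of the
   two ends of the interval contributes \<open>T * B\<close>.\<close>
 define L where "L = 2 ^ P * (2 * T * B)"
 have L0: "L \<ge> 0" using T B by (simp add: L_def)
 define \<Lambda> where "\<Lambda> = L / (1 - (1 / q) ^ P)"
 have qP: "(1 / q) ^ P < 1" using q1 P0 by (intro power_less_one_iff[THEN iffD2]) auto
 have \<Lambda>0: "\<Lambda> \<ge> 0" using L0 qP by (simp add: \<Lambda>_def)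
 show ?thesis
 proof (intro exI[of _ "\<kappa> ^ P * \<Lambda>"] conjI ballI allI impI)
  show "0 \<le> \<kappa> ^ P * \<Lambda>" using \<kappa> \<Lambda>0 by simp
  fix k h assume k: "k \<in> {1..N}" and h: "0 < h" "h \<le> T"
  \<comment> \<open>The least generation with mesh at most \<open>h\<close>; minimality gives the
    second inequality.\<close>
  obtain n where n: "T \<le> h * 2 ^ n" "h * 2 ^ n < 2 * T"
  proof -
   define Q where "Q n \<longleftrightarrow> T \<le> h * 2 ^ n" for n :: nat
   have "\<exists>n. T / h < 2 ^ n" by (rule real_arch_pow) simp
   then obtain n0 where "T / h < 2 ^ n0" by blast
   then have "Q n0" using h by (simp add: Q_def field_simps)
   then have l: "Q (LEAST n. Q n)" by (rule LeastI)
   show ?thesis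
   proof (cases "LEAST n. Q n")
    case 0
    then show ?thesis using l h T by (intro that[of 0]) (auto simp: Q_def)
   next
    case (Suc m)
    then have "\<not> Q m" using not_less_Least[of m Q] by simp
    then show ?thesis using l Suc by (intro that[of "Suc m"]) (auto simp: Q_def)
   qed
  qed
  define a where "a i t = vcell (n + i) (dceil (n + i) t) + vcell' (n + i) (dfloor (n + i) (t + h))" for i t
  have a0: "a i t \<ge> 0" for i t by (simp add: a_def vcell_nonneg)
  define S where "S t = (\<Sum>i. ennreal (q ^ (i * P) * a i t ^ P))" for t
  have am [measurable]: "a i \<in> borel_measurable borel" for i
   unfolding a_def
   using measurable_compose[OF dceil_measurable[of "n + i"], of "vcell (n + i)" borel]
    measurable_compose[OF dfloor_measurable[of "n + i" h], of "vcell' (n + i)" borel]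
   by (intro borel_measurable_add) auto
  have pt: "ennreal (word_sum k (X t (t + h)) ^ (P div k)) \<le> ennreal (\<kappa> ^ P) * S t" if t: "t \<in> {0..T - h}" for t
  proof (cases "S t = \<top>")
   case True
   then show ?thesis using \<kappa> by (simp add: ennreal_mult_top)
  next
   case False
   define s where "s = enn2real (S t)"
   have s: "S t = ennreal s" "s \<ge> 0" using False by (auto simp: s_def less_top)
   \<comment> \<open>A single term of the series \<open>S\<close> already forces the geometric decay
     of \<open>a i t\<close>.\<close>
   have ai: "a i t \<le> root P s * (1 / q) ^ i" for i
   proof -
    have "(\<Sum>i\<in>{i}. ennreal (q ^ (i * P) * a i t ^ P)) \<le> S t" unfolding S_def by (rule sum_le_suminf) auto
    then have "q ^ (i * P) * a i t ^ P \<le> s" using s by (simp add: ennreal_le_iff)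
    then have "(q ^ i * a i t) ^ P \<le> s" by (simp add: power_mult_distrib power_mult)
    then have "root P ((q ^ i * a i t) ^ P) \<le> root P s" using P0 by (intro real_root_le_mono) auto
    then have "q ^ i * a i t \<le> root P s" using P0 q1 a0[of i t] by (simp add: real_root_power_cancel)
    then show ?thesis using q1 by (simp add: power_one_over field_simps)
   qed
   have sum_a: "(\<Sum>i\<in>{n..m}. vcell i (dceil i t) + vcell' i (dfloor i (t + h))) \<le> \<kappa> * root P s" if "n \<le> m" for m
   proof -
    have "(\<Sum>i\<in>{n..m}. vcell i (dceil i t) + vcell' i (dfloor i (t + h))) = (\<Sum>i\<le>m - n. a i t)"
     by (rule sum.reindex_bij_witness[of _ "\<lambda>i. n + i" "\<lambda>i. i - n"]) (use that in \<open>auto simp: a_def\<close>)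
    also have "\<dots> \<le> (\<Sum>i\<le>m - n. root P s * (1 / q) ^ i)" by (intro sum_mono ai)
    also have "\<dots> = root P s * (\<Sum>i\<le>m - n. (1 / q) ^ i)" by (simp add: sum_distrib_left)
    also have "\<dots> \<le> root P s * (\<Sum>i. (1 / q) ^ i)"
     using q1 s(2) by (intro mult_left_mono sum_le_suminf summable_geometric real_root_ge_zero) auto
    also have "(\<Sum>i. (1 / q) ^ i) = \<kappa>" unfolding \<kappa>_def using q1 by (intro suminf_geometric) auto
    finally show ?thesis by (simp add: mult.commute)
   qed
   have t': "0 \<le> t" "0 \<le> h" "t + h \<le> T" using t h by auto
   have "fact k * word_sum k (X t (t + h)) \<le> (\<kappa> * root P s) ^ k"
   \<comment> \<open>The chain reaches the approximations of generation \<open>m + n\<close> with a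
     bound that does not depend on \<open>m\<close>; continuity then replaces them by
     \<open>t\<close> and \<open>t + h\<close>.\<close>
   proof (rule LIMSEQ_le_const2)
    show "(\<lambda>m. fact k * word_sum k (X (dyad T (m + n) (dceil (m + n) t)) (dyad T (m + n) (dfloor (m + n) (t + h)))))
      \<longlonglongrightarrow> fact k * word_sum k (X t (t + h))"
     unfolding word_sum_def
    proof (intro tendsto_mult tendsto_const tendsto_sum tendsto_rabs X_tendsto)
     show "(dyad T (m + n) (dceil (m + n) t), dyad T (m + n) (dfloor (m + n) (t + h))) \<in> simplex2 T" for m
      using chain_total[OF t' n, of "m + n"] dfloor_le[OF t'(3)] by (intro grid_in) auto
     show "(\<lambda>m. dyad T (m + n) (dceil (m + n) t)) \<longlonglongrightarrow> t"
      using LIMSEQ_ignore_initial_segment[OF dceil_tendsto[OF t'(1)], of n] .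
     show "(\<lambda>m. dyad T (m + n) (dfloor (m + n) (t + h))) \<longlonglongrightarrow> t + h"
      using LIMSEQ_ignore_initial_segment[OF dfloor_tendsto[of "t + h"], of n] t' by simp
    qed (use k t' in \<open>auto simp: simplex2_def\<close>)
    show "\<exists>N. \<forall>m\<ge>N. fact k * word_sum k (X (dyad T (m + n) (dceil (m + n) t)) (dyad T (m + n) (dfloor (m + n) (t + h))))
      \<le> (\<kappa> * root P s) ^ k"
    proof (intro exI allI impI)
     fix m
     have "domin (\<kappa> * root P s) (dyad T (m + n) (dceil (m + n) t)) (dyad T (m + n) (dfloor (m + n) (t + h)))"
      using chain_total[OF t' n, of "m + n"] sum_a[of "m + n"] by (auto intro: domin_mono)
     then show "fact k * word_sum k (X (dyad T (m + n) (dceil (m + n) t)) (dyad T (m + n) (dfloor (m + n) (t + h))))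
       \<le> (\<kappa> * root P s) ^ k"
      using k by (auto simp: domin_def)
    qed
   qed
   moreover have "1 * word_sum k (X t (t + h)) \<le> fact k * word_sum k (X t (t + h))"
    by (intro mult_right_mono word_sum_nonneg) simp
   ultimately have "word_sum k (X t (t + h)) \<le> (\<kappa> * root P s) ^ k" by simp
   then have "word_sum k (X t (t + h)) ^ (P div k) \<le> ((\<kappa> * root P s) ^ k) ^ (P div k)"
    by (intro power_mono word_sum_nonneg)
   also have "\<dots> = (\<kappa> * root P s) ^ P"
    using P[OF k] k by (auto simp: power_mult[symmetric])
   also have "\<dots> = \<kappa> ^ P * s" using P0 s(2) by (simp add: power_mult_distrib real_root_pow_pos2)
   finally show ?thesis using \<kappa> s by (simp add: ennreal_mult[symmetric] ennreal_leI)
  qed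
  have Ia: "(\<integral>\<^sup>+t\<in>{0..T - h}. ennreal (a i t ^ P) \<partial>lborel) \<le> ennreal (L * ((T / 2 ^ (n + i)) powr H) ^ P)" for i
  proof -
   define m where "m = n + i"
   define \<delta> where "\<delta> = T / 2 ^ m"
   have \<delta>0: "\<delta> \<ge> 0" using T by (simp add: \<delta>_def)
   have sumv: "(\<Sum>k<2 ^ m. ennreal (vcell m k ^ P)) \<le> ennreal (B * 2 ^ m * (\<delta> powr H) ^ P)"
   proof -
    have "(\<Sum>k<2 ^ m. ennreal (vcell m k ^ P)) = ennreal (\<Sum>k<2 ^ m. cell m k ^ P)"
     by (subst sum_ennreal[symmetric]) (auto simp: vcell_def cell_nonneg intro!: sum.cong)
    then show ?thesis using B(2)[of m] by (simp add: \<delta>_def ennreal_leI)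
   qed
   have I1: "(\<integral>\<^sup>+t\<in>{0..T - h}. ennreal (vcell m (dceil m t) ^ P) \<partial>lborel) \<le> ennreal (T * B * (\<delta> powr H) ^ P)"
   proof -
    have "(\<integral>\<^sup>+t\<in>{0..T - h}. ennreal (vcell m (dceil m t) ^ P) \<partial>lborel) \<le> ennreal \<delta> * (\<Sum>k<2 ^ m. ennreal (vcell m k ^ P))"
    proof (rule nn_integral_index_le[OF dceil_measurable])
     fix k :: nat
     have "emeasure lborel {t \<in> {0..T - h}. dceil m t = k} \<le> emeasure lborel {T * (real k - 1) / 2 ^ m..dyad T m k}"
      using dceil_bounds[of _ m] by (intro emeasure_mono) (auto simp: less_imp_le)
     also have "\<dots> = ennreal \<delta>"
     proof -
      have "dyad T m k - T * (real k - 1) / 2 ^ m = \<delta>"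
       by (simp add: \<delta>_def right_diff_distrib diff_divide_distrib)
      moreover have "T * (real k - 1) / 2 ^ m \<le> dyad T m k" using T by (simp add: divide_right_mono)
      ultimately show ?thesis by simp
     qed
     finally show "emeasure lborel {t \<in> {0..T - h}. dceil m t = k} \<le> ennreal \<delta>" .
    qed (use P0 in \<open>auto simp: vcell_def power_0_left\<close>)
    also have "\<dots> \<le> ennreal \<delta> * ennreal (B * 2 ^ m * (\<delta> powr H) ^ P)" by (intro mult_left_mono sumv) auto
    also have "\<dots> = ennreal (T * B * (\<delta> powr H) ^ P)"
     using B(1) \<delta>0 by (simp add: ennreal_mult[symmetric]) (simp add: \<delta>_def mult.assoc)
    finally show ?thesis .
   qed
   have I2: "(\<integral>\<^sup>+t\<in>{0..T - h}. ennreal (vcell' m (dfloor m (t + h)) ^ P) \<partial>lborel) \<le> ennreal (T * B * (\<delta> powr H) ^ P)"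
   proof -
    have "(\<integral>\<^sup>+t\<in>{0..T - h}. ennreal (vcell' m (dfloor m (t + h)) ^ P) \<partial>lborel) \<le> ennreal \<delta> * (\<Sum>k<2 ^ m + 1. ennreal (vcell' m k ^ P))"
    proof (rule nn_integral_index_le[OF dfloor_measurable])
     fix k :: nat
     have "emeasure lborel {t \<in> {0..T - h}. dfloor m (t + h) = k} \<le> emeasure lborel {dyad T m k - h..dyad T m (Suc k) - h}"
     proof (intro emeasure_mono subsetI)
      fix t assume "t \<in> {t \<in> {0..T - h}. dfloor m (t + h) = k}"
      then show "t \<in> {dyad T m k - h..dyad T m (Suc k) - h}"
       using dfloor_bounds[of "t + h" m] h by (auto simp: algebra_simps)
     qed simp
     also have "\<dots> = ennreal \<delta>"
     proof -
      have "dyad T m (Suc k) - dyad T m k = \<delta>"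
       by (simp add: \<delta>_def distrib_left add_divide_distrib)
      moreover have "dyad T m k \<le> dyad T m (Suc k)" using T by (simp add: divide_right_mono)
      ultimately show ?thesis by simp
     qed
     finally show "emeasure lborel {t \<in> {0..T - h}. dfloor m (t + h) = k} \<le> ennreal \<delta>" .
    qed (use P0 in \<open>auto simp: vcell'_def power_0_left\<close>)
    \<comment> \<open>The cell that ends at point \<open>k\<close> starts at \<open>k - 1\<close>:
      dropping the point \<open>0\<close> turns this into the sum over starting points.\<close>
    also have "(\<Sum>k<2 ^ m + 1. ennreal (vcell' m k ^ P)) = (\<Sum>k<2 ^ m. ennreal (vcell m k ^ P))"
    proof -
     have "(\<Sum>k<Suc (2 ^ m). ennreal (vcell' m k ^ P)) = ennreal (vcell' m 0 ^ P) + (\<Sum>k<2 ^ m. ennreal (vcell' m (Suc k) ^ P))"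
      by (rule sum.lessThan_Suc_shift)
     also have "\<dots> = (\<Sum>k<2 ^ m. ennreal (vcell m k ^ P))"
      using P0 by (simp add: vcell'_def vcell_def power_0_left Suc_le_eq)
     finally show ?thesis by simp
    qed
    also have "ennreal \<delta> * (\<Sum>k<2 ^ m. ennreal (vcell m k ^ P)) \<le> ennreal \<delta> * ennreal (B * 2 ^ m * (\<delta> powr H) ^ P)"
     by (intro mult_left_mono sumv) auto
    also have "\<dots> = ennreal (T * B * (\<delta> powr H) ^ P)"
     using B(1) \<delta>0 by (simp add: ennreal_mult[symmetric]) (simp add: \<delta>_def mult.assoc)
    finally show ?thesis .
   qed
   have m1: "(\<lambda>t. ennreal (vcell m (dceil m t) ^ P)) \<in> borel_measurable borel"
    "(\<lambda>t. ennreal (vcell' m (dfloor m (t + h)) ^ P)) \<in> borel_measurable borel"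
    using measurable_compose[OF dceil_measurable[of m], of "\<lambda>k. ennreal (vcell m k ^ P)" borel]
     measurable_compose[OF dfloor_measurable[of m h], of "\<lambda>k. ennreal (vcell' m k ^ P)" borel] by auto
   have two: "(x + y) ^ P \<le> 2 ^ P * (x ^ P + y ^ P)" if "x \<ge> 0" "y \<ge> 0" for x y :: real
    using sum_power_le[of "UNIV :: bool set" "\<lambda>b. if b then x else y" P] that P0 by (simp add: UNIV_bool add.commute)
   have "(\<integral>\<^sup>+t\<in>{0..T - h}. ennreal (a i t ^ P) \<partial>lborel)
     \<le> (\<integral>\<^sup>+t. ennreal (2 ^ P) * (ennreal (vcell m (dceil m t) ^ P) * indicator {0..T - h} t
       + ennreal (vcell' m (dfloor m (t + h)) ^ P) * indicator {0..T - h} t) \<partial>lborel)"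
   proof (rule nn_integral_mono)
    fix t
    have "ennreal (a i t ^ P) \<le> ennreal (2 ^ P) * (ennreal (vcell m (dceil m t) ^ P) + ennreal (vcell' m (dfloor m (t + h)) ^ P))"
     using two[OF vcell_nonneg(1) vcell_nonneg(2)]
     by (simp add: a_def m_def ennreal_mult[symmetric] ennreal_plus[symmetric] vcell_nonneg ennreal_leI del: ennreal_plus)
    then show "ennreal (a i t ^ P) * indicator {0..T - h} t \<le> ennreal (2 ^ P) * (ennreal (vcell m (dceil m t) ^ P) * indicator {0..T - h} t
       + ennreal (vcell' m (dfloor m (t + h)) ^ P) * indicator {0..T - h} t)"
     by (auto simp: indicator_def)
   qed
   also have "\<dots> = ennreal (2 ^ P) * ((\<integral>\<^sup>+t\<in>{0..T - h}. ennreal (vcell m (dceil m t) ^ P) \<partial>lborel)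
     + (\<integral>\<^sup>+t\<in>{0..T - h}. ennreal (vcell' m (dfloor m (t + h)) ^ P) \<partial>lborel))"
    using m1 by (simp add: nn_integral_cmult nn_integral_add)
   also have "\<dots> \<le> ennreal (2 ^ P) * (ennreal (T * B * (\<delta> powr H) ^ P) + ennreal (T * B * (\<delta> powr H) ^ P))"
    by (intro mult_left_mono add_mono I1 I2) auto
   also have "\<dots> = ennreal (L * (\<delta> powr H) ^ P)"
    using T B(1) by (simp add: ennreal_mult[symmetric] ennreal_plus[symmetric] L_def mult_ac del: ennreal_plus)
   finally show ?thesis by (simp add: \<delta>_def m_def)
  qed
  have "(\<integral>\<^sup>+t\<in>{0..T - h}. S t \<partial>lborel) = (\<integral>\<^sup>+t. (\<Sum>i. ennreal (q ^ (i * P) * a i t ^ P) * indicator {0..T - h} t) \<partial>lborel)"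
   by (simp add: S_def ennreal_suminf_multc)
  also have "\<dots> = (\<Sum>i. \<integral>\<^sup>+t. ennreal (q ^ (i * P) * a i t ^ P) * indicator {0..T - h} t \<partial>lborel)"
   by (intro nn_integral_suminf) measurable
  also have "\<dots> = (\<Sum>i. ennreal (q ^ (i * P)) * (\<integral>\<^sup>+t\<in>{0..T - h}. ennreal (a i t ^ P) \<partial>lborel))"
  proof (intro arg_cong[where f=suminf] ext)
   fix i
   have "(\<integral>\<^sup>+t. ennreal (q ^ (i * P) * a i t ^ P) * indicator {0..T - h} t \<partial>lborel)
     = (\<integral>\<^sup>+t. ennreal (q ^ (i * P)) * (ennreal (a i t ^ P) * indicator {0..T - h} t) \<partial>lborel)"
    using q1 a0 by (simp add: ennreal_mult mult.assoc)
   also have "\<dots> = ennreal (q ^ (i * P)) * (\<integral>\<^sup>+t\<in>{0..T - h}. ennreal (a i t ^ P) \<partial>lborel)"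
    by (intro nn_integral_cmult) measurable
   finally show "(\<integral>\<^sup>+t. ennreal (q ^ (i * P) * a i t ^ P) * indicator {0..T - h} t \<partial>lborel)
     = ennreal (q ^ (i * P)) * (\<integral>\<^sup>+t\<in>{0..T - h}. ennreal (a i t ^ P) \<partial>lborel)" .
  qed
  also have "\<dots> \<le> (\<Sum>i. ennreal (L * ((T / 2 ^ n) powr H) ^ P * ((1 / q) ^ P) ^ i))"
  proof (rule suminf_le)
   fix i
   have "ennreal (q ^ (i * P)) * (\<integral>\<^sup>+t\<in>{0..T - h}. ennreal (a i t ^ P) \<partial>lborel)
     \<le> ennreal (q ^ (i * P)) * ennreal (L * ((T / 2 ^ (n + i)) powr H) ^ P)"
    by (intro mult_left_mono Ia) auto
   also have "\<dots> = ennreal (q ^ (i * P) * (L * ((T / 2 ^ (n + i)) powr H) ^ P))"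
    using q1 L0 by (simp add: ennreal_mult)
   also have "q ^ (i * P) * (L * ((T / 2 ^ (n + i)) powr H) ^ P) = L * ((T / 2 ^ n) powr H) ^ P * ((1 / q) ^ P) ^ i"
   proof -
    have "(T / 2 ^ (n + i)) powr H = (T / 2 ^ n) powr H * (1 / q\<^sup>2) ^ i"
     unfolding q2[symmetric] using T by (simp add: powr_mult[symmetric] power_add)
    moreover have "q ^ (i * P) * ((1 / q\<^sup>2) ^ i) ^ P = ((1 / q) ^ P) ^ i"
    proof -
     have "q ^ (i * P) * ((1 / q\<^sup>2) ^ i) ^ P = (q * (1 / q\<^sup>2)) ^ (i * P)"
      unfolding power_mult_distrib[of q] by (simp add: power_mult[symmetric])
     also have "q * (1 / q\<^sup>2) = 1 / q" using q1 by (simp add: power2_eq_square)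
     finally show ?thesis by (simp add: power_mult[symmetric] mult.commute)
    qed
    ultimately show ?thesis by (simp add: power_mult_distrib mult_ac)
   qed
   finally show "ennreal (q ^ (i * P)) * (\<integral>\<^sup>+t\<in>{0..T - h}. ennreal (a i t ^ P) \<partial>lborel)
     \<le> ennreal (L * ((T / 2 ^ n) powr H) ^ P * ((1 / q) ^ P) ^ i)" .
  qed auto
  also have "\<dots> = ennreal (\<Sum>i. L * ((T / 2 ^ n) powr H) ^ P * ((1 / q) ^ P) ^ i)"
   using q1 qP L0 by (intro suminf_ennreal2 summable_mult summable_geometric) auto
  also have "(\<Sum>i. L * ((T / 2 ^ n) powr H) ^ P * ((1 / q) ^ P) ^ i) = \<Lambda> * ((T / 2 ^ n) powr H) ^ P"
   using q1 qP by (subst suminf_mult) (auto simp: suminf_geometric \<Lambda>_def intro!: summable_geometric)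
  also have "\<dots> \<le> \<Lambda> * (h powr H) ^ P"
   using \<Lambda>0 T H n(1) by (intro mult_left_mono power_mono powr_mono2) (auto simp: field_simps)
  finally have IS: "(\<integral>\<^sup>+t\<in>{0..T - h}. S t \<partial>lborel) \<le> ennreal (\<Lambda> * (h powr H) ^ P)" by (simp add: ennreal_leI)
  have "(\<integral>\<^sup>+t\<in>{0..T - h}. ennreal (word_sum k (X t (t + h)) ^ (P div k)) \<partial>lborel)
    \<le> (\<integral>\<^sup>+t. ennreal (\<kappa> ^ P) * (S t * indicator {0..T - h} t) \<partial>lborel)"
   using pt by (intro nn_integral_mono) (auto simp: indicator_def)
  also have "\<dots> = ennreal (\<kappa> ^ P) * (\<integral>\<^sup>+t\<in>{0..T - h}. S t \<partial>lborel)"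
   unfolding S_def by (intro nn_integral_cmult) measurable
  also have "\<dots> \<le> ennreal (\<kappa> ^ P) * ennreal (\<Lambda> * (h powr H) ^ P)" by (intro mult_left_mono IS) auto
  also have "\<dots> = ennreal (\<kappa> ^ P * \<Lambda> * (h powr H) ^ P)"
   using \<kappa> \<Lambda>0 by (simp add: ennreal_mult[symmetric] mult_ac)
  finally show "(\<integral>\<^sup>+t\<in>{0..T - h}. ennreal (word_sum k (X t (t + h)) ^ (P div k)) \<partial>lborel)
    \<le> ennreal (\<kappa> ^ P * \<Lambda> * (h powr H) ^ P)" .
 qed
qed

end

section \<open>From integral moments to Besov norms\<close>

lemma ennreal_powr_le:
 assumes "x \<le> ennreal y" "y \<ge> 0" "a \<ge> 0"
 shows "ennreal_powr x a \<le> ennreal (y powr a)"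
proof -
 have x: "x \<noteq> \<top>" using order.strict_trans1[OF assms(1) ennreal_less_top] by auto
 have "enn2real x \<le> y" using assms(1,2) x by (simp add: enn2real_leI)
 then show ?thesis using x assms by (simp add: ennreal_powr_def ennreal_leI powr_mono2)
qed

lemma ennreal_powr_less_top: "x < \<top> \<Longrightarrow> ennreal_powr x a < \<top>"
 by (auto simp: ennreal_powr_def)

text \<open>Whether \<open>y\<close> is below or above the reference size \<open>l\<close>, one of
  the two terms dominates. With \<open>l\<close> the natural size of \<open>y\<close> both are of
  the same order, so one large integral moment controls all smaller real ones.\<close>

lemma powr_interpolate:
 fixes y l :: real and m :: nat
 assumes "y \<ge> 0" "l > 0" "0 < a" "a \<le> real m"
 shows "y powr a \<le> l powr a + l powr (a - real m) * y ^ m"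
proof (cases "y \<le> l")
 case True
 then have "y powr a \<le> l powr a" using assms by (intro powr_mono2) auto
 then show ?thesis using assms by (simp add: add_increasing2)
next
 case False
 then have "y powr a = y powr (a - real m) * y powr (real m)" using assms by (simp add: powr_add[symmetric])
 also have "\<dots> \<le> l powr (a - real m) * y powr (real m)"
  using False assms by (intro mult_right_mono powr_mono2') auto
 also have "\<dots> = l powr (a - real m) * y ^ m" using False assms by (simp add: powr_realpow)
 finally show ?thesis by (simp add: add_increasing)
qed

context besov_lift
begin

text \<open>For \<open>h > 0\<close>, \<open>powr_interpolate\<close> at the natural size
  \<open>h powr (real k * H)\<close> passes from the integral exponent \<open>P div k\<close> to
  \<open>p / k\<close>, which may be below \<open>1\<close>. For \<open>h = 0\<close> the increments
  vanish by \<open>X_diag\<close>.\<close>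

lemma Lp_level_bound:
 assumes avg: "\<And>w e. 1 \<le> length w \<Longrightarrow> length w \<le> N \<Longrightarrow> \<exists>C. \<forall>n. dyadic_average T H X e w n \<le> C"
  and p: "p > 0" and k: "k \<in> {1..N}"
 shows "\<exists>C\<ge>0. \<forall>h. 0 \<le> h \<longrightarrow> h \<le> T \<longrightarrow>
  Lp_norm (ennreal p / of_nat k) (restrict_space lborel {0..T - h}) (\<lambda>t. level_norm k (X t (t + h)))
   \<le> ennreal (C * h powr (real k * H))"
proof -
 \<comment> \<open>A multiple of \<open>2 * j\<close> for every level \<open>j \<le> N\<close>, and
   at least \<open>p\<close>.\<close>
 define P where "P = 2 * fact N * (nat \<lceil>p\<rceil> + 1)"
 have Pdvd: "\<exists>e>0. P = j * (2 * e)" if "j \<in> {1..N}" for j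
 proof -
  have "j dvd fact N" using that by (intro dvd_fact) auto
  then obtain d where d: "fact N = j * d" by blast
  have "d > 0" using d fact_gt_zero[of N, where 'a=nat] by (intro Nat.gr0I) auto
  moreover have "P = j * (2 * (d * (nat \<lceil>p\<rceil> + 1)))"
   unfolding P_def d by (simp only: mult_ac)
  ultimately show ?thesis by (intro exI[of _ "d * (nat \<lceil>p\<rceil> + 1)"]) simp
 qed
 have P0: "P > 0" by (simp add: P_def)
 have Pp: "p \<le> real P"
 proof -
  have "p \<le> real (nat \<lceil>p\<rceil>)" by (rule real_nat_ceiling_ge)
  also have "\<dots> \<le> real P"
  proof (intro of_nat_mono)
   have "1 * nat \<lceil>p\<rceil> \<le> (2 * fact N) * (nat \<lceil>p\<rceil> + 1)"
    by (intro mult_mono le_add1) (auto intro: Suc_leI)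
   then show "nat \<lceil>p\<rceil> \<le> P" by (simp add: P_def)
  qed
  finally show ?thesis .
 qed
 obtain C where C: "C \<ge> 0" "\<And>h. 0 < h \<Longrightarrow> h \<le> T \<Longrightarrow>
  (\<integral>\<^sup>+t\<in>{0..T - h}. ennreal (word_sum k (X t (t + h)) ^ (P div k)) \<partial>lborel) \<le> ennreal (C * (h powr H) ^ P)"
  using word_sum_integral_bound[OF avg Pdvd P0] k by blast
 define m where "m = P div k"
 have km: "P = k * m" using Pdvd[OF k] k by (auto simp: m_def)
 have k0: "real k > 0" using k by simp
 have pk: "p / real k \<le> real m" using Pp k0 by (simp add: km field_simps)
 define a where "a = p / real k"
 have a0: "a > 0" using p k0 by (simp add: a_def)
 have ea: "ennreal p / of_nat k = ennreal a"
  using p k0 by (simp add: a_def ennreal_of_nat_eq_real_of_nat divide_ennreal)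
 show ?thesis
 proof (intro exI[of _ "(T + C) powr (1 / a)"] conjI allI impI)
  fix h :: real assume h: "0 \<le> h" "h \<le> T"
  have norm_def: "Lp_norm (ennreal p / of_nat k) (restrict_space lborel {0..T - h}) (\<lambda>t. level_norm k (X t (t + h)))
    = ennreal_powr (\<integral>\<^sup>+t\<in>{0..T - h}. ennreal (\<bar>level_norm k (X t (t + h))\<bar> powr a) \<partial>lborel) (1 / a)"
   unfolding ea Lp_norm_def using a0 by (simp add: nn_integral_restrict_space)
  show "Lp_norm (ennreal p / of_nat k) (restrict_space lborel {0..T - h}) (\<lambda>t. level_norm k (X t (t + h)))
   \<le> ennreal ((T + C) powr (1 / a) * h powr (real k * H))"
  proof (cases "h = 0")
   case True
   have "level_norm k (X t t) = 0" if "t \<in> {0..T}" for t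
   proof -
    have "X t t w = 0" if "length w = k" for w using \<open>t \<in> {0..T}\<close> that k by (intro X_diag) auto
    then show ?thesis by (simp add: level_norm_def)
   qed
   then have "(\<integral>\<^sup>+t\<in>{0..T}. ennreal (\<bar>level_norm k (X t t)\<bar> powr a) \<partial>lborel) = (\<integral>\<^sup>+t. 0 \<partial>(lborel :: real measure))"
    by (intro nn_integral_cong) (auto simp: indicator_def)
   then show ?thesis unfolding norm_def using True k0 H by (simp add: ennreal_powr_def)
  next
   case False
   then have h0: "h > 0" using h by simp
   define l where "l = h powr (real k * H)"
   have l0: "l > 0" using h0 by (simp add: l_def)
   have la: "l powr a = h powr (H * p)" using k0 by (simp add: l_def powr_powr a_def mult_ac)
   have lm: "l powr (a - real m) * (h powr H) ^ P = h powr (H * p)"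
   proof -
    have "(h powr H) ^ P = h powr (H * real P)" using h0 by (simp add: powr_realpow[symmetric] powr_powr)
    moreover have "l powr (a - real m) = h powr (H * p - H * real P)"
     using k0 by (simp add: l_def powr_powr a_def km algebra_simps)
    ultimately show ?thesis by (simp add: powr_add[symmetric])
   qed
   have "(\<integral>\<^sup>+t\<in>{0..T - h}. ennreal (\<bar>level_norm k (X t (t + h))\<bar> powr a) \<partial>lborel)
     \<le> (\<integral>\<^sup>+t. ennreal (l powr a) * indicator {0..T - h} t
       + ennreal (l powr (a - real m)) * (ennreal (word_sum k (X t (t + h)) ^ m) * indicator {0..T - h} t) \<partial>lborel)"
   proof (rule nn_integral_mono)
    fix t :: real
    have ln0: "level_norm k (X t (t + h)) \<ge> 0" by (simp add: level_norm_def sum_nonneg)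
    have "\<bar>level_norm k (X t (t + h))\<bar> powr a \<le> word_sum k (X t (t + h)) powr a"
     using ln0 level_norm_le_word_sum[of k "X t (t + h)"] a0 by (intro powr_mono2) auto
    also have "\<dots> \<le> l powr a + l powr (a - real m) * word_sum k (X t (t + h)) ^ m"
     using word_sum_nonneg l0 a0 pk by (intro powr_interpolate) (auto simp: a_def)
    finally have "ennreal (\<bar>level_norm k (X t (t + h))\<bar> powr a)
      \<le> ennreal (l powr a) + ennreal (l powr (a - real m)) * ennreal (word_sum k (X t (t + h)) ^ m)"
     using word_sum_nonneg[of k "X t (t + h)"]
     by (auto simp: ennreal_mult[symmetric] ennreal_plus[symmetric] intro!: ennreal_leI simp del: ennreal_plus)
    then show "ennreal (\<bar>level_norm k (X t (t + h))\<bar> powr a) * indicator {0..T - h} t \<le> ennreal (l powr a) * indicator {0..T - h} t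
       + ennreal (l powr (a - real m)) * (ennreal (word_sum k (X t (t + h)) ^ m) * indicator {0..T - h} t)"
     by (auto simp: indicator_def)
   qed
   also have "\<dots> = ennreal (l powr a) * emeasure lborel {0..T - h}
     + ennreal (l powr (a - real m)) * (\<integral>\<^sup>+t\<in>{0..T - h}. ennreal (word_sum k (X t (t + h)) ^ m) \<partial>lborel)"
   proof -
    have "continuous_on {0..T - h} (\<lambda>t. word_sum k (X t (t + h)))"
     unfolding word_sum_def
    proof (intro continuous_intros)
     fix w :: "'n list" assume "w \<in> {w. length w = k}"
     then have "continuous_on (simplex2 T) (\<lambda>(s, t). X s t w)" using k by (intro cont) auto
     then have "continuous_on {0..T - h} (\<lambda>t. (\<lambda>(s, t). X s t w) (t, t + h))"
      by (rule continuous_on_compose2) (use h0 in \<open>auto intro!: continuous_intros simp: simplex2_def\<close>)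
     then show "continuous_on {0..T - h} (\<lambda>t. X t (t + h) w)" by simp
    qed
    then have "(\<lambda>t. word_sum k (X t (t + h)) ^ m) \<in> borel_measurable (restrict_space borel {0..T - h})"
     by (intro borel_measurable_power borel_measurable_continuous_on_restrict)
    then have "(\<lambda>t. (word_sum k (X t (t + h)) ^ m) * indicator {0..T - h} t) \<in> borel_measurable borel"
     by (subst (asm) borel_measurable_restrict_space_iff) (auto simp: mult.commute)
    then have m: "(\<lambda>t. ennreal ((word_sum k (X t (t + h)) ^ m) * indicator {0..T - h} t)) \<in> borel_measurable lborel"
     by simp
    have "ennreal ((word_sum k (X t (t + h)) ^ m) * indicator {0..T - h} t)
      = ennreal (word_sum k (X t (t + h)) ^ m) * indicator {0..T - h} t" for t
     by (auto simp: indicator_def)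
    then have "(\<lambda>t. ennreal (word_sum k (X t (t + h)) ^ m) * indicator {0..T - h} t) \<in> borel_measurable lborel"
     using m by simp
    then show ?thesis by (subst nn_integral_add) (simp_all add: nn_integral_cmult nn_integral_cmult_indicator)
   qed
   also have "\<dots> \<le> ennreal (l powr a) * ennreal T + ennreal (l powr (a - real m)) * ennreal (C * (h powr H) ^ P)"
    using C(2)[OF h0 h(2)] h unfolding m_def[symmetric]
    by (intro add_mono mult_left_mono) (auto intro: ennreal_leI)
   also have "\<dots> = ennreal ((T + C) * h powr (H * p))"
   proof -
    have "ennreal (l powr a) * ennreal T + ennreal (l powr (a - real m)) * ennreal (C * (h powr H) ^ P)
      = ennreal (l powr a * T + l powr (a - real m) * (C * (h powr H) ^ P))"
     using C(1) T by (simp add: ennreal_mult[symmetric] ennreal_plus[symmetric] del: ennreal_plus)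
    also have "l powr (a - real m) * (C * (h powr H) ^ P) = C * (l powr (a - real m) * (h powr H) ^ P)" by simp
    finally show ?thesis unfolding lm la by (simp add: algebra_simps)
   qed
   finally have "ennreal_powr (\<integral>\<^sup>+t\<in>{0..T - h}. ennreal (\<bar>level_norm k (X t (t + h))\<bar> powr a) \<partial>lborel) (1 / a)
     \<le> ennreal (((T + C) * h powr (H * p)) powr (1 / a))"
    using C(1) T a0 by (intro ennreal_powr_le) auto
   also have "((T + C) * h powr (H * p)) powr (1 / a) = (T + C) powr (1 / a) * h powr (real k * H)"
    using C(1) T p k0 by (simp add: powr_mult powr_powr a_def mult_ac)
   finally show ?thesis unfolding norm_def .
  qed
 qed simp
qed

theorem besov_membership:
 assumes avg: "\<And>w e. 1 \<le> length w \<Longrightarrow> length w \<le> N \<Longrightarrow> \<exists>C. \<forall>n. dyadic_average T H X e w n \<le> C"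
  and p: "p > 0"
 shows "X \<in> besov_rough_paths N H (ennreal p) T"
 unfolding besov_rough_paths_def
proof (intro CollectI conjI X_rough_path)
 have fin: "besov_norm (real k * H) (ennreal p / of_nat k) T (\<lambda>s t. level_norm k (X s t)) < \<top>" if k: "k \<in> {1..N}" for k
 proof -
  obtain C where C: "C \<ge> 0" "\<And>h. 0 \<le> h \<Longrightarrow> h \<le> T \<Longrightarrow>
   Lp_norm (ennreal p / of_nat k) (restrict_space lborel {0..T - h}) (\<lambda>t. level_norm k (X t (t + h)))
    \<le> ennreal (C * h powr (real k * H))"
   using Lp_level_bound[OF avg p k] by blast
  have "besov_norm (real k * H) (ennreal p / of_nat k) T (\<lambda>s t. level_norm k (X s t)) \<le> ennreal C"
   unfolding besov_norm_def
  proof (rule SUP_least)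
   fix \<tau> assume \<tau>: "\<tau> \<in> {0<..T}"
   have "(SUP h\<in>{0..\<tau>}. Lp_norm (ennreal p / of_nat k) (restrict_space lborel {0..T - h}) (\<lambda>t. level_norm k (X t (t + h))))
     \<le> ennreal (C * \<tau> powr (real k * H))"
   proof (rule SUP_least)
    fix h assume h: "h \<in> {0..\<tau>}"
    have "C * h powr (real k * H) \<le> C * \<tau> powr (real k * H)"
     using h H C(1) by (intro mult_left_mono powr_mono2) auto
    then show "Lp_norm (ennreal p / of_nat k) (restrict_space lborel {0..T - h}) (\<lambda>t. level_norm k (X t (t + h)))
      \<le> ennreal (C * \<tau> powr (real k * H))"
     using C(2)[of h] h \<tau> by (auto intro: order.trans ennreal_leI)
   qed
   then have "ennreal (\<tau> powr - (real k * H)) *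
     (SUP h\<in>{0..\<tau>}. Lp_norm (ennreal p / of_nat k) (restrict_space lborel {0..T - h}) (\<lambda>t. level_norm k (X t (t + h))))
     \<le> ennreal (\<tau> powr - (real k * H)) * ennreal (C * \<tau> powr (real k * H))"
    by (intro mult_left_mono) auto
   also have "\<dots> = ennreal C"
    using \<tau> C(1) by (simp add: ennreal_mult[symmetric] powr_minus)
   finally show "ennreal (\<tau> powr - (real k * H)) *
     (SUP h\<in>{0..\<tau>}. Lp_norm (ennreal p / of_nat k) (restrict_space lborel {0..T - h}) (\<lambda>t. level_norm k (X t (t + h))))
     \<le> ennreal C" .
  qed
  then show ?thesis by (rule order.strict_trans1) simp
 qed
 show "(\<Sum>k = 1..N. ennreal_powr (besov_norm (real k * H) (ennreal p / of_nat k) T (\<lambda>s t. level_norm k (X s t))) (1 / real k)) < \<top>"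
  using fin by (simp add: ennreal_sum_less_top ennreal_powr_less_top)
qed

end

subsection \<open>Failure of Hoelder regularity\<close>

text \<open>A violation at one point persists on a neighbourhood relative to \<open>{0..b}\<close>,
  which contains an interval of positive length also at the end points.\<close>

lemma le_of_AE_le_continuous:
 fixes f :: "real \<Rightarrow> real"
 assumes "continuous_on {0..b} f" "b > 0" "AE x in restrict_space lborel {0..b}. f x \<le> K" "x \<in> {0..b}"
 shows "f x \<le> K"
proof (rule ccontr)
 assume "\<not> f x \<le> K"
 then have "K < f x" by simp
 have "\<forall>e>0. \<exists>d>0. \<forall>x'\<in>{0..b}. dist x' x < d \<longrightarrow> dist (f x') (f x) < e"
  using assms(1,4) by (auto simp: continuous_on_iff)
 then obtain d where d: "d > 0" "\<And>x'. x' \<in> {0..b} \<Longrightarrow> dist x' x < d \<Longrightarrow> dist (f x') (f x) < f x - K"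
  using \<open>K < f x\<close> by (metis diff_gt_0_iff_gt)
 define u where "u = max 0 (x - d)"
 define v where "v = min b (x + d)"
 have uv: "u < v" using assms(2,4) d(1) by (auto simp: u_def v_def)
 have "AE y in lborel. y \<in> {0..b} \<longrightarrow> f y \<le> K"
  using assms(3) by (subst (asm) AE_restrict_space_iff) auto
 then have "AE y in lborel. y \<notin> {u<..<v}"
 proof eventually_elim
  case (elim y)
  show ?case
  proof
   assume y: "y \<in> {u<..<v}"
   then have "y \<in> {0..b}" "dist y x < d" by (auto simp: u_def v_def dist_real_def)
   then show False using d(2)[of y] elim by (auto simp: dist_real_def)
  qed
 qed
 then have "emeasure lborel {u<..<v} = 0" by (subst (asm) AE_iff_measurable[of "{u<..<v}"]) auto
 then show False using uv by simp
qed

text \<open>The moment of order \<open>2 * e\<close> is at least \<open>e! / 2 ^ e\<close>, which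
  outgrows every geometric sequence.\<close>

lemma gauss_moment_superexponential:
 assumes "\<And>e. gauss_moment (2 * e) 1 \<le> K ^ (2 * e)"
 shows False
proof -
 have fact_sq: "fact e * fact e \<le> (fact (2 * e) :: real)" for e :: nat
 proof -
  have "fact e * fact e * real (2 * e choose e) = fact (2 * e)"
   using binomial_fact_lemma[of e "2 * e"] by (metis (no_types, lifting) add_diff_cancel_left' le_add1 mult_2 of_nat_fact of_nat_mult)
  moreover have "1 \<le> real (2 * e choose e)" by (simp add: Suc_le_eq)
  ultimately show ?thesis
   by (metis fact_ge_zero mult_left_mono mult_nonneg_nonneg mult.right_neutral)
 qed
 have "fact e \<le> (2 * K\<^sup>2) ^ e" for e :: nat
 proof -
  have "fact e / 2 ^ e \<le> fact (2 * e) / (2 ^ e * fact e :: real)"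
   using fact_sq[of e] by (simp add: field_simps)
  also have "\<dots> \<le> K ^ (2 * e)" using assms[of e] by (simp add: gauss_moment_def)
  also have "\<dots> = (K\<^sup>2) ^ e" by (simp add: power_mult)
  finally show ?thesis by (simp add: power_mult_distrib divide_le_eq mult.commute)
 qed
 then have "(2 * K\<^sup>2) ^ e / fact e \<ge> 1" for e :: nat by (simp add: field_simps)
 moreover have "(\<lambda>e. (2 * K\<^sup>2) ^ e / fact e) \<longlonglongrightarrow> 0"
  using summable_LIMSEQ_zero[OF summable_exp[of "2 * K\<^sup>2"]] by (simp add: divide_inverse mult.commute)
 ultimately show False using LIMSEQ_le_const[of _ 0 1] by fastforce
qed

context besov_lift
begin

text \<open>Continuity turns the essential bound into a bound at every time, in particular at the
  dyadic times that enter the averages.\<close>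

theorem besov_nonmembership:
 assumes lim: "\<And>e. (\<lambda>n. dyadic_average T H X e [i] n) \<longlonglongrightarrow> gauss_moment (2 * e) 1" and N: "1 \<le> N"
 shows "X \<notin> besov_rough_paths N H \<top> T"
proof (rule notI)
 assume "X \<in> besov_rough_paths N H \<top> T"
 then have "(\<Sum>k = 1..N. ennreal_powr (besov_norm (real k * H) (\<top> / of_nat k) T (\<lambda>s t. level_norm k (X s t))) (1 / real k)) < \<top>"
  by (simp add: besov_rough_paths_def)
 then have "\<forall>k\<in>{1..N}. ennreal_powr (besov_norm (real k * H) (\<top> / of_nat k) T (\<lambda>s t. level_norm k (X s t))) (1 / real k) < \<top>"
  by (subst (asm) ennreal_sum_less_top) auto
 from this[rule_format, of 1] have "ennreal_powr (besov_norm (real 1 * H) (\<top> / of_nat 1) T (\<lambda>s t. level_norm 1 (X s t))) (1 / real 1) < \<top>"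
  using N by simp
 then have fin: "besov_norm H \<top> T (\<lambda>s t. level_norm 1 (X s t)) \<noteq> \<top>"
  by (auto simp: ennreal_powr_def ennreal_top_divide split: if_splits)
 define K where "K = enn2real (besov_norm H \<top> T (\<lambda>s t. level_norm 1 (X s t)))"
 have K: "besov_norm H \<top> T (\<lambda>s t. level_norm 1 (X s t)) = ennreal K" "K \<ge> 0"
  using fin by (auto simp: K_def less_top)
 \<comment> \<open>The case \<open>h = T\<close> is left out, because the norm then sees a single
   time, a null set. Hence the restriction to \<open>n \<ge> 1\<close> below.\<close>
 have bound: "\<bar>X t (t + h) [i]\<bar> \<le> K * h powr H" if h: "0 < h" "h < T" and t: "t \<in> {0..T - h}" for t h
 proof -
  let ?f = "\<lambda>t. level_norm 1 (X t (t + h))"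
  let ?R = "restrict_space lborel {0..T - h}"
  have "ennreal (h powr - H) * Lp_norm \<top> ?R ?f \<le> besov_norm H \<top> T (\<lambda>s t. level_norm 1 (X s t))"
   unfolding besov_norm_def using h
   by (intro SUP_upper2[of h] mult_left_mono SUP_upper2[of h]) auto
  then have "ennreal (h powr - H) * esssup ?R (\<lambda>t. ennreal \<bar>?f t\<bar>) \<le> ennreal K"
   unfolding K by (simp add: Lp_norm_def)
  then have "ennreal (h powr H) * (ennreal (h powr - H) * esssup ?R (\<lambda>t. ennreal \<bar>?f t\<bar>)) \<le> ennreal (h powr H) * ennreal K"
   by (intro mult_left_mono) auto
  then have es: "esssup ?R (\<lambda>t. ennreal \<bar>?f t\<bar>) \<le> ennreal (K * h powr H)"
   using h K(2) by (simp add: mult.assoc[symmetric] ennreal_mult[symmetric] powr_minus mult.commute)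
  have cw: "continuous_on {0..T - h} (\<lambda>t. X t (t + h) w)" if "length w = 1" for w
  proof -
   have "continuous_on (simplex2 T) (\<lambda>(s, t). X s t w)" using that N by (intro cont) auto
   then have "continuous_on {0..T - h} (\<lambda>t. (\<lambda>(s, t). X s t w) (t, t + h))"
    by (rule continuous_on_compose2) (use h in \<open>auto intro!: continuous_intros simp: simplex2_def\<close>)
   then show ?thesis by simp
  qed
  have cf: "continuous_on {0..T - h} ?f"
   unfolding level_norm_def by (intro continuous_intros cw) auto
  have "AE t in ?R. ennreal \<bar>?f t\<bar> \<le> esssup ?R (\<lambda>t. ennreal \<bar>?f t\<bar>)"
   by (rule esssup_AE)
  then have "AE t in ?R. ?f t \<le> K * h powr H"
  proof eventually_elim
   case (elim t)
   then have "ennreal \<bar>?f t\<bar> \<le> ennreal (K * h powr H)" using es by (rule order.trans)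
   then show ?case using K(2) by (simp add: ennreal_le_iff)
  qed
  then have "?f t \<le> K * h powr H" using h t by (intro le_of_AE_le_continuous[OF cf]) auto
  moreover have "\<bar>X t (t + h) [i]\<bar> \<le> ?f t" using abs_le_level_norm[of "X t (t + h)" "[i]"] by simp
  ultimately show ?thesis by simp
 qed
 have "gauss_moment (2 * e) 1 \<le> K ^ (2 * e)" for e
 proof (rule LIMSEQ_le_const2[OF lim], intro exI[of _ 1] allI impI)
  fix n :: nat assume n: "1 \<le> n"
  define h where "h = T / 2 ^ n"
  have "(1 :: real) < 2 ^ n" using n by simp
  then have h: "0 < h" "h < T" using T by (auto simp: h_def field_simps)
  have "dyadic_average T H X e [i] n \<le> (\<Sum>k<(2 :: nat) ^ n. K ^ (2 * e)) / 2 ^ n"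
   unfolding dyadic_average_def
  proof (intro divide_right_mono sum_mono)
   fix k :: nat assume k: "k \<in> {..<2 ^ n}"
   define t where "t = dyad T n k"
   have e1: "dyad T n (Suc k) = t + h" by (simp add: t_def h_def distrib_left add_divide_distrib)
   have "t + h \<le> T" unfolding e1[symmetric] using point_bounds[of "Suc k" n] k by simp
   then have "t \<in> {0..T - h}" using T by (simp add: t_def)
   then have "\<bar>X t (t + h) [i]\<bar> \<le> K * h powr H" by (rule bound[OF h])
   then have "(2 ^ n / T) powr H * \<bar>X t (t + h) [i]\<bar> \<le> (2 ^ n / T) powr H * (K * h powr H)"
    by (intro mult_left_mono) auto
   also have "\<dots> = K * ((2 ^ n / T) powr H * h powr H)" by simp
   also have "(2 ^ n / T) powr H * h powr H = 1" using T by (simp add: h_def powr_mult[symmetric])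
   finally have "\<bar>(2 ^ n / T) powr H * X t (t + h) [i]\<bar> \<le> K" by (simp add: abs_mult)
   then have "\<bar>(2 ^ n / T) powr H * X t (t + h) [i]\<bar> ^ (2 * e) \<le> K ^ (2 * e)" by (intro power_mono) auto
   then show "(((2 ^ n / T) powr H) ^ length [i] * X (dyad T n k) (dyad T n (Suc k)) [i]) ^ (2 * e) \<le> K ^ (2 * e)"
    unfolding e1 t_def[symmetric] by (simp add: power_even_abs)
  qed simp
  then show "dyadic_average T H X e [i] n \<le> K ^ (2 * e)" by simp
 qed
 then show False by (intro gauss_moment_superexponential[of K])
qed

end

context noise_lift
begin

text \<open>Words and exponents are countably many, so all almost sure facts hold simultaneously;
  from then on the path is fixed and \<open>besov_lift\<close> applies.\<close>

theorem besov_regularity_AE: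
 assumes cont: "AE \<omega> in M. \<forall>w. length w \<le> N \<longrightarrow> continuous_on (simplex2 T) (\<lambda>(s, t). X \<omega> s t w)"
 shows "AE \<omega> in M. besov_critical N H T (X \<omega>)"
proof -
 have bdd: "AE \<omega> in M. \<forall>w. length w \<le> N \<longrightarrow> (\<forall>e. \<exists>C. \<forall>n. average e w n \<omega> \<le> C)"
  unfolding AE_all_countable
 proof
  fix w :: "'n list"
  show "AE \<omega> in M. length w \<le> N \<longrightarrow> (\<forall>e. \<exists>C. \<forall>n. average e w n \<omega> \<le> C)"
  proof (cases "length w \<le> N")
   case True
   then have "AE \<omega> in M. \<forall>e. \<exists>C. \<forall>n. average e w n \<omega> \<le> C"
    unfolding AE_all_countable using averages_bounded_AE by blast
   then show ?thesis by eventually_elim simp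
  qed simp
 qed
 obtain i :: 'n where True by simp
 have lim: "AE \<omega> in M. \<forall>e. (\<lambda>n. average e [i] n \<omega>) \<longlonglongrightarrow> gauss_moment (2 * e) 1"
  unfolding AE_all_countable using averages_limit_AE by blast
 show ?thesis
  using cont bdd lim chen_dyadic_AE nil_dyadic_AE
 proof eventually_elim
  case (elim \<omega>)
  have av: "average e w n \<omega> = dyadic_average T H (X \<omega>) e w n" for e w n
   by (simp add: average_def dyadic_average_def)
  interpret besov_lift T H N "X \<omega>"
   by unfold_locales (use T H elim in blast)+
  show ?case
   using besov_membership besov_nonmembership[of i] elim(2,3) N1 unfolding av by blast
 qed
qed

end

subsection \<open>Iterated integrals of dyadic interpolations\<close>

text \<open>Iterated integrals with prescribed velocities. Separating the velocities from the path
  allows \<open>deriv\<close> to be replaced by an explicit bounded measurable function.\<close>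

fun iint :: "('n \<Rightarrow> real \<Rightarrow> real) \<Rightarrow> 'n list \<Rightarrow> real \<Rightarrow> real \<Rightarrow> real" where
 "iint D [] s t = 1"
| "iint D (i # w) s t = integral {s..t} (\<lambda>u. iint D w s u * D i u)"

lemma iterated_integral_rev_iint:
 "iterated_integral_rev y w s t = iint (\<lambda>i. deriv (\<lambda>r. y r $ i)) w s t"
 by (induction w arbitrary: t) simp_all

lemma iint_cong:
 assumes "\<And>i u. u \<in> {0..T} \<Longrightarrow> D i u = D' i u" "0 \<le> s" "t \<le> T"
 shows "iint D w s t = iint D' w s t"
 using assms(3)
proof (induction w arbitrary: t)
 case (Cons i w)
 have "integral {s..t} (\<lambda>u. iint D w s u * D i u) = integral {s..t} (\<lambda>u. iint D' w s u * D' i u)"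
  using Cons assms by (intro integral_cong) auto
 then show ?case by simp
qed simp

lemma continuous_mult_bounded_integrable:
 fixes f g :: "real \<Rightarrow> real"
 assumes "continuous_on {s..t} f" "g \<in> borel_measurable borel" "\<And>u. \<bar>g u\<bar> \<le> K"
 shows "(\<lambda>u. f u * g u) integrable_on {s..t}"
proof -
 have "g \<in> borel_measurable (lebesgue_on {s..t})"
  using assms(2) by (intro measurable_restrict_space1 measurable_completion) simp
 moreover have "bounded (g ` {s..t})"
  unfolding bounded_iff using assms(3) by auto
 moreover have "f absolutely_integrable_on {s..t}"
  using assms(1) by (rule absolutely_integrable_continuous_real)
 ultimately have "(\<lambda>u. g u * f u) absolutely_integrable_on {s..t}"
  by (intro absolutely_integrable_bounded_measurable_product_real) auto
 then show ?thesis
  using set_lebesgue_integral_eq_integral(1) by (simp add: mult.commute)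
qed

lemma abs_integral_le:
 fixes f :: "real \<Rightarrow> real"
 assumes "f integrable_on {a..b}" "\<And>u. u \<in> {a..b} \<Longrightarrow> \<bar>f u\<bar> \<le> B" "a \<le> b"
 shows "\<bar>integral {a..b} f\<bar> \<le> B * (b - a)"
proof -
 have "norm (integral {a..b} f) \<le> integral {a..b} (\<lambda>_. B)"
  by (rule integral_norm_bound_integral) (use assms in auto)
 then show ?thesis using assms(3) by (simp add: mult.commute)
qed

text \<open>The bound and the Lipschitz estimate go together in the induction: for
  \<open>i # w\<close> one needs the bound for \<open>w\<close> near the moving end points and the
  Lipschitz estimate for \<open>w\<close> in the lower limit, which also sits inside the
  integrand.\<close>

lemma iint_Lipschitz:
 assumes D: "\<And>i. D i \<in> borel_measurable borel" "\<And>i u. \<bar>D i u\<bar> \<le> K" and K: "K \<ge> 0" and T: "T \<ge> 0"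
 shows "\<exists>C\<ge>0. \<exists>L\<ge>0. (\<forall>s t. 0 \<le> s \<longrightarrow> s \<le> t \<longrightarrow> t \<le> T \<longrightarrow> \<bar>iint D w s t\<bar> \<le> C) \<and>
  (\<forall>s t s' t'. 0 \<le> s \<longrightarrow> s \<le> t \<longrightarrow> t \<le> T \<longrightarrow> 0 \<le> s' \<longrightarrow> s' \<le> t' \<longrightarrow> t' \<le> T \<longrightarrow>
   \<bar>iint D w s t - iint D w s' t'\<bar> \<le> L * (\<bar>s - s'\<bar> + \<bar>t - t'\<bar>))"
proof (induction w)
 case Nil
 show ?case by (intro exI[of _ 1] conjI exI[of _ 0]) auto
next
 case (Cons i w)
 then obtain C L where C: "C \<ge> 0" "\<And>s t. 0 \<le> s \<Longrightarrow> s \<le> t \<Longrightarrow> t \<le> T \<Longrightarrow> \<bar>iint D w s t\<bar> \<le> C"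
  and L: "L \<ge> 0" "\<And>s t s' t'. 0 \<le> s \<Longrightarrow> s \<le> t \<Longrightarrow> t \<le> T \<Longrightarrow> 0 \<le> s' \<Longrightarrow> s' \<le> t' \<Longrightarrow> t' \<le> T \<Longrightarrow>
   \<bar>iint D w s t - iint D w s' t'\<bar> \<le> L * (\<bar>s - s'\<bar> + \<bar>t - t'\<bar>)"
  by blast
 define f where "f s u = iint D w s u * D i u" for s u
 have cont: "continuous_on {a..b} (iint D w s)" if "0 \<le> s" "s \<le> a" "b \<le> T" for s a b
 proof (rule continuous_on_subset)
  show "continuous_on {s..T} (iint D w s)"
  proof (rule lipschitz_on_continuous_on[of L])
   show "L-lipschitz_on {s..T} (iint D w s)"
    using L(2)[of s _ s] that L(1) by (intro lipschitz_onI) (auto simp: dist_real_def)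
  qed
 qed (use that in auto)
 have int: "f s integrable_on {a..b}" if "0 \<le> s" "s \<le> a" "b \<le> T" for s a b
  unfolding f_def by (rule continuous_mult_bounded_integrable[OF cont[OF that] D])
 have fb: "\<bar>f s u\<bar> \<le> C * K" if "0 \<le> s" "s \<le> u" "u \<le> T" for s u
  unfolding f_def abs_mult using C that D(2) by (intro mult_mono) auto
 define C' where "C' = C * K"
 have C'0: "C' \<ge> 0" using C(1) K by (simp add: C'_def)
 have I: "iint D (i # w) s t = integral {s..t} (f s)" for s t by (simp add: f_def[abs_def])
 have small: "\<bar>integral {a..b} (f s)\<bar> \<le> C' * (b - a)" if "0 \<le> s" "s \<le> a" "a \<le> b" "b \<le> T" for s a b
  unfolding C'_def using that fb by (intro abs_integral_le int) auto
 define L' where "L' = 2 * C' + L * K * T"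
 have L'0: "L' \<ge> 0" using C'0 L(1) K T by (simp add: L'_def)
 have key: "\<bar>integral {s..t} (f s) - integral {s'..t'} (f s')\<bar> \<le> L' * (\<bar>s - s'\<bar> + \<bar>t - t'\<bar>)"
  if st: "0 \<le> s" "s \<le> t" "t \<le> T" "s' \<le> t'" "t' \<le> T" "s \<le> s'" for s t s' t'
 proof (cases "s' \<le> t")
  case True
  have split: "integral {s..t} (f s) = integral {s..s'} (f s) + integral {s'..t} (f s)"
   using st True by (intro Henstock_Kurzweil_Integration.integral_combine[symmetric] int) auto
  have d: "\<bar>integral {s'..t} (f s) - integral {s'..t} (f s')\<bar> \<le> (L * K * T) * (s' - s)"
  proof -
   have "integral {s'..t} (f s) - integral {s'..t} (f s') = integral {s'..t} (\<lambda>u. f s u - f s' u)"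
    using st by (intro integral_diff[symmetric] int) auto
   also have "\<bar>\<dots>\<bar> \<le> (L * (s' - s) * K) * (t - s')"
   proof (rule abs_integral_le)
    show "(\<lambda>u. f s u - f s' u) integrable_on {s'..t}" using st by (intro integrable_diff int) auto
    fix u assume u: "u \<in> {s'..t}"
    have "\<bar>iint D w s u - iint D w s' u\<bar> \<le> L * (s' - s)"
     using L(2)[of s u s' u] u st by auto
    then show "\<bar>f s u - f s' u\<bar> \<le> L * (s' - s) * K"
     unfolding f_def left_diff_distrib[symmetric] abs_mult using D(2)[of i u] L(1) st by (intro mult_mono) auto
   qed (use True in simp)
   also have "\<dots> \<le> (L * (s' - s) * K) * T"
    using st L(1) K by (intro mult_left_mono) auto
   finally show ?thesis by (simp add: mult_ac)
  qed
  have e: "\<bar>integral {s'..t} (f s') - integral {s'..t'} (f s')\<bar> \<le> C' * \<bar>t - t'\<bar>"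
  proof (cases "t \<le> t'")
   case True
   then have "integral {s'..t'} (f s') = integral {s'..t} (f s') + integral {t..t'} (f s')"
    using st \<open>s' \<le> t\<close> by (intro Henstock_Kurzweil_Integration.integral_combine[symmetric] int) auto
   then show ?thesis using small[of s' t t'] st True \<open>s' \<le> t\<close> by simp
  next
   case False
   then have "integral {s'..t} (f s') = integral {s'..t'} (f s') + integral {t'..t} (f s')"
    using st by (intro Henstock_Kurzweil_Integration.integral_combine[symmetric] int) auto
   then show ?thesis using small[of s' t' t] st False by simp
  qed
  have g: "\<bar>integral {s..s'} (f s)\<bar> \<le> C' * (s' - s)" using st True by (intro small) auto
  have "\<bar>integral {s..t} (f s) - integral {s'..t'} (f s')\<bar>
    \<le> C' * (s' - s) + (L * K * T) * (s' - s) + C' * \<bar>t - t'\<bar>"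
   unfolding split using d e g by linarith
  also have "\<dots> \<le> L' * (s' - s) + L' * \<bar>t - t'\<bar>"
  proof (rule add_mono)
   have "0 \<le> C' * (s' - s)" using C'0 st by simp
   then show "C' * (s' - s) + L * K * T * (s' - s) \<le> L' * (s' - s)"
    by (simp add: L'_def algebra_simps)
   have "0 \<le> L * K * T" using L(1) K T by simp
   then show "C' * \<bar>t - t'\<bar> \<le> L' * \<bar>t - t'\<bar>" using C'0 by (intro mult_right_mono) (auto simp: L'_def)
  qed
  finally show ?thesis using st by (simp add: distrib_left)
 next
  \<comment> \<open>Disjoint intervals: each is shorter than the displacement of one of its end
    points.\<close>
  case False
  have "\<bar>integral {s..t} (f s)\<bar> \<le> C' * (t - s)" using st by (intro small) auto
  also have "\<dots> \<le> C' * (s' - s)" using C'0 False by (intro mult_left_mono) auto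
  finally have 1: "\<bar>integral {s..t} (f s)\<bar> \<le> C' * (s' - s)" .
  have "\<bar>integral {s'..t'} (f s')\<bar> \<le> C' * (t' - s')" using st by (intro small) auto
  also have "\<dots> \<le> C' * (t' - t)" using C'0 False by (intro mult_left_mono) auto
  finally have 2: "\<bar>integral {s'..t'} (f s')\<bar> \<le> C' * (t' - t)" .
  have "\<bar>integral {s..t} (f s) - integral {s'..t'} (f s')\<bar> \<le> C' * (s' - s) + C' * (t' - t)"
   using 1 2 by linarith
  also have "\<dots> = C' * (\<bar>s - s'\<bar> + \<bar>t - t'\<bar>)" using st False by (simp add: algebra_simps)
  also have "\<dots> \<le> L' * (\<bar>s - s'\<bar> + \<bar>t - t'\<bar>)"
   using C'0 L(1) K T by (intro mult_right_mono) (auto simp: L'_def)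
  finally show ?thesis .
 qed
 show ?case
 proof (rule exI[of _ "C' * T"], rule conjI[rotated], rule exI[of _ L'], intro conjI allI impI)
  show "0 \<le> C' * T" "0 \<le> L'" using C'0 T L'0 by auto
  show "\<bar>iint D (i # w) s t\<bar> \<le> C' * T" if "0 \<le> s" "s \<le> t" "t \<le> T" for s t
  proof -
   have "\<bar>integral {s..t} (f s)\<bar> \<le> C' * (t - s)" using that by (intro small) auto
   also have "\<dots> \<le> C' * T" using that C'0 by (intro mult_left_mono) auto
   finally show ?thesis unfolding I .
  qed
  show "\<bar>iint D (i # w) s t - iint D (i # w) s' t'\<bar> \<le> L' * (\<bar>s - s'\<bar> + \<bar>t - t'\<bar>)"
   if "0 \<le> s" "s \<le> t" "t \<le> T" "0 \<le> s'" "s' \<le> t'" "t' \<le> T" for s t s' t'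
   unfolding I using key[of s t s' t'] key[of s' t' s t] that
   by (cases "s \<le> s'") (auto simp: abs_minus_commute)
 qed
qed

lemma iint_continuous:
 assumes D: "\<And>i. D i \<in> borel_measurable borel" "\<And>i u. \<bar>D i u\<bar> \<le> K" and T: "T \<ge> 0"
 shows "continuous_on (simplex2 T) (\<lambda>(s, t). iint D w s t)"
proof -
 have "K \<ge> 0" using D(2) order.trans[OF abs_ge_zero] by blast
 from iint_Lipschitz[where D = D and K = K and T = T and w = w, OF D this T]
 obtain L where L0: "0 \<le> L" and L1: "\<forall>s t s' t'. 0 \<le> s \<longrightarrow> s \<le> t \<longrightarrow> t \<le> T \<longrightarrow> 0 \<le> s' \<longrightarrow> s' \<le> t' \<longrightarrow> t' \<le> T \<longrightarrow>
   \<bar>iint D w s t - iint D w s' t'\<bar> \<le> L * (\<bar>s - s'\<bar> + \<bar>t - t'\<bar>)"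
  by (elim exE conjE) (rule that, assumption+)
 note L = L0 L1[rule_format]
 show ?thesis
 proof (rule lipschitz_on_continuous_on[of "2 * L"], rule lipschitz_onI)
  fix p q assume "p \<in> simplex2 T" "q \<in> simplex2 T"
  then obtain s t s' t' where pq: "p = (s, t)" "q = (s', t')" "0 \<le> s" "s \<le> t" "t \<le> T" "0 \<le> s'" "s' \<le> t'" "t' \<le> T"
   by (auto simp: simplex2_def)
  have "\<bar>iint D w s t - iint D w s' t'\<bar> \<le> L * (\<bar>s - s'\<bar> + \<bar>t - t'\<bar>)" by (rule L(2)) (use pq in auto)
  also have "\<dots> \<le> L * (dist p q + dist p q)"
   using L(1) dist_fst_le[of p q] dist_snd_le[of p q] by (intro mult_left_mono add_mono) (auto simp: pq dist_real_def)
  finally show "dist (case p of (s, t) \<Rightarrow> iint D w s t) (case q of (s, t) \<Rightarrow> iint D w s t) \<le> 2 * L * dist p q"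
   by (simp add: pq dist_real_def)
 qed (use L(1) in simp)
qed

section \<open>Signatures of dyadic polygons\<close>

abbreviation exp_coeff :: "nat \<Rightarrow> real" where
 "exp_coeff k \<equiv> 1 / fact k"

lemma tens_exp_scale: "tens_exp c (\<lambda>i. \<theta> * D i) w = \<theta> ^ length w * tens_exp c D w"
proof -
 have "(\<Prod>i\<leftarrow>w. \<theta> * D i) = \<theta> ^ length w * (\<Prod>i\<leftarrow>w. D i)" by (induction w) auto
 then show ?thesis by (simp add: tens_exp_def)
qed

text \<open>The signature along a linear segment solves the equation of iterated integrals: a power
  divided by its factorial differentiates to the previous one, and this removes the last
  letter.\<close>

lemma tensor_prod_exp_deriv:
 "((\<lambda>\<theta>. tensor_prod S (tens_exp exp_coeff (\<lambda>i. \<theta> * D i)) (v @ [i])) has_real_derivative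
   tensor_prod S (tens_exp exp_coeff (\<lambda>i. \<theta> * D i)) v * D i) (at \<theta>)"
proof -
 let ?x = "\<lambda>\<theta> i. \<theta> * D i"
 have e: "tensor_prod S (tens_exp exp_coeff (?x \<theta>)) (v @ [i])
   = (\<Sum>j\<le>length v. S (take j v) * ((\<Prod>i\<leftarrow>drop j v. D i) * D i * (\<theta> ^ Suc (length v - j) / fact (Suc (length v - j))))) + S (v @ [i])" for \<theta>
 proof -
  have "tensor_prod S (tens_exp exp_coeff (?x \<theta>)) (v @ [i])
    = (\<Sum>j\<le>length v. S (take j (v @ [i])) * tens_exp exp_coeff (?x \<theta>) (drop j (v @ [i])))
     + S (v @ [i]) * tens_exp exp_coeff (?x \<theta>) []"
   by (simp add: tensor_prod_def)
  also have "(\<Sum>j\<le>length v. S (take j (v @ [i])) * tens_exp exp_coeff (?x \<theta>) (drop j (v @ [i])))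
    = (\<Sum>j\<le>length v. S (take j v) * ((\<Prod>i\<leftarrow>drop j v. D i) * D i * (\<theta> ^ Suc (length v - j) / fact (Suc (length v - j)))))"
   by (intro sum.cong refl) (simp add: tens_exp_scale tens_exp_def Suc_diff_le mult_ac)
  finally have "tensor_prod S (tens_exp exp_coeff (?x \<theta>)) (v @ [i])
    = (\<Sum>j\<le>length v. S (take j v) * ((\<Prod>i\<leftarrow>drop j v. D i) * D i * (\<theta> ^ Suc (length v - j) / fact (Suc (length v - j)))))
     + S (v @ [i]) * tens_exp exp_coeff (?x \<theta>) []" .
  moreover have "tens_exp exp_coeff (?x \<theta>) [] = 1" by (simp add: tens_exp_def)
  ultimately show ?thesis by (simp only: mult_1_right)
 qed
 have f: "tensor_prod S (tens_exp exp_coeff (?x \<theta>)) v * D i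
   = (\<Sum>j\<le>length v. S (take j v) * ((\<Prod>i\<leftarrow>drop j v. D i) * D i * (\<theta> ^ (length v - j) / fact (length v - j)))) + 0"
  unfolding tensor_prod_def tens_exp_scale sum_distrib_right by (simp add: tens_exp_def mult_ac)
 have g: "((\<lambda>\<theta>. \<theta> ^ Suc k / fact (Suc k)) has_real_derivative \<theta> ^ k / fact k) (at \<theta>)" for k and \<theta> :: real
 proof -
  have "((\<lambda>\<theta>. \<theta> ^ Suc k / fact (Suc k)) has_real_derivative (real (Suc k) * \<theta> ^ k) / fact (Suc k)) (at \<theta>)"
   by (auto intro!: derivative_eq_intros simp del: power_Suc fact_Suc)
  moreover have "(real (Suc k) * \<theta> ^ k) / fact (Suc k) = \<theta> ^ k / fact k"
   using of_nat_neq_0[of k, where 'a=real] by (simp only: fact_Suc of_nat_fact mult_divide_mult_cancel_left_if) simp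
  ultimately show ?thesis by simp
 qed
 show ?thesis
  unfolding e f
  by (intro DERIV_add DERIV_const DERIV_sum DERIV_cmult g)
qed

context
 fixes T :: real and m :: nat and x :: "real \<Rightarrow> real ^ 'n"
 assumes T: "T > 0"
begin

definition gp :: "nat \<Rightarrow> real" where
 "gp b = real b * (T / 2 ^ m)"

definition incr :: "nat \<Rightarrow> 'n \<Rightarrow> real" where
 "incr b i = x (gp (Suc b)) $ i - x (gp b) $ i"

lemma gp_Suc: "gp (Suc b) = gp b + T / 2 ^ m"
 by (simp add: gp_def distrib_right add_divide_distrib)

lemma mesh_pos: "T / 2 ^ m > 0"
 using T by simp

lemma interpolation_cell:
 assumes "gp b \<le> u" "u < gp (Suc b)"
 shows "dyadic_interpolation T m x u $ i = x (gp b) $ i + ((u - gp b) / (T / 2 ^ m)) * incr b i"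
proof -
 define h where "h = T / 2 ^ m"
 have h: "h > 0" using T by (simp add: h_def)
 have "real b \<le> u / h" "u / h < real b + 1"
  using assms h unfolding gp_Suc by (auto simp: gp_def h_def[symmetric] field_simps)
 then have "\<lfloor>u / h\<rfloor> = int b" by (intro floor_unique) auto
 moreover have "(real b + 1) * h = gp (Suc b)" by (simp add: gp_def h_def algebra_simps)
 ultimately show ?thesis
  unfolding dyadic_interpolation_def h_def[symmetric] Let_def
  by (simp add: incr_def) (simp add: gp_def h_def[symmetric])
qed

lemma interpolation_deriv:
 assumes "gp b < u" "u < gp (Suc b)"
 shows "deriv (\<lambda>r. dyadic_interpolation T m x r $ i) u = incr b i / (T / 2 ^ m)"
proof (rule DERIV_imp_deriv)
 have "((\<lambda>r. x (gp b) $ i + ((r - gp b) / (T / 2 ^ m)) * incr b i) has_real_derivative incr b i / (T / 2 ^ m)) (at u)"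
  using T by (auto intro!: derivative_eq_intros)
 then show "((\<lambda>r. dyadic_interpolation T m x r $ i) has_real_derivative incr b i / (T / 2 ^ m)) (at u)"
  by (rule DERIV_cong_ev[THEN iffD1, rotated -1])
   (use assms interpolation_cell[of b _ i] in \<open>auto intro!: eventually_mono[OF eventually_nhds_in_open[of "{gp b<..<gp (Suc b)}" u]]\<close>)
qed

text \<open>Induction on the word, outermost letter first. On one cell the integrand is the
  derivative found in \<open>tensor_prod_exp_deriv\<close>; the cells are then joined, the signature
  at the end of one cell being the start of the next.\<close>

lemma iterated_integral_grid:
 assumes "a \<le> b" "0 \<le> \<theta>" "\<theta> \<le> 1"
 shows "iterated_integral_rev (dyadic_interpolation T m x) w (gp a) (gp b + \<theta> * (T / 2 ^ m))
  = tensor_prod (sig exp_coeff incr a (b - a)) (tens_exp exp_coeff (\<lambda>i. \<theta> * incr b i)) (rev w)"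
 using assms
proof (induction w arbitrary: b \<theta>)
 case Nil
 then show ?case by (simp add: sig_Nil tens_exp_def)
next
 case (Cons i w)
 define h where "h = T / 2 ^ m"
 have h: "h > 0" using T by (simp add: h_def)
 define F where "F = (\<lambda>u. iterated_integral_rev (dyadic_interpolation T m x) w (gp a) u * deriv (\<lambda>r. dyadic_interpolation T m x r $ i) u)"
 define G where "G b \<theta> v = tensor_prod (sig exp_coeff incr a (b - a)) (tens_exp exp_coeff (\<lambda>i. \<theta> * incr b i)) v" for b \<theta> v
 have cell: "(F has_integral G b \<theta> (rev w @ [i]) - G b 0 (rev w @ [i])) {gp b..gp b + \<theta> * h}"
  if ab: "a \<le> b" and \<theta>: "0 \<le> \<theta>" "\<theta> \<le> 1" for b \<theta>
 proof -
  define f where "f u = G b ((u - gp b) / h) (rev w) * incr b i / h" for u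
  have "(f has_integral G b ((gp b + \<theta> * h - gp b) / h) (rev w @ [i]) - G b ((gp b - gp b) / h) (rev w @ [i])) {gp b..gp b + \<theta> * h}"
  proof (rule fundamental_theorem_of_calculus)
   show "gp b \<le> gp b + \<theta> * h" using h \<theta> by simp
   fix u
   have "((\<lambda>\<theta>. G b \<theta> (rev w @ [i])) has_real_derivative G b ((u - gp b) / h) (rev w) * incr b i) (at ((u - gp b) / h))"
    unfolding G_def by (rule tensor_prod_exp_deriv)
   moreover have "((\<lambda>u. (u - gp b) / h) has_real_derivative 1 / h) (at u)"
    using h by (auto intro!: derivative_eq_intros)
   ultimately have "((\<lambda>u. G b ((u - gp b) / h) (rev w @ [i])) has_real_derivative (G b ((u - gp b) / h) (rev w) * incr b i) * (1 / h)) (at u)"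
    by (rule DERIV_chain2)
   then show "((\<lambda>u. G b ((u - gp b) / h) (rev w @ [i])) has_vector_derivative f u) (at u within {gp b..gp b + \<theta> * h})"
    by (simp add: f_def has_real_derivative_iff_has_vector_derivative[symmetric] has_field_derivative_at_within)
  qed
  moreover have "(gp b + \<theta> * h - gp b) / h = \<theta>" using h by simp
  ultimately have "(f has_integral G b \<theta> (rev w @ [i]) - G b 0 (rev w @ [i])) {gp b..gp b + \<theta> * h}" by simp
  then show ?thesis
  \<comment> \<open>At the end points of the cell \<open>deriv\<close> is unspecified; finitely many
    points do not change the integral.\<close>
  proof (rule has_integral_spike_finite[rotated 2])
   show "finite {gp b, gp (Suc b)}" by simp
   fix u assume u: "u \<in> {gp b..gp b + \<theta> * h} - {gp b, gp (Suc b)}"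
   have "\<theta> * h \<le> h" using \<theta> h by (simp add: mult_left_le_one_le)
   then have u': "gp b < u" "u < gp (Suc b)" using u unfolding gp_Suc h_def[symmetric] by auto
   define \<eta> where "\<eta> = (u - gp b) / h"
   have \<eta>: "0 \<le> \<eta>" "\<eta> \<le> 1" "u = gp b + \<eta> * h" using u' h unfolding gp_Suc h_def[symmetric] by (auto simp: \<eta>_def field_simps)
   have "iterated_integral_rev (dyadic_interpolation T m x) w (gp a) u = G b \<eta> (rev w)"
    unfolding \<eta>(3) G_def h_def by (rule Cons.IH[OF ab \<eta>(1,2)])
   then show "F u = f u"
    unfolding F_def f_def interpolation_deriv[OF u'] by (simp add: \<eta>_def h_def)
  qed
 qed
 have G0: "G b 0 v = sig exp_coeff incr a (b - a) v" for b v
 proof -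
  have "tens_exp exp_coeff (\<lambda>i. 0 * incr b i) = tens_one"
   by (auto simp: tens_exp_def tens_one_def fun_eq_iff neq_Nil_conv)
  then show ?thesis by (simp add: G_def)
 qed
 have G1: "G b 1 v = G (Suc b) 0 v" if "a \<le> b" for b v
  unfolding G0 using that by (simp add: G_def Suc_diff_le)
 have "(F has_integral G b \<theta> (rev w @ [i])) {gp a..gp b + \<theta> * h}" if "a \<le> b" "0 \<le> \<theta>" "\<theta> \<le> 1" for b \<theta>
  using that
 proof (induction b arbitrary: \<theta> rule: dec_induct)
  case base
  have "G a 0 (rev w @ [i]) = 0" unfolding G0 by (simp add: tens_one_def)
  then show ?case using cell[of a \<theta>] base by simp
 next
  case (step b)
  have e: "gp b + 1 * h = gp (Suc b)" by (simp add: gp_Suc h_def)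
  have "(F has_integral G b 1 (rev w @ [i]) + (G (Suc b) \<theta> (rev w @ [i]) - G (Suc b) 0 (rev w @ [i]))) {gp a..gp (Suc b) + \<theta> * h}"
  proof (rule has_integral_combine)
   show "gp a \<le> gp (Suc b)" using step.hyps T by (simp add: gp_def divide_right_mono)
   show "gp (Suc b) \<le> gp (Suc b) + \<theta> * h" using h step.prems by simp
   show "(F has_integral G b 1 (rev w @ [i])) {gp a..gp (Suc b)}" using step.IH[of 1] unfolding e by simp
   show "(F has_integral G (Suc b) \<theta> (rev w @ [i]) - G (Suc b) 0 (rev w @ [i])) {gp (Suc b)..gp (Suc b) + \<theta> * h}"
    using step by (intro cell) auto
  qed
  then show ?case using G1[of b] step.hyps by simp
 qed
 from integral_unique[OF this[OF Cons.prems]] show ?case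
  by (simp add: F_def G_def h_def)
qed

lemma iterated_integral_sig:
 assumes "a \<le> b"
 shows "iterated_integral (dyadic_interpolation T m x) (gp a) (gp b) w = sig exp_coeff incr a (b - a) w"
proof -
 have "tens_exp exp_coeff (\<lambda>i. 0 * incr b i) = tens_one"
  by (auto simp: tens_exp_def tens_one_def fun_eq_iff neq_Nil_conv)
 then show ?thesis
  using iterated_integral_grid[OF assms, of 0 "rev w"] by (simp add: iterated_integral_def)
qed

lemma interpolation_cells:
 assumes "0 \<le> u" "u \<le> T"
 shows "(\<exists>b<2 ^ m. gp b < u \<and> u < gp (Suc b)) \<or> (\<exists>b\<le>2 ^ m. u = gp b)"
proof -
 define b where "b = nat \<lfloor>u / (T / 2 ^ m)\<rfloor>"
 have "real b = of_int \<lfloor>u / (T / 2 ^ m)\<rfloor>" using assms T by (simp add: b_def)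
 then have "real b \<le> u / (T / 2 ^ m)" "u / (T / 2 ^ m) < real b + 1" by linarith+
 then have 1: "gp b \<le> u" "u < gp (Suc b)"
  using T by (auto simp: gp_def field_simps)
 show ?thesis
 proof (cases "u = gp b")
  case True
  have "real b * (T / 2 ^ m) \<le> real (2 ^ m) * (T / 2 ^ m)" using True assms by (simp add: gp_def)
  from mult_right_le_imp_le[OF this mesh_pos] have "b \<le> 2 ^ m" by (simp only: of_nat_le_iff)
  then show ?thesis using True by auto
 next
  case False
  then have "gp b < u" using 1 by simp
  then have "gp b < T" using assms by simp
  then have "real b * (T / 2 ^ m) < real (2 ^ m) * (T / 2 ^ m)" by (simp add: gp_def)
  from mult_right_less_imp_less[OF this] have "b < 2 ^ m" using mesh_pos by (simp only: of_nat_less_iff less_imp_le)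
  then show ?thesis using False 1 by (intro disjI1 exI[of _ b]) auto
 qed
qed

lemma iterated_integral_continuous:
 "continuous_on (simplex2 T) (\<lambda>(s, t). iterated_integral (dyadic_interpolation T m x) s t w)"
proof -
 define d where "d i = deriv (\<lambda>r. dyadic_interpolation T m x r $ i)" for i
 \<comment> \<open>A bounded measurable function that agrees with \<open>deriv\<close> everywhere on
   \<open>[0, T]\<close>, including its unspecified values at the grid points, so that
   \<open>iint_cong\<close> applies literally.\<close>
 define D where "D i u = (\<Sum>b<2 ^ m. (incr b i / (T / 2 ^ m)) * indicator {gp b<..<gp (Suc b)} u)
  + (\<Sum>b\<le>2 ^ m. d i (gp b) * indicator {gp b} u)" for i u
 define K where "K = (\<Sum>i\<in>UNIV. (\<Sum>b<2 ^ m. \<bar>incr b i / (T / 2 ^ m)\<bar>) + (\<Sum>b\<le>2 ^ m. \<bar>d i (gp b)\<bar>))"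
 have gp_less: "gp b < gp b' \<longleftrightarrow> b < b'" for b b' using T by (simp add: gp_def divide_less_cancel)
 have meas: "D i \<in> borel_measurable borel" for i unfolding D_def by measurable
 have bound: "\<bar>D i u\<bar> \<le> K" for i u
 proof -
  have "\<bar>D i u\<bar> \<le> (\<Sum>b<2 ^ m. \<bar>incr b i / (T / 2 ^ m)\<bar>) + (\<Sum>b\<le>2 ^ m. \<bar>d i (gp b)\<bar>)"
   unfolding D_def
   by (intro order.trans[OF abs_triangle_ineq] add_mono order.trans[OF sum_abs] sum_mono)
    (auto simp: indicator_def)
  also have "\<dots> \<le> K" unfolding K_def by (rule member_le_sum) (auto intro!: add_nonneg_nonneg sum_nonneg)
  finally show ?thesis .
 qed
 have eq: "d i u = D i u" if u: "u \<in> {0..T}" for i u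
 proof -
  from interpolation_cells[of u] u
  have "(\<exists>b<2 ^ m. gp b < u \<and> u < gp (Suc b)) \<or> (\<exists>b\<le>2 ^ m. u = gp b)" by auto
  then show ?thesis
 proof (elim disjE exE conjE)
  fix b assume b: "b < 2 ^ m" "gp b < u" "u < gp (Suc b)"
  have "(\<Sum>b'<2 ^ m. (incr b' i / (T / 2 ^ m)) * indicator {gp b'<..<gp (Suc b')} u)
    = (\<Sum>b'<2 ^ m. if b' = b then incr b i / (T / 2 ^ m) else 0)"
  proof (intro sum.cong refl)
   fix b'
   have *: "b' = b" if "gp b' < u" "u < gp (Suc b')"
   proof -
    have "gp b < gp (Suc b')" "gp b' < gp (Suc b)" using b that by linarith+
    then show ?thesis unfolding gp_less by simp
   qed
   show "(incr b' i / (T / 2 ^ m)) * indicator {gp b'<..<gp (Suc b')} u = (if b' = b then incr b i / (T / 2 ^ m) else 0)"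
   proof (cases "b' = b")
    case True
    then show ?thesis using b by simp
   next
    case False
    then have "u \<notin> {gp b'<..<gp (Suc b')}" using * by auto
    then show ?thesis using False by simp
   qed
  qed
  moreover have "(\<Sum>b'\<le>2 ^ m. d i (gp b') * indicator {gp b'} u) = 0"
  proof (intro sum.neutral ballI)
   fix b'
   have "u \<noteq> gp b'"
   proof
    assume "u = gp b'"
    then have "b < b'" "b' < Suc b" using b unfolding gp_less[symmetric] by auto
    then show False by simp
   qed
   then show "d i (gp b') * indicator {gp b'} u = 0" by simp
  qed
  ultimately show ?thesis using b unfolding D_def d_def interpolation_deriv[OF b(2,3)] by simp
 next
  fix b assume b: "b \<le> 2 ^ m" "u = gp b"
  have "(\<Sum>b'<2 ^ m. (incr b' i / (T / 2 ^ m)) * indicator {gp b'<..<gp (Suc b')} u) = 0"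
   by (intro sum.neutral) (auto simp: b gp_less indicator_def)
  moreover have "(\<Sum>b'\<le>2 ^ m. d i (gp b') * indicator {gp b'} u) = (\<Sum>b'\<le>2 ^ m. if b' = b then d i (gp b) else 0)"
  proof (intro sum.cong refl)
   fix b'
   have "gp b' = gp b \<longleftrightarrow> b' = b" using gp_less[of b b'] gp_less[of b' b] by (cases b b' rule: linorder_cases) auto
   then show "d i (gp b') * indicator {gp b'} u = (if b' = b then d i (gp b) else 0)"
    by (auto simp: b indicator_def)
  qed
  ultimately show ?thesis using b by (simp add: D_def)
 qed
 qed
 have "continuous_on (simplex2 T) (\<lambda>(s, t). iint D (rev w) s t)"
  using T by (intro iint_continuous[OF meas bound]) simp
 moreover have "iterated_integral (dyadic_interpolation T m x) s t w = iint D (rev w) s t" if "(s, t) \<in> simplex2 T" for s t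
  unfolding iterated_integral_def iterated_integral_rev_iint using that eq
  by (intro iint_cong[of T]) (auto simp: simplex2_def d_def)
 ultimately show ?thesis by (subst continuous_on_cong[OF refl]) auto
qed

end

subsection \<open>Fractional Brownian motion\<close>

lemma (in prob_space) centered_gaussian_moments:
 assumes "centered_gaussian M Z"
 shows "gaussian_moments M (expectation (\<lambda>\<omega>. (Z \<omega>)^2)) Z"
proof -
 have "\<exists>v. gaussian_moments M v Z"
 proof (cases "AE \<omega> in M. Z \<omega> = 0")
  case True
  have "gaussian_moments M 0 Z"
   by (rule gaussian_moments_AE_cong[OF gaussian_moments_const_0])
    (use True assms in \<open>auto simp: centered_gaussian_def\<close>)
  then show ?thesis by blast
 next
  case False
  then show ?thesis using assms gaussian_moments_normal unfolding centered_gaussian_def by blast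
 qed
 then obtain v where v: "gaussian_moments M v Z" by blast
 then have "expectation (\<lambda>\<omega>. Z \<omega> ^ 2) = gauss_moment 2 v" unfolding gaussian_moments_def by blast
 then show ?thesis using v by simp
qed

lemma integrable_mult_of_squares:
 fixes u v :: "'a \<Rightarrow> real"
 assumes [measurable]: "u \<in> borel_measurable M" "v \<in> borel_measurable M"
  and "integrable M (\<lambda>x. (u x)^2)" "integrable M (\<lambda>x. (v x)^2)"
 shows "integrable M (\<lambda>x. u x * v x)"
proof (rule Bochner_Integration.integrable_bound)
 show "integrable M (\<lambda>x. ((u x)^2 + (v x)^2) / 2)" using assms by simp
 show "AE x in M. norm (u x * v x) \<le> norm (((u x)^2 + (v x)^2) / 2)"
  using abs_mult_le_half_squares by (intro AE_I2) (simp add: order.trans)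
qed measurable

text \<open>The approximants are eventually constant in \<open>m\<close>, so the probabilities that
  tend to zero are themselves zero.\<close>

lemma (in prob_space) AE_eq_of_limit_in_prob:
 fixes Y Z :: "'a \<Rightarrow> real"
 assumes [measurable]: "Y \<in> borel_measurable M" "Z \<in> borel_measurable M"
  and lim: "\<And>\<epsilon>. \<epsilon> > 0 \<Longrightarrow> (\<lambda>m. prob {\<omega> \<in> space M. \<epsilon> < \<bar>S m \<omega> - Z \<omega>\<bar>}) \<longlonglongrightarrow> 0"
  and ev: "\<And>m \<omega>. m \<ge> m0 \<Longrightarrow> \<omega> \<in> space M \<Longrightarrow> S m \<omega> = Y \<omega>"
 shows "AE \<omega> in M. Z \<omega> = Y \<omega>"
proof -
 have "AE \<omega> in M. \<bar>Y \<omega> - Z \<omega>\<bar> \<le> 1 / real (Suc l)" for l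
 proof -
  have "(\<lambda>m. prob {\<omega> \<in> space M. 1 / real (Suc l) < \<bar>Y \<omega> - Z \<omega>\<bar>}) \<longlonglongrightarrow> 0"
  proof (rule Lim_transform_eventually[OF lim])
   show "\<forall>\<^sub>F m in sequentially. prob {\<omega> \<in> space M. 1 / real (Suc l) < \<bar>S m \<omega> - Z \<omega>\<bar>}
     = prob {\<omega> \<in> space M. 1 / real (Suc l) < \<bar>Y \<omega> - Z \<omega>\<bar>}"
    using eventually_ge_at_top[of m0] by eventually_elim (intro arg_cong[where f=prob], auto simp: ev)
  qed simp
  then have "prob {\<omega> \<in> space M. 1 / real (Suc l) < \<bar>Y \<omega> - Z \<omega>\<bar>} = 0" by (simp add: LIMSEQ_const_iff)
  then have "{\<omega> \<in> space M. 1 / real (Suc l) < \<bar>Y \<omega> - Z \<omega>\<bar>} \<in> null_sets M"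
   by (auto simp: null_sets_def emeasure_eq_measure)
  then show ?thesis by (rule AE_I') (auto simp: not_le)
 qed
 then have "AE \<omega> in M. \<forall>l. \<bar>Y \<omega> - Z \<omega>\<bar> \<le> 1 / real (Suc l)" by (simp add: AE_all_countable)
 then show ?thesis
 proof eventually_elim
  case (elim \<omega>)
  show ?case
  proof (rule ccontr)
   assume "Z \<omega> \<noteq> Y \<omega>"
   then have "0 < \<bar>Y \<omega> - Z \<omega>\<bar>" by simp
   then obtain l where "1 / real (Suc l) < \<bar>Y \<omega> - Z \<omega>\<bar>" using nat_approx_posE by blast
   then show False using elim[rule_format, of l] by simp
  qed
 qed
qed

lemma gp_T: "T > 0 \<Longrightarrow> gp T m b = dyad T m b"
 by (simp add: gp_def)

lemma gp_refine: "T > 0 \<Longrightarrow> n \<le> m \<Longrightarrow> gp T m (a * 2 ^ (m - n)) = dyad T n a"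
 using power_add[of "2 :: real" "m - n" n] by (simp add: gp_def field_simps)

lemma gp_in: "T > 0 \<Longrightarrow> b \<le> 2 ^ m \<Longrightarrow> gp T m b \<in> {0..T}"
 using of_nat_mono[of b "2 ^ m", where 'a=real] by (simp add: gp_def field_simps)

lemma sum_incr: "T > 0 \<Longrightarrow> (\<Sum>k<r. incr T m x (a + k) i) = x (gp T m (a + r)) $ i - x (gp T m a) $ i"
 using sum_lessThan_telescope[of "\<lambda>k. x (gp T m (a + k)) $ i" r] by (simp add: incr_def)

text \<open>Increments of generation \<open>m\<close> divided by their standard deviation
  \<open>(T / 2 ^ m) powr H\<close>.\<close>

definition noise_of :: "real \<Rightarrow> real \<Rightarrow> (real \<Rightarrow> 'a \<Rightarrow> real ^ 'n) \<Rightarrow> nat \<Rightarrow> nat \<Rightarrow> 'n \<Rightarrow> 'a \<Rightarrow> real" where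
 "noise_of T H B m b i \<omega> = (T / 2 ^ m) powr (- H) * incr T m (\<lambda>u. B u \<omega>) b i"

lemma noise_of_scaled: "T > 0 \<Longrightarrow> (T / 2 ^ m) powr H * noise_of T H B m b i \<omega> = incr T m (\<lambda>u. B u \<omega>) b i"
 by (simp add: noise_of_def powr_minus)

text \<open>The covariance of two increments is a second difference of
  \<open>\<bar>t - s\<bar> powr (2 * H)\<close>, which is \<open>fgn\<close> after normalisation.
  Each component yields a Gaussian linear combination, and the components are added by
  independence.\<close>

lemma fbm_noise:
 fixes B :: "real \<Rightarrow> 'a \<Rightarrow> real ^ 'n"
 assumes "prob_space M" and T: "T > 0" and H: "H > 0" and fbm: "fractional_brownian_motion M T H B"
 shows "gaussian_family M ({..<2 ^ m} \<times> UNIV) (\<lambda>p \<omega>. noise_of T H B m (fst p) (snd p) \<omega>) (noise_cov H)"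
 unfolding gaussian_family_def
proof (intro conjI allI)
 interpret prob_space M by fact
 fix c :: "nat \<times> 'n \<Rightarrow> real"
 define h where "h = T / 2 ^ m"
 have h: "h > 0" using T by (simp add: h_def)
 define s where "s = h powr (- H)"
 let ?t = "gp T m"
 let ?N = "\<lambda>b b' i \<omega>. noise_of T H B m b i \<omega> * noise_of T H B m b' i \<omega>"
 have tin: "?t b \<in> {0..T}" if "b \<le> 2 ^ m" for b using gp_in[OF T that] .
 have gproc: "centered_gaussian M (\<lambda>\<omega>. \<Sum>t\<in>J. d t * B t \<omega> $ i)" if "finite J" "J \<subseteq> {0..T}" for J d i
  using fbm that unfolding fractional_brownian_motion_def centered_gaussian_process_def by blast
 have cov: "expectation (\<lambda>\<omega>. B u \<omega> $ i * B t \<omega> $ i) = (u powr (2 * H) + t powr (2 * H) - \<bar>t - u\<bar> powr (2 * H)) / 2"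
  if "u \<in> {0..T}" "t \<in> {0..T}" for u t i
  using fbm that unfolding fractional_brownian_motion_def by blast
 have gm1: "gaussian_moments M (expectation (\<lambda>\<omega>. (B t \<omega> $ i)^2)) (\<lambda>\<omega>. B t \<omega> $ i)" if "t \<in> {0..T}" for t i
  using centered_gaussian_moments[OF gproc[of "{t}" "\<lambda>_. 1" i]] that by simp
 have Bm: "(\<lambda>\<omega>. B t \<omega> $ i) \<in> borel_measurable M" and Bsq: "integrable M (\<lambda>\<omega>. (B t \<omega> $ i)^2)" if "t \<in> {0..T}" for t i
  using gm1[OF that, of i] unfolding gaussian_moments_def by blast+
 have BB: "integrable M (\<lambda>\<omega>. B u \<omega> $ i * B t \<omega> $ i)" if "u \<in> {0..T}" "t \<in> {0..T}" for u t i
  using that by (intro integrable_mult_of_squares Bm Bsq)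
 have xi: "noise_of T H B m b i \<omega> = s * (B (?t (Suc b)) \<omega> $ i - B (?t b) \<omega> $ i)" for b i \<omega>
  using T by (simp add: noise_of_def incr_def s_def h_def)
 have Exi: "integrable M (?N b b' i)"
  "expectation (?N b b' i) = fgn H (real b - real b')"
  if "b < 2 ^ m" "b' < 2 ^ m" for b b' i
 proof -
  let ?P = "\<lambda>u v \<omega>. B (?t u) \<omega> $ i * B (?t v) \<omega> $ i"
  have i: "integrable M (?P u v)" if "u \<le> 2 ^ m" "v \<le> 2 ^ m" for u v
   by (rule BB[OF tin[OF that(1)] tin[OF that(2)]])
  have E: "expectation (?P u v) = ((?t u) powr (2 * H) + (?t v) powr (2 * H) - h powr (2 * H) * \<bar>real v - real u\<bar> powr (2 * H)) / 2"
   if "u \<le> 2 ^ m" "v \<le> 2 ^ m" for u v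
  proof -
   have "\<bar>?t v - ?t u\<bar> = h * \<bar>real v - real u\<bar>"
    using h T by (simp add: gp_def h_def[symmetric] left_diff_distrib[symmetric] abs_mult)
   then show ?thesis unfolding cov[OF tin[OF that(1)] tin[OF that(2)]] using h by (simp add: powr_mult)
  qed
  have eq: "?N b b' i \<omega>
    = s * s * (?P (Suc b) (Suc b') \<omega> - ?P (Suc b) b' \<omega> - ?P b (Suc b') \<omega> + ?P b b' \<omega>)" for \<omega>
   unfolding xi by (simp add: algebra_simps)
  show "integrable M (?N b b' i)"
   unfolding eq using that by (intro Bochner_Integration.integrable_mult_right Bochner_Integration.integrable_add
     Bochner_Integration.integrable_diff i) auto
  have "expectation (?N b b' i)
    = s * s * (expectation (?P (Suc b) (Suc b')) - expectation (?P (Suc b) b') - expectation (?P b (Suc b')) + expectation (?P b b'))"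
   unfolding eq using that i[of "Suc b" "Suc b'"] i[of "Suc b" b'] i[of b "Suc b'"] i[of b b'] by simp
  also have "\<dots> = s * s * (h powr (2 * H) * fgn H (real b' - real b))"
  proof -
   have e: "real (Suc b') - real (Suc b) = real b' - real b" "real b' - real (Suc b) = real b' - real b - 1"
    "real (Suc b') - real b = real b' - real b + 1" by simp_all
   have "expectation (?P (Suc b) (Suc b')) - expectation (?P (Suc b) b') - expectation (?P b (Suc b')) + expectation (?P b b')
     = h powr (2 * H) * fgn H (real b' - real b)"
    using that by (subst (1 2 3 4) E) (auto simp: e fgn_def field_simps)
   then show ?thesis by simp
  qed
  also have "\<dots> = (s * s * h powr (2 * H)) * fgn H (real b - real b')"
   using fgn_minus[of H "real b - real b'"] by simp
  also have "s * s * h powr (2 * H) = 1" using h by (simp add: s_def powr_add[symmetric])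
  finally show "expectation (?N b b' i) = fgn H (real b - real b')" by simp
 qed
 define L where "L i \<omega> = (\<Sum>b<2 ^ m. c (b, i) * noise_of T H B m b i \<omega>)" for i \<omega>
 have Lcg: "centered_gaussian M (L i)" for i
 proof -
  define J where "J = ?t ` {..2 ^ m}"
  have J: "finite J" "J \<subseteq> {0..T}" using tin by (auto simp: J_def)
  \<comment> \<open>A combination of increments rewritten as one of values at grid times, the form
    in which the process is assumed Gaussian.\<close>
  define d where "d t = (\<Sum>b<2 ^ m. c (b, i) * s * ((if t = ?t (Suc b) then 1 else 0) - (if t = ?t b then 1 else 0)))" for t
  have "(\<Sum>t\<in>J. d t * B t \<omega> $ i) = L i \<omega>" for \<omega>
  proof -
   have pick: "(\<Sum>t\<in>J. (if t = u then 1 else 0) * B t \<omega> $ i) = B u \<omega> $ i" if "u \<in> J" for u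
   proof -
    have "(\<Sum>t\<in>J. (if t = u then 1 else 0) * B t \<omega> $ i) = (\<Sum>t\<in>J. if t = u then B u \<omega> $ i else 0)"
     by (intro sum.cong) auto
    then show ?thesis using that J(1) by simp
   qed
   have "(\<Sum>t\<in>J. d t * B t \<omega> $ i) = (\<Sum>b<2 ^ m. \<Sum>t\<in>J. c (b, i) * s * (((if t = ?t (Suc b) then 1 else 0) - (if t = ?t b then 1 else 0)) * B t \<omega> $ i))"
    unfolding d_def sum_distrib_right by (subst sum.swap) (simp add: mult.assoc)
   also have "\<dots> = (\<Sum>b<2 ^ m. c (b, i) * s * (B (?t (Suc b)) \<omega> $ i - B (?t b) \<omega> $ i))"
   proof (rule sum.cong[OF refl])
    fix b :: nat assume "b \<in> {..<2 ^ m}"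
    then have "?t (Suc b) \<in> J" "?t b \<in> J" by (auto simp: J_def)
    then show "(\<Sum>t\<in>J. c (b, i) * s * (((if t = ?t (Suc b) then 1 else 0) - (if t = ?t b then 1 else 0)) * B t \<omega> $ i))
      = c (b, i) * s * (B (?t (Suc b)) \<omega> $ i - B (?t b) \<omega> $ i)"
     unfolding sum_distrib_left[symmetric] left_diff_distrib sum_subtractf by (simp only: pick)
   qed
   also have "\<dots> = L i \<omega>" unfolding L_def xi by (simp add: mult.assoc)
   finally show ?thesis .
  qed
  then show ?thesis using gproc[OF J, of d i] by simp
 qed
 have EL: "expectation (\<lambda>\<omega>. (L i \<omega>)^2) = (\<Sum>b<2 ^ m. \<Sum>b'<2 ^ m. c (b, i) * c (b', i) * fgn H (real b - real b'))" for i
 proof -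
  have "(L i \<omega>)^2 = (\<Sum>b<2 ^ m. \<Sum>b'<2 ^ m. c (b, i) * c (b', i) * (?N b b' i \<omega>))" for \<omega>
   unfolding L_def power2_eq_square sum_product by (simp add: mult_ac)
  then have "expectation (\<lambda>\<omega>. (L i \<omega>)^2)
    = expectation (\<lambda>\<omega>. \<Sum>b<2 ^ m. \<Sum>b'<2 ^ m. c (b, i) * c (b', i) * (?N b b' i \<omega>))"
   by simp
  also have "\<dots> = (\<Sum>b<2 ^ m. \<Sum>b'<2 ^ m. expectation (\<lambda>\<omega>. c (b, i) * c (b', i) * (?N b b' i \<omega>)))"
   using Exi(1) by (subst Bochner_Integration.integral_sum, force)
    (intro sum.cong refl Bochner_Integration.integral_sum, auto)
  also have "\<dots> = (\<Sum>b<2 ^ m. \<Sum>b'<2 ^ m. c (b, i) * c (b', i) * fgn H (real b - real b'))"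
   using Exi(2) by (intro sum.cong refl) simp
  finally show ?thesis .
 qed
 have ind: "indep_vars (\<lambda>_. borel) L UNIV"
 proof -
  \<comment> \<open>The same combination as a measurable function of the component path, since
    independence is assumed for the component paths as a whole.\<close>
  define F where "F i x = (\<Sum>b<2 ^ m. c (b, i) * (s * (x (?t (Suc b)) - x (?t b))))" for i and x :: "real \<Rightarrow> real"
  have "indep_vars (\<lambda>_. PiM {0..T} (\<lambda>_. borel)) (\<lambda>i \<omega>. \<lambda>t\<in>{0..T}. B t \<omega> $ i) UNIV"
   using fbm unfolding fractional_brownian_motion_def by blast
  then have "indep_vars (\<lambda>_. borel) (\<lambda>i \<omega>. F i (\<lambda>t\<in>{0..T}. B t \<omega> $ i)) UNIV"
  proof (rule indep_vars_compose2)
   fix i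
   have comp: "(\<lambda>x. x (?t b)) \<in> borel_measurable (PiM {0..T} (\<lambda>_. borel))" if "b \<le> 2 ^ m" for b
    using tin[OF that] by (rule measurable_component_singleton)
   show "F i \<in> borel_measurable (PiM {0..T} (\<lambda>_. borel))"
    unfolding F_def by (intro borel_measurable_sum borel_measurable_times borel_measurable_diff borel_measurable_const) (auto intro!: comp simp: Suc_le_eq)
  qed
  moreover have "F i (\<lambda>t\<in>{0..T}. B t \<omega> $ i) = L i \<omega>" for i \<omega>
   unfolding F_def L_def xi using tin by (intro sum.cong) auto
  ultimately show ?thesis by simp
 qed
 have "gaussian_moments M (\<Sum>i\<in>UNIV. expectation (\<lambda>\<omega>. (L i \<omega>)^2)) (\<lambda>\<omega>. \<Sum>i\<in>UNIV. L i \<omega>)"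
  by (rule gaussian_moments_sum[OF _ ind]) (auto intro: centered_gaussian_moments Lcg)
 moreover have "(\<Sum>i\<in>UNIV. expectation (\<lambda>\<omega>. (L i \<omega>)^2)) = qform ({..<2 ^ m} \<times> UNIV) (noise_cov H) c"
  unfolding EL by (subst noise_cov_sum) auto
 moreover have "(\<Sum>i\<in>UNIV. L i \<omega>) = (\<Sum>p\<in>{..<2 ^ m} \<times> UNIV. c p * noise_of T H B m (fst p) (snd p) \<omega>)" for \<omega>
  unfolding L_def by (subst sum.swap) (simp add: sum.cartesian_product split_def)
 ultimately show "gaussian_moments M (qform ({..<2 ^ m} \<times> UNIV) (noise_cov H) c)
   (\<lambda>\<omega>. \<Sum>p\<in>{..<2 ^ m} \<times> UNIV. c p * noise_of T H B m (fst p) (snd p) \<omega>)"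
  by simp
qed simp

lemma grid_simplex: "T > 0 \<Longrightarrow> a \<le> b \<Longrightarrow> b \<le> 2 ^ n \<Longrightarrow> (dyad T n a, dyad T n b) \<in> simplex2 T"
 using of_nat_mono[of b "2 ^ n", where 'a=real] by (auto simp: simplex2_def divide_right_mono field_simps)

text \<open>A uniform limit in probability is a uniform limit almost surely along a subsequence, and
  the iterated integrals of the polygons are continuous.\<close>

lemma canonical_lift_continuous_AE:
 fixes B :: "real \<Rightarrow> 'a \<Rightarrow> real ^ 'n" and X :: "'a \<Rightarrow> 'n two_param"
 assumes "prob_space M" and T: "T > 0" and lift: "canonical_lift M N T B X"
 shows "AE \<omega> in M. \<forall>w. length w \<le> N \<longrightarrow> continuous_on (simplex2 T) (\<lambda>(s, t). X \<omega> s t w)"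
proof -
 interpret prob_space M by fact
 define I where "I m \<omega> s t w = iterated_integral (dyadic_interpolation T m (\<lambda>u. B u \<omega>)) s t w" for m \<omega> s t w
 have "\<forall>w l. \<exists>E :: nat \<Rightarrow> 'a set. length w \<le> N \<longrightarrow>
   (\<forall>m. E m \<in> sets M \<and> (\<forall>\<omega> \<in> space M - E m. \<forall>(s, t)\<in>simplex2 T. \<bar>I m \<omega> s t w - X \<omega> s t w\<bar> \<le> 1 / real (Suc l))) \<and>
   (\<lambda>m. prob (E m)) \<longlonglongrightarrow> 0"
 proof (intro allI)
  fix w :: "'n list" and l
  show "\<exists>E :: nat \<Rightarrow> 'a set. length w \<le> N \<longrightarrow>
   (\<forall>m. E m \<in> sets M \<and> (\<forall>\<omega> \<in> space M - E m. \<forall>(s, t)\<in>simplex2 T. \<bar>I m \<omega> s t w - X \<omega> s t w\<bar> \<le> 1 / real (Suc l))) \<and>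
   (\<lambda>m. prob (E m)) \<longlonglongrightarrow> 0"
  proof (cases "length w \<le> N")
   case True
   then have "uniform_limit_in_prob M (simplex2 T) (\<lambda>m (s, t) \<omega>. I m \<omega> s t w) (\<lambda>(s, t) \<omega>. X \<omega> s t w)"
    using lift unfolding canonical_lift_def I_def by blast
   from this[unfolded uniform_limit_in_prob_def, rule_format, of "1 / real (Suc l)"] show ?thesis
    by (auto simp: split_def)
  qed simp
 qed
 then obtain E where "\<And>w l. length w \<le> N \<longrightarrow>
   (\<forall>m. E w l m \<in> sets M \<and> (\<forall>\<omega> \<in> space M - E w l m. \<forall>(s, t)\<in>simplex2 T. \<bar>I m \<omega> s t w - X \<omega> s t w\<bar> \<le> 1 / real (Suc l))) \<and>
   (\<lambda>m. prob (E w l m)) \<longlonglongrightarrow> 0"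
  unfolding choice_iff by (elim exE) (rule that, iprover)
 then have E: "\<And>w l m. length w \<le> N \<Longrightarrow> E w l m \<in> sets M"
  "\<And>w l m \<omega> s t. length w \<le> N \<Longrightarrow> \<omega> \<in> space M - E w l m \<Longrightarrow> (s, t) \<in> simplex2 T \<Longrightarrow> \<bar>I m \<omega> s t w - X \<omega> s t w\<bar> \<le> 1 / real (Suc l)"
  "\<And>w l. length w \<le> N \<Longrightarrow> (\<lambda>m. prob (E w l m)) \<longlonglongrightarrow> 0"
  by blast+
 define F where "F i m = (case from_nat i of (w, l) \<Rightarrow> if length w \<le> N then E w l m else {})" for i m
 have "F i m \<in> sets M" for i m unfolding F_def using E(1) by (simp add: split_beta)
 moreover have "(\<lambda>m. prob (F i m)) \<longlonglongrightarrow> 0" for i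
  using E(3) by (cases "length (fst (from_nat i :: 'n list \<times> nat)) \<le> N") (simp_all add: F_def split_beta)
 ultimately obtain r where r: "strict_mono r" "AE \<omega> in M. \<forall>i. \<forall>\<^sub>F j in sequentially. \<omega> \<notin> F i (r j)"
  using common_subsequence_AE[of F] by blast
 show ?thesis using r(2) AE_space
 proof eventually_elim
  case (elim \<omega>)
  show ?case
  proof (intro allI impI)
   fix w :: "'n list" assume w: "length w \<le> N"
   have "uniform_limit (simplex2 T) (\<lambda>j (s, t). I (r j) \<omega> s t w) (\<lambda>(s, t). X \<omega> s t w) sequentially"
   proof (rule uniform_limitI)
    fix e :: real assume "e > 0"
    then obtain l where l: "1 / real (Suc l) < e" using nat_approx_posE by blast
    have "\<forall>\<^sub>F j in sequentially. \<omega> \<notin> F (to_nat (w, l)) (r j)" using elim(1) by blast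
    then show "\<forall>\<^sub>F j in sequentially. \<forall>z\<in>simplex2 T. dist (case z of (s, t) \<Rightarrow> I (r j) \<omega> s t w) (case z of (s, t) \<Rightarrow> X \<omega> s t w) < e"
    proof eventually_elim
     case (elim j)
     then have "\<omega> \<in> space M - E w l (r j)" using w \<open>\<omega> \<in> space M\<close> by (simp add: F_def)
     then show ?case using E(2)[OF w, of \<omega> l "r j"] l by (fastforce simp: dist_real_def)
    qed
   qed
   then show "continuous_on (simplex2 T) (\<lambda>(s, t). X \<omega> s t w)"
   proof (rule uniform_limit_theorem[rotated])
    show "\<forall>\<^sub>F j in sequentially. continuous_on (simplex2 T) (\<lambda>(s, t). I (r j) \<omega> s t w)"
    unfolding I_def using iterated_integral_continuous[OF T] by (intro always_eventually allI)
   qed simp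
  qed
 qed
qed

text \<open>The canonical lift is a limit of signatures of dyadic polygons, and between grid points
  these are grid signatures with coefficients \<open>1 / k!\<close>. This puts it into the frame of
  \<open>noise_lift\<close>.\<close>

theorem fbm_besov_AE:
 fixes B :: "real \<Rightarrow> 'a \<Rightarrow> real ^ 'n" and X :: "'a \<Rightarrow> 'n two_param"
 assumes M: "prob_space M" and T: "T > 0" and H: "0 < H" "H \<le> 1 / 2" and N: "1 \<le> N"
  and fbm: "fractional_brownian_motion M T H B" and lift: "canonical_lift M N T B X"
 shows "AE \<omega> in M. besov_critical N H T (X \<omega>)"
proof -
 interpret prob_space M by fact
 let ?x = "\<lambda>m \<omega> b i. (T / 2 ^ m) powr H * noise_of T H B m b i \<omega>" and ?B = "\<lambda>m \<omega>. dyadic_interpolation T m (\<lambda>u. B u \<omega>)"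
 have sig_eq: "sig exp_coeff (?x m \<omega>) (a * 2 ^ (m - n)) ((b - a) * 2 ^ (m - n)) w
   = iterated_integral (?B m \<omega>) (dyad T n a) (dyad T n b) w"
  if "a \<le> b" "n \<le> m" for a b n m w \<omega>
 proof -
  have "iterated_integral (?B m \<omega>) (gp T m (a * 2 ^ (m - n))) (gp T m (b * 2 ^ (m - n))) w
    = sig exp_coeff (incr T m (\<lambda>u. B u \<omega>)) (a * 2 ^ (m - n)) (b * 2 ^ (m - n) - a * 2 ^ (m - n)) w"
   using that by (intro iterated_integral_sig[OF T]) simp
  then show ?thesis using that T by (simp add: gp_refine noise_of_scaled[OF T] diff_mult_distrib)
 qed
 have limit: "(\<lambda>m. prob {\<omega> \<in> space M. \<epsilon> < \<bar>sig exp_coeff (?x m \<omega>) (a * 2 ^ (m - n)) ((b - a) * 2 ^ (m - n)) w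
     - X \<omega> (dyad T n a) (dyad T n b) w\<bar>}) \<longlonglongrightarrow> 0"
  if ab: "a \<le> b" "b \<le> 2 ^ n" "length w \<le> N" "\<epsilon> > 0" for n a b w \<epsilon>
 proof -
  have "uniform_limit_in_prob M (simplex2 T) (\<lambda>m (s, t) \<omega>. iterated_integral (?B m \<omega>) s t w) (\<lambda>(s, t) \<omega>. X \<omega> s t w)"
   using lift ab unfolding canonical_lift_def by blast
  from this[unfolded uniform_limit_in_prob_def, rule_format, OF ab(4)]
  obtain E where E0: "\<forall>m. E m \<in> sets M \<and> (\<forall>\<omega>\<in>space M - E m. \<forall>z\<in>simplex2 T.
    \<bar>(case z of (s, t) \<Rightarrow> \<lambda>\<omega>. iterated_integral (?B m \<omega>) s t w) \<omega> - (case z of (s, t) \<Rightarrow> \<lambda>\<omega>. X \<omega> s t w) \<omega>\<bar> \<le> \<epsilon>)"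
   and E3: "(\<lambda>m. prob (E m)) \<longlonglongrightarrow> 0"
   by (elim exE conjE) (rule that)
  have E1: "E m \<in> sets M" for m using E0 by simp
  have E2: "\<bar>iterated_integral (?B m \<omega>) s t w - X \<omega> s t w\<bar> \<le> \<epsilon>"
   if "\<omega> \<in> space M - E m" "(s, t) \<in> simplex2 T" for m \<omega> s t
   using bspec[OF bspec[OF conjunct2[OF E0[rule_format, of m]] that(1)] that(2)] by simp
  show ?thesis
  proof (rule real_tendsto_sandwich[OF _ _ tendsto_const E3])
   show "\<forall>\<^sub>F m in sequentially. prob {\<omega> \<in> space M. \<epsilon> < \<bar>sig exp_coeff (?x m \<omega>) (a * 2 ^ (m - n)) ((b - a) * 2 ^ (m - n)) w
     - X \<omega> (dyad T n a) (dyad T n b) w\<bar>} \<le> prob (E m)"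
    using eventually_ge_at_top[of n]
   proof eventually_elim
    case (elim m)
    show ?case
    proof (rule finite_measure_mono[OF _ E1], rule subsetI, rule ccontr)
     fix \<omega> assume \<omega>: "\<omega> \<in> {\<omega> \<in> space M. \<epsilon> < \<bar>sig exp_coeff (?x m \<omega>) (a * 2 ^ (m - n)) ((b - a) * 2 ^ (m - n)) w
     - X \<omega> (dyad T n a) (dyad T n b) w\<bar>}" "\<omega> \<notin> E m"
     then show False using E2[of \<omega> m, OF _ grid_simplex[OF T ab(1,2)]] by (simp add: sig_eq[OF ab(1) elim])
    qed
   qed
  qed simp
 qed
 have meas: "(\<lambda>\<omega>. X \<omega> (dyad T n a) (dyad T n b) w) \<in> borel_measurable M"
  if "a \<le> b" "b \<le> 2 ^ n" "length w \<le> N" for n a b w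
  using lift grid_simplex[OF T that(1,2)] that(3) unfolding canonical_lift_def by blast
 \<comment> \<open>At level one the grid sums telescope, so for \<open>m \<ge> n\<close> the
   approximants do not depend on \<open>m\<close>.\<close>
 have level1: "AE \<omega> in M. X \<omega> (dyad T n k) (dyad T n (Suc k)) [i] = (T / 2 ^ n) powr H * noise_of T H B n k i \<omega>"
  if k: "k < 2 ^ n" for n k i
 proof (rule AE_eq_of_limit_in_prob[OF _ meas limit])
  have "noise_of T H B n k i \<in> borel_measurable M"
   using gaussian_family_measurable[OF fbm_noise[OF M T H(1) fbm, of n], of "(k, i)"] k by simp
  then show "(\<lambda>\<omega>. (T / 2 ^ n) powr H * noise_of T H B n k i \<omega>) \<in> borel_measurable M" by simp
  fix m \<omega> assume m: "n \<le> m"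
  have "sig exp_coeff (?x m \<omega>) (k * 2 ^ (m - n)) ((Suc k - k) * 2 ^ (m - n)) [i]
    = (\<Sum>b<2 ^ (m - n). incr T m (\<lambda>u. B u \<omega>) (k * 2 ^ (m - n) + b) i)"
   by (subst sig_single) (simp_all add: noise_of_scaled[OF T])
  also have "\<dots> = B (gp T m (k * 2 ^ (m - n) + 2 ^ (m - n))) \<omega> $ i - B (gp T m (k * 2 ^ (m - n))) \<omega> $ i"
   by (rule sum_incr[OF T])
  also have "k * 2 ^ (m - n) + 2 ^ (m - n) = Suc k * 2 ^ (m - n)" by simp
  also have "B (gp T m (Suc k * 2 ^ (m - n))) \<omega> $ i - B (gp T m (k * 2 ^ (m - n))) \<omega> $ i = incr T n (\<lambda>u. B u \<omega>) k i"
   unfolding gp_refine[OF T m] using T by (simp add: incr_def gp_T)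
  finally show "sig exp_coeff (?x m \<omega>) (k * 2 ^ (m - n)) ((Suc k - k) * 2 ^ (m - n)) [i]
    = (T / 2 ^ n) powr H * noise_of T H B n k i \<omega>" by (simp add: noise_of_scaled[OF T])
 qed (use k N in auto)
 interpret noise_lift M T H exp_coeff N "noise_of T H B" X
 proof unfold_locales
  show "AE \<omega> in M. \<forall>n i. \<forall>k<2 ^ n. X \<omega> (dyad T n k) (dyad T n (Suc k)) [i] = (T / 2 ^ n) powr H * noise_of T H B n k i \<omega>"
   unfolding AE_all_countable using level1 by (intro allI) (auto intro!: AE_impI)
 qed (use T H N fbm_noise[OF M T H(1) fbm] meas limit in auto)
 show ?thesis by (rule besov_regularity_AE[OF canonical_lift_continuous_AE[OF M T lift]])
qed

subsection \<open>Brownian motion and the Ito isometry\<close>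

lemma borel_measurable_vec_nth: "(\<lambda>x :: real ^ 'n. x $ i) \<in> borel_measurable borel"
 by (intro borel_measurable_continuous_onI continuous_intros)

locale brownian = prob_space M for M :: "'a measure" +
 fixes T :: real and W :: "real \<Rightarrow> 'a \<Rightarrow> real ^ 'n"
 assumes T: "0 < T" and bm: "brownian_motion M T W"
begin

abbreviation past :: "real \<Rightarrow> 'a measure" where
 "past \<equiv> natural_filtration M W"

lemma W_measurable: "t \<in> {0..T} \<Longrightarrow> W t \<in> borel_measurable M"
 using bm unfolding brownian_motion_def by blast

lemma W_nth_measurable: "t \<in> {0..T} \<Longrightarrow> (\<lambda>\<omega>. W t \<omega> $ i) \<in> borel_measurable M"
 using measurable_compose[OF W_measurable borel_measurable_vec_nth] .

lemma increment_moments: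
 assumes "0 \<le> s" "s \<le> t" "t \<le> T"
 shows "gaussian_moments M (t - s) (\<lambda>\<omega>. W t \<omega> $ i - W s \<omega> $ i)"
proof (cases "s = t")
 case False
 then have "distributed M lborel (\<lambda>\<omega>. W t \<omega> $ i - W s \<omega> $ i) (normal_density 0 (sqrt (t - s)))"
  using bm assms unfolding brownian_motion_def by simp
 from gaussian_moments_normal[OF this] False assms show ?thesis by simp
qed (simp add: gaussian_moments_const_0)

lemma space_past [simp]: "space (past c) = space M"
 by (simp add: natural_filtration_def space_measure_of_conv)

lemma sets_past: "sets (past c) = sigma_sets (space M) {W u -` A \<inter> space M | u A. 0 \<le> u \<and> u \<le> c \<and> A \<in> sets borel}"
 unfolding natural_filtration_def by (rule sets_measure_of) auto

lemma past_mono: "a \<le> c \<Longrightarrow> subalgebra (past c) (past a)"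
 unfolding subalgebra_def sets_past
 by (intro conjI sigma_sets_subseteq) (simp, blast intro: order.trans)

lemma past_subalgebra: "c \<le> T \<Longrightarrow> subalgebra M (past c)"
 unfolding subalgebra_def sets_past
 by (auto intro!: sets.sigma_sets_subset measurable_sets W_measurable)

lemma W_adapted: "0 \<le> u \<Longrightarrow> u \<le> c \<Longrightarrow> (\<lambda>\<omega>. W u \<omega> $ i) \<in> borel_measurable (past c)"
proof (rule measurable_compose[OF _ borel_measurable_vec_nth])
 assume "0 \<le> u" "u \<le> c"
 then show "W u \<in> borel_measurable (past c)"
  by (intro measurableI) (auto simp: sets_past)
qed

text \<open>Independence is given for increments over a partition only. The times in
  \<open>U\<close> are ordered together with \<open>0\<close> and \<open>c\<close>; the values of
  \<open>W\<close> there are almost surely sums of increments up to \<open>c\<close>, and the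
  increment from \<open>c\<close> to \<open>d\<close> is the next one.\<close>

lemma cylinder_indep_increment:
 assumes cd: "0 \<le> c" "c < d" "d \<le> T" and U: "finite U" "U \<subseteq> {0..c}"
  and S: "\<And>u. u \<in> U \<Longrightarrow> S u \<in> sets borel" and S': "S' \<in> sets borel"
 shows "prob ({\<omega> \<in> space M. \<forall>u\<in>U. W u \<omega> \<in> S u} \<inter> ((\<lambda>\<omega>. W d \<omega> - W c \<omega>) -` S' \<inter> space M))
  = prob {\<omega> \<in> space M. \<forall>u\<in>U. W u \<omega> \<in> S u} * prob ((\<lambda>\<omega>. W d \<omega> - W c \<omega>) -` S' \<inter> space M)"
proof -
 define V where "V = insert 0 (insert c U)"
 define l where "l = sorted_list_of_set V"
 define r where "r = length l - 1"
 have V: "finite V" "V \<subseteq> {0..c}" using U cd by (auto simp: V_def)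
 have l: "set l = V" "sorted_wrt (<) l" using V(1) by (simp_all add: l_def)
 have "l \<noteq> []" using l(1) by (auto simp: V_def)
 then have r: "length l = Suc r" by (simp add: r_def)
 have less: "l ! j < l ! k" if "j < k" "k \<le> r" for j k
  using sorted_wrt_nth_less[OF l(2) that(1)] that(2) r by simp
 have range: "l ! j \<in> {0..c}" if "j \<le> r" for j using nth_mem[of j l] that r l(1) V(2) by auto
 have mem: "\<exists>k\<le>r. u = l ! k" if "u \<in> V" for u
  using that r unfolding l(1)[symmetric] in_set_conv_nth by (auto simp: less_Suc_eq_le)
 have l0: "l ! 0 = 0"
 proof -
  obtain k where "k \<le> r" "0 = l ! k" using mem[of 0] by (auto simp: V_def)
  then show ?thesis using less[of 0 k] range[of 0] by (cases "k = 0") auto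
 qed
 have lr: "l ! r = c"
 proof -
  obtain k where "k \<le> r" "c = l ! k" using mem[of c] by (auto simp: V_def)
  then show ?thesis using less[of k r] range[of r] by (cases "k = r") auto
 qed
 define \<tau> where "\<tau> j = (if j \<le> r then l ! j else d)" for j
 define \<Delta> where "\<Delta> j \<omega> = W (\<tau> (Suc j)) \<omega> - W (\<tau> j) \<omega>" for j \<omega>
 have "0 \<le> \<tau> 0 \<and> \<tau> (Suc r) \<le> T \<and> (\<forall>j<Suc r. \<tau> j < \<tau> (Suc j))"
  using less cd lr l0 by (auto simp: \<tau>_def less_Suc_eq)
 then have ind: "indep_vars (\<lambda>_. borel) \<Delta> {..<Suc r}"
  using bm unfolding brownian_motion_def \<Delta>_def[abs_def] by blast
 have iv: "indep_var (PiM {..<r} (\<lambda>_. borel)) (\<lambda>\<omega>. restrict (\<lambda>j. \<Delta> j \<omega>) {..<r})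
   (PiM {r} (\<lambda>_. borel)) (\<lambda>\<omega>. restrict (\<lambda>j. \<Delta> j \<omega>) {r})"
  by (rule indep_var_restrict[OF ind]) auto
 obtain k where k: "\<And>u. u \<in> U \<Longrightarrow> k u \<le> r \<and> u = \<tau> (k u)"
  using mem unfolding \<tau>_def V_def by (metis insert_iff)
 define E where "E = {\<omega> \<in> space M. \<forall>u\<in>U. W u \<omega> \<in> S u}"
 define E' where "E' = {\<omega> \<in> space M. \<forall>u\<in>U. (\<Sum>j<k u. \<Delta> j \<omega>) \<in> S u}"
 define G where "G = (\<lambda>\<omega>. W d \<omega> - W c \<omega>) -` S' \<inter> space M"
 have \<Delta>m [measurable]: "\<Delta> j \<in> borel_measurable M" if "j \<le> r" for j
  using range that cd unfolding \<Delta>_def[abs_def] \<tau>_def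
  by (intro borel_measurable_diff W_measurable) (force split: if_splits)+
 have Wm: "W u \<in> borel_measurable M" if "u \<in> U" for u using that U(2) cd by (intro W_measurable) auto
 have "{\<omega> \<in> space M. W u \<omega> \<in> S u} \<in> sets M" if "u \<in> U" for u
  using measurable_sets[OF Wm[OF that] S[OF that]] by (simp add: vimage_def Int_def conj_commute)
 then have "E \<in> sets M" unfolding E_def using U(1) by (rule sets.sets_Collect_finite_All)
 moreover have "E' \<in> sets M" unfolding E'_def
 proof -
  have "{\<omega> \<in> space M. (\<Sum>j<k u. \<Delta> j \<omega>) \<in> S u} \<in> sets M" if "u \<in> U" for u
  proof -
   have "(\<lambda>\<omega>. \<Sum>j<k u. \<Delta> j \<omega>) \<in> borel_measurable M" using k[OF that] by (intro borel_measurable_sum \<Delta>m) auto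
   from measurable_sets[OF this S[OF that]] show ?thesis by (simp add: vimage_def Int_def conj_commute)
  qed
  then show "{\<omega> \<in> space M. \<forall>u\<in>U. (\<Sum>j<k u. \<Delta> j \<omega>) \<in> S u} \<in> sets M" using U(1) by (rule sets.sets_Collect_finite_All)
 qed
 moreover have "G \<in> sets M" unfolding G_def
  using W_measurable[of c] W_measurable[of d] cd S' by (intro measurable_sets[OF _ S'] borel_measurable_diff) auto
 moreover have "AE \<omega> in M. \<omega> \<in> E \<longleftrightarrow> \<omega> \<in> E'"
 proof -
  have "AE \<omega> in M. W 0 \<omega> = 0" using bm unfolding brownian_motion_def by blast
  then show ?thesis
  proof eventually_elim
   case (elim \<omega>)
   have "(\<Sum>j<k u. \<Delta> j \<omega>) = W u \<omega>" if "u \<in> U" for u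
   proof -
    have "(\<Sum>j<k u. \<Delta> j \<omega>) = W (\<tau> (k u)) \<omega> - W (\<tau> 0) \<omega>"
     unfolding \<Delta>_def using sum_lessThan_telescope[of "\<lambda>j. W (\<tau> j) \<omega>"] .
    then show ?thesis using k[OF that, THEN conjunct2, symmetric] elim l0 by (simp add: \<tau>_def[of 0])
   qed
   then show ?case by (auto simp: E_def E'_def)
  qed
 qed
 ultimately have eq: "prob (E \<inter> G) = prob (E' \<inter> G)" "prob E = prob E'"
  by (auto intro!: finite_measure_eq_AE)
 define Xa where "Xa = {x \<in> space (PiM {..<r} (\<lambda>_. borel)). \<forall>u\<in>U. (\<Sum>j<k u. x j) \<in> S u}"
 define Xb where "Xb = {x \<in> space (PiM {r} (\<lambda>_. borel)). x r \<in> S'}"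
 have Xb: "Xb \<in> sets (PiM {r} (\<lambda>_. borel))"
  unfolding Xb_def using measurable_sets[OF measurable_component_singleton[of r "{r}" "\<lambda>_. borel"] S']
  by (simp add: vimage_def Int_def conj_commute)
 have "{x \<in> space (PiM {..<r} (\<lambda>_. borel)). (\<Sum>j<k u. x j) \<in> S u} \<in> sets (PiM {..<r} (\<lambda>_. borel))" if "u \<in> U" for u
 proof -
  have "(\<lambda>x. \<Sum>j<k u. x j :: real ^ 'n) \<in> borel_measurable (PiM {..<r} (\<lambda>_. borel))"
   using k[OF that] by (intro borel_measurable_sum measurable_component_singleton) auto
  from measurable_sets[OF this S[OF that]] show ?thesis by (simp add: vimage_def Int_def conj_commute)
 qed
 then have Xa: "Xa \<in> sets (PiM {..<r} (\<lambda>_. borel))" unfolding Xa_def using U(1) by (rule sets.sets_Collect_finite_All)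
 have "(\<lambda>\<omega>. restrict (\<lambda>j. \<Delta> j \<omega>) {..<r}) -` Xa \<inter> space M = E'"
 proof -
  have "(\<Sum>j<k u. restrict (\<lambda>j. \<Delta> j \<omega>) {..<r} j) = (\<Sum>j<k u. \<Delta> j \<omega>)" if "u \<in> U" for u \<omega>
   using k[OF that] by (intro sum.cong) auto
  then show ?thesis by (auto simp: Xa_def E'_def space_PiM simp del: restrict_apply)
 qed
 moreover have "(\<lambda>\<omega>. restrict (\<lambda>j. \<Delta> j \<omega>) {r}) -` Xb \<inter> space M = G"
  using lr by (auto simp: Xb_def G_def space_PiM \<Delta>_def \<tau>_def)
 moreover have "(\<lambda>\<omega>. (restrict (\<lambda>j. \<Delta> j \<omega>) {..<r}, restrict (\<lambda>j. \<Delta> j \<omega>) {r})) -` (Xa \<times> Xb) \<inter> space M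
   = ((\<lambda>\<omega>. restrict (\<lambda>j. \<Delta> j \<omega>) {..<r}) -` Xa \<inter> space M) \<inter> ((\<lambda>\<omega>. restrict (\<lambda>j. \<Delta> j \<omega>) {r}) -` Xb \<inter> space M)"
  by auto
 ultimately have "prob (E' \<inter> G) = prob E' * prob G" using indep_varD[OF iv Xa Xb] by simp
 then show ?thesis unfolding E_def[symmetric] G_def[symmetric] eq .
qed

text \<open>Cylinder sets are stable under intersection and generate the past, so independence
  extends from them by the pi-lambda argument.\<close>

lemma past_indep_increment:
 assumes cd: "0 \<le> c" "c < d" "d \<le> T" and G: "G \<in> borel_measurable (past c)"
 shows "indep_var borel G borel (\<lambda>\<omega>. W d \<omega> $ j - W c \<omega> $ j)"
proof -
 let ?Z = "\<lambda>\<omega>. W d \<omega> - W c \<omega>"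
 define A where "A = {{\<omega> \<in> space M. \<forall>u\<in>U. W u \<omega> \<in> S u} | U S. finite U \<and> U \<subseteq> {0..c} \<and> (\<forall>u\<in>U. S u \<in> sets borel)}"
 define B where "B = {?Z -` S \<inter> space M | S. S \<in> sets borel}"
 have Zm: "?Z \<in> borel_measurable M" using cd by (intro borel_measurable_diff W_measurable) auto
 have AE: "A \<subseteq> sets M"
 proof
  fix E assume "E \<in> A"
  then obtain U S where U: "finite U" "U \<subseteq> {0..c}" "\<And>u. u \<in> U \<Longrightarrow> S u \<in> sets borel"
   and E: "E = {\<omega> \<in> space M. \<forall>u\<in>U. W u \<omega> \<in> S u}" unfolding A_def by blast
  have "{\<omega> \<in> space M. W u \<omega> \<in> S u} \<in> sets M" if "u \<in> U" for u
   using measurable_sets[OF W_measurable U(3)[OF that], of u] that U(2) cd by (auto simp: vimage_def Int_def conj_commute)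
  then show "E \<in> sets M" unfolding E using U(1) by (rule sets.sets_Collect_finite_All)
 qed
 have "indep_set A B"
 proof (rule indep_setI[OF AE])
  show "B \<subseteq> sets M" unfolding B_def using Zm by (auto intro: measurable_sets)
  fix a b assume "a \<in> A" "b \<in> B"
  then obtain U S S' where U: "finite U" "U \<subseteq> {0..c}" "\<forall>u\<in>U. S u \<in> sets borel" "S' \<in> sets borel"
   and ab: "a = {\<omega> \<in> space M. \<forall>u\<in>U. W u \<omega> \<in> S u}" "b = ?Z -` S' \<inter> space M"
   unfolding A_def B_def by (elim CollectE exE conjE) (rule that, assumption+)
  show "prob (a \<inter> b) = prob a * prob b"
   unfolding ab using U by (intro cylinder_indep_increment[OF cd]) auto
 qed
 moreover have "Int_stable A" unfolding Int_stable_def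
 proof (intro ballI)
  fix a b assume "a \<in> A" "b \<in> A"
  from \<open>a \<in> A\<close> obtain U S where U: "finite U" "U \<subseteq> {0..c}" "\<forall>u\<in>U. S u \<in> sets borel"
   and a: "a = {\<omega> \<in> space M. \<forall>u\<in>U. W u \<omega> \<in> S u}"
   unfolding A_def by (elim CollectE exE conjE) (rule that)
  from \<open>b \<in> A\<close> obtain U' S' where U': "finite U'" "U' \<subseteq> {0..c}" "\<forall>u\<in>U'. S' u \<in> sets borel"
   and b: "b = {\<omega> \<in> space M. \<forall>u\<in>U'. W u \<omega> \<in> S' u}"
   unfolding A_def by (elim CollectE exE conjE) (rule that)
  define S'' where "S'' u = (if u \<in> U then S u else UNIV) \<inter> (if u \<in> U' then S' u else UNIV)" for u
  have "a \<inter> b = {\<omega> \<in> space M. \<forall>u\<in>U \<union> U'. W u \<omega> \<in> S'' u}"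
   unfolding a b S''_def by auto
  then show "a \<inter> b \<in> A" unfolding A_def
   using U U' by (intro CollectI exI[of _ "U \<union> U'"] exI[of _ S'']) (auto simp: S''_def)
 qed
 moreover have "Int_stable B" unfolding Int_stable_def
 proof (intro ballI)
  fix a b assume "a \<in> B" "b \<in> B"
  then obtain S S' where "S \<in> sets borel" "S' \<in> sets borel" "a = ?Z -` S \<inter> space M" "b = ?Z -` S' \<inter> space M"
   unfolding B_def by (elim CollectE exE conjE) (rule that)
  then show "a \<inter> b \<in> B" unfolding B_def by (intro CollectI exI[of _ "S \<inter> S'"]) auto
 qed
 ultimately have isets: "indep_set (sigma_sets (space M) A) (sigma_sets (space M) B)"
  by (rule indep_set_sigma_sets)
 have "{W u -` S \<inter> space M | u S. 0 \<le> u \<and> u \<le> c \<and> S \<in> sets borel} \<subseteq> A"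
 proof clarify
  fix u and S :: "(real ^ 'n) set" assume u: "0 \<le> u" "u \<le> c" "S \<in> sets borel"
  then show "W u -` S \<inter> space M \<in> A" unfolding A_def
   by (intro CollectI exI[of _ "{u}"] exI[of _ "\<lambda>_. S"]) auto
 qed
 then have "sets (past c) \<subseteq> sigma_sets (space M) A" unfolding sets_past by (rule sigma_sets_subseteq)
 then have "{G -` S \<inter> space M | S. S \<in> sets borel} \<subseteq> sigma_sets (space M) A"
  using measurable_sets[OF G] by auto
 then have sub1: "sigma_sets (space M) {G -` S \<inter> space M | S. S \<in> sets borel} \<subseteq> sigma_sets (space M) A"
  by (rule sigma_sets_mono)
 let ?Y = "\<lambda>\<omega>. W d \<omega> $ j - W c \<omega> $ j"
 have "{?Y -` S \<inter> space M | S. S \<in> sets borel} \<subseteq> B"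
 proof clarify
  fix S :: "real set" assume "S \<in> sets borel"
  then have "(\<lambda>x. x $ j) -` S \<in> sets (borel :: (real ^ 'n) measure)"
   using measurable_sets[OF borel_measurable_vec_nth[of j]] by simp
  then show "?Y -` S \<inter> space M \<in> B" unfolding B_def
   by (intro CollectI exI[of _ "(\<lambda>x. x $ j) -` S"]) auto
 qed
 then have sub2: "sigma_sets (space M) {?Y -` S \<inter> space M | S. S \<in> sets borel} \<subseteq> sigma_sets (space M) B"
  by (rule sigma_sets_subseteq)
 have "indep_set (sigma_sets (space M) {G -` S \<inter> space M | S. S \<in> sets borel})
   (sigma_sets (space M) {?Y -` S \<inter> space M | S. S \<in> sets borel})"
  using isets unfolding indep_set_def
  by (rule indep_sets_mono_sets) (use sub1 sub2 in \<open>auto split: bool.split\<close>)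
 moreover have "G \<in> borel_measurable M" using measurable_from_subalg[OF past_subalgebra G] cd by simp
 moreover have "?Y \<in> borel_measurable M" using measurable_compose[OF Zm borel_measurable_vec_nth[of j]] by simp
 ultimately show ?thesis unfolding indep_var_eq by blast
qed

lemma times_increment:
 fixes j :: 'n
 assumes cd: "0 \<le> c" "c \<le> d" "d \<le> T" and G: "G \<in> borel_measurable (past c)" "integrable M G"
 defines "Z \<equiv> \<lambda>\<omega>. W d \<omega> $ j - W c \<omega> $ j"
 shows "integrable M (\<lambda>\<omega>. G \<omega> * Z \<omega>)" "expectation (\<lambda>\<omega>. G \<omega> * Z \<omega>) = 0"
  "integrable M (\<lambda>\<omega>. G \<omega> * (Z \<omega>)^2)" "expectation (\<lambda>\<omega>. G \<omega> * (Z \<omega>)^2) = expectation G * (d - c)"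
proof -
 have "integrable M (\<lambda>\<omega>. G \<omega> * Z \<omega>) \<and> expectation (\<lambda>\<omega>. G \<omega> * Z \<omega>) = 0 \<and>
  integrable M (\<lambda>\<omega>. G \<omega> * (Z \<omega>)^2) \<and> expectation (\<lambda>\<omega>. G \<omega> * (Z \<omega>)^2) = expectation G * (d - c)"
 proof (cases "c = d")
  case False
  then have ind: "indep_var borel G borel Z" unfolding Z_def using cd G by (intro past_indep_increment) auto
  have "gaussian_moments M (d - c) Z" unfolding Z_def using cd by (rule increment_moments)
  then have Z: "integrable M (\<lambda>\<omega>. Z \<omega> ^ k)" "expectation (\<lambda>\<omega>. Z \<omega> ^ k) = gauss_moment k (d - c)" for k
   unfolding gaussian_moments_def by blast+
  have Z1: "integrable M Z" "expectation Z = 0" using Z[of 1] by (simp_all add: gauss_moment_def)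
  have ind2: "indep_var borel G borel (\<lambda>\<omega>. (Z \<omega>)^2)"
   using indep_var_compose[OF ind measurable_ident, of "\<lambda>x. x\<^sup>2" borel] by (simp add: o_def)
  show ?thesis
   using indep_var_integrable[OF ind G(2) Z1(1)] indep_var_lebesgue_integral[OF ind G(2) Z1(1)] Z1
    indep_var_integrable[OF ind2 G(2) Z(1)] indep_var_lebesgue_integral[OF ind2 G(2) Z(1)] Z(2)[of 2] by simp
 qed (simp add: Z_def)
 then show "integrable M (\<lambda>\<omega>. G \<omega> * Z \<omega>)" "expectation (\<lambda>\<omega>. G \<omega> * Z \<omega>) = 0"
  "integrable M (\<lambda>\<omega>. G \<omega> * (Z \<omega>)^2)" "expectation (\<lambda>\<omega>. G \<omega> * (Z \<omega>)^2) = expectation G * (d - c)" by blast+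
qed

text \<open>If the intervals overlap, cutting at \<open>c\<close> and at \<open>e = min b d\<close>
  leaves five products. Four of them are a variable of the past times a later increment and have
  mean zero; the squared increment over the overlap gives its length.\<close>

lemma ito_covariance_le:
 fixes j :: 'n
 assumes ab: "0 \<le> a" "a \<le> b" "b \<le> T" and cd: "a \<le> c" "c \<le> d" "d \<le> T"
  and \<xi>: "\<xi> \<in> borel_measurable (past a)" "integrable M (\<lambda>\<omega>. (\<xi> \<omega>)^2)"
  and \<eta>: "\<eta> \<in> borel_measurable (past c)" "integrable M (\<lambda>\<omega>. (\<eta> \<omega>)^2)"
 defines "B \<equiv> \<lambda>u \<omega>. W u \<omega> $ j"
 shows "integrable M (\<lambda>\<omega>. \<xi> \<omega> * (B b \<omega> - B a \<omega>) * (\<eta> \<omega> * (B d \<omega> - B c \<omega>))) \<and>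
  expectation (\<lambda>\<omega>. \<xi> \<omega> * (B b \<omega> - B a \<omega>) * (\<eta> \<omega> * (B d \<omega> - B c \<omega>)))
   = expectation (\<lambda>\<omega>. \<xi> \<omega> * \<eta> \<omega>) * max 0 (min b d - c)"
proof -
 have up: "f \<in> borel_measurable (past v)" if "f \<in> borel_measurable (past u)" "u \<le> v" for f :: "'a \<Rightarrow> real" and u v
  using measurable_from_subalg[OF past_mono[OF that(2)] that(1)] .
 have toM: "f \<in> borel_measurable M" if "f \<in> borel_measurable (past u)" "u \<le> T" for f :: "'a \<Rightarrow> real" and u
  using measurable_from_subalg[OF past_subalgebra[OF that(2)] that(1)] .
 have Bp: "B u \<in> borel_measurable (past v)" if "0 \<le> u" "u \<le> v" for u v
  unfolding B_def using W_adapted[OF that] .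
 have \<xi>sq: "(\<lambda>\<omega>. (\<xi> \<omega>)^2) \<in> borel_measurable (past a)" using \<xi>(1) by simp
 have P: "(\<lambda>\<omega>. \<xi> \<omega> * (B u \<omega> - B a \<omega>) * \<eta> \<omega>) \<in> borel_measurable (past v)"
  "integrable M (\<lambda>\<omega>. \<xi> \<omega> * (B u \<omega> - B a \<omega>) * \<eta> \<omega>)" if "a \<le> u" "u \<le> v" "c \<le> v" "v \<le> T" for u v
 proof -
  show "(\<lambda>\<omega>. \<xi> \<omega> * (B u \<omega> - B a \<omega>) * \<eta> \<omega>) \<in> borel_measurable (past v)"
   using ab cd that by (intro borel_measurable_times borel_measurable_diff Bp up[OF \<xi>(1)] up[OF \<eta>(1)]) auto
  have "integrable M (\<lambda>\<omega>. (\<xi> \<omega>)^2 * (B u \<omega> - B a \<omega>)^2)"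
   unfolding B_def using ab that \<xi>sq \<xi>(2) by (intro times_increment(3)) auto
  moreover have "(\<lambda>\<omega>. \<xi> \<omega> * (B u \<omega> - B a \<omega>)) \<in> borel_measurable M"
   using ab cd that by (intro borel_measurable_times borel_measurable_diff toM[OF Bp, of _ u] toM[OF \<xi>(1)]) auto
  ultimately show "integrable M (\<lambda>\<omega>. \<xi> \<omega> * (B u \<omega> - B a \<omega>) * \<eta> \<omega>)"
   using cd \<eta> by (intro integrable_mult_of_squares toM[OF \<eta>(1)]) (simp_all add: power_mult_distrib)
 qed
 have Q: "(\<lambda>\<omega>. \<xi> \<omega> * \<eta> \<omega>) \<in> borel_measurable (past c)" "integrable M (\<lambda>\<omega>. \<xi> \<omega> * \<eta> \<omega>)"
  using ab cd \<xi> \<eta> by (auto intro!: borel_measurable_times integrable_mult_of_squares up[OF \<xi>(1)] toM[OF \<xi>(1)] toM[OF \<eta>(1)])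
 show ?thesis
 proof (cases "b \<le> c")
  case True
  have e: "\<xi> \<omega> * (B b \<omega> - B a \<omega>) * (\<eta> \<omega> * (B d \<omega> - B c \<omega>)) = (\<xi> \<omega> * (B b \<omega> - B a \<omega>) * \<eta> \<omega>) * (W d \<omega> $ j - W c \<omega> $ j)" for \<omega>
   by (simp add: B_def)
  have "max 0 (min b d - c) = 0" using True by simp
  then show ?thesis unfolding e
   using times_increment(1,2)[OF _ cd(2,3) P[of b c]] ab cd True by simp
 next
  case False
  define e where "e = min b d"
  have e: "c \<le> e" "e \<le> b" "e \<le> d" "e \<le> T" "e = b \<or> e = d" using False cd ab by (auto simp: e_def)
  have Q2: "(\<lambda>\<omega>. (\<xi> \<omega> * \<eta> \<omega>) * (B e \<omega> - B c \<omega>)) \<in> borel_measurable (past e)"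
   using ab cd e by (intro borel_measurable_times borel_measurable_diff Bp up[OF \<xi>(1)] up[OF \<eta>(1)]) auto
  have c0: "0 \<le> c" "0 \<le> e" using ab cd e by auto
  note t1 = times_increment[OF c0(1) e(1) e(4) P[of c c], of j]
  note t2 = times_increment[OF c0(2) e(3) cd(3) P[of c e], of j]
  note t3 = times_increment[OF c0(1) e(1) e(4) Q, of j]
  note t4 = times_increment[OF c0(2) e(3) cd(3) Q2, unfolded B_def, OF t3(1), of j]
  note t5 = times_increment[OF c0(2) e(2) ab(3) Q2, unfolded B_def, OF t3(1), of j]
  \<comment> \<open>\<open>e\<close> is one of the two right end points, so one of the increments
    beyond \<open>e\<close> is zero.\<close>
  have z: "(B b \<omega> - B e \<omega>) * (B d \<omega> - B e \<omega>) = 0" for \<omega> using e(5) by auto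
  have eq: "\<xi> \<omega> * (B b \<omega> - B a \<omega>) * (\<eta> \<omega> * (B d \<omega> - B c \<omega>))
   = (\<xi> \<omega> * (B c \<omega> - B a \<omega>) * \<eta> \<omega>) * (W e \<omega> $ j - W c \<omega> $ j)
   + (\<xi> \<omega> * (B c \<omega> - B a \<omega>) * \<eta> \<omega>) * (W d \<omega> $ j - W e \<omega> $ j)
   + (\<xi> \<omega> * \<eta> \<omega>) * (W e \<omega> $ j - W c \<omega> $ j)^2
   + ((\<xi> \<omega> * \<eta> \<omega>) * (W e \<omega> $ j - W c \<omega> $ j)) * (W d \<omega> $ j - W e \<omega> $ j)
   + ((\<xi> \<omega> * \<eta> \<omega>) * (W e \<omega> $ j - W c \<omega> $ j)) * (W b \<omega> $ j - W e \<omega> $ j)" for \<omega>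
  proof -
   have "x * (bb - ba) * (y * (bd - bc)) = (x * (bc - ba) * y) * (be - bc) + (x * (bc - ba) * y) * (bd - be)
     + (x * y) * (be - bc)^2 + ((x * y) * (be - bc)) * (bd - be) + ((x * y) * (be - bc)) * (bb - be)
     + x * y * ((bb - be) * (bd - be))" for x y ba bb bc bd be :: real by algebra
   from this[of "\<xi> \<omega>" "B b \<omega>" "B a \<omega>" "\<eta> \<omega>" "B d \<omega>" "B c \<omega>" "B e \<omega>"] z show ?thesis by (simp add: B_def)
  qed
  have "max 0 (min b d - c) = e - c" using e(1) by (simp add: e_def)
  then show ?thesis unfolding eq using t1 t2 t3 t4 t5 ab cd e by simp
 qed
qed

lemma ito_covariance:
 assumes ab: "0 \<le> a" "a \<le> b" "b \<le> T" and cd: "0 \<le> c" "c \<le> d" "d \<le> T"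
  and \<xi>: "\<xi> \<in> borel_measurable (past a)" "integrable M (\<lambda>\<omega>. (\<xi> \<omega>)^2)"
  and \<eta>: "\<eta> \<in> borel_measurable (past c)" "integrable M (\<lambda>\<omega>. (\<eta> \<omega>)^2)"
 shows "integrable M (\<lambda>\<omega>. \<xi> \<omega> * (W b \<omega> $ j - W a \<omega> $ j) * (\<eta> \<omega> * (W d \<omega> $ j - W c \<omega> $ j)))"
  "expectation (\<lambda>\<omega>. \<xi> \<omega> * (W b \<omega> $ j - W a \<omega> $ j) * (\<eta> \<omega> * (W d \<omega> $ j - W c \<omega> $ j)))
   = expectation (\<lambda>\<omega>. \<xi> \<omega> * \<eta> \<omega>) * max 0 (min b d - max a c)"
 using ito_covariance_le[OF ab _ cd(2,3) \<xi> \<eta>, of j] ito_covariance_le[OF cd _ ab(2,3) \<eta> \<xi>, of j]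
 by (cases "a \<le> c"; simp add: max_def min.commute mult.commute)+

text \<open>The intervals may overlap, and both sides are the same double sum over lengths of
  overlaps. In this form the isometry applies directly to the difference of two simple integrals
  over different partitions.\<close>

lemma ito_isometry:
 fixes \<xi> :: "'i \<Rightarrow> 'a \<Rightarrow> real"
 assumes I: "finite I" and ab: "\<And>i. i \<in> I \<Longrightarrow> 0 \<le> a i \<and> a i \<le> b i \<and> b i \<le> T"
  and \<xi>: "\<And>i. i \<in> I \<Longrightarrow> \<xi> i \<in> borel_measurable (past (a i))" "\<And>i. i \<in> I \<Longrightarrow> integrable M (\<lambda>\<omega>. (\<xi> i \<omega>)^2)"
 shows "(\<integral>\<^sup>+\<omega>. ennreal ((\<Sum>i\<in>I. \<xi> i \<omega> * (W (b i) \<omega> $ j - W (a i) \<omega> $ j))^2) \<partial>M)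
  = (\<integral>\<^sup>+\<omega>. (\<integral>\<^sup>+u. ennreal ((\<Sum>i\<in>I. \<xi> i \<omega> * indicator {a i<..b i} u)^2) \<partial>lborel) \<partial>M)"
proof -
 define L where "L i k = max 0 (min (b i) (b k) - max (a i) (a k))" for i k
 define B where "B i \<omega> = W (b i) \<omega> $ j - W (a i) \<omega> $ j" for i \<omega>
 let ?f = "\<lambda>\<omega> u. \<Sum>i\<in>I. \<xi> i \<omega> * indicator {a i<..b i} u" and ?S = "\<lambda>\<omega>. \<Sum>i\<in>I. \<Sum>k\<in>I. \<xi> i \<omega> * \<xi> k \<omega> * L i k"
 let ?Q = "\<lambda>\<omega>. \<Sum>i\<in>I. \<Sum>k\<in>I. \<xi> i \<omega> * B i \<omega> * (\<xi> k \<omega> * B k \<omega>)"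
 have "(\<integral>\<^sup>+\<omega>. ennreal ((\<Sum>i\<in>I. \<xi> i \<omega> * B i \<omega>)^2) \<partial>M)
   = (\<integral>\<^sup>+\<omega>. ennreal (?Q \<omega>) \<partial>M)"
  unfolding power2_eq_square sum_product ..
 also have "\<dots> = ennreal (expectation ?Q)"
 proof (rule nn_integral_eq_integral)
  show "integrable M ?Q"
   unfolding B_def using ab \<xi> by (intro Bochner_Integration.integrable_sum ito_covariance) auto
  show "AE \<omega> in M. 0 \<le> (?Q \<omega>)"
   unfolding sum_product[symmetric] by (intro AE_I2) simp
 qed
 also have "expectation ?Q
   = (\<Sum>i\<in>I. \<Sum>k\<in>I. expectation (\<lambda>\<omega>. \<xi> i \<omega> * B i \<omega> * (\<xi> k \<omega> * B k \<omega>)))"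
  unfolding B_def using ab \<xi>
  by (subst Bochner_Integration.integral_sum; intro Bochner_Integration.integrable_sum ito_covariance sum.cong refl Bochner_Integration.integral_sum)
   auto
 also have "\<dots> = (\<Sum>i\<in>I. \<Sum>k\<in>I. expectation (\<lambda>\<omega>. \<xi> i \<omega> * \<xi> k \<omega>) * L i k)"
  unfolding B_def L_def using ab \<xi> by (intro sum.cong refl ito_covariance(2)) auto
 finally have 1: "(\<integral>\<^sup>+\<omega>. ennreal ((\<Sum>i\<in>I. \<xi> i \<omega> * B i \<omega>)^2) \<partial>M)
   = ennreal (\<Sum>i\<in>I. \<Sum>k\<in>I. expectation (\<lambda>\<omega>. \<xi> i \<omega> * \<xi> k \<omega>) * L i k)" .
 have inner: "(\<integral>\<^sup>+u. ennreal ((?f \<omega> u)^2) \<partial>lborel) = ennreal (?S \<omega>)"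
  and nonneg: "0 \<le> (?S \<omega>)" for \<omega>
 proof -
  have sq: "(?f \<omega> u)^2
    = (\<Sum>i\<in>I. \<Sum>k\<in>I. \<xi> i \<omega> * \<xi> k \<omega> * indicator {max (a i) (a k)<..min (b i) (b k)} u)" for u
   unfolding power2_eq_square sum_product by (intro sum.cong refl) (auto simp: indicator_def)
  have hb: "has_bochner_integral lborel (\<lambda>u. (?f \<omega> u)^2) (?S \<omega>)"
   unfolding sq
  proof (intro has_bochner_integral_sum has_bochner_integral_mult_right)
   fix i k
   have em: "emeasure lborel {max (a i) (a k)<..min (b i) (b k)} = ennreal (L i k)"
    by (cases "max (a i) (a k) \<le> min (b i) (b k)") (auto simp: L_def max_def)
   have "measure lborel {max (a i) (a k)<..min (b i) (b k)} = L i k"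
    unfolding measure_def em by (rule enn2real_ennreal) (simp add: L_def)
   then show "has_bochner_integral lborel (indicator {max (a i) (a k)<..min (b i) (b k)}) (L i k)"
    using has_bochner_integral_real_indicator[of "{max (a i) (a k)<..min (b i) (b k)}" lborel] em by (simp del: emeasure_lborel_Ioc)
  qed
  then show "0 \<le> (?S \<omega>)"
   using has_bochner_integral_integral_eq[OF hb] Bochner_Integration.integral_nonneg[of lborel "\<lambda>u. (?f \<omega> u)^2"]
   by simp
  show "(\<integral>\<^sup>+u. ennreal ((?f \<omega> u)^2) \<partial>lborel) = ennreal (?S \<omega>)"
   using nn_integral_eq_integral[of lborel "\<lambda>u. (?f \<omega> u)^2"]
    has_bochner_integral_integral_eq[OF hb] has_bochner_integral_integrable hb[THEN integrable.intros] by simp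
 qed
 have \<xi>\<xi>: "integrable M (\<lambda>\<omega>. \<xi> i \<omega> * \<xi> k \<omega>)" if "i \<in> I" "k \<in> I" for i k
  using that ab \<xi> by (intro integrable_mult_of_squares measurable_from_subalg[OF past_subalgebra \<xi>(1)]) force+
 have "(\<integral>\<^sup>+\<omega>. ennreal (?S \<omega>) \<partial>M) = ennreal (expectation (\<lambda>\<omega>. \<Sum>i\<in>I. \<Sum>k\<in>I. \<xi> i \<omega> * \<xi> k \<omega> * L i k))"
  using \<xi>\<xi> nonneg by (intro nn_integral_eq_integral Bochner_Integration.integrable_sum) auto
 also have "expectation (\<lambda>\<omega>. \<Sum>i\<in>I. \<Sum>k\<in>I. \<xi> i \<omega> * \<xi> k \<omega> * L i k) = (\<Sum>i\<in>I. \<Sum>k\<in>I. expectation (\<lambda>\<omega>. \<xi> i \<omega> * \<xi> k \<omega>) * L i k)"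
  using \<xi>\<xi> by (simp add: Bochner_Integration.integral_sum)
 finally show ?thesis using 1 unfolding inner B_def by simp
qed

end

section \<open>Left-point Riemann sums of the Ito integral\<close>

lemma partition_of_mono:
 assumes "partition_of s t r p" "j \<le> k" "k \<le> r"
 shows "p j \<le> p k"
 using assms(2,3)
proof (induction k rule: dec_induct)
 case (step l)
 then have "p l \<le> p (Suc l)" using assms(1) by (simp add: partition_of_def)
 then show ?case using step by simp
qed simp

lemma partition_of_range: "partition_of s t r p \<Longrightarrow> k \<le> r \<Longrightarrow> s \<le> p k \<and> p k \<le> t"
 using partition_of_mono[of s t r p 0 k] partition_of_mono[of s t r p k r] by (simp add: partition_of_def)

lemma partition_cell:
 assumes p: "partition_of s t r p" and u: "s < u" "u \<le> t"
 shows "\<exists>k<r. p k < u \<and> u \<le> p (Suc k)"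
proof -
 define k where "k = (LEAST k. u \<le> p k)"
 have ur: "u \<le> p r" using p u by (simp add: partition_of_def)
 have k: "u \<le> p k" unfolding k_def by (rule LeastI[of _ r]) fact
 have kr: "k \<le> r" unfolding k_def by (rule Least_le) fact
 have "k \<noteq> 0" using k p u by (metis leD partition_of_def)
 then obtain l where l: "k = Suc l" by (cases k) auto
 have "\<not> u \<le> p l" unfolding k_def[symmetric] using not_less_Least[of l "\<lambda>k. u \<le> p k"] l k_def by simp
 then show ?thesis using k kr l by (intro exI[of _ l]) auto
qed

lemma simple_process_cell:
 assumes p: "partition_of s t r p" and k: "k < r" "p k < u" "u \<le> p (Suc k)"
 shows "simple_process r p \<xi> u \<omega> = \<xi> k \<omega>"
proof -
 have "\<xi> j \<omega> * indicator {p j<..p (Suc j)} u = (if j = k then \<xi> k \<omega> else 0)" if "j < r" for j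
 proof (cases j k rule: linorder_cases)
  case less
  then show ?thesis using partition_of_mono[OF p, of "Suc j" k] k by (auto simp: indicator_def)
 next
  case greater
  then show ?thesis using partition_of_mono[OF p, of "Suc k" j] k that by (auto simp: indicator_def)
 qed (use k in auto)
 then show ?thesis unfolding simple_process_def using k(1) by simp
qed

lemma simple_process_outside:
 assumes "partition_of s t r p" "u \<notin> {s<..t}"
 shows "simple_process r p \<xi> u \<omega> = 0"
 unfolding simple_process_def
proof (intro sum.neutral ballI)
 fix k assume "k \<in> {..<r}"
 then show "\<xi> k \<omega> * indicator {p k<..p (Suc k)} u = 0"
  using partition_of_range[OF assms(1), of k] partition_of_range[OF assms(1), of "Suc k"] assms(2)
  by (auto simp: indicator_def)
qed

lemma square_diff_le: "ennreal ((x - y)^2) \<le> 2 * ennreal ((z - x)^2) + 2 * ennreal ((z - y)^2)"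
proof -
 have "(x - y)^2 \<le> 2 * (z - x)^2 + 2 * (z - y)^2"
  using zero_le_power2[of "(z - x) + (z - y)"] by (simp add: power2_eq_square algebra_simps)
 then have "ennreal ((x - y)^2) \<le> ennreal (2 * (z - x)^2 + 2 * (z - y)^2)" by (rule ennreal_leI)
 then show ?thesis by (simp add: ennreal_plus ennreal_mult)
qed

lemma nn_integral_square_diff_le:
 fixes f g e :: "'b \<Rightarrow> real"
 assumes [measurable]: "f \<in> borel_measurable P" "g \<in> borel_measurable P" "e \<in> borel_measurable P"
 shows "(\<integral>\<^sup>+x. ennreal ((f x - g x)^2) \<partial>P) \<le> 2 * (\<integral>\<^sup>+x. ennreal ((e x - f x)^2) \<partial>P) + 2 * (\<integral>\<^sup>+x. ennreal ((e x - g x)^2) \<partial>P)"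
proof -
 have "(\<integral>\<^sup>+x. ennreal ((f x - g x)^2) \<partial>P) \<le> (\<integral>\<^sup>+x. 2 * ennreal ((e x - f x)^2) + 2 * ennreal ((e x - g x)^2) \<partial>P)"
  by (intro nn_integral_mono square_diff_le)
 also have "\<dots> = 2 * (\<integral>\<^sup>+x. ennreal ((e x - f x)^2) \<partial>P) + 2 * (\<integral>\<^sup>+x. ennreal ((e x - g x)^2) \<partial>P)"
  by (subst nn_integral_add) (simp_all add: nn_integral_cmult)
 finally show ?thesis .
qed

context brownian
begin

lemma simple_adapted_measurable:
 assumes "simple_adapted M past s t m \<tau> \<xi>" "t \<le> T" "k < m"
 shows "\<xi> k \<in> borel_measurable M"
 using assms unfolding simple_adapted_def square_integrable_def by blast

text \<open>\<open>ito_isometry\<close> over the disjoint sum of the two partitions, the second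
  process taken with negative sign.\<close>

lemma simple_ito_isometry:
 assumes st: "0 \<le> s" "t \<le> T" and S: "simple_adapted M past s t m \<tau> \<xi>" and S': "simple_adapted M past s t m' \<tau>' \<xi>'"
 shows "(\<integral>\<^sup>+\<omega>. ennreal ((simple_ito_integral (\<lambda>u \<omega>. W u \<omega> $ j) m \<tau> \<xi> \<omega> - simple_ito_integral (\<lambda>u \<omega>. W u \<omega> $ j) m' \<tau>' \<xi>' \<omega>)^2) \<partial>M)
  = (\<integral>\<^sup>+\<omega>. (\<integral>\<^sup>+u. ennreal ((simple_process m \<tau> \<xi> u \<omega> - simple_process m' \<tau>' \<xi>' u \<omega>)^2) \<partial>lborel) \<partial>M)"
proof -
 define I where "I = {..<m} <+> {..<m'}"
 define a where "a = case_sum \<tau> \<tau>'"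
 define b where "b = case_sum (\<lambda>k. \<tau> (Suc k)) (\<lambda>k. \<tau>' (Suc k))"
 define \<zeta> where "\<zeta> = case_sum \<xi> (\<lambda>k \<omega>. - \<xi>' k \<omega>)"
 have range: "0 \<le> \<tau> k \<and> \<tau> k \<le> \<tau> (Suc k) \<and> \<tau> (Suc k) \<le> T" if "k < m" "simple_adapted M past s t m \<tau> \<xi>" for k m \<tau> \<xi>
  using that partition_of_range[of s t m \<tau> k] partition_of_range[of s t m \<tau> "Suc k"] st
  unfolding simple_adapted_def partition_of_def by force
 have iso: "(\<integral>\<^sup>+\<omega>. ennreal ((\<Sum>i\<in>I. \<zeta> i \<omega> * (W (b i) \<omega> $ j - W (a i) \<omega> $ j))^2) \<partial>M)
   = (\<integral>\<^sup>+\<omega>. (\<integral>\<^sup>+u. ennreal ((\<Sum>i\<in>I. \<zeta> i \<omega> * indicator {a i<..b i} u)^2) \<partial>lborel) \<partial>M)"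
 proof (rule ito_isometry)
  show "finite I" by (simp add: I_def)
  show "0 \<le> a i \<and> a i \<le> b i \<and> b i \<le> T" if "i \<in> I" for i
   using that range[OF _ S] range[OF _ S'] by (auto simp: I_def a_def b_def)
  show "\<zeta> i \<in> borel_measurable (past (a i))" "integrable M (\<lambda>\<omega>. (\<zeta> i \<omega>)^2)" if "i \<in> I" for i
   using that S S' by (auto simp: I_def a_def \<zeta>_def simple_adapted_def square_integrable_def)
 qed
 have diff: "(\<Sum>i\<in>I. \<zeta> i \<omega> * g (a i) (b i)) = (\<Sum>k<m. \<xi> k \<omega> * g (\<tau> k) (\<tau> (Suc k))) - (\<Sum>k<m'. \<xi>' k \<omega> * g (\<tau>' k) (\<tau>' (Suc k)))"
  for \<omega> and g :: "real \<Rightarrow> real \<Rightarrow> real"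
  by (simp add: I_def sum.Plus a_def b_def \<zeta>_def sum_negf)
 have "(\<Sum>i\<in>I. \<zeta> i \<omega> * (W (b i) \<omega> $ j - W (a i) \<omega> $ j))
   = simple_ito_integral (\<lambda>u \<omega>. W u \<omega> $ j) m \<tau> \<xi> \<omega> - simple_ito_integral (\<lambda>u \<omega>. W u \<omega> $ j) m' \<tau>' \<xi>' \<omega>" for \<omega>
  unfolding simple_ito_integral_def by (rule diff[of \<omega> "\<lambda>x y. W y \<omega> $ j - W x \<omega> $ j"])
 moreover have "(\<Sum>i\<in>I. \<zeta> i \<omega> * indicator {a i<..b i} u) = simple_process m \<tau> \<xi> u \<omega> - simple_process m' \<tau>' \<xi>' u \<omega>" for u \<omega>
  unfolding simple_process_def by (rule diff[of \<omega> "\<lambda>x y. indicator {x<..y} u"])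
 ultimately show ?thesis using iso by (simp only:)
qed

lemma simple_process_measurable:
 assumes "\<And>k. k < r \<Longrightarrow> \<xi> k \<in> borel_measurable M"
 shows "(\<lambda>z. simple_process r p \<xi> (snd z) (fst z)) \<in> borel_measurable (M \<Otimes>\<^sub>M lborel)"
 unfolding simple_process_def
proof (intro borel_measurable_sum borel_measurable_times)
 fix k assume "k \<in> {..<r}"
 then show "(\<lambda>z. \<xi> k (fst z)) \<in> borel_measurable (M \<Otimes>\<^sub>M lborel)"
  by (intro measurable_compose[OF measurable_fst]) (use assms in auto)
qed measurable

text \<open>The definition of the integral provides some approximating simple processes; the Riemann
  sums come from another sequence, the left-point step processes. Both approximate the integrand in
  mean square, so by the isometry their integrals have the same limit.\<close>

theorem ito_riemann_sums:
 fixes i j :: 'n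
 assumes st: "0 \<le> s" "s \<le> t" "t \<le> T"
  and I: "has_ito_integral M past (\<lambda>u \<omega>. W u \<omega> $ j) s t (\<lambda>u \<omega>. W u \<omega> $ i - W s \<omega> $ i) I"
  and p: "\<And>m. partition_of s t (r m) (p m)"
  and mesh: "\<And>m k. k < r m \<Longrightarrow> p m (Suc k) - p m k \<le> h m" "h \<longlonglongrightarrow> 0" "\<And>m. 0 < h m"
  and \<epsilon>: "\<epsilon> > 0"
 shows "(\<lambda>m. prob {\<omega> \<in> space M. \<epsilon> <
  \<bar>(\<Sum>k<r m. (W (p m k) \<omega> $ i - W s \<omega> $ i) * (W (p m (Suc k)) \<omega> $ j - W (p m k) \<omega> $ j)) - I \<omega>\<bar>}) \<longlonglongrightarrow> 0"
proof -
 define Y where "Y u \<omega> = W u \<omega> $ i - W s \<omega> $ i" for u \<omega>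
 define Rp where "Rp m = simple_process (r m) (p m) (\<lambda>k. Y (p m k))" for m
 define RI where "RI m = simple_ito_integral (\<lambda>u \<omega>. W u \<omega> $ j) (r m) (p m) (\<lambda>k. Y (p m k))" for m
 let ?d = "\<lambda>m. \<integral>\<^sup>+\<omega>. ennreal ((RI m \<omega> - I \<omega>)^2) \<partial>M"
 let ?r = "\<lambda>m' m u \<omega>. (Rp m' u \<omega> - Rp m u \<omega>)^2"
 define P where "P = M \<Otimes>\<^sub>M (lborel :: real measure)"
 interpret PP: pair_sigma_finite M "lborel :: real measure" by unfold_locales
 have Ym: "Y u \<in> borel_measurable M" if "u \<in> {s..t}" for u
  unfolding Y_def[abs_def] using that st by (intro borel_measurable_diff W_nth_measurable) auto
 have Ysq: "gaussian_moments M (v - u) (\<lambda>\<omega>. Y v \<omega> - Y u \<omega>)" if "s \<le> u" "u \<le> v" "v \<le> t" for u v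
  using increment_moments[of u v i] that st by (simp add: Y_def)
 have radapt: "simple_adapted M past s t (r m) (p m) (\<lambda>k. Y (p m k))" for m
  unfolding simple_adapted_def square_integrable_def
 proof (intro conjI allI impI p)
  fix k assume "k < r m"
  then have u: "s \<le> p m k" "p m k \<le> t" using partition_of_range[OF p, of k m] by auto
  show "Y (p m k) \<in> borel_measurable (past (p m k))"
   unfolding Y_def[abs_def] using u st by (intro borel_measurable_diff W_adapted) auto
  show "Y (p m k) \<in> borel_measurable M" using u by (intro Ym) auto
  show "integrable M (\<lambda>\<omega>. (Y (p m k) \<omega>)^2)"
   using Ysq[of s "p m k"] u unfolding gaussian_moments_def by (simp add: Y_def)
 qed
 have Rval: "\<exists>v. u - h m \<le> v \<and> v < u \<and> s \<le> v \<and> (\<forall>\<omega>. Rp m u \<omega> = Y v \<omega>)" if "s < u" "u \<le> t" for u m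
 proof -
  obtain k where k: "k < r m" "p m k < u" "u \<le> p m (Suc k)" using partition_cell[OF p \<open>s < u\<close> \<open>u \<le> t\<close>] by blast
  then show ?thesis
   using mesh(1)[OF k(1)] partition_of_range[OF p, of k m] simple_process_cell[OF p k]
   by (intro exI[of _ "p m k"]) (auto simp: Rp_def)
 qed
 have Rout: "Rp m u \<omega> = 0" if "u \<notin> {s<..t}" for m u \<omega>
  using simple_process_outside[OF p that] by (simp add: Rp_def)
 have Rm [measurable]: "(\<lambda>z. Rp m (snd z) (fst z)) \<in> borel_measurable P" for m
  unfolding P_def Rp_def by (intro simple_process_measurable simple_adapted_measurable[OF radapt st(3)])
 \<comment> \<open>\<open>W\<close> is measurable at each fixed time and only almost surely
   continuous, so joint measurability of the integrand is not given. The pointwise limit of the step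
   processes is jointly measurable and almost surely agrees with the integrand on
   \<open>(s, t]\<close>.\<close>
 define Yt where "Yt z = lim (\<lambda>m. Rp m (snd z) (fst z))" for z
 have Ytm [measurable]: "Yt \<in> borel_measurable P" unfolding Yt_def[abs_def] by measurable
 have conv: "AE \<omega> in M. \<forall>u. (\<lambda>m. Rp m u \<omega>) \<longlonglongrightarrow> indicator {s<..t} u * Y u \<omega>"
 proof -
  have "AE \<omega> in M. continuous_on {0..T} (\<lambda>t. W t \<omega>)" using bm unfolding brownian_motion_def by blast
  then show ?thesis
  proof eventually_elim
   case (elim \<omega>)
   show ?case
   proof
    fix u
    show "(\<lambda>m. Rp m u \<omega>) \<longlonglongrightarrow> indicator {s<..t} u * Y u \<omega>"
    proof (cases "u \<in> {s<..t}")
     case True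
     then have "\<forall>m. \<exists>v. u - h m \<le> v \<and> v < u \<and> s \<le> v \<and> (\<forall>\<omega>. Rp m u \<omega> = Y v \<omega>)" using Rval by simp
     then obtain v where v: "\<And>m. u - h m \<le> v m" "\<And>m. v m < u" "\<And>m. s \<le> v m" "\<And>m \<omega>. Rp m u \<omega> = Y (v m) \<omega>" by metis
     have "v \<longlonglongrightarrow> u"
     proof (rule real_tendsto_sandwich[OF _ _ _ tendsto_const])
      show "(\<lambda>m. u - h m) \<longlonglongrightarrow> u" using tendsto_diff[OF tendsto_const mesh(2), of u] by simp
     qed (use v in \<open>auto intro!: always_eventually less_imp_le\<close>)
     moreover have "continuous_on {0..T} (\<lambda>u. Y u \<omega>)" unfolding Y_def using elim by (intro continuous_intros)
     moreover have "u \<in> {0..T}" using True st by auto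
     ultimately have "(\<lambda>m. Y (v m) \<omega>) \<longlonglongrightarrow> Y u \<omega>"
     proof (intro continuous_on_tendsto_compose[of "{0..T}" "\<lambda>u. Y u \<omega>"])
      have "v m \<in> {0..T}" for m using v(2,3)[of m] True st by auto
      then show "\<forall>\<^sub>F m in sequentially. v m \<in> {0..T}" by simp
     qed
     then show ?thesis using True by (simp add: v(4))
    qed (simp add: Rout)
   qed
  qed
 qed
 then have Yt: "AE \<omega> in M. \<forall>u. Yt (\<omega>, u) = indicator {s<..t} u * Y u \<omega>"
  by eventually_elim (auto simp: Yt_def intro: limI)
 have fst: "(\<integral>\<^sup>+\<omega>. (\<integral>\<^sup>+u. f (\<omega>, u) \<partial>lborel) \<partial>M) = integral\<^sup>N P f" if "f \<in> borel_measurable P" for f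
  using that unfolding P_def by (rule lborel.nn_integral_fst)
 have snd: "(\<integral>\<^sup>+u. (\<integral>\<^sup>+\<omega>. f (\<omega>, u) \<partial>M) \<partial>lborel) = integral\<^sup>N P f" if "f \<in> borel_measurable P" for f
  using that unfolding P_def by (rule PP.nn_integral_snd)
 \<comment> \<open>For fixed \<open>u\<close> the two step processes take values of \<open>Y\<close>
   at times at most \<open>h m + h m'\<close> apart, which bounds the variance of their
   difference.\<close>
 have Rdist: "(\<integral>\<^sup>+z. ennreal (?r m' m (snd z) (fst z)) \<partial>P) \<le> ennreal ((h m + h m') * (t - s))" for m m'
 proof -
  have "(\<integral>\<^sup>+\<omega>. ennreal (?r m' m u \<omega>) \<partial>M) \<le> ennreal (h m + h m') * indicator {s<..t} u" for u
  proof (cases "u \<in> {s<..t}")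
   case True
   then obtain v v' where v: "u - h m \<le> v" "v < u" "s \<le> v" "\<And>\<omega>. Rp m u \<omega> = Y v \<omega>"
    "u - h m' \<le> v'" "v' < u" "s \<le> v'" "\<And>\<omega>. Rp m' u \<omega> = Y v' \<omega>"
    using Rval[of u m] Rval[of u m'] by auto
   define x y where "x = min v v'" and "y = max v v'"
   have xy: "s \<le> x" "x \<le> y" "y \<le> t" "y - x \<le> h m + h m'" using v True mesh(3)[of m] mesh(3)[of m'] by (auto simp: x_def y_def)
   have gm: "gaussian_moments M (y - x) (\<lambda>\<omega>. Y y \<omega> - Y x \<omega>)" by (rule Ysq) (use xy in auto)
   have "?r m' m u \<omega> = (Y y \<omega> - Y x \<omega>)^2" for \<omega>
    by (simp add: v x_def y_def min_def max_def power2_commute)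
   moreover have "integrable M (\<lambda>\<omega>. (Y y \<omega> - Y x \<omega>)^2)" "expectation (\<lambda>\<omega>. (Y y \<omega> - Y x \<omega>)^2) = y - x"
    using gm unfolding gaussian_moments_def by (blast, metis gauss_moment_2)
   ultimately have "(\<integral>\<^sup>+\<omega>. ennreal (?r m' m u \<omega>) \<partial>M) = ennreal (y - x)"
    by (simp add: nn_integral_eq_integral)
   then show ?thesis using True xy(4) by (simp add: ennreal_leI)
  qed (simp add: Rout)
  then have "(\<integral>\<^sup>+u. (\<integral>\<^sup>+\<omega>. ennreal (?r m' m u \<omega>) \<partial>M) \<partial>lborel) \<le> (\<integral>\<^sup>+u. ennreal (h m + h m') * indicator {s<..t} u \<partial>lborel)"
   by (rule nn_integral_mono)
  also have "\<dots> = ennreal ((h m + h m') * (t - s))"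
   using st mesh(3)[of m] mesh(3)[of m'] by (subst nn_integral_cmult_indicator) (auto simp: ennreal_mult)
  finally show ?thesis using snd[of "\<lambda>z. ennreal (?r m' m (snd z) (fst z))"] by simp
 qed
 \<comment> \<open>Fatou's lemma in \<open>m'\<close>; eventually \<open>h m' < h m\<close>, whence
   the factor \<open>2\<close>.\<close>
 have Ydist: "(\<integral>\<^sup>+z. ennreal ((Yt z - Rp m (snd z) (fst z))^2) \<partial>P) \<le> ennreal (2 * h m * (t - s))" for m
 proof -
  have "(\<integral>\<^sup>+z. ennreal ((Yt z - Rp m (snd z) (fst z))^2) \<partial>P)
    = (\<integral>\<^sup>+\<omega>. (\<integral>\<^sup>+u. ennreal ((Yt (\<omega>, u) - Rp m u \<omega>)^2) \<partial>lborel) \<partial>M)"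
   using fst[of "\<lambda>z. ennreal ((Yt z - Rp m (snd z) (fst z))^2)"] by simp
  also have "\<dots> = (\<integral>\<^sup>+\<omega>. (\<integral>\<^sup>+u. liminf (\<lambda>m'. ennreal (?r m' m u \<omega>)) \<partial>lborel) \<partial>M)"
  proof (rule nn_integral_cong_AE)
   show "AE \<omega> in M. (\<integral>\<^sup>+u. ennreal ((Yt (\<omega>, u) - Rp m u \<omega>)^2) \<partial>lborel)
     = (\<integral>\<^sup>+u. liminf (\<lambda>m'. ennreal (?r m' m u \<omega>)) \<partial>lborel)"
    using conv Yt
   proof eventually_elim
    case (elim \<omega>)
    have "(\<lambda>m'. ennreal (?r m' m u \<omega>)) \<longlonglongrightarrow> ennreal ((Yt (\<omega>, u) - Rp m u \<omega>)^2)" for u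
     using elim by (intro tendsto_intros tendsto_ennrealI) simp
    then have "liminf (\<lambda>m'. ennreal (?r m' m u \<omega>)) = ennreal ((Yt (\<omega>, u) - Rp m u \<omega>)^2)" for u
     by (intro lim_imp_Liminf) simp_all
    then show ?case by simp
   qed
  qed
  also have "\<dots> = (\<integral>\<^sup>+z. liminf (\<lambda>m'. ennreal (?r m' m (snd z) (fst z))) \<partial>P)"
   using fst[of "\<lambda>z. liminf (\<lambda>m'. ennreal (?r m' m (snd z) (fst z)))"] by simp
  also have "\<dots> \<le> liminf (\<lambda>m'. \<integral>\<^sup>+z. ennreal (?r m' m (snd z) (fst z)) \<partial>P)"
   by (rule nn_integral_liminf) measurable
  also have "\<dots> \<le> ennreal (2 * h m * (t - s))"
  proof (rule Liminf_le)
   show "\<forall>\<^sub>F m' in sequentially. (\<integral>\<^sup>+z. ennreal (?r m' m (snd z) (fst z)) \<partial>P) \<le> ennreal (2 * h m * (t - s))"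
    using order_tendstoD(2)[OF mesh(2) mesh(3)[of m]]
   proof eventually_elim
    case (elim m')
    then have "(h m + h m') * (t - s) \<le> 2 * h m * (t - s)" using st by (intro mult_right_mono) auto
    then show ?case using Rdist[of m' m] ennreal_leI order.trans by blast
   qed
  qed simp
  finally show ?thesis .
 qed
 have I': "has_ito_integral M past (\<lambda>u \<omega>. W u \<omega> $ j) s t Y I"
  using I unfolding Y_def[abs_def] .
 obtain n \<tau> \<xi> where S: "\<And>k. simple_adapted M past s t (n k) (\<tau> k) (\<xi> k)"
  and S1: "(\<lambda>k. \<integral>\<^sup>+\<omega>. (\<integral>\<^sup>+u\<in>{s..t}. ennreal ((Y u \<omega> - simple_process (n k) (\<tau> k) (\<xi> k) u \<omega>)^2) \<partial>lborel) \<partial>M) \<longlonglongrightarrow> 0"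
  and S2: "(\<lambda>k. \<integral>\<^sup>+\<omega>. ennreal ((I \<omega> - simple_ito_integral (\<lambda>u \<omega>. W u \<omega> $ j) (n k) (\<tau> k) (\<xi> k) \<omega>)^2) \<partial>M) \<longlonglongrightarrow> 0"
  using I' unfolding has_ito_integral_def by (elim conjE exE) (rule that, blast+)
 have Im [measurable]: "I \<in> borel_measurable M" using I unfolding has_ito_integral_def square_integrable_def by blast
 define Sp where "Sp k = simple_process (n k) (\<tau> k) (\<xi> k)" for k
 define SI where "SI k = simple_ito_integral (\<lambda>u \<omega>. W u \<omega> $ j) (n k) (\<tau> k) (\<xi> k)" for k
 have Spm [measurable]: "(\<lambda>z. Sp k (snd z) (fst z)) \<in> borel_measurable P" for k
  unfolding P_def Sp_def by (intro simple_process_measurable simple_adapted_measurable[OF S st(3)])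
 have sim: "simple_ito_integral (\<lambda>u \<omega>. W u \<omega> $ j) r' p' \<zeta> \<in> borel_measurable M"
  if "simple_adapted M past s t r' p' \<zeta>" for r' p' \<zeta>
  unfolding simple_ito_integral_def[abs_def]
 proof (intro borel_measurable_sum borel_measurable_times borel_measurable_diff W_nth_measurable)
  fix k assume k: "k \<in> {..<r'}"
  then show "\<zeta> k \<in> borel_measurable M" using simple_adapted_measurable[OF that st(3)] by simp
  have "partition_of s t r' p'" using that by (simp add: simple_adapted_def)
  from partition_of_range[OF this, of k] partition_of_range[OF this, of "Suc k"] k st
  show "p' k \<in> {0..T}" "p' (Suc k) \<in> {0..T}" by auto
 qed
 have SIm [measurable]: "SI k \<in> borel_measurable M" for k unfolding SI_def by (rule sim[OF S])
 have RIm [measurable]: "RI m \<in> borel_measurable M" for m unfolding RI_def by (rule sim[OF radapt])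
 have S1': "(\<lambda>k. \<integral>\<^sup>+z. ennreal ((Yt z - Sp k (snd z) (fst z))^2) \<partial>P) \<longlonglongrightarrow> 0"
 proof -
  have "(\<integral>\<^sup>+\<omega>. (\<integral>\<^sup>+u\<in>{s..t}. ennreal ((Y u \<omega> - Sp k u \<omega>)^2) \<partial>lborel) \<partial>M)
    = (\<integral>\<^sup>+\<omega>. (\<integral>\<^sup>+u. ennreal ((Yt (\<omega>, u) - Sp k u \<omega>)^2) \<partial>lborel) \<partial>M)" for k
  proof (rule nn_integral_cong_AE)
   show "AE \<omega> in M. (\<integral>\<^sup>+u\<in>{s..t}. ennreal ((Y u \<omega> - Sp k u \<omega>)^2) \<partial>lborel)
     = (\<integral>\<^sup>+u. ennreal ((Yt (\<omega>, u) - Sp k u \<omega>)^2) \<partial>lborel)"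
    using Yt
   proof eventually_elim
    case (elim \<omega>)
    have "partition_of s t (n k) (\<tau> k)" using S[of k] by (simp add: simple_adapted_def)
    note out = simple_process_outside[OF this]
    \<comment> \<open>At \<open>u = s\<close> the integrand and every simple process vanish, so the
      closed and the half-open interval give the same integral.\<close>
    have "ennreal ((Y u \<omega> - Sp k u \<omega>)^2) * indicator {s..t} u = ennreal ((Yt (\<omega>, u) - Sp k u \<omega>)^2)" for u
     using elim by (cases "u \<in> {s<..t}"; cases "u = s") (auto simp: out Sp_def Y_def)
    then show ?case by simp
   qed
  qed
  also have "(\<integral>\<^sup>+\<omega>. (\<integral>\<^sup>+u. ennreal ((Yt (\<omega>, u) - Sp k u \<omega>)^2) \<partial>lborel) \<partial>M) = (\<integral>\<^sup>+z. ennreal ((Yt z - Sp k (snd z) (fst z))^2) \<partial>P)" for k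
   using fst[of "\<lambda>z. ennreal ((Yt z - Sp k (snd z) (fst z))^2)"] by simp
  finally show ?thesis using S1 unfolding Sp_def[symmetric] by simp
 qed
 \<comment> \<open>Triangle inequality through \<open>SI k\<close>, with the isometry for the step
   processes; letting \<open>k\<close> tend to infinity leaves four times the bound in
   \<open>Ydist\<close>.\<close>
 have L2: "?d m \<le> ennreal (8 * h m * (t - s))" for m
 proof -
  let ?x = "\<lambda>k. \<integral>\<^sup>+\<omega>. ennreal ((I \<omega> - SI k \<omega>)^2) \<partial>M"
  let ?y = "\<lambda>k. \<integral>\<^sup>+z. ennreal ((Yt z - Sp k (snd z) (fst z))^2) \<partial>P"
  let ?c = "ennreal (2 * h m * (t - s))"
  have "?d m \<le> 2 * (2 * ?y k + 2 * ?c) + 2 * ?x k" for k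
  proof -
   have "(\<integral>\<^sup>+\<omega>. ennreal ((SI k \<omega> - RI m \<omega>)^2) \<partial>M)
     = (\<integral>\<^sup>+\<omega>. (\<integral>\<^sup>+u. ennreal ((Sp k u \<omega> - Rp m u \<omega>)^2) \<partial>lborel) \<partial>M)"
    unfolding SI_def RI_def Sp_def Rp_def by (rule simple_ito_isometry[OF st(1,3) S radapt])
   also have "\<dots> = (\<integral>\<^sup>+z. ennreal ((Sp k (snd z) (fst z) - Rp m (snd z) (fst z))^2) \<partial>P)"
    using fst[of "\<lambda>z. ennreal ((Sp k (snd z) (fst z) - Rp m (snd z) (fst z))^2)"] by simp
   also have "\<dots> \<le> 2 * ?y k + 2 * (\<integral>\<^sup>+z. ennreal ((Yt z - Rp m (snd z) (fst z))^2) \<partial>P)"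
    by (rule nn_integral_square_diff_le) measurable
   also have "\<dots> \<le> 2 * ?y k + 2 * ?c" by (intro add_left_mono mult_left_mono Ydist) simp
   finally have "(\<integral>\<^sup>+\<omega>. ennreal ((SI k \<omega> - RI m \<omega>)^2) \<partial>M) \<le> 2 * ?y k + 2 * ?c" .
   moreover have "?d m
     \<le> 2 * (\<integral>\<^sup>+\<omega>. ennreal ((SI k \<omega> - RI m \<omega>)^2) \<partial>M) + 2 * (\<integral>\<^sup>+\<omega>. ennreal ((SI k \<omega> - I \<omega>)^2) \<partial>M)"
    by (rule nn_integral_square_diff_le) measurable
   moreover have "(SI k \<omega> - I \<omega>)^2 = (I \<omega> - SI k \<omega>)^2" for \<omega> by (rule power2_commute)
   ultimately show ?thesis
    by (simp only:) (erule order.trans, intro add_right_mono mult_left_mono, assumption, simp)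
  qed
  moreover have "(\<lambda>k. 2 * (2 * ?y k + 2 * ?c) + 2 * ?x k) \<longlonglongrightarrow> 2 * (2 * 0 + 2 * ?c) + 2 * 0"
   using S1' S2[folded SI_def] by (intro tendsto_add ennreal_tendsto_cmult tendsto_const) simp_all
  ultimately have "?d m \<le> 2 * (2 * 0 + 2 * ?c) + 2 * 0"
   by (intro LIMSEQ_le_const) auto
  moreover have "2 * (2 * 0 + 2 * ennreal x) + 2 * 0 = ennreal (4 * x)" if "0 \<le> x" for x
   using that by (simp add: ennreal_mult)
  from this[of "2 * h m * (t - s)"] have "2 * (2 * 0 + 2 * ?c) + 2 * 0 = ennreal (8 * h m * (t - s))"
   using st mesh(3)[of m] by (simp add: mult.assoc)
  ultimately show ?thesis by (simp only:)
 qed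
 have bound: "prob {\<omega> \<in> space M. \<epsilon> < \<bar>RI m \<omega> - I \<omega>\<bar>} \<le> 8 * h m * (t - s) / \<epsilon>\<^sup>2" for m
 proof -
  let ?E = "{\<omega> \<in> space M. \<epsilon> < \<bar>RI m \<omega> - I \<omega>\<bar>}"
  have sq: "\<epsilon>\<^sup>2 \<le> x\<^sup>2" if "\<epsilon> < \<bar>x\<bar>" for x using that \<epsilon> by (metis abs_le_square_iff abs_of_pos less_imp_le)
  have "ennreal (\<epsilon>\<^sup>2) * emeasure M ?E = (\<integral>\<^sup>+\<omega>. ennreal (\<epsilon>\<^sup>2) * indicator ?E \<omega> \<partial>M)"
   by (rule nn_integral_cmult_indicator[symmetric]) measurable
  also have "\<dots> \<le> ?d m"
   by (intro nn_integral_mono) (auto simp: indicator_def intro!: ennreal_leI sq)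
  also have "\<dots> \<le> ennreal (8 * h m * (t - s))" by (rule L2)
  finally have "ennreal (\<epsilon>\<^sup>2 * prob ?E) \<le> ennreal (8 * h m * (t - s))"
   by (simp add: emeasure_eq_measure ennreal_mult)
  then have "\<epsilon>\<^sup>2 * prob ?E \<le> 8 * h m * (t - s)" using st mesh(3)[of m] by (subst (asm) ennreal_le_iff) auto
  then show ?thesis using \<epsilon> by (simp add: field_simps)
 qed
 have "(\<lambda>m. prob {\<omega> \<in> space M. \<epsilon> < \<bar>RI m \<omega> - I \<omega>\<bar>}) \<longlonglongrightarrow> 0"
 proof (rule real_tendsto_sandwich[OF _ _ tendsto_const])
  show "(\<lambda>m. 8 * h m * (t - s) / \<epsilon>\<^sup>2) \<longlonglongrightarrow> 0"
   using tendsto_mult_right[OF mesh(2), of "8 * (t - s) / \<epsilon>\<^sup>2"] by (simp add: mult_ac)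
 qed (use bound in auto)
 then show ?thesis by (simp add: RI_def simple_ito_integral_def Y_def)
qed

end

section \<open>Brownian motion as the case of white noise\<close>

lemma fgn_half: "fgn (1 / 2) (real a - real b) = (if a = b then 1 else 0)"
proof (cases a b rule: linorder_cases)
 case less
 then have "real a + 1 \<le> real b" by linarith
 then show ?thesis using less by (simp add: fgn_def)
next
 case greater
 then have "real b + 1 \<le> real a" by linarith
 then show ?thesis using greater by (simp add: fgn_def)
qed (simp add: fgn_def)

lemma sig_pair:
 assumes "c 0 = 1" "c 1 = 1"
 shows "sig c x a r [i, j] = (\<Sum>k<r. (\<Sum>l<k. x (a + l) i) * x (a + k) j) + c 2 * (\<Sum>k<r. x (a + k) i * x (a + k) j)"
proof (induction r)
 case (Suc r)
 have "sig c x a (Suc r) [i, j] = sig c x a r [i, j] + sig c x a r [i] * x (a + r) j + c 2 * (x (a + r) i * x (a + r) j)"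
  using assms by (simp add: tensor_prod_def tens_exp_def sig_Nil atMost_Suc numeral_2_eq_2)
 then show ?case using Suc sig_single[OF assms, of x a r i] by (simp add: distrib_left)
qed (simp add: tens_one_def)

text \<open>Membership only looks at the simplex and at levels up to \<open>N\<close>, so the lift
  may be exchanged for a path that agrees with it there.\<close>

lemma besov_rough_paths_cong:
 fixes X Y :: "'n::finite two_param"
 assumes eq: "\<And>s t w. (s, t) \<in> simplex2 T \<Longrightarrow> length w \<le> N \<Longrightarrow> X s t w = Y s t w"
 shows "X \<in> besov_rough_paths N \<alpha> p T \<longleftrightarrow> Y \<in> besov_rough_paths N \<alpha> p T"
proof -
 have "rough_path N T X \<longleftrightarrow> rough_path N T Y"
  unfolding rough_path_def
 proof (intro conj_cong iff_allI imp_cong refl)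
  show "(\<forall>(s, t)\<in>simplex2 T. X s t [] = 1) \<longleftrightarrow> (\<forall>(s, t)\<in>simplex2 T. Y s t [] = 1)"
   using eq[of _ _ "[]"] by auto
  show "(\<lambda>(s, t). X s t w) \<in> borel_measurable (restrict_space borel (simplex2 T)) \<longleftrightarrow>
    (\<lambda>(s, t). Y s t w) \<in> borel_measurable (restrict_space borel (simplex2 T))" if "length w \<le> N" for w
   using eq that by (intro measurable_cong) (auto simp: space_restrict_space)
  fix s t u and w :: "'n list" assume *: "0 \<le> s \<and> s \<le> t \<and> t \<le> u \<and> u \<le> T \<and> length w \<le> N"
  then have "tensor_prod (X s t) (X t u) w = tensor_prod (Y s t) (Y t u) w"
   by (intro tensor_prod_cong eq) (auto simp: simplex2_def)
  moreover have "X s u w = Y s u w" using * by (intro eq) (auto simp: simplex2_def)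
  ultimately show "(tensor_prod (X s t) (X t u) w = X s u w) = (tensor_prod (Y s t) (Y t u) w = Y s u w)" by simp
 qed
 moreover have "besov_norm \<gamma> q T (\<lambda>s t. level_norm k (X s t)) = besov_norm \<gamma> q T (\<lambda>s t. level_norm k (Y s t))"
  if "k \<in> {1..N}" for k \<gamma> q
 proof -
  have lev: "level_norm k (X t (t + h)) = level_norm k (Y t (t + h))" if "0 \<le> t" "0 \<le> h" "t \<le> T - h" for t h
   unfolding level_norm_def using that \<open>k \<in> {1..N}\<close>
   by (intro arg_cong[where f = sqrt] sum.cong refl arg_cong[where f = "\<lambda>x. x\<^sup>2"] eq) (auto simp: simplex2_def)
  have cong: "Lp_norm q (restrict_space lborel {0..T - h}) f = Lp_norm q (restrict_space lborel {0..T - h}) g"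
   if fg: "\<And>t. t \<in> {0..T - h} \<Longrightarrow> f t = g t" for f g :: "real \<Rightarrow> real" and h
  proof -
   let ?R = "restrict_space lborel {0..T - h}"
   have sp: "f t = g t" if "t \<in> space ?R" for t using that fg by (simp add: space_restrict_space)
   have "(\<integral>\<^sup>+x. ennreal (\<bar>f x\<bar> powr enn2real q) \<partial>?R) = (\<integral>\<^sup>+x. ennreal (\<bar>g x\<bar> powr enn2real q) \<partial>?R)"
    by (intro nn_integral_cong) (simp add: sp)
   moreover have "(\<lambda>x. ennreal \<bar>f x\<bar>) \<in> borel_measurable ?R \<longleftrightarrow> (\<lambda>x. ennreal \<bar>g x\<bar>) \<in> borel_measurable ?R"
    by (intro measurable_cong) (simp add: sp)
   moreover have "Limsup (ae_filter ?R) (\<lambda>x. ennreal \<bar>f x\<bar>) = Limsup (ae_filter ?R) (\<lambda>x. ennreal \<bar>g x\<bar>)"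
    by (intro Limsup_eq AE_I2) (simp add: sp)
   ultimately show ?thesis by (simp add: Lp_norm_def esssup_def)
  qed
  show ?thesis unfolding besov_norm_def
   by (intro SUP_cong refl arg_cong2[where f = "(*)"] cong) (auto intro!: lev)
 qed
 then have "(\<Sum>k = 1..N. ennreal_powr (besov_norm (real k * \<alpha>) (p / of_nat k) T (\<lambda>s t. level_norm k (X s t))) (1 / real k))
   = (\<Sum>k = 1..N. ennreal_powr (besov_norm (real k * \<alpha>) (p / of_nat k) T (\<lambda>s t. level_norm k (Y s t))) (1 / real k))"
  by (intro sum.cong) auto
 ultimately show ?thesis unfolding besov_rough_paths_def by (simp only: mem_Collect_eq)
qed

lemma (in prob_space) limit_in_prob_add:
 fixes F G :: "nat \<Rightarrow> 'a \<Rightarrow> real"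
 assumes [measurable]: "\<And>m. F m \<in> borel_measurable M" "\<And>m. G m \<in> borel_measurable M" "f \<in> borel_measurable M" "g \<in> borel_measurable M"
  and F: "\<And>\<epsilon>. \<epsilon> > 0 \<Longrightarrow> (\<lambda>m. prob {\<omega> \<in> space M. \<epsilon> < \<bar>F m \<omega> - f \<omega>\<bar>}) \<longlonglongrightarrow> 0"
  and G: "\<And>\<epsilon>. \<epsilon> > 0 \<Longrightarrow> (\<lambda>m. prob {\<omega> \<in> space M. \<epsilon> < \<bar>G m \<omega> - g \<omega>\<bar>}) \<longlonglongrightarrow> 0"
  and a: "a > 0" and \<epsilon>: "\<epsilon> > 0"
 shows "(\<lambda>m. prob {\<omega> \<in> space M. \<epsilon> < \<bar>(F m \<omega> + a * G m \<omega>) - (f \<omega> + a * g \<omega>)\<bar>}) \<longlonglongrightarrow> 0"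
proof (rule real_tendsto_sandwich[OF _ _ tendsto_const])
 let ?F = "\<lambda>m. {\<omega> \<in> space M. \<epsilon> / 2 < \<bar>F m \<omega> - f \<omega>\<bar>}" and ?G = "\<lambda>m. {\<omega> \<in> space M. \<epsilon> / (2 * a) < \<bar>G m \<omega> - g \<omega>\<bar>}"
 let ?D = "\<lambda>m. {\<omega> \<in> space M. \<epsilon> < \<bar>(F m \<omega> + a * G m \<omega>) - (f \<omega> + a * g \<omega>)\<bar>}"
 show "(\<lambda>m. prob (?F m) + prob (?G m)) \<longlonglongrightarrow> 0"
  using tendsto_add[OF F G, of "\<epsilon> / 2" "\<epsilon> / (2 * a)"] a \<epsilon> by simp
 show "\<forall>\<^sub>F m in sequentially. prob (?D m) \<le> prob (?F m) + prob (?G m)"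
 proof (rule always_eventually, rule allI)
  fix m
  have "\<epsilon> / 2 < \<bar>x\<bar> \<or> \<epsilon> / (2 * a) < \<bar>y\<bar>" if "\<epsilon> < \<bar>x + a * y\<bar>" for x y
  proof (rule ccontr)
   assume "\<not> ?thesis"
   then have "\<bar>x\<bar> \<le> \<epsilon> / 2" "a * \<bar>y\<bar> \<le> \<epsilon> / 2" using a by (auto simp: field_simps)
   then show False using that abs_triangle_ineq[of x "a * y"] a by (simp add: abs_mult)
  qed
  from this[of "F m _ - f _" "G m _ - g _"]
  have "{\<omega> \<in> space M. \<epsilon> < \<bar>(F m \<omega> + a * G m \<omega>) - (f \<omega> + a * g \<omega>)\<bar>} \<subseteq> ?F m \<union> ?G m"
   by (auto simp: algebra_simps)
  then have "prob (?D m) \<le> prob (?F m \<union> ?G m)"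
   by (intro finite_measure_mono) auto
  also have "\<dots> \<le> prob (?F m) + prob (?G m)" by (intro measure_Un_le) auto
  finally show "prob (?D m) \<le> prob (?F m) + prob (?G m)" .
 qed
qed simp

context brownian
begin

text \<open>Increments are independent over time and, for each cell, across components;
  \<open>fgn (1 / 2)\<close> is the identity matrix, so the variances in a linear combination simply
  add.\<close>

lemma brownian_noise:
 "gaussian_family M ({..<2 ^ m} \<times> UNIV) (\<lambda>p \<omega>. noise_of T (1 / 2) W m (fst p) (snd p) \<omega>) (noise_cov (1 / 2))"
 unfolding gaussian_family_def
proof (intro conjI allI)
 fix c :: "nat \<times> 'n \<Rightarrow> real"
 define h where "h = T / 2 ^ m"
 have h: "h > 0" using T by (simp add: h_def)
 define s where "s = h powr (- (1 / 2))"
 let ?t = "gp T m"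
 have t: "?t b < ?t (Suc b)" "?t (Suc b) - ?t b = h" for b
  using T by (simp_all add: gp_def h_def field_simps)
 have tin: "?t b \<in> {0..T}" if "b \<le> 2 ^ m" for b using gp_in[OF T that] .
 have xi: "noise_of T (1 / 2) W m b i \<omega> = s * (W (?t (Suc b)) \<omega> $ i - W (?t b) \<omega> $ i)" for b i \<omega>
  using T by (simp add: noise_of_def incr_def s_def h_def)
 have s2: "s\<^sup>2 * h = 1"
 proof -
  have "s * s = h powr (- 1)" by (simp add: s_def powr_add[symmetric])
  then show ?thesis using h by (simp add: power2_eq_square powr_neg_one)
 qed
 define L where "L b \<omega> = (\<Sum>i\<in>UNIV. c (b, i) * noise_of T (1 / 2) W m b i \<omega>)" for b \<omega>
 have L: "gaussian_moments M (\<Sum>i\<in>UNIV. (c (b, i))^2) (L b)" if "b < 2 ^ m" for b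
 proof -
  have tt: "0 \<le> ?t b" "?t (Suc b) \<le> T" using tin[of b] tin[of "Suc b"] that by auto
  have "gaussian_moments M (\<Sum>i\<in>UNIV. (c (b, i) * s)^2 * h) (\<lambda>\<omega>. \<Sum>i\<in>UNIV. c (b, i) * s * (W (?t (Suc b)) \<omega> $ i - W (?t b) \<omega> $ i))"
  proof (rule gaussian_moments_sum)
   have "indep_vars (\<lambda>_. borel) (\<lambda>i \<omega>. W (?t (Suc b)) \<omega> $ i - W (?t b) \<omega> $ i) UNIV"
    using bm tt t(1) unfolding brownian_motion_def by blast
   then show "indep_vars (\<lambda>_. borel) (\<lambda>i \<omega>. c (b, i) * s * (W (?t (Suc b)) \<omega> $ i - W (?t b) \<omega> $ i)) UNIV"
    by (rule indep_vars_compose2) simp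
   show "gaussian_moments M ((c (b, i) * s)^2 * h) (\<lambda>\<omega>. c (b, i) * s * (W (?t (Suc b)) \<omega> $ i - W (?t b) \<omega> $ i))" for i
    using gaussian_moments_cmult[OF increment_moments[OF tt(1) less_imp_le[OF t(1)] tt(2)], of "c (b, i) * s" i]
    unfolding t(2) .
  qed simp
  moreover have "(c (b, i) * s)^2 * h = (c (b, i))^2" for i using s2 by (simp add: power_mult_distrib mult.assoc)
  ultimately show ?thesis unfolding L_def[abs_def] xi by (simp add: mult.assoc)
 qed
 have "indep_vars (\<lambda>_. borel) L {..<2 ^ m}"
 proof -
  have "indep_vars (\<lambda>_. borel) (\<lambda>b \<omega>. W (?t (Suc b)) \<omega> - W (?t b) \<omega>) {..<2 ^ m}"
   using bm t(1) tin[of 0] tin[of "2 ^ m"] unfolding brownian_motion_def by simp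
  from indep_vars_compose2[OF this, of "\<lambda>b x. \<Sum>i\<in>UNIV. c (b, i) * (s * x $ i)" "\<lambda>_. borel"]
  have "indep_vars (\<lambda>_. borel) (\<lambda>b \<omega>. \<Sum>i\<in>UNIV. c (b, i) * (s * (W (?t (Suc b)) \<omega> - W (?t b) \<omega>) $ i)) {..<2 ^ m}"
   using borel_measurable_vec_nth by (auto intro!: borel_measurable_sum borel_measurable_times)
  then show ?thesis unfolding L_def[abs_def] xi by simp
 qed
 then have "gaussian_moments M (\<Sum>b<2 ^ m. \<Sum>i\<in>UNIV. (c (b, i))^2) (\<lambda>\<omega>. \<Sum>b<2 ^ m. L b \<omega>)"
  by (intro gaussian_moments_sum L) auto
 moreover have "(\<Sum>b<2 ^ m. \<Sum>i\<in>UNIV. (c (b, i))^2) = qform ({..<2 ^ m} \<times> UNIV) (noise_cov (1 / 2)) c"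
 proof -
  have "qform ({..<2 ^ m} \<times> UNIV) (noise_cov (1 / 2)) c
    = (\<Sum>i\<in>UNIV. \<Sum>a<2 ^ m. \<Sum>b<2 ^ m. c (a, i) * c (b, i) * fgn (1 / 2) (real a - real b))"
   by (subst noise_cov_sum) auto
  also have "\<dots> = (\<Sum>i\<in>UNIV. \<Sum>a<2 ^ m. \<Sum>b<2 ^ m. if a = b then (c (a, i))^2 else 0)"
   unfolding fgn_half by (intro sum.cong refl) (auto simp: power2_eq_square)
  also have "\<dots> = (\<Sum>i\<in>UNIV. \<Sum>a<2 ^ m. (c (a, i))^2)" by (intro sum.cong refl) simp
  also have "\<dots> = (\<Sum>b<2 ^ m. \<Sum>i\<in>UNIV. (c (b, i))^2)" by (rule sum.swap)
  finally show ?thesis by simp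
 qed
 moreover have "(\<Sum>b<2 ^ m. L b \<omega>) = (\<Sum>p\<in>{..<2 ^ m} \<times> UNIV. c p * noise_of T (1 / 2) W m (fst p) (snd p) \<omega>)" for \<omega>
  unfolding L_def by (simp add: sum.cartesian_product split_def)
 ultimately show "gaussian_moments M (qform ({..<2 ^ m} \<times> UNIV) (noise_cov (1 / 2)) c)
   (\<lambda>\<omega>. \<Sum>p\<in>{..<2 ^ m} \<times> UNIV. c p * noise_of T (1 / 2) W m (fst p) (snd p) \<omega>)"
  by simp
qed simp

definition ito_sum :: "nat \<Rightarrow> nat \<Rightarrow> nat \<Rightarrow> 'n \<Rightarrow> 'n \<Rightarrow> 'a \<Rightarrow> real" where
 "ito_sum m a r i j \<omega> = (\<Sum>k<r. (W (gp T m (a + k)) \<omega> $ i - W (gp T m a) \<omega> $ i)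
   * (W (gp T m (a + Suc k)) \<omega> $ j - W (gp T m (a + k)) \<omega> $ j))"

definition cov_sum :: "nat \<Rightarrow> nat \<Rightarrow> nat \<Rightarrow> 'n \<Rightarrow> 'n \<Rightarrow> 'a \<Rightarrow> real" where
 "cov_sum m a r i j \<omega> = (\<Sum>k<r. (W (gp T m (a + Suc k)) \<omega> $ i - W (gp T m (a + k)) \<omega> $ i)
   * (W (gp T m (a + Suc k)) \<omega> $ j - W (gp T m (a + k)) \<omega> $ j))"

lemma sums_measurable:
 assumes "a \<le> b" "b \<le> 2 ^ n"
 shows "ito_sum (n + m) (a * 2 ^ m) ((b - a) * 2 ^ m) i j \<in> borel_measurable M"
  "cov_sum (n + m) (a * 2 ^ m) ((b - a) * 2 ^ m) i j \<in> borel_measurable M"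
proof -
 have "a * 2 ^ m + (b - a) * 2 ^ m = b * 2 ^ m" using assms by (simp add: diff_mult_distrib)
 also have "\<dots> \<le> 2 ^ (n + m)" using assms by (simp add: power_add)
 finally have le: "a * 2 ^ m + (b - a) * 2 ^ m \<le> 2 ^ (n + m)" .
 have W: "(\<lambda>\<omega>. W (gp T (n + m) l) \<omega> $ i) \<in> borel_measurable M" if "l \<le> 2 ^ (n + m)" for l i
  using that gp_in[OF T] by (intro W_nth_measurable) auto
 show "ito_sum (n + m) (a * 2 ^ m) ((b - a) * 2 ^ m) i j \<in> borel_measurable M"
  "cov_sum (n + m) (a * 2 ^ m) ((b - a) * 2 ^ m) i j \<in> borel_measurable M"
  unfolding ito_sum_def[abs_def] cov_sum_def[abs_def] using le
  by (auto intro!: borel_measurable_sum borel_measurable_times borel_measurable_diff W)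
qed

text \<open>At level two the grid signature is the left-point sum plus \<open>c 2\<close> times the
  sum of products of increments. The coefficient \<open>c 2\<close> thus decides between the two
  integrals, and one argument serves both.\<close>

theorem brownian_lift_besov_AE:
 fixes c :: "nat \<Rightarrow> real" and X :: "'a \<Rightarrow> 'n two_param"
 assumes c: "c 0 = 1" "c 1 = 1" and lift: "lift_of_path M T W X"
  and meas: "\<And>s t i j. (s, t) \<in> simplex2 T \<Longrightarrow> (\<lambda>\<omega>. X \<omega> s t [i, j]) \<in> borel_measurable M"
  and limit: "\<And>n a b i j \<epsilon>. a \<le> b \<Longrightarrow> b \<le> 2 ^ n \<Longrightarrow> \<epsilon> > 0 \<Longrightarrow>
   (\<lambda>m. prob {\<omega> \<in> space M. \<epsilon> < \<bar>(ito_sum (n + m) (a * 2 ^ m) ((b - a) * 2 ^ m) i j \<omega> + c 2 * cov_sum (n + m) (a * 2 ^ m) ((b - a) * 2 ^ m) i j \<omega>) - X \<omega> (dyad T n a) (dyad T n b) [i, j]\<bar>}) \<longlonglongrightarrow> 0"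
 shows "AE \<omega> in M. besov_critical 2 (1 / 2) T (X \<omega>)"
proof -
 \<comment> \<open>The lift has its levels \<open>0\<close> and \<open>1\<close> prescribed only
   almost surely. The modification has them exactly, which makes these coordinates measurable and
   the limits at levels \<open>0\<close> and \<open>1\<close> trivial.\<close>
 define X' where "X' \<omega> s t w = (if length w = 0 then 1 else if length w = 1 then W t \<omega> $ hd w - W s \<omega> $ hd w else X \<omega> s t w)" for \<omega> s t w
 have X'0: "X' \<omega> s t [] = 1" and X'1: "X' \<omega> s t [i] = W t \<omega> $ i - W s \<omega> $ i" and X'2: "X' \<omega> s t [i, j] = X \<omega> s t [i, j]" for \<omega> s t i j
  by (simp_all add: X'_def)
 have words: "w = [] \<or> (\<exists>i. w = [i]) \<or> (\<exists>i j. w = [i, j])" if "length w \<le> 2" for w :: "'n list"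
  using that by (cases w rule: remdups_adj.cases) auto
 have eq: "AE \<omega> in M. \<forall>p. X \<omega> \<in> besov_rough_paths 2 (1 / 2) p T \<longleftrightarrow> X' \<omega> \<in> besov_rough_paths 2 (1 / 2) p T"
 proof -
  have "AE \<omega> in M. \<forall>(s, t) \<in> simplex2 T. X \<omega> s t [] = 1 \<and> (\<forall>i. X \<omega> s t [i] = W t \<omega> $ i - W s \<omega> $ i)"
   using lift unfolding lift_of_path_def by blast
  then show ?thesis
  proof eventually_elim
   case (elim \<omega>)
   have "X \<omega> s t w = X' \<omega> s t w" if "(s, t) \<in> simplex2 T" "length w \<le> 2" for s t w
    using words[OF that(2)] elim that(1) by (auto simp: X'0 X'1 X'2)
   then show ?case by (intro allI besov_rough_paths_cong)
  qed
 qed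
 have cont: "AE \<omega> in M. \<forall>w. length w \<le> 2 \<longrightarrow> continuous_on (simplex2 T) (\<lambda>(s, t). X' \<omega> s t w)"
 proof -
  have "AE \<omega> in M. \<forall>i j. continuous_on (simplex2 T) (\<lambda>(s, t). X \<omega> s t [i, j])"
   using lift unfolding lift_of_path_def by blast
  moreover have "AE \<omega> in M. continuous_on {0..T} (\<lambda>t. W t \<omega>)" using bm unfolding brownian_motion_def by blast
  ultimately show ?thesis
  proof eventually_elim
   case (elim \<omega>)
   have "continuous_on (simplex2 T) (\<lambda>(s, t). W t \<omega> $ i - W s \<omega> $ i)" for i
   proof -
    have "continuous_on (simplex2 T) (\<lambda>z. W (snd z) \<omega>)" "continuous_on (simplex2 T) (\<lambda>z. W (fst z) \<omega>)"
     by (rule continuous_on_compose2[OF elim(2)]; (intro continuous_intros)?; auto simp: simplex2_def)+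
    then show ?thesis unfolding split_beta by (intro continuous_intros)
   qed
   moreover have "continuous_on (simplex2 T) (\<lambda>(s, t). X' \<omega> s t [])" by (simp add: X'0 split_beta)
   ultimately show ?case using elim(1) unfolding X'1[symmetric] X'2[symmetric] by (metis words)
  qed
 qed
 let ?\<xi> = "noise_of T (1 / 2) W"
 have sig_eq: "sig c (\<lambda>b i. (T / 2 ^ m) powr (1 / 2) * ?\<xi> m b i \<omega>) a r w = sig c (incr T m (\<lambda>u. W u \<omega>)) a r w" for m a r w \<omega>
  by (simp add: noise_of_scaled[OF T])
 have s1: "sig c (incr T m (\<lambda>u. W u \<omega>)) (a * 2 ^ (m - n)) ((b - a) * 2 ^ (m - n)) [i] = X' \<omega> (dyad T n a) (dyad T n b) [i]"
  if "a \<le> b" "n \<le> m" for a b n m i \<omega>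
 proof -
  have "a * 2 ^ (m - n) + (b - a) * 2 ^ (m - n) = b * 2 ^ (m - n)" using that by (simp add: diff_mult_distrib)
  then show ?thesis using that
   by (simp add: sig_single[of c, OF c] sum_incr[OF T] gp_refine[OF T] X'1)
 qed
 have s2: "sig c (incr T m (\<lambda>u. W u \<omega>)) a r [i, j] = ito_sum m a r i j \<omega> + c 2 * cov_sum m a r i j \<omega>" for m a r i j \<omega>
  unfolding sig_pair[of c, OF c] ito_sum_def cov_sum_def sum_incr[OF T] using T by (simp add: incr_def)
 interpret noise_lift M T "1 / 2" c 2 ?\<xi> X'
 proof unfold_locales
  show "AE \<omega> in M. \<forall>n i. \<forall>k<2 ^ n. X' \<omega> (dyad T n k) (dyad T n (Suc k)) [i] = (T / 2 ^ n) powr (1 / 2) * ?\<xi> n k i \<omega>"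
   unfolding X'1 noise_of_scaled[OF T] using T by (simp add: incr_def gp_T)
  fix n a b :: nat and w :: "'n list" assume ab: "a \<le> b" "b \<le> 2 ^ n" "length w \<le> 2"
  let ?s = "dyad T n a" and ?t = "dyad T n b"
  have st: "(?s, ?t) \<in> simplex2 T" by (rule grid_simplex[OF T ab(1,2)])
  then have "?s \<in> {0..T}" "?t \<in> {0..T}" by (auto simp: simplex2_def)
  then show "(\<lambda>\<omega>. X' \<omega> ?s ?t w) \<in> borel_measurable M"
   using words[OF ab(3)] meas[OF st] by (auto simp: X'0 X'1 X'2 intro!: borel_measurable_diff W_nth_measurable)
  fix \<epsilon> :: real assume \<epsilon>: "\<epsilon> > 0"
  let ?E = "\<lambda>m. {\<omega> \<in> space M. \<epsilon> < \<bar>sig c (incr T m (\<lambda>u. W u \<omega>)) (a * 2 ^ (m - n)) ((b - a) * 2 ^ (m - n)) w - X' \<omega> ?s ?t w\<bar>}"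
  show "(\<lambda>m. prob {\<omega> \<in> space M. \<epsilon> < \<bar>sig c (\<lambda>b i. (T / 2 ^ m) powr (1 / 2) * ?\<xi> m b i \<omega>) (a * 2 ^ (m - n)) ((b - a) * 2 ^ (m - n)) w - X' \<omega> ?s ?t w\<bar>}) \<longlonglongrightarrow> 0"
   unfolding sig_eq
  proof (cases "length w \<le> 1")
   case True
   then have "w = [] \<or> (\<exists>i. w = [i])" using words[OF ab(3)] by auto
   then have "prob (?E m) = 0"
    if "n \<le> m" for m using s1[OF ab(1) that] \<epsilon> by (auto simp: sig_Nil[of c, OF c(1)] X'0)
   then show "(\<lambda>m. prob (?E m)) \<longlonglongrightarrow> 0"
    by (intro tendsto_eventually eventually_sequentiallyI[of n])
  next
   case False
   then obtain i j where w: "w = [i, j]" using words[OF ab(3)] by auto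
   have "(\<lambda>m. prob {\<omega> \<in> space M. \<epsilon> < \<bar>(ito_sum (m + n) (a * 2 ^ (m + n - n)) ((b - a) * 2 ^ (m + n - n)) i j \<omega> + c 2 * cov_sum (m + n) (a * 2 ^ (m + n - n)) ((b - a) * 2 ^ (m + n - n)) i j \<omega>) - X \<omega> ?s ?t [i, j]\<bar>}) \<longlonglongrightarrow> 0"
    using limit[OF ab(1,2) \<epsilon>, of i j] by (simp add: add.commute)
   then show "(\<lambda>m. prob (?E m)) \<longlonglongrightarrow> 0"
    unfolding w s2 X'2 by (rule LIMSEQ_offset)
  qed
 qed (use T c brownian_noise in auto)
 show ?thesis using besov_regularity_AE[OF cont] eq by eventually_elim blast
qed

lemma dyadic_partition:
 fixes a b m n :: nat
 defines "p \<equiv> \<lambda>k. gp T (n + m) (a * 2 ^ m + k)"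
 assumes "a \<le> b"
 shows "partition_of (dyad T n a) (dyad T n b) ((b - a) * 2 ^ m) p" "p (Suc k) - p k = T / 2 ^ (n + m)"
proof -
 have "a * 2 ^ m + (b - a) * 2 ^ m = b * 2 ^ m" using assms(2) by (simp add: diff_mult_distrib)
 then show "partition_of (dyad T n a) (dyad T n b) ((b - a) * 2 ^ m) p"
  using gp_refine[OF T, of n "n + m"] T unfolding partition_of_def p_def
  by (auto simp: gp_def divide_right_mono simp del: of_nat_add of_nat_mult)
 show "p (Suc k) - p k = T / 2 ^ (n + m)" using T by (simp add: p_def gp_def diff_divide_distrib[symmetric] algebra_simps)
qed

lemma mesh_tendsto: "(\<lambda>m. T / 2 ^ (n + m)) \<longlonglongrightarrow> 0"
proof -
 have "(\<lambda>m. (T / 2 ^ n) * (1 / 2) ^ m) \<longlonglongrightarrow> (T / 2 ^ n) * 0"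
  by (intro tendsto_mult tendsto_const LIMSEQ_realpow_zero) auto
 then show ?thesis by (simp add: power_add power_divide)
qed

lemma ito_dyadic_limit:
 assumes ab: "a \<le> b" "b \<le> 2 ^ n" and \<epsilon>: "\<epsilon> > 0"
  and I: "has_ito_integral M past (\<lambda>u \<omega>. W u \<omega> $ j) (dyad T n a) (dyad T n b)
   (\<lambda>u \<omega>. W u \<omega> $ i - W (dyad T n a) \<omega> $ i) I"
 shows "(\<lambda>m. prob {\<omega> \<in> space M. \<epsilon> < \<bar>ito_sum (n + m) (a * 2 ^ m) ((b - a) * 2 ^ m) i j \<omega> - I \<omega>\<bar>}) \<longlonglongrightarrow> 0"
proof -
 have st: "0 \<le> dyad T n a" "dyad T n a \<le> dyad T n b" "dyad T n b \<le> T"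
  using grid_simplex[OF T ab] by (auto simp: simplex2_def)
 have e: "gp T (n + m) (a * 2 ^ m) = dyad T n a" for m using gp_refine[OF T, of n "n + m"] by simp
 show ?thesis
  using ito_riemann_sums[OF st I dyadic_partition(1)[OF ab(1)], where h = "\<lambda>m. T / 2 ^ (n + m)" and \<epsilon> = \<epsilon>]
   dyadic_partition(2)[OF ab(1), of n] mesh_tendsto[of n] T \<epsilon>
  by (simp add: ito_sum_def e)
qed

lemma covariation_dyadic_limit:
 assumes ab: "a \<le> b" "b \<le> 2 ^ n" and \<epsilon>: "\<epsilon> > 0"
  and Q: "has_covariation M (dyad T n a) (dyad T n b)
   (\<lambda>u \<omega>. W u \<omega> $ i - W (dyad T n a) \<omega> $ i) (\<lambda>u \<omega>. W u \<omega> $ j) Q"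
 shows "(\<lambda>m. prob {\<omega> \<in> space M. \<epsilon> < \<bar>cov_sum (n + m) (a * 2 ^ m) ((b - a) * 2 ^ m) i j \<omega> - Q \<omega>\<bar>}) \<longlonglongrightarrow> 0"
proof -
 define S where "S m = cov_sum (n + m) (a * 2 ^ m) ((b - a) * 2 ^ m) i j" for m
 have Qm [measurable]: "Q \<in> borel_measurable M" using Q unfolding has_covariation_def by blast
 have Sm [measurable]: "S m \<in> borel_measurable M" for m
  unfolding S_def by (rule sums_measurable[OF ab])
 show ?thesis unfolding S_def[symmetric]
 proof (rule LIMSEQ_I)
  fix e :: real assume e: "e > 0"
  \<comment> \<open>In \<open>has_covariation\<close> one number bounds both the deviation and the
    probability, so the smaller of the two targets is used.\<close>
  define \<eta> where "\<eta> = min e \<epsilon>"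
  have "\<eta> > 0" using e \<epsilon> by (simp add: \<eta>_def)
  then obtain \<delta> where \<delta>: "\<delta> > 0" and small: "\<And>m \<tau>. partition_of (dyad T n a) (dyad T n b) m \<tau> \<and> (\<forall>j<m. \<tau> (Suc j) - \<tau> j < \<delta>) \<Longrightarrow>
    prob {\<omega> \<in> space M. \<eta> < \<bar>(\<Sum>k<m. ((W (\<tau> (Suc k)) \<omega> $ i - W (dyad T n a) \<omega> $ i) - (W (\<tau> k) \<omega> $ i - W (dyad T n a) \<omega> $ i))
     * (W (\<tau> (Suc k)) \<omega> $ j - W (\<tau> k) \<omega> $ j)) - Q \<omega>\<bar>} < \<eta>"
   using Q unfolding has_covariation_def by blast
  obtain m0 where m0: "\<And>m. m \<ge> m0 \<Longrightarrow> T / 2 ^ (n + m) < \<delta>"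
   using order_tendstoD(2)[OF mesh_tendsto[of n] \<delta>] unfolding eventually_sequentially by blast
  show "\<exists>m0. \<forall>m\<ge>m0. norm (prob {\<omega> \<in> space M. \<epsilon> < \<bar>S m \<omega> - Q \<omega>\<bar>} - 0) < e"
  proof (intro exI[of _ m0] allI impI)
   fix m assume "m \<ge> m0"
   then have "prob {\<omega> \<in> space M. \<eta> < \<bar>S m \<omega> - Q \<omega>\<bar>} < \<eta>"
    using small[of "(b - a) * 2 ^ m" "\<lambda>k. gp T (n + m) (a * 2 ^ m + k)"] dyadic_partition[OF ab(1), of n m] m0 by (simp add: S_def cov_sum_def)
   moreover have "prob {\<omega> \<in> space M. \<epsilon> < \<bar>S m \<omega> - Q \<omega>\<bar>} \<le> prob {\<omega> \<in> space M. \<eta> < \<bar>S m \<omega> - Q \<omega>\<bar>}"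
   proof (rule finite_measure_mono)
    show "{\<omega> \<in> space M. \<eta> < \<bar>S m \<omega> - Q \<omega>\<bar>} \<in> sets M" by measurable
   qed (auto simp: \<eta>_def)
   ultimately show "norm (prob {\<omega> \<in> space M. \<epsilon> < \<bar>S m \<omega> - Q \<omega>\<bar>} - 0) < e" by (simp add: \<eta>_def)
  qed
 qed
qed

theorem ito_besov_AE:
 assumes "ito_brownian_rough_path M T W X"
 shows "AE \<omega> in M. besov_critical 2 (1 / 2) T (X \<omega>)"
proof -
 have I: "has_ito_integral M past (\<lambda>u \<omega>. W u \<omega> $ j) s t (\<lambda>u \<omega>. W u \<omega> $ i - W s \<omega> $ i) (\<lambda>\<omega>. X \<omega> s t [i, j])"
  if "(s, t) \<in> simplex2 T" for s t i j
  using assms that unfolding ito_brownian_rough_path_def by blast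
 show ?thesis
 proof (rule brownian_lift_besov_AE[of "\<lambda>k. if k \<le> 1 then 1 else 0"])
  show "lift_of_path M T W X" using assms unfolding ito_brownian_rough_path_def by blast
  show "(\<lambda>\<omega>. X \<omega> s t [i, j]) \<in> borel_measurable M" if "(s, t) \<in> simplex2 T" for s t i j
   using I[OF that] unfolding has_ito_integral_def square_integrable_def by blast
 qed (use ito_dyadic_limit[OF _ _ _ I[OF grid_simplex[OF T]]] in auto)
qed

text \<open>Along dyadic partitions the Ito sums and the sums of products of increments converge
  separately in probability; with \<open>c 2 = 1 / 2\<close> they add up to the Stratonovich
  integral.\<close>

theorem stratonovich_besov_AE:
 assumes "stratonovich_brownian_rough_path M T W X"
 shows "AE \<omega> in M. besov_critical 2 (1 / 2) T (X \<omega>)"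
proof -
 have I: "has_stratonovich_integral M past (\<lambda>u \<omega>. W u \<omega> $ j) s t (\<lambda>u \<omega>. W u \<omega> $ i - W s \<omega> $ i) (\<lambda>\<omega>. X \<omega> s t [i, j])"
  if "(s, t) \<in> simplex2 T" for s t i j
  using assms that unfolding stratonovich_brownian_rough_path_def by blast
 have meas: "(\<lambda>\<omega>. X \<omega> s t [i, j]) \<in> borel_measurable M" if "(s, t) \<in> simplex2 T" for s t i j
  using I[OF that] unfolding has_stratonovich_integral_def by blast
 show ?thesis
 proof (rule brownian_lift_besov_AE[of "\<lambda>k. if k \<le> 1 then 1 else 1 / 2"])
  show "lift_of_path M T W X" using assms unfolding stratonovich_brownian_rough_path_def by blast
  fix n a b :: nat and i j :: 'n and \<epsilon> :: real assume ab: "a \<le> b" "b \<le> 2 ^ n" and \<epsilon>: "\<epsilon> > 0"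
  let ?s = "dyad T n a" and ?t = "dyad T n b"
  let ?R = "\<lambda>m. ito_sum (n + m) (a * 2 ^ m) ((b - a) * 2 ^ m) i j" and ?C = "\<lambda>m. cov_sum (n + m) (a * 2 ^ m) ((b - a) * 2 ^ m) i j"
  note st = grid_simplex[OF T ab]
  obtain J Q where J: "has_ito_integral M past (\<lambda>u \<omega>. W u \<omega> $ j) ?s ?t (\<lambda>u \<omega>. W u \<omega> $ i - W ?s \<omega> $ i) J"
   and Q: "has_covariation M ?s ?t (\<lambda>u \<omega>. W u \<omega> $ i - W ?s \<omega> $ i) (\<lambda>u \<omega>. W u \<omega> $ j) Q"
   and X: "AE \<omega> in M. X \<omega> ?s ?t [i, j] = J \<omega> + Q \<omega> / 2"
   using I[OF st] unfolding has_stratonovich_integral_def by blast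
  have [measurable]: "J \<in> borel_measurable M" "Q \<in> borel_measurable M" "?R m \<in> borel_measurable M" "?C m \<in> borel_measurable M"
   "(\<lambda>\<omega>. X \<omega> ?s ?t [i, j]) \<in> borel_measurable M" for m
   using J Q sums_measurable[OF ab] meas[OF st] unfolding has_ito_integral_def square_integrable_def has_covariation_def by blast+
  have "(\<lambda>m. prob {\<omega> \<in> space M. \<epsilon> < \<bar>(?R m \<omega> + 1 / 2 * ?C m \<omega>) - (J \<omega> + 1 / 2 * Q \<omega>)\<bar>}) \<longlonglongrightarrow> 0"
   by (rule limit_in_prob_add) (use ito_dyadic_limit[OF ab _ J] covariation_dyadic_limit[OF ab _ Q] \<epsilon> in auto)
  moreover have "prob {\<omega> \<in> space M. \<epsilon> < \<bar>(?R m \<omega> + 1 / 2 * ?C m \<omega>) - (J \<omega> + 1 / 2 * Q \<omega>)\<bar>}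
    = prob {\<omega> \<in> space M. \<epsilon> < \<bar>(?R m \<omega> + 1 / 2 * ?C m \<omega>) - X \<omega> ?s ?t [i, j]\<bar>}" for m
  proof (rule finite_measure_eq_AE)
   show "AE \<omega> in M. \<omega> \<in> {\<omega> \<in> space M. \<epsilon> < \<bar>(?R m \<omega> + 1 / 2 * ?C m \<omega>) - (J \<omega> + 1 / 2 * Q \<omega>)\<bar>}
     \<longleftrightarrow> \<omega> \<in> {\<omega> \<in> space M. \<epsilon> < \<bar>(?R m \<omega> + 1 / 2 * ?C m \<omega>) - X \<omega> ?s ?t [i, j]\<bar>}"
    using X by eventually_elim simp
  qed measurable
  ultimately show "(\<lambda>m. prob {\<omega> \<in> space M. \<epsilon> < \<bar>(?R m \<omega> + (if 2 \<le> (1 :: nat) then 1 else 1 / 2) * ?C m \<omega>) - X \<omega> ?s ?t [i, j]\<bar>}) \<longlonglongrightarrow> 0"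
   by simp
 qed (use meas in auto)
qed

end

theorem theorem5p2:
 fixes M :: "'a measure" and T :: real
 assumes "prob_space M" and "0 < T"
 shows
  "(\<forall>(W :: real \<Rightarrow> 'a \<Rightarrow> real ^ 'n) (X :: 'a \<Rightarrow> 'n two_param).
    brownian_motion M T W \<and>
    (ito_brownian_rough_path M T W X \<or> stratonovich_brownian_rough_path M T W X) \<longrightarrow>
    (AE \<omega> in M.
      (\<forall>p :: real. 2 < p \<longrightarrow> X \<omega> \<in> besov_rough_paths 2 (1 / 2) (ennreal p) T) \<and>
      X \<omega> \<notin> besov_rough_paths 2 (1 / 2) \<top> T)) \<and>
   (\<forall>(H :: real) (B :: real \<Rightarrow> 'a \<Rightarrow> real ^ 'n) (X :: 'a \<Rightarrow> 'n two_param).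
    1 / 4 < H \<and> H \<le> 1 / 2 \<and>
    fractional_brownian_motion M T H B \<and> canonical_lift M (fbm_level H) T B X \<longrightarrow>
    (AE \<omega> in M.
      (\<forall>p :: real. 1 / H < p \<longrightarrow> X \<omega> \<in> besov_rough_paths (fbm_level H) H (ennreal p) T) \<and>
      X \<omega> \<notin> besov_rough_paths (fbm_level H) H \<top> T))"
proof (intro conjI allI impI, goal_cases)
 case (1 W X)
 then interpret brownian M T W using assms by (simp add: brownian_def brownian_axioms_def)
 have "AE \<omega> in M. besov_critical 2 (1 / 2) T (X \<omega>)"
  using 1 ito_besov_AE stratonovich_besov_AE by blast
 then show ?case by eventually_elim simp
next
 case (2 H B X)
 then have H: "0 < H" by simp
 have pos: "0 < p" if "1 / H < p" for p using that H by (meson less_trans zero_less_divide_1_iff)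
 have "AE \<omega> in M. besov_critical (fbm_level H) H T (X \<omega>)"
  using 2 H by (intro fbm_besov_AE[OF assms, of H _ B]) (auto simp: fbm_level_def)
 then show ?case by eventually_elim (use pos in blast)
qed

end
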